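(* Let $F:\mathbb{R}^{2}\to\mathbb{R}$ be a nonconstant stationary isotropic (centred) Gaussian random field of unit variance, normalised so that its covariance function satisfies $C_F(r)=1-r^2+g_4r^4-g_6r^6+o(r^6)$ as $r\to 0$, and assume that $F$ is a.s. $C^{4+\epsilon}(\mathbb{R}^{2})$ for some $\epsilon>0$. Then, as $r\to 0^+$, the two-point correlation functions corresponding to local minima, local maxima, saddles and local extrema satisfy $$K_2^{min,min}(r)=O(r^3\log(1/r)),\qquad K_2^{max,max}(r)=O(r^3\log(1/r)),$$ $$K_2^{saddle,saddle}(r)=O(r^3\log(1/r)),\qquad K_2^{e,e}(r)=O(r^3\log(1/r)).$$ Moreover, let $b_{1,1}$ be the linear form (the coefficient of $r$ in the expansion of minus the trace of the conditioned Hessian) defined in the context. If $b_{1,1}\neq 0$, then $$K_2^{max,min}(r)=O(r^3),$$ and if $b_{1,1}=0$, then $$K_2^{max,min}(r)=O(r^7).$$ The case $b_{1,1}=0$ occurs for the random plane wave model, i.e. the field with covariance $J_0(\|x-y\|)$ (after rescaling so that the covariance function satisfies $C_F(r)=1-r^2+g_4r^4-g_6r^6+o(r^6)$ as $r\to 0$, $J_0(2\|x-y\|)$), where $J_0$ is the Bessel function of the first kind of order $0$.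
   Context: "Nonconstant" means that $F$ is not a.s. equal to a (random) constant function of $x$. Isotropy means that $C_F(\|x-y\|)=\mathbb{E}[F(x)F(y)]$ depends only on $\|x-y\|$. Here $g_{2k}=(-1)^kC_F^{(2k)}(0)/(2k)!$, and the normalisation is $C_F(0)=1$, $g_2=1$. For types $\alpha,\beta\in\{min,max,saddle,e\}$ ($e$ = local extremum, i.e. local minimum or local maximum), the two-point correlation function is given by the restricted Kac-Rice formula: for $x\ne y$, $r=\|x-y\|$, $$K_2^{\alpha,\beta}(r)=\phi_{(\nabla F(x),\nabla F(y))}(0,0)\cdot\mathbb{E}\big[|\det H_F(x)|\,|\det H_F(y)|\,\mathbf 1\{H_F(x)\text{ of type }\alpha\}\,\mathbf 1\{H_F(y)\text{ of type }\beta\}\ \big|\ \nabla F(x)=\nabla F(y)=0\big],$$ where $\phi_{(\nabla F(x),\nabla F(y))}$ is the density of the Gaussian vector $(\nabla F(x),\nabla F(y))\in\mathbb{R}^4$, $H_F$ is the Hessian of $F$, and a symmetric $2\times2$ matrix $H$ is of type $min$ if it is positive definite, $max$ if it is negative definite, $saddle$ if $\det H<0$, and $e$ if $\det H>0$. By stationarity and isotropy this depends only on $r$. Definition of $b_{1,1}$: take $x=(0,0)$, $y=(0,r)$, $r>0$, and let $\zeta=(\zeta_1,\dots,\zeta_6)$ be the Gaussian vector $(F_{11}(x),F_{12}(x),F_{22}(x),F_{11}(y),F_{12}(y),F_{22}(y))$ conditioned on $\nabla F(x)=\nabla F(y)=0$ (subscripts denote partial derivatives), with covariance matrix $\mathbf\Delta(r)$.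 Write $\mathbf\Delta(r)=\mathbf Q(r)\mathbf\Lambda(r)\mathbf Q(r)^t$ with $\mathbf\Lambda(r)$ the diagonal matrix of eigenvalues and $\mathbf Q(r)$ the orthogonal matrix whose columns are corresponding normalised eigenvectors, chosen so that the entries of $\mathbf Q(r)$ and $\mathbf\Lambda(r)^{1/2}$ admit Taylor expansions at $r=0$. Write $\zeta=\mathbf Q(r)\mathbf\Lambda(r)^{1/2}\xi$ with $\xi=(\xi_1,\dots,\xi_6)$ a standard Gaussian vector in $\mathbb{R}^6$. Then $b_1:=-(\zeta_1+\zeta_3)$, minus the trace of the conditioned Hessian at $x$, expands as $$b_1=b_{1,0}+b_{1,1}\,r+b_{1,2}\,r^2+O(r^3)\quad (r\to0),$$ where the $b_{1,j}$ are linear forms in $\xi$ with coefficients not depending on $r$. "$b_{1,1}=0$" means that $b_{1,1}$ is the zero linear form. *)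

theory Defs
  imports "HOL-Probability.Probability" "HOL-Library.Landau_Symbols"
begin

section \<open>Gaussian random variables, fields and conditioning\<close>

text \<open>The degenerate case (a.s. zero) counts as Gaussian.\<close>

definition centred_gaussian :: "'w measure \<Rightarrow> ('w \<Rightarrow> real) \<Rightarrow> bool" where
  "centred_gaussian M X \<longleftrightarrow> X \<in> borel_measurable M \<and>
     ((AE \<omega> in M. X \<omega> = 0) \<or> (\<exists>\<sigma>>0. distributed M lborel X (normal_density 0 \<sigma>)))"

definition centred_gaussian_field :: "'w measure \<Rightarrow> ('p \<Rightarrow> 'w \<Rightarrow> real) \<Rightarrow> bool" where
  "centred_gaussian_field M F \<longleftrightarrow>
     (\<forall>S a. finite S \<longrightarrow> centred_gaussian M (\<lambda>\<omega>. \<Sum>x\<in>S. a x * F x \<omega>))"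

text \<open>Strict stationarity: the finite-dimensional distributions are translation invariant.\<close>

definition stationary_field :: "'w measure \<Rightarrow> ('p::ab_group_add \<Rightarrow> 'w \<Rightarrow> real) \<Rightarrow> bool" where
  "stationary_field M F \<longleftrightarrow>
     (\<forall>h S. finite S \<longrightarrow>
        distr M (Pi\<^sub>M S (\<lambda>_. borel)) (\<lambda>\<omega>. \<lambda>x\<in>S. F (x + h) \<omega>) =
        distr M (Pi\<^sub>M S (\<lambda>_. borel)) (\<lambda>\<omega>. \<lambda>x\<in>S. F x \<omega>))"

text \<open>
  The isotropic covariance function of a centred field. Only the values of \<open>C\<close> on the
  nonnegative half-line are constrained.
\<close>

definition isotropic_covariance ::
    "'w measure \<Rightarrow> ('p::real_normed_vector \<Rightarrow> 'w \<Rightarrow> real) \<Rightarrow> (real \<Rightarrow> real) \<Rightarrow> bool" where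
  "isotropic_covariance M F C \<longleftrightarrow>
     (\<forall>x y. integral\<^sup>L M (\<lambda>\<omega>. F x \<omega> * F y \<omega>) = C (norm (x - y)))"

text \<open>
  Expectations are taken in the completion of the probability space. For measurable integrands
  this is the usual integral. The completion is needed because derivatives of the paths exist
  only almost surely: on the exceptional null set \<^const>\<open>deriv\<close> returns arbitrary values, which
  may destroy measurability, and the Bochner integral of a non-measurable function is \<open>0\<close>.
\<close>

definition expect :: "'w measure \<Rightarrow> ('w \<Rightarrow> real) \<Rightarrow> real" where
  "expect M f = integral\<^sup>L (completion M) f"

text \<open>(Cross-)covariance matrix of centred random vectors.\<close>

definition cov_matrix ::
    "'w measure \<Rightarrow> ('w \<Rightarrow> real ^ 'n) \<Rightarrow> ('w \<Rightarrow> real ^ 'm) \<Rightarrow> real ^ 'm ^ 'n" where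
  "cov_matrix M X Y = (\<chi> i j. expect M (\<lambda>\<omega>. X \<omega> $ i * Y \<omega> $ j))"

text \<open>Density of the centred Gaussian vector with nonsingular covariance matrix \<open>S\<close>.\<close>

definition gaussian_density :: "real ^ 'n ^ 'n \<Rightarrow> real ^ 'n \<Rightarrow> real" where
  "gaussian_density S v =
     exp (- (v \<bullet> (matrix_inv S *v v)) / 2) / sqrt ((2 * pi) ^ CARD('n) * det S)"

text \<open>
  Gaussian conditioning (regression). For a centred jointly Gaussian pair \<open>(X, Y)\<close> with
  nonsingular \<open>Cov(Y)\<close>, the residual \<open>X - Cov(X,Y) Cov(Y)\<^sup>-\<^sup>1 Y\<close> is independent of \<open>Y\<close>, and the
  conditional law of \<open>X\<close> given \<open>Y = y\<close> (the version that is continuous in \<open>y\<close>) is the law of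
  the following random vector.
\<close>

definition gaussian_cond ::
    "'w measure \<Rightarrow> ('w \<Rightarrow> real ^ 'n) \<Rightarrow> ('w \<Rightarrow> real ^ 'm) \<Rightarrow> real ^ 'm \<Rightarrow> 'w \<Rightarrow> real ^ 'n" where
  "gaussian_cond M X Y y \<omega> =
     X \<omega> + (cov_matrix M X Y ** matrix_inv (cov_matrix M Y Y)) *v (y - Y \<omega>)"


section \<open>Partial derivatives and smoothness of paths\<close>

definition partial_deriv :: "'n \<Rightarrow> (real ^ 'n \<Rightarrow> real) \<Rightarrow> real ^ 'n \<Rightarrow> real" where
  "partial_deriv i f x = deriv (\<lambda>t. f (x + t *\<^sub>R axis i 1)) 0"

definition partial_derivs :: "'n list \<Rightarrow> (real ^ 'n \<Rightarrow> real) \<Rightarrow> real ^ 'n \<Rightarrow> real" where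
  "partial_derivs js f = foldr partial_deriv js f"

definition C_diff :: "nat \<Rightarrow> (real ^ 'n \<Rightarrow> real) \<Rightarrow> bool" where
  "C_diff k f \<longleftrightarrow>
     (\<forall>js. length js < k \<longrightarrow>
        (\<forall>i x. (\<lambda>t. partial_derivs js f (x + t *\<^sub>R axis i 1)) differentiable (at 0))) \<and>
     (\<forall>js. length js \<le> k \<longrightarrow> continuous_on UNIV (partial_derivs js f))"

text \<open>
  \<open>C\<^sup>k\<^sup>+\<^sup>\<epsilon>\<close> for \<open>0 < \<epsilon> \<le> 1\<close>: the derivatives of order \<open>k\<close> are locally Hoelder continuous with
  exponent \<open>\<epsilon>\<close>.
\<close>

definition C_Holder :: "nat \<Rightarrow> real \<Rightarrow> (real ^ 'n \<Rightarrow> real) \<Rightarrow> bool" where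
  "C_Holder k \<epsilon> f \<longleftrightarrow> C_diff k f \<and>
     (\<forall>js K. length js = k \<and> compact K \<longrightarrow>
        (\<exists>L. \<forall>x\<in>K. \<forall>y\<in>K.
           \<bar>partial_derivs js f x - partial_derivs js f y\<bar> \<le> L * norm (x - y) powr \<epsilon>))"


section \<open>The two-point correlation function\<close>

type_synonym 'w field2 = "real ^ 2 \<Rightarrow> 'w \<Rightarrow> real"

definition field_deriv :: "2 list \<Rightarrow> 'w field2 \<Rightarrow> real ^ 2 \<Rightarrow> 'w \<Rightarrow> real" where
  "field_deriv js F x \<omega> = partial_derivs js (\<lambda>z. F z \<omega>) x"

definition gradient_pair :: "'w field2 \<Rightarrow> real ^ 2 \<Rightarrow> real ^ 2 \<Rightarrow> 'w \<Rightarrow> real ^ 4" where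
  "gradient_pair F x y \<omega> =
     vector [field_deriv [1] F x \<omega>, field_deriv [2] F x \<omega>,
             field_deriv [1] F y \<omega>, field_deriv [2] F y \<omega>]"

definition hessian_pair :: "'w field2 \<Rightarrow> real ^ 2 \<Rightarrow> real ^ 2 \<Rightarrow> 'w \<Rightarrow> real ^ 6" where
  "hessian_pair F x y \<omega> =
     vector [field_deriv [1,1] F x \<omega>, field_deriv [1,2] F x \<omega>, field_deriv [2,2] F x \<omega>,
             field_deriv [1,1] F y \<omega>, field_deriv [1,2] F y \<omega>, field_deriv [2,2] F y \<omega>]"

definition sym_matrix2 :: "real \<Rightarrow> real \<Rightarrow> real \<Rightarrow> real ^ 2 ^ 2" where
  "sym_matrix2 a b c = vector [vector [a, b], vector [b, c]]"

definition first_hessian :: "real ^ 6 \<Rightarrow> real ^ 2 ^ 2" where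
  "first_hessian z = sym_matrix2 (z $ 1) (z $ 2) (z $ 3)"

definition second_hessian :: "real ^ 6 \<Rightarrow> real ^ 2 ^ 2" where
  "second_hessian z = sym_matrix2 (z $ 4) (z $ 5) (z $ 6)"

datatype crit_type = Minimum | Maximum | Saddle | Extremum

fun of_type :: "real ^ 2 ^ 2 \<Rightarrow> crit_type \<Rightarrow> bool" where
  "of_type H Minimum \<longleftrightarrow> (\<forall>v. v \<noteq> 0 \<longrightarrow> v \<bullet> (H *v v) > 0)"
| "of_type H Maximum \<longleftrightarrow> (\<forall>v. v \<noteq> 0 \<longrightarrow> v \<bullet> (H *v v) < 0)"
| "of_type H Saddle \<longleftrightarrow> det H < 0"
| "of_type H Extremum \<longleftrightarrow> det H > 0"

definition cond_hessian_pair ::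
    "'w measure \<Rightarrow> 'w field2 \<Rightarrow> real ^ 2 \<Rightarrow> real ^ 2 \<Rightarrow> 'w \<Rightarrow> real ^ 6" where
  "cond_hessian_pair M F x y = gaussian_cond M (hessian_pair F x y) (gradient_pair F x y) 0"

definition kac_rice_weight :: "crit_type \<Rightarrow> crit_type \<Rightarrow> real ^ 6 \<Rightarrow> real" where
  "kac_rice_weight \<alpha> \<beta> z =
     \<bar>det (first_hessian z)\<bar> * \<bar>det (second_hessian z)\<bar> *
     of_bool (of_type (first_hessian z) \<alpha>) * of_bool (of_type (second_hessian z) \<beta>)"

definition two_point_corr ::
    "'w measure \<Rightarrow> 'w field2 \<Rightarrow> crit_type \<Rightarrow> crit_type \<Rightarrow> real ^ 2 \<Rightarrow> real ^ 2 \<Rightarrow> real" where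
  "two_point_corr M F \<alpha> \<beta> x y =
     gaussian_density (cov_matrix M (gradient_pair F x y) (gradient_pair F x y)) 0 *
     expect M (\<lambda>\<omega>. kac_rice_weight \<alpha> \<beta> (cond_hessian_pair M F x y \<omega>))"

text \<open>
  For a stationary isotropic field the two-point correlation function depends only on the
  distance; as a function of the distance it is evaluated at the points \<open>(0,0)\<close> and \<open>(0,r)\<close>.
\<close>

definition K2 :: "'w measure \<Rightarrow> 'w field2 \<Rightarrow> crit_type \<Rightarrow> crit_type \<Rightarrow> real \<Rightarrow> real" where
  "K2 M F \<alpha> \<beta> r = two_point_corr M F \<alpha> \<beta> 0 (axis 2 r)"


section \<open>The linear form \<open>b\<^sub>1\<^sub>,\<^sub>1\<close>\<close>

definition Delta :: "'w measure \<Rightarrow> 'w field2 \<Rightarrow> real \<Rightarrow> real ^ 6 ^ 6" where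
  "Delta M F r = cov_matrix M (cond_hessian_pair M F 0 (axis 2 r)) (cond_hessian_pair M F 0 (axis 2 r))"

definition diag_matrix :: "real ^ 'n \<Rightarrow> real ^ 'n ^ 'n" where
  "diag_matrix l = (\<chi> i j. if i = j then l $ i else 0)"

definition sqrt_diag_matrix :: "real ^ 'n \<Rightarrow> real ^ 'n ^ 'n" where
  "sqrt_diag_matrix l = diag_matrix (\<chi> i. sqrt (l $ i))"

text \<open>
  Second-order Taylor expansion at \<open>0\<^sup>+\<close> with Peano remainder. The coefficients are unique, and
  an expansion with remainder \<open>O(r\<^sup>3)\<close> is one with remainder \<open>o(r\<^sup>2)\<close>; the latter is what is
  available when the field is no smoother than \<open>C\<^sup>4\<^sup>+\<^sup>\<epsilon>\<close>.
\<close>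

definition has_taylor2 :: "(real \<Rightarrow> real) \<Rightarrow> real \<Rightarrow> real \<Rightarrow> real \<Rightarrow> bool" where
  "has_taylor2 f a0 a1 a2 \<longleftrightarrow>
     (\<lambda>r. f r - (a0 + a1 * r + a2 * r ^ 2)) \<in> o[at_right 0](\<lambda>r. r ^ 2)"

text \<open>
  \<open>l r\<close> is the vector of diagonal entries of \<open>\<Lambda>(r)\<close>. Only small \<open>r > 0\<close> matter.
\<close>

definition expandable_diagonalisation ::
    "(real \<Rightarrow> real ^ 6 ^ 6) \<Rightarrow> (real \<Rightarrow> real ^ 6 ^ 6) \<Rightarrow> (real \<Rightarrow> real ^ 6) \<Rightarrow> bool" where
  "expandable_diagonalisation D Q l \<longleftrightarrow>
     (\<forall>\<^sub>F r in at_right 0.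
        orthogonal_matrix (Q r) \<and> D r = Q r ** diag_matrix (l r) ** transpose (Q r)) \<and>
     (\<forall>i j. \<exists>a0 a1 a2. has_taylor2 (\<lambda>r. Q r $ i $ j) a0 a1 a2) \<and>
     (\<forall>i j. \<exists>a0 a1 a2. has_taylor2 (\<lambda>r. sqrt_diag_matrix (l r) $ i $ j) a0 a1 a2)"

text \<open>\<open>b\<^sub>1\<close> as a linear form in \<open>\<xi>\<close>, where \<open>\<zeta> = Q \<Lambda>\<^sup>1\<^sup>/\<^sup>2 \<xi>\<close>.\<close>

definition b1 :: "real ^ 6 ^ 6 \<Rightarrow> real ^ 6 \<Rightarrow> real ^ 6 \<Rightarrow> real" where
  "b1 Q l \<xi> = (let \<zeta> = (Q ** sqrt_diag_matrix l) *v \<xi> in - (\<zeta> $ 1 + \<zeta> $ 3))"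

text \<open>
  \<open>b\<close> is the first-order coefficient form \<open>b\<^sub>1\<^sub>,\<^sub>1\<close> for some admissible choice of \<open>Q\<close> and \<open>\<Lambda>\<close>
  (such a choice is not unique: the eigenvectors may at least be permuted and change sign).
\<close>

definition is_b11 :: "'w measure \<Rightarrow> 'w field2 \<Rightarrow> (real ^ 6 \<Rightarrow> real) \<Rightarrow> bool" where
  "is_b11 M F b \<longleftrightarrow>
     (\<exists>Q l b10 b12. expandable_diagonalisation (Delta M F) Q l \<and>
        linear b10 \<and> linear b \<and> linear b12 \<and>
        (\<forall>\<xi>. has_taylor2 (\<lambda>r. b1 (Q r) (l r) \<xi>) (b10 \<xi>) (b \<xi>) (b12 \<xi>)))"


section \<open>The Bessel function \<open>J\<^sub>0\<close>\<close>

definition bessel_J0 :: "real \<Rightarrow> real" where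
  "bessel_J0 x = (\<Sum>k. (-1) ^ k * (x / 2) ^ (2 * k) / (fact k)\<^sup>2)"

end

theory Submission
  imports Defs
begin

text \<open>
  Put the two points at \<open>0\<close> and \<open>(0,r)\<close> and replace the derivatives of \<open>F\<close> at the two points by
  their half sums and half differences. By the reflection symmetries of the configuration, the
  four gradient and six Hessian variables obtained in this way split into four mutually
  uncorrelated families, each with exactly one gradient variable. Conditioning on vanishing
  gradients therefore subtracts from each Hessian variable a multiple of a single gradient
  variable (\<open>cond_hessian_pair_eq\<close>). Write \<open>p, q, m\<close> for the residuals of the half sums of
  \<open>F\<^sub>1\<^sub>1, F\<^sub>2\<^sub>2, F\<^sub>1\<^sub>2\<close> and \<open>a, b, n\<close> for those of the half differences. The conditioned Hessians
  are then the symmetric matrices with entries \<open>p - a, m - n, q - b\<close> and \<open>p + a, m + n, q + b\<close>,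
  and \<open>(p,q)\<close>, \<open>(a,b)\<close>, \<open>m\<close>, \<open>n\<close> are independent. Taylor expansion of the covariance shows that
  \<open>p\<close> is of order \<open>1\<close>, that \<open>a, b, n\<close> are of order \<open>r\<close>, and that \<open>q, m\<close> are of order \<open>r\<^sup>2\<close>; the
  density of the gradient pair at \<open>0\<close> is of order \<open>r\<^sup>-\<^sup>2\<close> (\<open>dens_bound\<close>).
  
  If both critical points have the same type, the two determinants \<open>u, v\<close> have the same sign.
  Hence \<open>|v - u| \<le> |u + v|\<close> and \<open>|u v| \<le> ((u + v)/2)\<^sup>2\<close>. Up to random factors with bounded
  moments, \<open>(u + v)/2\<close> is of order \<open>r\<^sup>2\<close>, whereas \<open>(v - u)/2 = p b + O(r\<^sup>3)\<close>, where \<open>p b\<close> is of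
  order \<open>r\<close>. So the product of the independent nondegenerate Gaussian variables \<open>p\<close> and \<open>b/r\<close> has
  to be of order \<open>r\<close>, which has probability of order \<open>r log(1/r)\<close>
  (\<open>det_pair_bounds\<close>, \<open>gaussian_small_product\<close>). Altogether \<open>K\<^sub>2\<close> is of order
  \<open>r\<^sup>-\<^sup>2 r\<^sup>4 r log(1/r)\<close> (\<open>K2_same_type\<close>).
  
  If the first point is a maximum and the second a minimum, then the traces \<open>S - D\<close> and \<open>S + D\<close>,
  where \<open>S = p + q\<close> and \<open>D = a + b\<close>, are negative and positive, so that \<open>|S| \<le> D\<close>; moreover both
  determinants are at most \<open>D\<^sup>2\<close> (\<open>kac_rice_weight_max_min\<close>). As \<open>S\<close> is independent of \<open>D\<close> and has
  a bounded density, the expectation is at most of the order of the fifth power of the standard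
  deviation of \<open>D\<close> (\<open>gaussian_dominated_fourth_moment\<close>). Here
  \<open>Var D = 32 (9 g\<^sub>6 - 4 g\<^sub>4\<^sup>2) r\<^sup>2 + O(r\<^sup>4)\<close> (\<open>quad_VD\<close>). The standard deviation is thus \<open>O(r)\<close>,
  which gives \<open>r\<^sup>-\<^sup>2 r\<^sup>5 = r\<^sup>3\<close>, and it is \<open>O(r\<^sup>2)\<close> if \<open>9 g\<^sub>6 = 4 g\<^sub>4\<^sup>2\<close>, which gives
  \<open>r\<^sup>-\<^sup>2 r\<^sup>1\<^sup>0 = r\<^sup>8\<close> and in particular \<open>O(r\<^sup>7)\<close>.
  
  The trace at the first point is \<open>S - D\<close>. In any diagonalisation with Taylor expansions, \<open>S\<close>
  contributes nothing to first order in \<open>r\<close>, so that \<open>b\<^sub>1\<^sub>,\<^sub>1\<close> vanishes if and only if \<open>D\<close> is of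
  order \<open>r\<^sup>2\<close>, that is, if and only if \<open>9 g\<^sub>6 = 4 g\<^sub>4\<^sup>2\<close> (\<open>eigenvector_trace_order\<close>,
  \<open>is_b11_eq_0_iff\<close>). For \<open>J\<^sub>0(2 r)\<close> one has \<open>g\<^sub>4 = 1/4\<close> and \<open>g\<^sub>6 = 1/36\<close>, and equality holds.
\<close>

section \<open>Gaussian variables through characteristic functions\<close>

text \<open>
  For \<open>\<sigma> = 0\<close> this is the point mass at \<open>0\<close>, so that the degenerate Gaussian law is included.
\<close>

abbreviation scaled_normal :: "real \<Rightarrow> real measure" where
  "scaled_normal \<sigma> \<equiv> distr std_normal_distribution borel (\<lambda>z. \<sigma> * z)"

lemma real_distribution_scaled_normal: "real_distribution (scaled_normal \<sigma>)"
proof -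
  interpret real_distribution std_normal_distribution by (rule real_dist_normal_dist)
  show ?thesis by (simp add: real_distribution_distr)
qed

lemma char_scaled_normal: "char (scaled_normal \<sigma>) t = exp (- (\<sigma>\<^sup>2 * t\<^sup>2) / 2)"
proof -
  have "char (scaled_normal \<sigma>) t = char std_normal_distribution (t * \<sigma>)"
    by (simp add: char_def integral_distr mult.assoc)
  then show ?thesis
    by (simp add: char_std_normal_distribution power_mult_distrib mult.commute)
qed

context prob_space
begin

lemma centred_gaussian_distr:
  assumes "centred_gaussian M X"
  shows "\<exists>\<sigma>\<ge>0. distr M borel X = scaled_normal \<sigma>"
proof -
  interpret sn: prob_space std_normal_distribution by (rule prob_space_normal_density) simp
  have X[measurable]: "X \<in> borel_measurable M" using assms by (simp add: centred_gaussian_def)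
  from assms consider "AE \<omega> in M. X \<omega> = 0" 
    | \<sigma> where "\<sigma> > 0" "distributed M lborel X (normal_density 0 \<sigma>)"
    by (auto simp: centred_gaussian_def)
  then show ?thesis
  proof cases
    case 1
    have "distr M borel X = distr M borel (\<lambda>_. 0)"
      using 1 by (intro distr_cong_AE) auto
    also have "\<dots> = scaled_normal 0"
      by (simp add: sn.distr_const)
    finally show ?thesis by blast
  next
    case 2
    then have "distributed M lborel (\<lambda>x. (X x - 0) / \<sigma>) std_normal_density"
      using normal_standard_normal_convert[of \<sigma> X 0] by simp
    then have d: "distr M borel (\<lambda>x. X x / \<sigma>) = std_normal_distribution"
      by (simp add: distributed_def cong: distr_cong)
    have "distr (distr M borel (\<lambda>x. X x / \<sigma>)) borel (\<lambda>z. \<sigma> * z) = distr M borel X"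
      using 2(1) by (subst distr_distr) (auto simp: comp_def)
    then show ?thesis using d 2(1) by (auto intro!: exI[of _ \<sigma>])
  qed
qed

lemma centred_gaussianI:
  assumes X[measurable]: "X \<in> borel_measurable M" and "\<sigma> \<ge> 0"
    and d: "distr M borel X = scaled_normal \<sigma>"
  shows "centred_gaussian M X"
proof (cases "\<sigma> = 0")
  case True
  interpret sn: prob_space std_normal_distribution by (rule prob_space_normal_density) simp
  have "distr M borel X = return borel 0"
    using d True by (simp add: sn.distr_const)
  moreover have "AE x in return borel (0::real). x = 0" by (subst AE_return) auto
  ultimately have "AE x in distr M borel X. x = 0" by (simp only:)
  then have "AE \<omega> in M. X \<omega> = 0" by (subst (asm) AE_distr_iff) auto
  then show ?thesis by (simp add: centred_gaussian_def)
next
  case False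
  then have s: "\<sigma> > 0" using assms by simp
  interpret sn: prob_space std_normal_distribution by (rule prob_space_normal_density) simp
  have "distributed std_normal_distribution lborel (\<lambda>x. x) std_normal_density"
    by (auto simp: distributed_def distr_id2)
  from sn.normal_density_affine[OF this, of \<sigma> 0] s
  have "distributed std_normal_distribution lborel (\<lambda>x. \<sigma> * x) (normal_density 0 \<sigma>)" by simp
  then have "scaled_normal \<sigma> = density lborel (normal_density 0 \<sigma>)"
    by (simp add: distributed_def cong: distr_cong)
  then have "distributed M lborel X (normal_density 0 \<sigma>)"
    using d by (auto simp: distributed_def cong: distr_cong)
  then show ?thesis using s by (auto simp: centred_gaussian_def)
qed

lemma centred_gaussian_moments:
  assumes "centred_gaussian M X"
  shows "integrable M (\<lambda>\<omega>. X \<omega> ^ k)" "expectation X = 0"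
    "distr M borel X = scaled_normal (sqrt (expectation (\<lambda>\<omega>. (X \<omega>)\<^sup>2)))"
proof -
  from centred_gaussian_distr[OF assms] obtain \<sigma> where s: "\<sigma> \<ge> 0" "distr M borel X = scaled_normal \<sigma>"
    by blast
  have X[measurable]: "X \<in> borel_measurable M" using assms by (simp add: centred_gaussian_def)
  have *: "integrable M (\<lambda>\<omega>. f (X \<omega>)) \<longleftrightarrow> integrable std_normal_distribution (\<lambda>z. f (\<sigma> * z))"
    "expectation (\<lambda>\<omega>. f (X \<omega>)) = (LINT z|std_normal_distribution. f (\<sigma> * z))"
    if [measurable]: "f \<in> borel_measurable borel" for f :: "real \<Rightarrow> real"
    using integrable_distr_eq[of X M borel f] integral_distr[of X M borel f]
      integrable_distr_eq[of "\<lambda>z. \<sigma> * z" std_normal_distribution borel f] 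
      integral_distr[of "\<lambda>z. \<sigma> * z" std_normal_distribution borel f] s(2)
    by simp_all
  show "integrable M (\<lambda>\<omega>. X \<omega> ^ k)"
    by (subst *) (auto simp: power_mult_distrib intro!: integrable_std_normal_distribution_moment)
  show "expectation X = 0"
    using *(2)[of "\<lambda>x. x"] integral_std_normal_distribution_moment_odd[of 1] by simp
  have "expectation (\<lambda>\<omega>. (X \<omega>)\<^sup>2) = \<sigma>\<^sup>2"
    using std_normal_distribution_even_moments(1)[of 1]
    by (subst *) (auto simp: power_mult_distrib fact_numeral)
  then show "distr M borel X = scaled_normal (sqrt (expectation (\<lambda>\<omega>. (X \<omega>)\<^sup>2)))"
    using s by simp
qed

lemma char_centred_gaussian:
  assumes "centred_gaussian M X"
  shows "char (distr M borel X) t = exp (- (expectation (\<lambda>\<omega>. (X \<omega>)\<^sup>2) * t\<^sup>2) / 2)"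
proof -
  have "0 \<le> expectation (\<lambda>\<omega>. (X \<omega>)\<^sup>2)" by (intro integral_nonneg_AE) auto
  then show ?thesis
    by (subst centred_gaussian_moments(3)[OF assms], subst char_scaled_normal) simp
qed

text \<open>
  By dominated convergence the characteristic functions converge pointwise. One value of the
  limit, taken where it is positive, determines the limit of the variances, and then all values
  of the limit are those of a Gaussian characteristic function.
\<close>

lemma centred_gaussian_AE_limit:
  assumes g: "\<And>n. centred_gaussian M (X n)" and Y[measurable]: "Y \<in> borel_measurable M"
    and lim: "AE \<omega> in M. (\<lambda>n. X n \<omega>) \<longlonglongrightarrow> Y \<omega>"
  shows "centred_gaussian M Y"
    and "(\<lambda>n. expectation (\<lambda>\<omega>. (X n \<omega>)\<^sup>2)) \<longlonglongrightarrow> expectation (\<lambda>\<omega>. (Y \<omega>)\<^sup>2)"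
proof -
  define v where "v n = expectation (\<lambda>\<omega>. (X n \<omega>)\<^sup>2)" for n
  have X[measurable]: "X n \<in> borel_measurable M" for n using g by (simp add: centred_gaussian_def)
  interpret D: real_distribution "distr M borel Y" by (rule real_distribution_distr) simp
  have chlim: "(\<lambda>n. complex_of_real (exp (- (v n * t\<^sup>2) / 2))) \<longlonglongrightarrow> char (distr M borel Y) t" for t
  proof -
    have "(\<lambda>n. CLINT \<omega>|M. iexp (t * X n \<omega>)) \<longlonglongrightarrow> (CLINT \<omega>|M. iexp (t * Y \<omega>))"
    proof (rule integral_dominated_convergence[where w="\<lambda>_. 1"])
      show "AE \<omega> in M. (\<lambda>n. iexp (t * X n \<omega>)) \<longlonglongrightarrow> iexp (t * Y \<omega>)"
        using lim by eventually_elim (auto intro!: tendsto_intros)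
    qed auto
    moreover have "(CLINT \<omega>|M. iexp (t * X n \<omega>)) = exp (- (v n * t\<^sup>2) / 2)" for n
      using char_centred_gaussian[OF g, of n t] by (simp add: char_def integral_distr v_def)
    moreover have "(CLINT \<omega>|M. iexp (t * Y \<omega>)) = char (distr M borel Y) t"
      by (simp add: char_def integral_distr)
    ultimately show ?thesis by simp
  qed
  have relim: "(\<lambda>n. exp (- (v n * t\<^sup>2) / 2)) \<longlonglongrightarrow> Re (char (distr M borel Y) t)" for t
    using tendsto_Re[OF chlim[of t]] by simp
  \<comment> \<open>The limit is positive near \<open>0\<close>, so that its logarithm determines the limit of the variances.\<close>
  have "isCont (\<lambda>t. Re (char (distr M borel Y) t)) 0"
    by (intro continuous_Re D.isCont_char)
  then have "((\<lambda>t. Re (char (distr M borel Y) t)) \<longlongrightarrow> 1) (at 0)"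
    using D.char_zero by (simp add: isCont_def)
  then have "\<forall>\<^sub>F t in at 0. Re (char (distr M borel Y) t) > 0"
    by (rule order_tendstoD) simp
  then obtain d where d: "d > 0" "\<And>t. t \<noteq> 0 \<Longrightarrow> dist t 0 < d \<Longrightarrow> Re (char (distr M borel Y) t) > 0"
    unfolding eventually_at by auto
  define t0 where "t0 = d / 2"
  have t0: "t0 > 0" "Re (char (distr M borel Y) t0) > 0"
    using d by (auto simp: t0_def)
  define V where "V = - 2 * ln (Re (char (distr M borel Y) t0)) / t0\<^sup>2"
  have "(\<lambda>n. - 2 * ln (exp (- (v n * t0\<^sup>2) / 2)) / t0\<^sup>2) \<longlonglongrightarrow> V"
    unfolding V_def using relim[of t0] t0 by (intro tendsto_intros) auto
  moreover have "- 2 * ln (exp (- (v n * t0\<^sup>2) / 2)) / t0\<^sup>2 = v n" for n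
    using t0 by simp
  ultimately have vV: "v \<longlonglongrightarrow> V" by simp
  have "0 \<le> v n" for n unfolding v_def by (intro integral_nonneg_AE) auto
  then have V0: "V \<ge> 0" using vV by (intro LIMSEQ_le_const[OF vV]) auto
  have "char (distr M borel Y) t = char (scaled_normal (sqrt V)) t" for t
  proof -
    have "(\<lambda>n. complex_of_real (exp (- (v n * t\<^sup>2) / 2))) \<longlonglongrightarrow> complex_of_real (exp (- (V * t\<^sup>2) / 2))"
      by (intro tendsto_intros vV) simp
    from LIMSEQ_unique[OF this chlim] show ?thesis using V0 by (simp add: char_scaled_normal)
  qed
  then have eq: "distr M borel Y = scaled_normal (sqrt V)"
    by (intro Levy_uniqueness real_distribution_scaled_normal) (auto simp: D.real_distribution_axioms)
  show gY: "centred_gaussian M Y"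
    by (rule centred_gaussianI[OF Y _ eq]) (use V0 in simp)
  have "exp (- (V * 1\<^sup>2) / 2) = exp (- (expectation (\<lambda>\<omega>. (Y \<omega>)\<^sup>2) * 1\<^sup>2) / 2)"
    using char_centred_gaussian[OF gY, of 1] char_scaled_normal[of "sqrt V" 1] V0 unfolding eq
    by (metis of_real_eq_iff real_sqrt_pow2)
  then have "expectation (\<lambda>\<omega>. (Y \<omega>)\<^sup>2) = V" by simp
  then show "(\<lambda>n. expectation (\<lambda>\<omega>. (X n \<omega>)\<^sup>2)) \<longlonglongrightarrow> expectation (\<lambda>\<omega>. (Y \<omega>)\<^sup>2)"
    using vV by (simp add: v_def[abs_def])
qed

section \<open>Independence from factorising characteristic functions\<close>

text \<open>
  Normalising the weight \<open>w\<close> to a probability density changes the measure, but by the hypothesis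
  not the characteristic function of \<open>X\<close>; by Levy's uniqueness theorem the law of \<open>X\<close> is
  unchanged too, and hence \<open>w\<close> is uncorrelated with all indicators of \<open>X\<close>.
\<close>

lemma weighted_law_real:
  fixes X w :: "'a \<Rightarrow> real"
  assumes X[measurable]: "X \<in> borel_measurable M" and w[measurable]: "w \<in> borel_measurable M"
    and w0: "\<And>\<omega>. 0 \<le> w \<omega>" and wC: "\<And>\<omega>. w \<omega> \<le> C"
    and fac: "\<And>t. (CLINT \<omega>|M. w \<omega> * iexp (t * X \<omega>)) = (\<integral>\<omega>. w \<omega> \<partial>M) * (CLINT \<omega>|M. iexp (t * X \<omega>))"
    and A[measurable]: "A \<in> sets borel"
  shows "(\<integral>\<omega>. w \<omega> * indicator A (X \<omega>) \<partial>M) = (\<integral>\<omega>. w \<omega> \<partial>M) * (\<integral>\<omega>. indicator A (X \<omega>) \<partial>M)"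
proof -
  define c where "c = (\<integral>\<omega>. w \<omega> \<partial>M)"
  have iw: "integrable M w"
    by (rule integrable_const_bound[where B=C]) (use w0 wC in auto)
  show ?thesis
  proof (cases "c = 0")
    case True
    then have "AE \<omega> in M. w \<omega> = 0"
      using integral_nonneg_eq_0_iff_AE[OF iw] w0 by (auto simp: c_def)
    then have "(\<integral>\<omega>. w \<omega> * indicator A (X \<omega>) \<partial>M) = (\<integral>\<omega>. 0 \<partial>M)"
      by (intro integral_cong_AE) auto
    then show ?thesis using True by (simp add: c_def)
  next
    case False
    have "c \<ge> 0" unfolding c_def using w0 by (intro integral_nonneg_AE) auto
    then have c: "c > 0" using False by simp
    define Q where "Q = density M (\<lambda>\<omega>. ennreal (w \<omega> / c))"
    have "(\<integral>\<^sup>+ \<omega>. ennreal (w \<omega> / c) \<partial>M) = ennreal (\<integral>\<omega>. w \<omega> / c \<partial>M)"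
      using iw w0 c by (intro nn_integral_eq_integral) auto
    also have "\<dots> = 1" using c by (simp add: c_def[symmetric])
    finally have Q: "prob_space Q"
      unfolding Q_def by (intro prob_spaceI) (simp add: emeasure_density cong: nn_integral_cong)
    interpret Q: prob_space Q by fact
    have XQ[measurable]: "X \<in> borel_measurable Q" by (simp add: Q_def)
    have iQ: "(CLINT \<omega>|Q. f \<omega>) = (CLINT \<omega>|M. (w \<omega> / c) *\<^sub>R f \<omega>)" if "f \<in> borel_measurable M" for f
      unfolding Q_def using w0 c that by (subst integral_density) auto
    have "char (distr Q borel X) t = char (distr M borel X) t" for t
    proof -
      have "char (distr Q borel X) t = (CLINT \<omega>|Q. iexp (t * X \<omega>))"
        by (simp add: char_def integral_distr)
      also have "\<dots> = (CLINT \<omega>|M. (w \<omega> / c) *\<^sub>R iexp (t * X \<omega>))"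
        by (rule iQ) simp
      also have "\<dots> = (CLINT \<omega>|M. (1/c) * (w \<omega> * iexp (t * X \<omega>)))"
        by (intro Bochner_Integration.integral_cong) (auto simp: scaleR_conv_of_real)
      also have "\<dots> = (1/c) * (CLINT \<omega>|M. w \<omega> * iexp (t * X \<omega>))"
        by (rule integral_mult_right_zero)
      also have "\<dots> = (CLINT \<omega>|M. iexp (t * X \<omega>))"
        unfolding fac c_def[symmetric] using c by simp
      finally show ?thesis by (simp add: char_def integral_distr)
    qed
    then have eq: "distr Q borel X = distr M borel X"
      by (intro Levy_uniqueness) (auto intro!: Q.real_distribution_distr real_distribution_distr)
    have "(\<integral>\<omega>. w \<omega> / c * indicator A (X \<omega>) \<partial>M) = (\<integral>\<omega>. indicator A (X \<omega>) \<partial>Q)"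
      unfolding Q_def using w0 c by (subst integral_density) auto
    also have "\<dots> = (\<integral>x. indicator A x \<partial>distr Q borel X)"
      by (subst integral_distr) auto
    also have "\<dots> = (\<integral>\<omega>. indicator A (X \<omega>) \<partial>M)"
      unfolding eq by (subst integral_distr) auto
    finally show ?thesis using c by (simp add: c_def[symmetric] field_simps)
  qed
qed

text \<open>
  The complex version, for the real and imaginary parts of \<open>W\<close> separately: after the addition of
  the constant \<open>C\<close> they become nonnegative.
\<close>

lemma weighted_law:
  fixes X :: "'a \<Rightarrow> real" and W :: "'a \<Rightarrow> complex"
  assumes X[measurable]: "X \<in> borel_measurable M" and W[measurable]: "W \<in> borel_measurable M"
    and WC: "\<And>\<omega>. norm (W \<omega>) \<le> C"
    and fac: "\<And>t. (CLINT \<omega>|M. W \<omega> * iexp (t * X \<omega>)) = (CLINT \<omega>|M. W \<omega>) * (CLINT \<omega>|M. iexp (t * X \<omega>))"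
    and A[measurable]: "A \<in> sets borel"
  shows "(CLINT \<omega>|M. W \<omega> * indicator A (X \<omega>)) = (CLINT \<omega>|M. W \<omega>) * (CLINT \<omega>|M. indicator A (X \<omega>))"
proof -
  have iW: "integrable M W" by (rule integrable_const_bound[where B=C]) (use WC in auto)
  have ie: "integrable M (\<lambda>\<omega>. iexp (t * X \<omega>))" for t
    by (rule integrable_const_bound[where B=1]) auto
  have iWe: "integrable M (\<lambda>\<omega>. W \<omega> * iexp (t * X \<omega>))" for t
    by (rule integrable_const_bound[where B=C]) (use WC in \<open>auto simp: norm_mult\<close>)
  have iA: "integrable M (\<lambda>\<omega>. indicat_real A (X \<omega>))"
    by (rule integrable_const_bound[where B=1]) (auto simp: indicator_def)
  have iWA: "integrable M (\<lambda>\<omega>. W \<omega> * indicat_real A (X \<omega>))"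
    by (rule integrable_const_bound[where B=C]) (use WC in \<open>auto simp: norm_mult indicator_def intro: order_trans[OF norm_ge_zero]\<close>)
  \<comment> \<open>Conjugation turns the hypothesis at \<open>- t\<close> into the hypothesis for the conjugate weight at \<open>t\<close>.\<close>
  have facc: "(CLINT \<omega>|M. cnj (W \<omega>) * iexp (t * X \<omega>)) = (CLINT \<omega>|M. cnj (W \<omega>)) * (CLINT \<omega>|M. iexp (t * X \<omega>))" for t
  proof -
    have e: "cnj (iexp (- t * X \<omega>)) = iexp (t * X \<omega>)" for \<omega>
      by (simp add: exp_cnj)
    have "cnj (CLINT \<omega>|M. W \<omega> * iexp (- t * X \<omega>)) = cnj ((CLINT \<omega>|M. W \<omega>) * (CLINT \<omega>|M. iexp (- t * X \<omega>)))"
      using fac[of "-t"] by (rule arg_cong)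
    moreover have "cnj (CLINT \<omega>|M. W \<omega> * iexp (- t * X \<omega>)) = (CLINT \<omega>|M. cnj (W \<omega>) * iexp (t * X \<omega>))"
      using Bochner_Integration.integral_cnj[of M "\<lambda>\<omega>. W \<omega> * iexp (- t * X \<omega>)"]
      by (simp only: complex_cnj_mult e)
    moreover have "cnj (CLINT \<omega>|M. iexp (- t * X \<omega>)) = (CLINT \<omega>|M. iexp (t * X \<omega>))"
      using Bochner_Integration.integral_cnj[of M "\<lambda>\<omega>. iexp (- t * X \<omega>)"] by (simp only: e)
    moreover have "cnj (CLINT \<omega>|M. W \<omega>) = (CLINT \<omega>|M. cnj (W \<omega>))"
      using Bochner_Integration.integral_cnj[of M W] by (simp only:)
    ultimately show ?thesis by (simp only: complex_cnj_mult)
  qed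
  have icW: "integrable M (\<lambda>\<omega>. cnj (W \<omega>))" using iW by simp
  have [measurable]: "(\<lambda>\<omega>. cnj (W \<omega>)) \<in> borel_measurable M"
    using icW by (rule borel_measurable_integrable)
  have icWe: "integrable M (\<lambda>\<omega>. cnj (W \<omega>) * iexp (t * X \<omega>))" for t
    by (rule integrable_const_bound[where B=C]) (use WC in \<open>auto simp: norm_mult\<close>)
  have C0: "0 \<le> C" using order_trans[OF norm_ge_zero WC] by blast
  have part: "(\<integral>\<omega>. g \<omega> * indicator A (X \<omega>) \<partial>M) = (\<integral>\<omega>. g \<omega> \<partial>M) * (\<integral>\<omega>. indicator A (X \<omega>) \<partial>M)"
    if g: "\<And>\<omega>. complex_of_real (g \<omega>) = \<alpha> * W \<omega> + \<beta> * cnj (W \<omega>)" and gC: "\<And>\<omega>. \<bar>g \<omega>\<bar> \<le> C"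
      and gm[measurable]: "g \<in> borel_measurable M" for g \<alpha> \<beta>
  proof -
    have ig: "integrable M g" by (rule integrable_const_bound[where B=C]) (use gC in auto)
    have igA: "integrable M (\<lambda>\<omega>. g \<omega> * indicat_real A (X \<omega>))"
      by (rule integrable_const_bound[where B=C]) (use gC C0 in \<open>auto simp: abs_mult indicator_def\<close>)
    have gi: "complex_of_real (\<integral>\<omega>. g \<omega> \<partial>M) = \<alpha> * (CLINT \<omega>|M. W \<omega>) + \<beta> * (CLINT \<omega>|M. cnj (W \<omega>))"
      by (subst integral_complex_of_real[symmetric]) (use iW icW in \<open>simp add: g\<close>)
    have "(\<integral>\<omega>. (C + g \<omega>) * indicator A (X \<omega>) \<partial>M) = (\<integral>\<omega>. C + g \<omega> \<partial>M) * (\<integral>\<omega>. indicator A (X \<omega>) \<partial>M)"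
    proof (rule weighted_law_real[where C="2 * C"])
      fix \<omega>
      show "0 \<le> C + g \<omega>" "C + g \<omega> \<le> 2 * C" using gC[of \<omega>] by auto
    next
      fix t
      have "(CLINT \<omega>|M. (C + g \<omega>) * iexp (t * X \<omega>))
          = (CLINT \<omega>|M. C * iexp (t * X \<omega>) + (\<alpha> * (W \<omega> * iexp (t * X \<omega>)) + \<beta> * (cnj (W \<omega>) * iexp (t * X \<omega>))))"
        by (intro Bochner_Integration.integral_cong) (auto simp: g algebra_simps)
      also have "\<dots> = C * (CLINT \<omega>|M. iexp (t * X \<omega>)) + (\<alpha> * (CLINT \<omega>|M. W \<omega> * iexp (t * X \<omega>))
           + \<beta> * (CLINT \<omega>|M. cnj (W \<omega>) * iexp (t * X \<omega>)))"
        using ie iWe icWe by (subst Bochner_Integration.integral_add; (subst Bochner_Integration.integral_add)?) auto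
      also have "\<dots> = (C + complex_of_real (\<integral>\<omega>. g \<omega> \<partial>M)) * (CLINT \<omega>|M. iexp (t * X \<omega>))"
        unfolding fac facc gi by (simp add: algebra_simps)
      also have "(C + complex_of_real (\<integral>\<omega>. g \<omega> \<partial>M)) = complex_of_real (\<integral>\<omega>. C + g \<omega> \<partial>M)"
        using ig by (simp add: prob_space)
      finally show "(CLINT \<omega>|M. complex_of_real (C + g \<omega>) * iexp (t * X \<omega>)) =
        complex_of_real (\<integral>\<omega>. C + g \<omega> \<partial>M) * (CLINT \<omega>|M. iexp (t * X \<omega>))" by simp
    qed auto
    moreover have "(\<integral>\<omega>. (C + g \<omega>) * indicator A (X \<omega>) \<partial>M)
        = C * (\<integral>\<omega>. indicator A (X \<omega>) \<partial>M) + (\<integral>\<omega>. g \<omega> * indicator A (X \<omega>) \<partial>M)"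
      using iA igA by (simp add: distrib_right)
    moreover have "(\<integral>\<omega>. C + g \<omega> \<partial>M) = C + (\<integral>\<omega>. g \<omega> \<partial>M)"
      using ig by (simp add: prob_space)
    ultimately show ?thesis by (simp add: algebra_simps)
  qed
  have re: "(\<integral>\<omega>. Re (W \<omega>) * indicator A (X \<omega>) \<partial>M) = (\<integral>\<omega>. Re (W \<omega>) \<partial>M) * (\<integral>\<omega>. indicator A (X \<omega>) \<partial>M)"
    by (rule part[of _ "1/2" "1/2"])
       (auto simp: complex_eq_iff intro!: order_trans[OF abs_Re_le_cmod WC])
  have im: "(\<integral>\<omega>. Im (W \<omega>) * indicator A (X \<omega>) \<partial>M) = (\<integral>\<omega>. Im (W \<omega>) \<partial>M) * (\<integral>\<omega>. indicator A (X \<omega>) \<partial>M)"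
    by (rule part[of _ "-\<i>/2" "\<i>/2"])
       (auto simp: complex_eq_iff intro!: order_trans[OF abs_Im_le_cmod WC])
  have ind: "(CLINT \<omega>|M. indicator A (X \<omega>)) = complex_of_real (\<integral>\<omega>. indicator A (X \<omega>) \<partial>M)"
  proof -
    have "(CLINT \<omega>|M. indicator A (X \<omega>)) = (CLINT \<omega>|M. complex_of_real (indicator A (X \<omega>)))"
      by (intro Bochner_Integration.integral_cong) (auto simp: indicator_def)
    then show ?thesis by (simp only: integral_complex_of_real)
  qed
  have WA: "(CLINT \<omega>|M. W \<omega> * indicator A (X \<omega>)) = (CLINT \<omega>|M. W \<omega> * indicat_real A (X \<omega>))"
    by (intro Bochner_Integration.integral_cong) (auto simp: indicator_def)
  have "Re (CLINT \<omega>|M. W \<omega> * indicat_real A (X \<omega>)) = (\<integral>\<omega>. Re (W \<omega>) * indicator A (X \<omega>) \<partial>M)"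
    using iWA by (subst integral_Re[symmetric]) (auto intro!: Bochner_Integration.integral_cong)
  moreover have "Im (CLINT \<omega>|M. W \<omega> * indicat_real A (X \<omega>)) = (\<integral>\<omega>. Im (W \<omega>) * indicator A (X \<omega>) \<partial>M)"
    using iWA by (subst integral_Im[symmetric]) (auto intro!: Bochner_Integration.integral_cong)
  moreover have "Re (CLINT \<omega>|M. W \<omega>) = (\<integral>\<omega>. Re (W \<omega>) \<partial>M)" "Im (CLINT \<omega>|M. W \<omega>) = (\<integral>\<omega>. Im (W \<omega>) \<partial>M)"
    using iW by auto
  ultimately show ?thesis
    unfolding WA ind by (simp add: complex_eq_iff re im)
qed

text \<open>
  The exponentials \<open>exp (i a\<^sub>i X\<^sub>i)\<close> are exchanged for indicators of events \<open>X\<^sub>i \<in> A\<^sub>i\<close> one index at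
  a time. In each exchange, the product of the indicators and exponentials of the other variables
  is the weight, and only the one-dimensional uniqueness theorem is applied.
\<close>

lemma indep_vars_of_char:
  fixes X :: "'i \<Rightarrow> 'a \<Rightarrow> real"
  assumes fin: "finite I" and X[measurable]: "\<And>i. i \<in> I \<Longrightarrow> X i \<in> borel_measurable M"
    and fac: "\<And>a. (CLINT \<omega>|M. iexp (\<Sum>i\<in>I. a i * X i \<omega>)) = (\<Prod>i\<in>I. CLINT \<omega>|M. iexp (a i * X i \<omega>))"
  shows "indep_vars (\<lambda>_. borel) X I"
proof -
  \<comment> \<open>\<open>J\<close> is the set of indices for which the exchange has been made.\<close>
  have claim: "(CLINT \<omega>|M. (\<Prod>j\<in>J. indicator (A j) (X j \<omega>)) * iexp (\<Sum>i\<in>I - J. a i * X i \<omega>))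
      = (\<Prod>j\<in>J. CLINT \<omega>|M. indicator (A j) (X j \<omega>)) * (\<Prod>i\<in>I - J. CLINT \<omega>|M. iexp (a i * X i \<omega>))"
    if "finite J" "J \<subseteq> I" "\<And>j. j \<in> J \<Longrightarrow> A j \<in> sets borel" for J A a
    using that
  proof (induction J arbitrary: a rule: finite_induct)
    case empty
    then show ?case using fac by simp
  next
    case (insert j J)
    note [measurable] = X
    have jI: "j \<in> I" "J \<subseteq> I" "j \<notin> J" using insert by auto
    have A[measurable]: "\<And>k. k \<in> J \<Longrightarrow> A k \<in> sets borel" "A j \<in> sets borel" using insert by auto
    have XJ: "X k \<in> borel_measurable M" if "k \<in> J" for k using X jI that by auto
    have XJ': "X k \<in> borel_measurable M" if "k \<in> I - insert j J" for k using X jI that by auto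
    define W where "W \<omega> = (\<Prod>k\<in>J. indicator (A k) (X k \<omega>)) * iexp (\<Sum>i\<in>I - insert j J. a i * X i \<omega>)" for \<omega>
    have Wm[measurable]: "W \<in> borel_measurable M"
    proof -
      have "(\<lambda>\<omega>. indicator (A k) (X k \<omega>) :: complex) \<in> borel_measurable M" if "k \<in> J" for k
        using XJ[OF that] A(1)[OF that] by measurable
      moreover have "(\<lambda>\<omega>. \<Sum>i\<in>I - insert j J. a i * X i \<omega>) \<in> borel_measurable M"
        using XJ' by (intro borel_measurable_sum borel_measurable_times) auto
      ultimately show ?thesis unfolding W_def
        by (intro borel_measurable_times borel_measurable_prod) auto
    qed
    have WC: "norm (W \<omega>) \<le> 1" for \<omega>
      unfolding W_def norm_mult prod_norm[symmetric]
      by (auto simp: indicator_def intro!: prod_le_1)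
    have split: "I - J = insert j (I - insert j J)" using jI by auto
    have finI: "finite (I - insert j J)" using fin by auto
    have step: "(CLINT \<omega>|M. W \<omega> * iexp (t * X j \<omega>))
        = (\<Prod>k\<in>J. CLINT \<omega>|M. indicator (A k) (X k \<omega>)) * ((CLINT \<omega>|M. iexp (t * X j \<omega>)) * (\<Prod>i\<in>I - insert j J. CLINT \<omega>|M. iexp (a i * X i \<omega>)))" for t
    proof -
      have "(CLINT \<omega>|M. W \<omega> * iexp (t * X j \<omega>))
        = (CLINT \<omega>|M. (\<Prod>k\<in>J. indicator (A k) (X k \<omega>)) * iexp (\<Sum>i\<in>I - J. (a(j := t)) i * X i \<omega>))"
      proof (intro Bochner_Integration.integral_cong refl)
        fix \<omega>
        have "(\<Sum>i\<in>I - J. (a(j := t)) i * X i \<omega>) = t * X j \<omega> + (\<Sum>i\<in>I - insert j J. a i * X i \<omega>)"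
          unfolding split using finI by (subst sum.insert) (auto intro!: sum.cong)
        then show "W \<omega> * iexp (t * X j \<omega>) = (\<Prod>k\<in>J. indicator (A k) (X k \<omega>)) * iexp (\<Sum>i\<in>I - J. (a(j := t)) i * X i \<omega>)"
          by (simp add: W_def exp_add[symmetric] algebra_simps)
      qed
      also have "\<dots> = (\<Prod>k\<in>J. CLINT \<omega>|M. indicator (A k) (X k \<omega>)) * (\<Prod>i\<in>I - J. CLINT \<omega>|M. iexp ((a(j := t)) i * X i \<omega>))"
        using insert.IH[of "a(j := t)"] insert.prems by auto
      also have "(\<Prod>i\<in>I - J. CLINT \<omega>|M. iexp ((a(j := t)) i * X i \<omega>))
         = (CLINT \<omega>|M. iexp (t * X j \<omega>)) * (\<Prod>i\<in>I - insert j J. CLINT \<omega>|M. iexp (a i * X i \<omega>))"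
        unfolding split using finI by (subst prod.insert) (auto intro!: prod.cong)
      finally show ?thesis .
    qed
    have W0: "(CLINT \<omega>|M. W \<omega>) = (\<Prod>k\<in>J. CLINT \<omega>|M. indicator (A k) (X k \<omega>)) * (\<Prod>i\<in>I - insert j J. CLINT \<omega>|M. iexp (a i * X i \<omega>))"
      using step[of 0] by (simp add: prob_space)
    have "(CLINT \<omega>|M. W \<omega> * indicator (A j) (X j \<omega>)) = (CLINT \<omega>|M. W \<omega>) * (CLINT \<omega>|M. indicator (A j) (X j \<omega>))"
      by (rule weighted_law[OF X[OF jI(1)] Wm WC _ A(2)]) (simp only: step W0 mult_ac)
    moreover have "(CLINT \<omega>|M. (\<Prod>k\<in>insert j J. indicator (A k) (X k \<omega>)) * iexp (\<Sum>i\<in>I - insert j J. a i * X i \<omega>))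
        = (CLINT \<omega>|M. W \<omega> * indicator (A j) (X j \<omega>))"
      using insert.hyps by (intro Bochner_Integration.integral_cong) (auto simp: W_def)
    ultimately show ?case using insert.hyps by (simp add: W0)
  qed
  show ?thesis
    unfolding indep_vars_def2
  proof (intro conjI ballI indep_setsI)
    fix i assume "i \<in> I" then show "{X i -` A \<inter> space M |A. A \<in> sets borel} \<subseteq> events" using X by auto
  next
    fix A J assume J: "J \<noteq> {}" "J \<subseteq> I" "finite J" "\<forall>j\<in>J. A j \<in> {X j -` B \<inter> space M |B. B \<in> sets borel}"
    then obtain B where B: "\<And>j. j \<in> J \<Longrightarrow> A j = X j -` B j \<inter> space M" "\<And>j. j \<in> J \<Longrightarrow> B j \<in> sets borel"
      by simp metis
    have XJ: "X k \<in> borel_measurable M" if "k \<in> J" for k using X J that by auto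
    have AJ: "A j \<in> events" if "j \<in> J" for j using measurable_sets[OF XJ[OF that] B(2)[OF that]] B(1)[OF that] by simp
    have cp: "(CLINT \<omega>|M. indicator S \<omega>) = complex_of_real (prob S)" if "S \<in> events" for S
    proof -
      have "(CLINT \<omega>|M. indicator S \<omega>) = (CLINT \<omega>|M. complex_of_real (indicator S \<omega>))"
        by (intro Bochner_Integration.integral_cong) (auto simp: indicator_def)
      then show ?thesis using that by (simp add: integral_complex_of_real)
    qed
    have 1: "(CLINT \<omega>|M. indicator (B j) (X j \<omega>)) = complex_of_real (prob (A j))" if "j \<in> J" for j
      by (subst cp[OF AJ[OF that], symmetric])
         (use B(1)[OF that] in \<open>auto intro!: Bochner_Integration.integral_cong simp: indicator_def\<close>)
    have 2: "(CLINT \<omega>|M. (\<Prod>j\<in>J. indicator (B j) (X j \<omega>))) = complex_of_real (prob (\<Inter>j\<in>J. A j))"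
    proof -
      have "(\<Inter>j\<in>J. A j) \<in> events" using AJ J by auto
      from cp[OF this] show ?thesis
      proof (rule trans[rotated], intro Bochner_Integration.integral_cong refl)
        fix \<omega> assume w: "\<omega> \<in> space M"
        show "(\<Prod>j\<in>J. indicator (B j) (X j \<omega>)) = (indicator (\<Inter>j\<in>J. A j) \<omega> :: complex)"
        proof (cases "\<forall>j\<in>J. X j \<omega> \<in> B j")
          case True
          then show ?thesis using B(1) w by (auto simp: indicator_def)
        next
          case False
          then obtain j where "j \<in> J" "X j \<omega> \<notin> B j" by auto
          then show ?thesis using B(1) J(3) by (auto simp: indicator_def prod_zero_iff)
        qed
      qed
    qed
    have "complex_of_real (prob (\<Inter>j\<in>J. A j)) = (\<Prod>j\<in>J. complex_of_real (prob (A j)))"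
      using claim[of J B "\<lambda>_. 0", OF J(3) J(2) B(2)] 1 2 by (simp add: prob_space)
    then show "prob (\<Inter>j\<in>J. A j) = (\<Prod>j\<in>J. prob (A j))"
      by (metis of_real_eq_iff of_real_prod)
  qed (use X in auto)
qed

end

section \<open>Gaussian spaces\<close>

text \<open>
  A linear set of centred Gaussian variables: any finitely many of its elements are jointly
  Gaussian, and their joint law is determined by the bilinear form \<open>ip\<close> of covariances.
\<close>

locale gaussian_space = prob_space M for M :: "'w measure" +
  fixes H :: "('w \<Rightarrow> real) set"
  assumes gaussian: "X \<in> H \<Longrightarrow> centred_gaussian M X"
    and lincomb: "X \<in> H \<Longrightarrow> Y \<in> H \<Longrightarrow> (\<lambda>\<omega>. a * X \<omega> + b * Y \<omega>) \<in> H"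
begin

definition ip :: "('w \<Rightarrow> real) \<Rightarrow> ('w \<Rightarrow> real) \<Rightarrow> real" where
  "ip X Y = expectation (\<lambda>\<omega>. X \<omega> * Y \<omega>)"

lemma measurable_H: "X \<in> H \<Longrightarrow> X \<in> borel_measurable M"
  using gaussian by (simp add: centred_gaussian_def)

lemma scale_H: "X \<in> H \<Longrightarrow> (\<lambda>\<omega>. a * X \<omega>) \<in> H"
  using lincomb[of X X a 0] by simp

lemma add_H: "X \<in> H \<Longrightarrow> Y \<in> H \<Longrightarrow> (\<lambda>\<omega>. X \<omega> + Y \<omega>) \<in> H"
  using lincomb[of X Y 1 1] by simp

lemma diff_H: "X \<in> H \<Longrightarrow> Y \<in> H \<Longrightarrow> (\<lambda>\<omega>. X \<omega> - Y \<omega>) \<in> H"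
  using lincomb[of X Y 1 "-1"] by simp

lemma sum_H:
  assumes "finite I" "I \<noteq> {}" "\<And>i. i \<in> I \<Longrightarrow> X i \<in> H"
  shows "(\<lambda>\<omega>. \<Sum>i\<in>I. a i * X i \<omega>) \<in> H"
  using assms by (induction I rule: finite_ne_induct) (auto intro!: add_H scale_H)

lemma integrable_mult_H:
  assumes "X \<in> H" "Y \<in> H"
  shows "integrable M (\<lambda>\<omega>. X \<omega> * Y \<omega>)"
proof (rule Bochner_Integration.integrable_bound)
  show "integrable M (\<lambda>\<omega>. X \<omega> ^ 2 + Y \<omega> ^ 2)"
    using centred_gaussian_moments(1)[OF gaussian] assms by auto
  have "\<bar>a * b\<bar> \<le> a\<^sup>2 + b\<^sup>2" for a b :: real
  proof -
    have "0 \<le> \<bar>a\<bar> * \<bar>b\<bar>" by simp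
    then show ?thesis
      using sum_squares_bound[of "\<bar>a\<bar>" "\<bar>b\<bar>"] unfolding abs_mult power2_abs by linarith
  qed
  then show "AE \<omega> in M. norm (X \<omega> * Y \<omega>) \<le> norm ((X \<omega>)\<^sup>2 + (Y \<omega>)\<^sup>2)"
    by auto
qed (use measurable_H assms in auto)

lemma ip_commute: "ip X Y = ip Y X"
  by (simp add: ip_def mult.commute)

lemma ip_lincomb_left:
  "X \<in> H \<Longrightarrow> Y \<in> H \<Longrightarrow> Z \<in> H \<Longrightarrow> ip (\<lambda>\<omega>. a * X \<omega> + b * Y \<omega>) Z = a * ip X Z + b * ip Y Z"
  using integrable_mult_H[of X Z] integrable_mult_H[of Y Z]
  by (simp add: ip_def distrib_right mult.assoc)

lemma ip_lincomb_right:
  "X \<in> H \<Longrightarrow> Y \<in> H \<Longrightarrow> Z \<in> H \<Longrightarrow> ip Z (\<lambda>\<omega>. a * X \<omega> + b * Y \<omega>) = a * ip Z X + b * ip Z Y"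
  using ip_lincomb_left[of X Y Z a b] by (simp add: ip_commute)

lemma ip_add_left: "X \<in> H \<Longrightarrow> Y \<in> H \<Longrightarrow> Z \<in> H \<Longrightarrow> ip (\<lambda>\<omega>. X \<omega> + Y \<omega>) Z = ip X Z + ip Y Z"
  using ip_lincomb_left[of X Y Z 1 1] by simp

lemma ip_add_right: "X \<in> H \<Longrightarrow> Y \<in> H \<Longrightarrow> Z \<in> H \<Longrightarrow> ip Z (\<lambda>\<omega>. X \<omega> + Y \<omega>) = ip Z X + ip Z Y"
  using ip_lincomb_right[of X Y Z 1 1] by simp

lemma ip_diff_left: "X \<in> H \<Longrightarrow> Y \<in> H \<Longrightarrow> Z \<in> H \<Longrightarrow> ip (\<lambda>\<omega>. X \<omega> - Y \<omega>) Z = ip X Z - ip Y Z"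
  using ip_lincomb_left[of X Y Z 1 "-1"] by simp

lemma ip_diff_right: "X \<in> H \<Longrightarrow> Y \<in> H \<Longrightarrow> Z \<in> H \<Longrightarrow> ip Z (\<lambda>\<omega>. X \<omega> - Y \<omega>) = ip Z X - ip Z Y"
  using ip_lincomb_right[of X Y Z 1 "-1"] by simp

lemma ip_scale_left: "ip (\<lambda>\<omega>. a * X \<omega>) Z = a * ip X Z"
  by (simp add: ip_def mult.assoc)

lemma ip_scale_right: "ip Z (\<lambda>\<omega>. a * X \<omega>) = a * ip Z X"
  by (simp add: ip_def mult.left_commute)

lemma ip_sum_left:
  assumes "finite I" "\<And>i. i \<in> I \<Longrightarrow> X i \<in> H" "Z \<in> H"
  shows "ip (\<lambda>\<omega>. \<Sum>i\<in>I. a i * X i \<omega>) Z = (\<Sum>i\<in>I. a i * ip (X i) Z)"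
proof -
  have "integrable M (\<lambda>\<omega>. a i * (X i \<omega> * Z \<omega>))" if "i \<in> I" for i
    using integrable_mult_H[of "X i" Z] assms that by auto
  then show ?thesis
    by (simp add: ip_def sum_distrib_right mult.assoc Bochner_Integration.integral_sum)
qed

lemma ip_nonneg: "0 \<le> ip X X"
  unfolding ip_def by (intro integral_nonneg_AE) auto

lemma ip_Cauchy_Schwarz:
  assumes "X \<in> H" "Y \<in> H"
  shows "(ip X Y)\<^sup>2 \<le> ip X X * ip Y Y"
proof -
  have q: "0 \<le> ip X X + 2 * t * ip X Y + t\<^sup>2 * ip Y Y" for t
  proof -
    have "0 \<le> ip (\<lambda>\<omega>. 1 * X \<omega> + t * Y \<omega>) (\<lambda>\<omega>. 1 * X \<omega> + t * Y \<omega>)" by (rule ip_nonneg)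
    also have "\<dots> = ip X X + 2 * t * ip X Y + t\<^sup>2 * ip Y Y"
      using assms lincomb[OF assms, of 1 t]
      by (simp add: ip_lincomb_left[of X Y _ 1, simplified] ip_lincomb_right[of X Y _ 1, simplified] 
          ip_commute[of Y X] algebra_simps power2_eq_square)
    finally show ?thesis .
  qed
  show ?thesis
  proof (cases "ip Y Y = 0")
    case True
    have "ip X Y = 0"
    proof (rule ccontr)
      assume n: "ip X Y \<noteq> 0"
      have "0 \<le> ip X X + 2 * (- (ip X X + 1) / (2 * ip X Y)) * ip X Y"
        using q[of "- (ip X X + 1) / (2 * ip X Y)"] True by simp
      then show False using n by (simp add: field_simps)
    qed
    then show ?thesis using ip_nonneg[of X] True by simp
  next
    case False
    then have p: "ip Y Y > 0" using ip_nonneg[of Y] by simp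
    have "0 \<le> ip X X + 2 * (- ip X Y / ip Y Y) * ip X Y + (- ip X Y / ip Y Y)\<^sup>2 * ip Y Y" by (rule q)
    also have "\<dots> = ip X X - (ip X Y)\<^sup>2 / ip Y Y"
      using p by (simp add: field_simps power2_eq_square)
    finally show ?thesis using p by (simp add: field_simps)
  qed
qed

text \<open>
  By polarisation this reduces to the convergence of variances along almost sure limits.
\<close>

lemma ip_tendsto:
  assumes X: "\<And>n. X n \<in> H" and Y: "Y \<in> H" and Z: "Z \<in> H"
    and lim: "AE \<omega> in M. (\<lambda>n. X n \<omega>) \<longlonglongrightarrow> Y \<omega>"
  shows "(\<lambda>n. ip (X n) Z) \<longlonglongrightarrow> ip Y Z"
proof -
  have pol: "ip U Z = (ip (\<lambda>\<omega>. U \<omega> + Z \<omega>) (\<lambda>\<omega>. U \<omega> + Z \<omega>) - ip U U - ip Z Z) / 2" if "U \<in> H" for U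
    using that Z add_H[OF that Z] by (simp add: ip_add_left ip_add_right ip_commute[of Z U])
  have "(\<lambda>n. ip (\<lambda>\<omega>. X n \<omega> + Z \<omega>) (\<lambda>\<omega>. X n \<omega> + Z \<omega>)) \<longlonglongrightarrow> ip (\<lambda>\<omega>. Y \<omega> + Z \<omega>) (\<lambda>\<omega>. Y \<omega> + Z \<omega>)"
    unfolding ip_def power2_eq_square[symmetric]
  proof (rule centred_gaussian_AE_limit)
    show "AE \<omega> in M. (\<lambda>n. X n \<omega> + Z \<omega>) \<longlonglongrightarrow> Y \<omega> + Z \<omega>"
      using lim by eventually_elim (auto intro!: tendsto_intros)
  qed (use X Y Z add_H gaussian measurable_H in auto)
  moreover have "(\<lambda>n. ip (X n) (X n)) \<longlonglongrightarrow> ip Y Y"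
    unfolding ip_def power2_eq_square[symmetric]
    by (rule centred_gaussian_AE_limit) (use X Y lim gaussian measurable_H in auto)
  ultimately have "(\<lambda>n. (ip (\<lambda>\<omega>. X n \<omega> + Z \<omega>) (\<lambda>\<omega>. X n \<omega> + Z \<omega>) - ip (X n) (X n) - ip Z Z) / 2)
      \<longlonglongrightarrow> (ip (\<lambda>\<omega>. Y \<omega> + Z \<omega>) (\<lambda>\<omega>. Y \<omega> + Z \<omega>) - ip Y Y - ip Z Z) / 2"
    by (intro tendsto_intros) auto
  then show ?thesis using X Y by (simp add: pol[symmetric])
qed

text \<open>
  One step of sequential closure under almost sure limits; it is iterated below, once for each
  order of differentiation.
\<close>

definition AE_closure :: "('w \<Rightarrow> real) set" where
  "AE_closure = {Y \<in> borel_measurable M. \<exists>X. (\<forall>n. X n \<in> H) \<and> (AE \<omega> in M. (\<lambda>n::nat. X n \<omega>) \<longlonglongrightarrow> Y \<omega>)}"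

lemma gaussian_space_AE_closure: "gaussian_space M AE_closure"
proof
  fix Y assume "Y \<in> AE_closure"
  then show "centred_gaussian M Y"
    using centred_gaussian_AE_limit(1) gaussian by (auto simp: AE_closure_def)
next
  fix Y Z a b assume "Y \<in> AE_closure" "Z \<in> AE_closure"
  then obtain X X' where *: "\<And>n::nat. X n \<in> H" "\<And>n::nat. X' n \<in> H" 
    "AE \<omega> in M. (\<lambda>n. X n \<omega>) \<longlonglongrightarrow> Y \<omega>" "AE \<omega> in M. (\<lambda>n. X' n \<omega>) \<longlonglongrightarrow> Z \<omega>"
    "Y \<in> borel_measurable M" "Z \<in> borel_measurable M"
    by (auto simp: AE_closure_def)
  have "AE \<omega> in M. (\<lambda>n. a * X n \<omega> + b * X' n \<omega>) \<longlonglongrightarrow> a * Y \<omega> + b * Z \<omega>"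
    using *(3,4) by eventually_elim (auto intro!: tendsto_intros)
  with * lincomb show "(\<lambda>\<omega>. a * Y \<omega> + b * Z \<omega>) \<in> AE_closure"
    unfolding AE_closure_def by (auto intro!: exI[of _ "\<lambda>n \<omega>. a * X n \<omega> + b * X' n \<omega>"])
qed

lemma subset_AE_closure: "H \<subseteq> AE_closure"
  unfolding AE_closure_def using measurable_H by (auto intro!: exI)

text \<open>
  The variance of a linear combination of uncorrelated variables is the sum of the variances, so
  that the joint characteristic function factorises.
\<close>

lemma uncorrelated_indep_vars:
  assumes I: "finite I" "I \<noteq> {}" and X: "\<And>i. i \<in> I \<Longrightarrow> X i \<in> H"
    and unc: "\<And>i j. i \<in> I \<Longrightarrow> j \<in> I \<Longrightarrow> i \<noteq> j \<Longrightarrow> ip (X i) (X j) = 0"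
  shows "indep_vars (\<lambda>_. borel) X I"
proof (rule indep_vars_of_char[OF I(1)])
  show "X i \<in> borel_measurable M" if "i \<in> I" for i using X measurable_H that by auto
  have ch: "(CLINT \<omega>|M. iexp (Y \<omega>)) = exp (- ip Y Y / 2)" if "Y \<in> H" for Y
    using char_centred_gaussian[OF gaussian[OF that], of 1] measurable_H[OF that]
    by (simp add: char_def integral_distr ip_def power2_eq_square)
  fix a :: "_ \<Rightarrow> real"
  let ?S = "\<lambda>\<omega>. \<Sum>i\<in>I. a i * X i \<omega>"
  have S: "?S \<in> H" using I X by (rule sum_H)
  have "ip ?S ?S = (\<Sum>i\<in>I. a i * ip ?S (X i))"
    using ip_sum_left[of I X ?S a, OF I(1) X S] by (simp add: ip_commute)
  also have "\<dots> = (\<Sum>i\<in>I. (a i)\<^sup>2 * ip (X i) (X i))"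
  proof (intro sum.cong refl)
    fix i assume i: "i \<in> I"
    have "ip ?S (X i) = (\<Sum>j\<in>I. a j * ip (X j) (X i))"
      using ip_sum_left[of I X "X i" a, OF I(1) X X[OF i]] by simp
    also have "\<dots> = (\<Sum>j\<in>I. if j = i then a i * ip (X i) (X i) else 0)"
      using unc i by (intro sum.cong) auto
    finally show "a i * ip ?S (X i) = (a i)\<^sup>2 * ip (X i) (X i)"
      using I i by (simp add: power2_eq_square)
  qed
  finally have v: "ip ?S ?S = (\<Sum>i\<in>I. (a i)\<^sup>2 * ip (X i) (X i))" .
  have "(CLINT \<omega>|M. iexp (?S \<omega>)) = complex_of_real (exp (\<Sum>i\<in>I. - ((a i)\<^sup>2 * ip (X i) (X i)) / 2))"
    unfolding ch[OF S] v by (simp add: sum_negf sum_divide_distrib)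
  also have "\<dots> = (\<Prod>i\<in>I. complex_of_real (exp (- ((a i)\<^sup>2 * ip (X i) (X i)) / 2)))"
    using I by (simp add: exp_sum)
  also have "\<dots> = (\<Prod>i\<in>I. CLINT \<omega>|M. iexp (a i * X i \<omega>))"
    by (intro prod.cong refl)
       (subst ch[OF scale_H[OF X]], simp_all add: ip_scale_left ip_scale_right power2_eq_square mult_ac)
  finally show "(CLINT \<omega>|M. iexp (?S \<omega>)) = (\<Prod>i\<in>I. CLINT \<omega>|M. iexp (a i * X i \<omega>))" .
qed

end

section \<open>Moment and small ball estimates\<close>

lemma integrable_std_normal_weight: "integrable std_normal_distribution (\<lambda>z. (1 + V * z\<^sup>2) ^ k)"
proof -
  have "(\<lambda>z::real. (1 + V * z\<^sup>2) ^ k) = (\<lambda>z. \<Sum>i\<le>k. real (k choose i) * V ^ (k - i) * z ^ (2 * (k - i)))"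
    by (simp add: binomial_ring[of 1] power_mult_distrib power_mult mult.assoc)
  then show ?thesis
    by (auto intro!: integrable_std_normal_distribution_moment)
qed

definition normal_weight_moment :: "nat \<Rightarrow> real \<Rightarrow> real" where
  "normal_weight_moment k V = (LINT z|std_normal_distribution. (1 + V * z\<^sup>2) ^ k)"

lemma normal_weight_moment_nonneg: "0 \<le> V \<Longrightarrow> 0 \<le> normal_weight_moment k V"
  unfolding normal_weight_moment_def by (intro integral_nonneg_AE) auto

context prob_space
begin

lemma nn_integral_centred_gaussian:
  assumes "centred_gaussian M X" and [measurable]: "f \<in> borel_measurable borel"
  shows "(\<integral>\<^sup>+\<omega>. f (X \<omega>) \<partial>M) = (\<integral>\<^sup>+z. f (sqrt (expectation (\<lambda>\<omega>. (X \<omega>)\<^sup>2)) * z) \<partial>std_normal_distribution)"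
proof -
  have X[measurable]: "X \<in> borel_measurable M" using assms by (simp add: centred_gaussian_def)
  have "(\<integral>\<^sup>+\<omega>. f (X \<omega>) \<partial>M) = (\<integral>\<^sup>+x. f x \<partial>distr M borel X)"
    by (subst nn_integral_distr) auto
  also have "\<dots> = (\<integral>\<^sup>+z. f (sqrt (expectation (\<lambda>\<omega>. (X \<omega>)\<^sup>2)) * z) \<partial>std_normal_distribution)"
    by (subst centred_gaussian_moments(3)[OF assms(1)], subst nn_integral_distr) auto
  finally show ?thesis .
qed

lemma gaussian_weight_moment:
  assumes "centred_gaussian M X" and V: "expectation (\<lambda>\<omega>. (X \<omega>)\<^sup>2) \<le> V"
  shows "(\<integral>\<^sup>+\<omega>. ennreal ((1 + (X \<omega>)\<^sup>2) ^ k) \<partial>M) \<le> ennreal (normal_weight_moment k V)"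
proof -
  have e0: "0 \<le> expectation (\<lambda>\<omega>. (X \<omega>)\<^sup>2)" by (intro integral_nonneg_AE) auto
  have "(\<integral>\<^sup>+\<omega>. ennreal ((1 + (X \<omega>)\<^sup>2) ^ k) \<partial>M)
      = (\<integral>\<^sup>+z. ennreal ((1 + (sqrt (expectation (\<lambda>\<omega>. (X \<omega>)\<^sup>2)) * z)\<^sup>2) ^ k) \<partial>std_normal_distribution)"
    by (rule nn_integral_centred_gaussian[OF assms(1)]) measurable
  also have "\<dots> \<le> (\<integral>\<^sup>+z. ennreal ((1 + V * z\<^sup>2) ^ k) \<partial>std_normal_distribution)"
    using e0 V by (intro nn_integral_mono ennreal_leI power_mono add_left_mono)
       (auto simp: power_mult_distrib intro!: mult_right_mono)
  also have "\<dots> = ennreal (normal_weight_moment k V)"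
    unfolding normal_weight_moment_def
    by (intro nn_integral_eq_integral integrable_std_normal_weight AE_I2)
      (use order_trans[OF e0 V] in simp)
  finally show ?thesis .
qed

text \<open>
  The density of a Gaussian variable with standard deviation at least \<open>\<sigma>\<close> is at most \<open>1 / (2 \<sigma>)\<close>.
\<close>

lemma gaussian_small_ball:
  assumes g: "centred_gaussian M X" and t: "0 \<le> t" and \<sigma>: "\<sigma> > 0" "\<sigma>\<^sup>2 \<le> expectation (\<lambda>\<omega>. (X \<omega>)\<^sup>2)"
  shows "(\<integral>\<^sup>+\<omega>. indicator {-t..t} (X \<omega>) \<partial>M) \<le> ennreal (t / \<sigma>)"
proof -
  define s where "s = sqrt (expectation (\<lambda>\<omega>. (X \<omega>)\<^sup>2))"
  have "s \<ge> \<sigma>"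
    using real_le_rsqrt[OF \<sigma>(2)] by (simp add: s_def)
  then have s: "s \<ge> \<sigma>" "s > 0"
    using \<sigma> by auto
  have pi: "sqrt (2 * pi) \<ge> 2"
    using pi_gt3 by (intro real_le_rsqrt) auto
  have dens: "std_normal_density z \<le> 1 / 2" for z
  proof -
    have "std_normal_density z \<le> 1 / sqrt (2 * pi) * 1"
      unfolding std_normal_density_def by (intro mult_left_mono) auto
    also have "\<dots> \<le> 1 / 2" using pi by (simp add: field_simps)
    finally show ?thesis .
  qed
  have "(\<integral>\<^sup>+\<omega>. indicator {-t..t} (X \<omega>) \<partial>M) = (\<integral>\<^sup>+z. indicator {-t..t} (s * z) \<partial>std_normal_distribution)"
    unfolding s_def by (rule nn_integral_centred_gaussian[OF g]) measurable
  also have "\<dots> = (\<integral>\<^sup>+z. ennreal (std_normal_density z) * indicator {-t..t} (s * z) \<partial>lborel)"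
    by (subst nn_integral_density) auto
  also have "\<dots> \<le> (\<integral>\<^sup>+z. ennreal (1 / 2) * indicator {- (t / s)..t / s} z \<partial>lborel)"
    using s dens by (intro nn_integral_mono mult_mono ennreal_leI) (auto simp: indicator_def field_simps)
  also have "\<dots> = ennreal (1 / 2) * emeasure lborel {- (t / s)..t / s}"
    by (subst nn_integral_cmult) auto
  also have "\<dots> = ennreal (1 / 2 * (t / s + t / s))"
  proof -
    have "emeasure lborel {- (t / s)..t / s} = ennreal (t / s + t / s)"
      using s t by (subst emeasure_lborel_Icc) auto
    then show ?thesis
      using s t by (simp only:) (rule ennreal_mult[symmetric]; simp)
  qed
  also have "\<dots> = ennreal (t / s)" by simp
  also have "\<dots> \<le> ennreal (t / \<sigma>)"
    using s t \<sigma> by (intro ennreal_leI divide_left_mono) auto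
  finally show ?thesis .
qed

text \<open>
  Independence of two random variables with possibly different range types, in the form of
  Fubini's theorem for the joint law.
\<close>

definition indep_pair :: "'b measure \<Rightarrow> ('a \<Rightarrow> 'b) \<Rightarrow> 'c measure \<Rightarrow> ('a \<Rightarrow> 'c) \<Rightarrow> bool" where
  "indep_pair S X T Y \<longleftrightarrow> X \<in> measurable M S \<and> Y \<in> measurable M T \<and>
     (\<forall>f\<in>borel_measurable (S \<Otimes>\<^sub>M T).
        (\<integral>\<^sup>+\<omega>. f (X \<omega>, Y \<omega>) \<partial>M) = (\<integral>\<^sup>+\<omega>. (\<integral>\<^sup>+\<omega>'. f (X \<omega>', Y \<omega>) \<partial>M) \<partial>M))"

lemma indep_nn_integral_pair:
  "indep_pair S X T Y \<Longrightarrow> f \<in> borel_measurable (S \<Otimes>\<^sub>M T) \<Longrightarrow>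
    (\<integral>\<^sup>+\<omega>. f (X \<omega>, Y \<omega>) \<partial>M) = (\<integral>\<^sup>+\<omega>. (\<integral>\<^sup>+\<omega>'. f (X \<omega>', Y \<omega>) \<partial>M) \<partial>M)"
  by (auto simp: indep_pair_def)

lemma indep_pair_of_indep_var:
  assumes ind: "indep_var S X T Y" and g: "g \<in> measurable S S'" "h \<in> measurable T T'"
  shows "indep_pair S' (\<lambda>\<omega>. g (X \<omega>)) T' (\<lambda>\<omega>. h (Y \<omega>))"
  unfolding indep_pair_def
proof (intro conjI ballI)
  note g[measurable]
  have [measurable]: "X \<in> measurable M S" "Y \<in> measurable M T"
    using indep_var_rv1[OF ind] indep_var_rv2[OF ind] by auto
  show "(\<lambda>\<omega>. g (X \<omega>)) \<in> measurable M S'" "(\<lambda>\<omega>. h (Y \<omega>)) \<in> measurable M T'" by measurable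
  fix f :: "_ \<Rightarrow> ennreal" assume [measurable]: "f \<in> borel_measurable (S' \<Otimes>\<^sub>M T')"
  interpret X: prob_space "distr M S X" by (rule prob_space_distr) simp
  interpret Y: prob_space "distr M T Y" by (rule prob_space_distr) simp
  interpret pair_sigma_finite "distr M S X" "distr M T Y" ..
  let ?f = "\<lambda>z. f (g (fst z), h (snd z))"
  have f': "?f \<in> borel_measurable (S \<Otimes>\<^sub>M T)" by measurable
  have "(\<integral>\<^sup>+\<omega>. f (g (X \<omega>), h (Y \<omega>)) \<partial>M) = (\<integral>\<^sup>+z. ?f z \<partial>distr M (S \<Otimes>\<^sub>M T) (\<lambda>x. (X x, Y x)))"
    by (subst nn_integral_distr) auto
  also have "\<dots> = (\<integral>\<^sup>+z. ?f z \<partial>(distr M S X \<Otimes>\<^sub>M distr M T Y))"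
    using ind by (simp add: indep_var_distribution_eq)
  also have "\<dots> = (\<integral>\<^sup>+y. (\<integral>\<^sup>+x. ?f (x, y) \<partial>distr M S X) \<partial>distr M T Y)"
    using f' by (subst nn_integral_snd[symmetric]) (auto simp: case_prod_beta')
  also have "\<dots> = (\<integral>\<^sup>+\<omega>. (\<integral>\<^sup>+x. ?f (x, Y \<omega>) \<partial>distr M S X) \<partial>M)"
    by (subst nn_integral_distr) auto
  also have "\<dots> = (\<integral>\<^sup>+\<omega>. (\<integral>\<^sup>+\<omega>'. ?f (X \<omega>', Y \<omega>) \<partial>M) \<partial>M)"
  proof (intro nn_integral_cong)
    fix \<omega> assume "\<omega> \<in> space M"
    then have "Y \<omega> \<in> space T" by (rule measurable_space[rotated]) simp
    then show "(\<integral>\<^sup>+x. ?f (x, Y \<omega>) \<partial>distr M S X) = (\<integral>\<^sup>+\<omega>'. ?f (X \<omega>', Y \<omega>) \<partial>M)"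
      by (subst nn_integral_distr) auto
  qed
  finally show "(\<integral>\<^sup>+\<omega>. f (g (X \<omega>), h (Y \<omega>)) \<partial>M) = (\<integral>\<^sup>+\<omega>. (\<integral>\<^sup>+\<omega>'. f (g (X \<omega>'), h (Y \<omega>)) \<partial>M) \<partial>M)"
    by simp
qed

end

section \<open>Small products of independent Gaussian variables\<close>

text \<open>
  This is \<open>min 1 (\<epsilon> / |x|)\<close>: up to a constant, the probability that a nondegenerate Gaussian
  variable is at most \<open>\<epsilon> / |x|\<close> in absolute value.
\<close>

definition capped_inverse :: "real \<Rightarrow> real \<Rightarrow> real" where
  "capped_inverse \<epsilon> x = (if \<bar>x\<bar> \<le> \<epsilon> then 1 else \<epsilon> / \<bar>x\<bar>)"

lemma capped_inverse_measurable[measurable]: "capped_inverse \<epsilon> \<in> borel_measurable borel"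
  unfolding capped_inverse_def[abs_def] by measurable

text \<open>
  On the dyadic shell where \<open>|x|\<close> is comparable to \<open>2\<^sup>k \<epsilon>\<close>, the value is at most \<open>2\<^sup>-\<^sup>k\<close>.
\<close>

lemma capped_inverse_dyadic:
  assumes "0 < \<epsilon>" "\<bar>x\<bar> \<le> 1" "1 \<le> 2 ^ K * \<epsilon>"
  shows "capped_inverse \<epsilon> x \<le> (\<Sum>k\<le>K. (1/2) ^ k * indicator {- (2 ^ (k + 1) * \<epsilon>)..2 ^ (k + 1) * \<epsilon>} x)"
proof -
  let ?P = "\<lambda>k. \<bar>x\<bar> \<le> 2 ^ (k + 1) * \<epsilon>"
  have K: "?P K" using assms by simp
  define k where "k = (LEAST k. ?P k)"
  have k: "?P k" "k \<le> K" unfolding k_def using K by (auto intro: LeastI Least_le)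
  have "capped_inverse \<epsilon> x \<le> (1/2) ^ k"
  proof (cases k)
    case 0
    then show ?thesis using assms by (auto simp: capped_inverse_def)
  next
    case (Suc j)
    then have "\<not> ?P j" using not_less_Least[of j ?P] k_def by auto
    then have big: "\<bar>x\<bar> > 2 ^ k * \<epsilon>" using Suc by simp
    moreover have "1 * \<epsilon> \<le> 2 ^ k * \<epsilon>" using assms by (intro mult_right_mono) auto
    ultimately have "\<bar>x\<bar> > \<epsilon>" by simp
    then show ?thesis
      using big assms by (auto simp: capped_inverse_def field_simps power_one_over)
  qed
  also have "\<dots> = (1/2) ^ k * indicator {- (2 ^ (k + 1) * \<epsilon>)..2 ^ (k + 1) * \<epsilon>} x"
    using k(1) by (auto simp: indicator_def abs_le_iff)
  also have "\<dots> \<le> (\<Sum>k\<le>K. (1/2) ^ k * indicator {- (2 ^ (k + 1) * \<epsilon>)..2 ^ (k + 1) * \<epsilon>} x)"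
    by (rule member_le_sum[of k "{..K}" "\<lambda>k. (1/2) ^ k * indicator {- (2 ^ (k + 1) * \<epsilon>)..2 ^ (k + 1) * \<epsilon>} x"])
       (use k in auto)
  finally show ?thesis .
qed

context prob_space
begin

text \<open>
  Each of the about \<open>log (1/\<epsilon>)\<close> dyadic shells below \<open>1\<close> contributes a multiple of \<open>\<epsilon>\<close>: a value
  \<open>2\<^sup>-\<^sup>k\<close> on an event of probability of order \<open>2\<^sup>k \<epsilon>\<close>. This is where the logarithm comes from.
\<close>

lemma gaussian_capped_inverse:
  assumes g: "centred_gaussian M P" and \<sigma>: "\<sigma> > 0" "\<sigma>\<^sup>2 \<le> expectation (\<lambda>\<omega>. (P \<omega>)\<^sup>2)"
    and V: "expectation (\<lambda>\<omega>. (P \<omega>)\<^sup>2) \<le> V" and \<epsilon>: "0 < \<epsilon>" "\<epsilon> \<le> 1 / 2"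
  shows "(\<integral>\<^sup>+\<omega>. ennreal ((1 + (P \<omega>)\<^sup>2) ^ 3 * capped_inverse \<epsilon> (P \<omega>)) \<partial>M)
    \<le> ennreal ((96 / \<sigma> + 2 * normal_weight_moment 3 V) * (\<epsilon> * ln (1 / \<epsilon>)))"
proof -
  have [measurable]: "P \<in> borel_measurable M" using g by (simp add: centred_gaussian_def)
  have V0: "0 \<le> V" using \<sigma> V by (meson order_trans zero_le_power2)
  \<comment> \<open>The smallest number of shells that reach from \<open>\<epsilon>\<close> to \<open>1\<close>.\<close>
  define K where "K = nat \<lceil>log 2 (1 / \<epsilon>)\<rceil>"
  have lg: "1 \<le> log 2 (1 / \<epsilon>)" using \<epsilon> by (simp add: le_log_iff field_simps)
  have K1: "log 2 (1 / \<epsilon>) \<le> real K" "real K \<le> log 2 (1 / \<epsilon>) + 1"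
    using lg ceiling_correct[of "log 2 (1 / \<epsilon>)"] unfolding K_def by linarith+
  have "1 / \<epsilon> \<le> 2 ^ K"
    using K1(1) \<epsilon> by (simp add: log_le_iff powr_realpow)
  then have K2: "1 \<le> 2 ^ K * \<epsilon>" using \<epsilon> by (simp add: field_simps)
  have ln2: "1 / 2 \<le> ln (2::real)" using ln_le_minus_one[of "1/2 :: real"] by (simp add: ln_div)
  have "log 2 (1 / \<epsilon>) = ln (1 / \<epsilon>) / ln 2" by (simp add: log_def)
  also have "\<dots> \<le> ln (1 / \<epsilon>) / (1 / 2)"
    using ln2 \<epsilon> by (intro divide_left_mono) auto
  finally have lg2: "log 2 (1 / \<epsilon>) \<le> 2 * ln (1 / \<epsilon>)" by simp
  have lnhalf: "1 / 2 \<le> ln (1 / \<epsilon>)" using lg lg2 by simp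
  have K3: "real K + 1 \<le> 6 * ln (1 / \<epsilon>)" using K1 lg lg2 by linarith
  have pw: "(1 + x\<^sup>2) ^ 3 * capped_inverse \<epsilon> x 
      \<le> 8 * (\<Sum>k\<le>K. (1/2) ^ k * indicator {- (2 ^ (k + 1) * \<epsilon>)..2 ^ (k + 1) * \<epsilon>} x) + \<epsilon> * (1 + x\<^sup>2) ^ 3" for x
  proof (cases "\<bar>x\<bar> \<le> 1")
    case True
    have ci: "0 \<le> capped_inverse \<epsilon> x" using \<epsilon> by (simp add: capped_inverse_def)
    have "x\<^sup>2 \<le> 1" using True by (simp add: abs_square_le_1)
    then have "(1 + x\<^sup>2) ^ 3 \<le> (1 + 1) ^ 3" by (intro power_mono) auto
    then have "(1 + x\<^sup>2) ^ 3 * capped_inverse \<epsilon> x \<le> 8 * capped_inverse \<epsilon> x"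
      using ci by (intro mult_right_mono) auto
    also have "\<dots> \<le> 8 * (\<Sum>k\<le>K. (1/2) ^ k * indicator {- (2 ^ (k + 1) * \<epsilon>)..2 ^ (k + 1) * \<epsilon>} x)"
      using capped_inverse_dyadic[OF \<epsilon>(1) True K2] by simp
    also have "\<dots> \<le> \<dots> + \<epsilon> * (1 + x\<^sup>2) ^ 3" using \<epsilon> by simp
    finally show ?thesis .
  next
    case False
    have "capped_inverse \<epsilon> x \<le> \<epsilon>"
      using False \<epsilon> mult_left_mono[of 1 "\<bar>x\<bar>" \<epsilon>] by (auto simp: capped_inverse_def field_simps)
    then have "(1 + x\<^sup>2) ^ 3 * capped_inverse \<epsilon> x \<le> (1 + x\<^sup>2) ^ 3 * \<epsilon>" by (intro mult_left_mono) auto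
    also have "\<dots> \<le> 8 * (\<Sum>k\<le>K. (1/2) ^ k * indicator {- (2 ^ (k + 1) * \<epsilon>)..2 ^ (k + 1) * \<epsilon>} x) + \<epsilon> * (1 + x\<^sup>2) ^ 3"
      by (auto intro!: sum_nonneg)
    finally show ?thesis .
  qed
  have "(\<integral>\<^sup>+\<omega>. ennreal ((1 + (P \<omega>)\<^sup>2) ^ 3 * capped_inverse \<epsilon> (P \<omega>)) \<partial>M)
    \<le> (\<integral>\<^sup>+\<omega>. (\<Sum>k\<le>K. ennreal (8 * (1/2) ^ k) * indicator {- (2 ^ (k + 1) * \<epsilon>)..2 ^ (k + 1) * \<epsilon>} (P \<omega>))
        + ennreal \<epsilon> * ennreal ((1 + (P \<omega>)\<^sup>2) ^ 3) \<partial>M)"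
  proof (intro nn_integral_mono)
    fix \<omega>
    have "ennreal ((1 + (P \<omega>)\<^sup>2) ^ 3 * capped_inverse \<epsilon> (P \<omega>))
      \<le> ennreal ((\<Sum>k\<le>K. 8 * (1/2) ^ k * indicator {- (2 ^ (k + 1) * \<epsilon>)..2 ^ (k + 1) * \<epsilon>} (P \<omega>)) + \<epsilon> * (1 + (P \<omega>)\<^sup>2) ^ 3)"
      using pw[of "P \<omega>"] by (intro ennreal_leI) (simp only: sum_distrib_left mult.assoc)
    also have "\<dots> = (\<Sum>k\<le>K. ennreal (8 * (1/2) ^ k * indicator {- (2 ^ (k + 1) * \<epsilon>)..2 ^ (k + 1) * \<epsilon>} (P \<omega>)))
        + ennreal (\<epsilon> * (1 + (P \<omega>)\<^sup>2) ^ 3)"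
      using \<epsilon> by (subst ennreal_plus) (auto intro!: sum_nonneg simp: sum_ennreal)
    also have "\<dots> = (\<Sum>k\<le>K. ennreal (8 * (1/2) ^ k) * indicator {- (2 ^ (k + 1) * \<epsilon>)..2 ^ (k + 1) * \<epsilon>} (P \<omega>))
        + ennreal \<epsilon> * ennreal ((1 + (P \<omega>)\<^sup>2) ^ 3)"
      using \<epsilon> by (intro arg_cong2[where f="(+)"] sum.cong ennreal_mult) (auto simp: indicator_def)
    finally show "ennreal ((1 + (P \<omega>)\<^sup>2) ^ 3 * capped_inverse \<epsilon> (P \<omega>)) \<le> \<dots>" .
  qed
  also have "\<dots> = (\<Sum>k\<le>K. ennreal (8 * (1/2) ^ k) * (\<integral>\<^sup>+\<omega>. indicator {- (2 ^ (k + 1) * \<epsilon>)..2 ^ (k + 1) * \<epsilon>} (P \<omega>) \<partial>M))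
        + ennreal \<epsilon> * (\<integral>\<^sup>+\<omega>. ennreal ((1 + (P \<omega>)\<^sup>2) ^ 3) \<partial>M)"
  proof (subst nn_integral_add)
    show "(\<integral>\<^sup>+\<omega>. (\<Sum>k\<le>K. ennreal (8 * (1/2) ^ k) * indicator {- (2 ^ (k + 1) * \<epsilon>)..2 ^ (k + 1) * \<epsilon>} (P \<omega>)) \<partial>M)
        + (\<integral>\<^sup>+\<omega>. ennreal \<epsilon> * ennreal ((1 + (P \<omega>)\<^sup>2) ^ 3) \<partial>M)
      = (\<Sum>k\<le>K. ennreal (8 * (1/2) ^ k) * (\<integral>\<^sup>+\<omega>. indicator {- (2 ^ (k + 1) * \<epsilon>)..2 ^ (k + 1) * \<epsilon>} (P \<omega>) \<partial>M))
        + ennreal \<epsilon> * (\<integral>\<^sup>+\<omega>. ennreal ((1 + (P \<omega>)\<^sup>2) ^ 3) \<partial>M)"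
      by (intro arg_cong2[where f="(+)"], subst nn_integral_sum, measurable,
          intro sum.cong refl nn_integral_cmult, measurable, intro nn_integral_cmult, measurable)
  qed measurable
  also have "\<dots> \<le> (\<Sum>k\<le>K. ennreal (8 * (1/2) ^ k) * ennreal (2 ^ (k + 1) * \<epsilon> / \<sigma>))
        + ennreal \<epsilon> * ennreal (normal_weight_moment 3 V)"
    using \<epsilon> by (intro add_mono sum_mono mult_left_mono gaussian_small_ball[OF g _ \<sigma>] gaussian_weight_moment[OF g V]) auto
  also have "\<dots> = (\<Sum>k\<le>K. ennreal (16 * \<epsilon> / \<sigma>)) + ennreal (\<epsilon> * normal_weight_moment 3 V)"
    using \<epsilon> \<sigma> normal_weight_moment_nonneg[OF V0]
    by (intro arg_cong2[where f="(+)"] sum.cong) (auto simp: ennreal_mult[symmetric] field_simps power_one_over)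
  also have "\<dots> = ennreal ((real K + 1) * (16 * \<epsilon> / \<sigma>) + \<epsilon> * normal_weight_moment 3 V)"
    using \<epsilon> \<sigma> normal_weight_moment_nonneg[OF V0]
    by (simp add: ennreal_of_nat_eq_real_of_nat ennreal_mult[symmetric] add.commute flip: ennreal_plus ennreal_1)
  also have "\<dots> \<le> ennreal ((96 / \<sigma> + 2 * normal_weight_moment 3 V) * (\<epsilon> * ln (1 / \<epsilon>)))"
  proof (rule ennreal_leI)
    have "(real K + 1) * (16 * \<epsilon> / \<sigma>) \<le> (6 * ln (1 / \<epsilon>)) * (16 * \<epsilon> / \<sigma>)"
      using K3 \<epsilon> \<sigma> by (intro mult_right_mono) auto
    moreover have "\<epsilon> * normal_weight_moment 3 V * 1 \<le> \<epsilon> * normal_weight_moment 3 V * (2 * ln (1 / \<epsilon>))"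
      using \<epsilon> lnhalf normal_weight_moment_nonneg[OF V0] by (intro mult_left_mono) auto
    ultimately show "(real K + 1) * (16 * \<epsilon> / \<sigma>) + \<epsilon> * normal_weight_moment 3 V
        \<le> (96 / \<sigma> + 2 * normal_weight_moment 3 V) * (\<epsilon> * ln (1 / \<epsilon>))"
      by (simp add: algebra_simps)
  qed
  finally show ?thesis .
qed

text \<open>
  The condition \<open>|B| \<le> t (1 + B\<^sup>2)\<close> also holds for large \<open>|B|\<close>. There \<open>1 \<le> 2 t (1 + B\<^sup>2)\<close>, so
  that the factor \<open>t\<close> is obtained at the cost of one more power of the weight.
\<close>

lemma gaussian_weighted_small_ball:
  assumes g: "centred_gaussian M B" and \<sigma>: "\<sigma> > 0" "\<sigma>\<^sup>2 \<le> expectation (\<lambda>\<omega>. (B \<omega>)\<^sup>2)"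
    and V: "expectation (\<lambda>\<omega>. (B \<omega>)\<^sup>2) \<le> V" and t: "0 \<le> t"
  shows "(\<integral>\<^sup>+\<omega>. ennreal ((1 + (B \<omega>)\<^sup>2)\<^sup>2 * of_bool (\<bar>B \<omega>\<bar> \<le> t * (1 + (B \<omega>)\<^sup>2))) \<partial>M)
    \<le> ennreal ((8 / \<sigma> + 2 * normal_weight_moment 3 V + normal_weight_moment 2 V) * min 1 t)"
    (is "?I \<le> _")
proof -
  have [measurable]: "B \<in> borel_measurable M" using g by (simp add: centred_gaussian_def)
  have V0: "0 \<le> V" using \<sigma> V by (meson order_trans zero_le_power2)
  note nn = normal_weight_moment_nonneg[OF V0]
  have I1: "?I \<le> ennreal (normal_weight_moment 2 V)"
    by (rule order_trans[OF nn_integral_mono gaussian_weight_moment[OF g V]]) (auto intro!: ennreal_leI)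
  have pw: "(1 + x\<^sup>2)\<^sup>2 * of_bool (\<bar>x\<bar> \<le> t * (1 + x\<^sup>2)) \<le> 4 * indicator {-(2*t)..2*t} x + (2 * t) * (1 + x\<^sup>2) ^ 3" for x
  proof (cases "\<bar>x\<bar> \<le> t * (1 + x\<^sup>2)")
    case True
    show ?thesis
    proof (cases "\<bar>x\<bar> \<le> 1")
      case x1: True
      then have x2: "x\<^sup>2 \<le> 1" by (simp add: abs_square_le_1)
      then have "(1 + x\<^sup>2)\<^sup>2 \<le> (1 + 1)\<^sup>2" by (intro power_mono) auto
      then have "(1 + x\<^sup>2)\<^sup>2 \<le> 4" by simp
      moreover have "t * (1 + x\<^sup>2) \<le> t * 2" using x2 t by (intro mult_left_mono) auto
      then have "x \<in> {-(2*t)..2*t}" using True by auto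
      moreover have "0 \<le> (2 * t) * (1 + x\<^sup>2) ^ 3" using t by simp
      ultimately have "(1 + x\<^sup>2)\<^sup>2 \<le> 4 * 1 + (2 * t) * (1 + x\<^sup>2) ^ 3" "indicator {-(2*t)..2*t} x = (1::real)"
        by (simp_all only: indicator_simps)
      then show ?thesis using True by (simp only: of_bool_eq mult_1_right)
    next
      case False
      then have x1: "1 \<le> \<bar>x\<bar>" by simp
      have x2: "\<bar>x\<bar> * \<bar>x\<bar> = x\<^sup>2" by (simp add: power2_eq_square)
      have "1 \<le> x\<^sup>2" using x1 mult_mono[of 1 "\<bar>x\<bar>" 1 "\<bar>x\<bar>"] x2 by simp
      then have "t * (1 + x\<^sup>2) \<le> t * (2 * x\<^sup>2)" using t by (intro mult_left_mono) auto
      moreover have "t * (2 * x\<^sup>2) = (2 * t * \<bar>x\<bar>) * \<bar>x\<bar>" unfolding x2[symmetric] by (simp only: mult_ac)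
      ultimately have "1 * \<bar>x\<bar> \<le> (2 * t * \<bar>x\<bar>) * \<bar>x\<bar>"
        using True by linarith
      then have "1 \<le> 2 * t * \<bar>x\<bar>" using x1 by (subst (asm) mult_le_cancel_right) auto
      also have "\<dots> \<le> 2 * t * (1 + x\<^sup>2)"
        using t x1 x2 mult_left_mono[of 1 "\<bar>x\<bar>" "\<bar>x\<bar>"] by (intro mult_left_mono) auto
      finally have "(1 + x\<^sup>2)\<^sup>2 * 1 \<le> (1 + x\<^sup>2)\<^sup>2 * (2 * t * (1 + x\<^sup>2))" by (intro mult_left_mono) auto
      also have "\<dots> = (2 * t) * (1 + x\<^sup>2) ^ 3" by (simp only: power2_eq_square power3_eq_cube mult_ac)
      finally have le: "(1 + x\<^sup>2)\<^sup>2 * 1 \<le> (2 * t) * (1 + x\<^sup>2) ^ 3" .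
      have "0 \<le> 4 * indicat_real {-(2*t)..2*t} x" by simp
      with le True show ?thesis by (simp only: of_bool_eq)
    qed
  next
    case False
    then show ?thesis using t by simp
  qed
  have "?I \<le> (\<integral>\<^sup>+\<omega>. ennreal 4 * indicator {-(2*t)..2*t} (B \<omega>) + ennreal (2 * t) * ennreal ((1 + (B \<omega>)\<^sup>2) ^ 3) \<partial>M)"
  proof (rule nn_integral_mono)
    fix \<omega>
    have "ennreal ((1 + (B \<omega>)\<^sup>2)\<^sup>2 * of_bool (\<bar>B \<omega>\<bar> \<le> t * (1 + (B \<omega>)\<^sup>2)))
      \<le> ennreal (4 * indicator {-(2*t)..2*t} (B \<omega>) + (2 * t) * (1 + (B \<omega>)\<^sup>2) ^ 3)"
      by (intro ennreal_leI pw)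
    also have "\<dots> = ennreal (4 * indicator {-(2*t)..2*t} (B \<omega>)) + ennreal ((2 * t) * (1 + (B \<omega>)\<^sup>2) ^ 3)"
      using t by (intro ennreal_plus) auto
    also have "\<dots> = ennreal 4 * indicator {-(2*t)..2*t} (B \<omega>) + ennreal (2 * t) * ennreal ((1 + (B \<omega>)\<^sup>2) ^ 3)"
      using t by (intro arg_cong2[where f="(+)"] ennreal_mult) (auto simp: indicator_def)
    finally show "ennreal ((1 + (B \<omega>)\<^sup>2)\<^sup>2 * of_bool (\<bar>B \<omega>\<bar> \<le> t * (1 + (B \<omega>)\<^sup>2))) \<le> \<dots>" .
  qed
  also have "\<dots> = ennreal 4 * (\<integral>\<^sup>+\<omega>. indicator {-(2*t)..2*t} (B \<omega>) \<partial>M) + ennreal (2 * t) * (\<integral>\<^sup>+\<omega>. ennreal ((1 + (B \<omega>)\<^sup>2) ^ 3) \<partial>M)"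
    by (subst nn_integral_add) (auto simp: nn_integral_cmult)
  also have "\<dots> \<le> ennreal 4 * ennreal (2 * t / \<sigma>) + ennreal (2 * t) * ennreal (normal_weight_moment 3 V)"
    using t by (intro add_mono mult_left_mono gaussian_small_ball[OF g _ \<sigma>] gaussian_weight_moment[OF g V]) auto
  also have "\<dots> = ennreal (4 * (2 * t / \<sigma>)) + ennreal (2 * t * normal_weight_moment 3 V)"
    using t \<sigma> nn by (intro arg_cong2[where f="(+)"] ennreal_mult[symmetric]) auto
  also have "\<dots> = ennreal ((8 / \<sigma> + 2 * normal_weight_moment 3 V) * t)"
    using t \<sigma> nn by (subst ennreal_plus[symmetric]) (auto simp: algebra_simps)
  finally have I2: "?I \<le> ennreal ((8 / \<sigma> + 2 * normal_weight_moment 3 V) * t)" .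
  show ?thesis
  proof (cases "t \<le> 1")
    case True
    then have "(8 / \<sigma> + 2 * normal_weight_moment 3 V) * t
      \<le> (8 / \<sigma> + 2 * normal_weight_moment 3 V + normal_weight_moment 2 V) * min 1 t"
      using t nn by (auto simp: min_def intro!: mult_right_mono)
    with I2 show ?thesis by (meson ennreal_leI order_trans)
  next
    case False
    then have "normal_weight_moment 2 V
      \<le> (8 / \<sigma> + 2 * normal_weight_moment 3 V + normal_weight_moment 2 V) * min 1 t"
      using t nn \<sigma> by (auto simp: min_def)
    with I1 show ?thesis by (meson ennreal_leI order_trans)
  qed
qed

definition small_product_const :: "real \<Rightarrow> real \<Rightarrow> real \<Rightarrow> real" where
  "small_product_const \<sigma> V \<tau> = (8 / \<sigma> + 2 * normal_weight_moment 3 V + normal_weight_moment 2 V)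
      * (96 / \<sigma> + 2 * normal_weight_moment 3 V) * \<tau>"

text \<open>
  Integrating over \<open>B\<close> with \<open>P\<close> and \<open>T\<close> held fixed turns the condition on \<open>P B\<close> into the factor
  \<open>capped_inverse \<epsilon> P\<close>; integrating this over \<open>P\<close> gives \<open>\<epsilon> log (1/\<epsilon>)\<close>. The variable \<open>T\<close> stands for
  the polynomial weight in the remaining variables; since the bound \<open>\<epsilon> W\<close> of the condition grows
  with the weight \<open>W\<close>, one more power of \<open>W\<close> is needed than the two in the integrand, whence the
  third moment.
\<close>

lemma gaussian_small_product:
  assumes B: "centred_gaussian M B" "\<sigma>\<^sup>2 \<le> expectation (\<lambda>\<omega>. (B \<omega>)\<^sup>2)" "expectation (\<lambda>\<omega>. (B \<omega>)\<^sup>2) \<le> V"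
    and P: "centred_gaussian M P" "\<sigma>\<^sup>2 \<le> expectation (\<lambda>\<omega>. (P \<omega>)\<^sup>2)" "expectation (\<lambda>\<omega>. (P \<omega>)\<^sup>2) \<le> V"
    and \<sigma>: "\<sigma> > 0" and \<tau>: "\<tau> \<ge> 0"
    and indB: "indep_pair borel B (borel \<Otimes>\<^sub>M borel) (\<lambda>\<omega>. (P \<omega>, T \<omega>))"
    and indP: "indep_pair borel P borel T"
    and T1: "\<And>\<omega>. T \<omega> \<ge> (1::real)" and T3: "(\<integral>\<^sup>+\<omega>. ennreal (T \<omega> ^ 3) \<partial>M) \<le> ennreal \<tau>"
    and \<epsilon>: "0 < \<epsilon>" "\<epsilon> \<le> 1 / 2"
  shows "(\<integral>\<^sup>+\<omega>. ennreal (((1 + (P \<omega>)\<^sup>2) * (1 + (B \<omega>)\<^sup>2) * T \<omega>)\<^sup>2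
        * of_bool (\<bar>P \<omega> * B \<omega>\<bar> \<le> \<epsilon> * ((1 + (P \<omega>)\<^sup>2) * (1 + (B \<omega>)\<^sup>2) * T \<omega>))) \<partial>M)
      \<le> ennreal (small_product_const \<sigma> V \<tau> * (\<epsilon> * ln (1 / \<epsilon>)))"
proof -
  define c where "c = 8 / \<sigma> + 2 * normal_weight_moment 3 V + normal_weight_moment 2 V"
  have V0: "0 \<le> V" using B by (meson order_trans zero_le_power2)
  note nn = normal_weight_moment_nonneg[OF V0]
  have c0: "0 \<le> c" using nn \<sigma> by (simp add: c_def)
  have [measurable]: "B \<in> borel_measurable M" "P \<in> borel_measurable M"
    using B P by (auto simp: centred_gaussian_def)
  have [measurable]: "T \<in> borel_measurable M" using indP by (simp add: indep_pair_def)
  let ?f = "\<lambda>(b, p, t). ennreal (((1 + p\<^sup>2) * (1 + b\<^sup>2) * t)\<^sup>2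
        * of_bool (\<bar>p * b\<bar> \<le> \<epsilon> * ((1 + p\<^sup>2) * (1 + b\<^sup>2) * t)))"
  have "(\<integral>\<^sup>+\<omega>. ?f (B \<omega>, (P \<omega>, T \<omega>)) \<partial>M) = (\<integral>\<^sup>+\<omega>. (\<integral>\<^sup>+\<omega>'. ?f (B \<omega>', (P \<omega>, T \<omega>)) \<partial>M) \<partial>M)"
    by (rule indep_nn_integral_pair[OF indB]) (simp add: case_prod_beta')
  also have "\<dots> \<le> (\<integral>\<^sup>+\<omega>. ennreal c * (ennreal ((1 + (P \<omega>)\<^sup>2) ^ 3 * capped_inverse \<epsilon> (P \<omega>)) * ennreal (T \<omega> ^ 3)) \<partial>M)"
  proof (intro nn_integral_mono)
    fix \<omega>
    define p t where "p = P \<omega>" and "t = T \<omega>"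
    have t1: "t \<ge> 1" using T1 by (simp add: t_def)
    \<comment> \<open>The condition reads \<open>|b| \<le> u (1 + b\<^sup>2)\<close>; for \<open>p = 0\<close> it always holds, and so does the one with \<open>u = 1\<close>.\<close>
    define u where "u = (if p = 0 then 1 else \<epsilon> * (1 + p\<^sup>2) * t / \<bar>p\<bar>)"
    have u0: "0 \<le> u" using \<epsilon> t1 by (simp add: u_def)
    have "(\<integral>\<^sup>+\<omega>'. ?f (B \<omega>', (p, t)) \<partial>M)
      \<le> (\<integral>\<^sup>+\<omega>'. ennreal (((1 + p\<^sup>2) * t)\<^sup>2) * ennreal ((1 + (B \<omega>')\<^sup>2)\<^sup>2 * of_bool (\<bar>B \<omega>'\<bar> \<le> u * (1 + (B \<omega>')\<^sup>2))) \<partial>M)"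
    proof (intro nn_integral_mono)
      fix \<omega>'
      define b where "b = B \<omega>'"
      have imp: "\<bar>b\<bar> \<le> u * (1 + b\<^sup>2)" if "\<bar>p * b\<bar> \<le> \<epsilon> * ((1 + p\<^sup>2) * (1 + b\<^sup>2) * t)"
      proof (cases "p = 0")
        case True
        have "2 * \<bar>b\<bar> \<le> 1 + b\<^sup>2" using sum_squares_bound[of 1 "\<bar>b\<bar>"] by simp
        then show ?thesis using True abs_ge_zero[of b] unfolding u_def by (simp del: abs_ge_zero)
      next
        case False
        then show ?thesis using that by (simp add: u_def field_simps abs_mult)
      qed
      have "((1 + p\<^sup>2) * (1 + b\<^sup>2) * t)\<^sup>2 * of_bool (\<bar>p * b\<bar> \<le> \<epsilon> * ((1 + p\<^sup>2) * (1 + b\<^sup>2) * t))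
        \<le> ((1 + p\<^sup>2) * t)\<^sup>2 * ((1 + b\<^sup>2)\<^sup>2 * of_bool (\<bar>b\<bar> \<le> u * (1 + b\<^sup>2)))"
        using imp by (auto simp: power_mult_distrib)
      then show "?f (B \<omega>', (p, t)) \<le> ennreal (((1 + p\<^sup>2) * t)\<^sup>2) * ennreal ((1 + (B \<omega>')\<^sup>2)\<^sup>2 * of_bool (\<bar>B \<omega>'\<bar> \<le> u * (1 + (B \<omega>')\<^sup>2)))"
        unfolding b_def[symmetric] case_prod_conv by (subst ennreal_mult[symmetric]) (auto intro!: ennreal_leI)
    qed
    also have "\<dots> \<le> ennreal (((1 + p\<^sup>2) * t)\<^sup>2) * ennreal (c * min 1 u)"
      unfolding c_def
      by (subst nn_integral_cmult) (auto intro!: mult_left_mono gaussian_weighted_small_ball[OF B(1) \<sigma> B(2,3) u0])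
    also have "\<dots> = ennreal (((1 + p\<^sup>2) * t)\<^sup>2 * (c * min 1 u))"
      using c0 u0 by (intro ennreal_mult[symmetric]) auto
    also have "\<dots> \<le> ennreal (c * ((1 + p\<^sup>2) ^ 3 * capped_inverse \<epsilon> p * t ^ 3))"
    proof (rule ennreal_leI)
      have pt: "1 * 1 \<le> (1 + p\<^sup>2) * t" using t1 by (intro mult_mono) auto
      have "min 1 u \<le> (1 + p\<^sup>2) * t * capped_inverse \<epsilon> p"
      proof (cases "\<bar>p\<bar> \<le> \<epsilon>")
        case True
        have "min 1 u \<le> 1" by simp
        with True pt show ?thesis by (simp add: capped_inverse_def)
      next
        case False
        then have "p \<noteq> 0" using \<epsilon> by auto
        have "min 1 u \<le> u" by simp
        with False \<open>p \<noteq> 0\<close> show ?thesis by (simp add: capped_inverse_def u_def mult_ac)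
      qed
      then have "((1 + p\<^sup>2) * t)\<^sup>2 * c * min 1 u \<le> ((1 + p\<^sup>2) * t)\<^sup>2 * c * ((1 + p\<^sup>2) * t * capped_inverse \<epsilon> p)"
        using c0 by (intro mult_left_mono) auto
      then show "((1 + p\<^sup>2) * t)\<^sup>2 * (c * min 1 u) \<le> c * ((1 + p\<^sup>2) ^ 3 * capped_inverse \<epsilon> p * t ^ 3)"
        by (simp add: power_mult_distrib power2_eq_square power3_eq_cube mult_ac)
    qed
    also have "\<dots> = ennreal c * (ennreal ((1 + p\<^sup>2) ^ 3 * capped_inverse \<epsilon> p) * ennreal (t ^ 3))"
      using c0 \<epsilon> t1 by (subst ennreal_mult[symmetric], simp add: capped_inverse_def, simp,
          subst ennreal_mult[symmetric]) (auto simp: capped_inverse_def)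
    finally show "(\<integral>\<^sup>+\<omega>'. ?f (B \<omega>', (P \<omega>, T \<omega>)) \<partial>M)
      \<le> ennreal c * (ennreal ((1 + (P \<omega>)\<^sup>2) ^ 3 * capped_inverse \<epsilon> (P \<omega>)) * ennreal (T \<omega> ^ 3))"
      by (simp add: p_def t_def)
  qed
  also have "\<dots> = ennreal c * (\<integral>\<^sup>+\<omega>. ennreal ((1 + (P \<omega>)\<^sup>2) ^ 3 * capped_inverse \<epsilon> (P \<omega>)) * ennreal (T \<omega> ^ 3) \<partial>M)"
    by (rule nn_integral_cmult) measurable
  also have "(\<integral>\<^sup>+\<omega>. ennreal ((1 + (P \<omega>)\<^sup>2) ^ 3 * capped_inverse \<epsilon> (P \<omega>)) * ennreal (T \<omega> ^ 3) \<partial>M)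
    = (\<integral>\<^sup>+\<omega>. (\<lambda>(p, t). ennreal ((1 + p\<^sup>2) ^ 3 * capped_inverse \<epsilon> p) * ennreal (t ^ 3)) (P \<omega>, T \<omega>) \<partial>M)"
    by simp
  also have "\<dots> = (\<integral>\<^sup>+\<omega>. (\<integral>\<^sup>+\<omega>'. (\<lambda>(p, t). ennreal ((1 + p\<^sup>2) ^ 3 * capped_inverse \<epsilon> p) * ennreal (t ^ 3)) (P \<omega>', T \<omega>) \<partial>M) \<partial>M)"
    by (rule indep_nn_integral_pair[OF indP]) measurable
  also have "\<dots> = (\<integral>\<^sup>+\<omega>. (\<integral>\<^sup>+\<omega>'. ennreal ((1 + (P \<omega>')\<^sup>2) ^ 3 * capped_inverse \<epsilon> (P \<omega>')) \<partial>M) * ennreal (T \<omega> ^ 3) \<partial>M)"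
    by (simp add: nn_integral_multc)
  also have "\<dots> = (\<integral>\<^sup>+\<omega>'. ennreal ((1 + (P \<omega>')\<^sup>2) ^ 3 * capped_inverse \<epsilon> (P \<omega>')) \<partial>M) * (\<integral>\<^sup>+\<omega>. ennreal (T \<omega> ^ 3) \<partial>M)"
    by (rule nn_integral_cmult) measurable
  also have "ennreal c * \<dots> \<le> ennreal c * (ennreal ((96 / \<sigma> + 2 * normal_weight_moment 3 V) * (\<epsilon> * ln (1 / \<epsilon>))) * ennreal \<tau>)"
    by (intro mult_left_mono mult_mono gaussian_capped_inverse[OF P(1) \<sigma> P(2,3) \<epsilon>] T3) auto
  also have "\<dots> = ennreal (small_product_const \<sigma> V \<tau> * (\<epsilon> * ln (1 / \<epsilon>)))"
  proof -
    have "0 \<le> (96 / \<sigma> + 2 * normal_weight_moment 3 V) * (\<epsilon> * ln (1 / \<epsilon>))" using \<epsilon> \<sigma> nn by simp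
    then show ?thesis
      using c0 \<tau> by (simp only: ennreal_mult[symmetric] mult_nonneg_nonneg small_product_const_def c_def[symmetric])
        (simp only: mult_ac)
  qed
  finally show ?thesis by simp
qed

text \<open>
  Given \<open>D\<close>, the event has probability at most \<open>|D| / \<sigma>\<close>; what remains is a fifth absolute moment.
\<close>

lemma gaussian_dominated_fourth_moment:
  assumes S: "centred_gaussian M S" "\<sigma> > 0" "\<sigma>\<^sup>2 \<le> expectation (\<lambda>\<omega>. (S \<omega>)\<^sup>2)"
    and D: "centred_gaussian M D" and ind: "indep_pair borel S borel D"
  shows "(\<integral>\<^sup>+\<omega>. ennreal ((D \<omega>) ^ 4 * of_bool (\<bar>S \<omega>\<bar> \<le> \<bar>D \<omega>\<bar>)) \<partial>M)
    \<le> ennreal (normal_weight_moment 3 1 / \<sigma> * sqrt (expectation (\<lambda>\<omega>. (D \<omega>)\<^sup>2)) ^ 5)"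
proof -
  have [measurable]: "S \<in> borel_measurable M" "D \<in> borel_measurable M"
    using S D by (auto simp: centred_gaussian_def)
  define v where "v = sqrt (expectation (\<lambda>\<omega>. (D \<omega>)\<^sup>2))"
  have v0: "v \<ge> 0" unfolding v_def by (intro real_sqrt_ge_zero integral_nonneg_AE) auto
  let ?f = "\<lambda>(s, d). ennreal (d ^ 4 * of_bool (\<bar>s\<bar> \<le> \<bar>d\<bar>))"
  have "(\<integral>\<^sup>+\<omega>. ?f (S \<omega>, D \<omega>) \<partial>M) = (\<integral>\<^sup>+\<omega>. (\<integral>\<^sup>+\<omega>'. ?f (S \<omega>', D \<omega>) \<partial>M) \<partial>M)"
    by (rule indep_nn_integral_pair[OF ind]) measurable
  also have "\<dots> \<le> (\<integral>\<^sup>+\<omega>. ennreal (1 / \<sigma>) * ennreal (\<bar>D \<omega>\<bar> ^ 5) \<partial>M)"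
  proof (intro nn_integral_mono)
    fix \<omega>
    have "(\<integral>\<^sup>+\<omega>'. ?f (S \<omega>', D \<omega>) \<partial>M) = (\<integral>\<^sup>+\<omega>'. ennreal (D \<omega> ^ 4) * indicator {-\<bar>D \<omega>\<bar>..\<bar>D \<omega>\<bar>} (S \<omega>') \<partial>M)"
      by (intro nn_integral_cong) (auto simp: indicator_def abs_le_iff)
    also have "\<dots> \<le> ennreal (D \<omega> ^ 4) * ennreal (\<bar>D \<omega>\<bar> / \<sigma>)"
      by (subst nn_integral_cmult) (auto intro!: mult_left_mono gaussian_small_ball[OF S(1) _ S(2,3)])
    also have "\<dots> = ennreal (D \<omega> ^ 4 * (\<bar>D \<omega>\<bar> / \<sigma>))"
      using S(2) by (intro ennreal_mult[symmetric]) auto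
    also have "D \<omega> ^ 4 * (\<bar>D \<omega>\<bar> / \<sigma>) = 1 / \<sigma> * \<bar>D \<omega>\<bar> ^ 5"
      using power_even_abs[of 4 "D \<omega>"] by (simp add: eval_nat_numeral)
    also have "ennreal \<dots> = ennreal (1 / \<sigma>) * ennreal (\<bar>D \<omega>\<bar> ^ 5)"
      using S(2) by (intro ennreal_mult) auto
    finally show "(\<integral>\<^sup>+\<omega>'. ?f (S \<omega>', D \<omega>) \<partial>M) \<le> \<dots>" .
  qed
  also have "\<dots> = ennreal (1 / \<sigma>) * (\<integral>\<^sup>+\<omega>. ennreal (\<bar>D \<omega>\<bar> ^ 5) \<partial>M)"
    by (rule nn_integral_cmult) measurable
  finally have 1: "(\<integral>\<^sup>+\<omega>. ?f (S \<omega>, D \<omega>) \<partial>M) \<le> ennreal (1 / \<sigma>) * (\<integral>\<^sup>+\<omega>. ennreal (\<bar>D \<omega>\<bar> ^ 5) \<partial>M)" .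
  have "(\<integral>\<^sup>+\<omega>. ennreal (\<bar>D \<omega>\<bar> ^ 5) \<partial>M) = (\<integral>\<^sup>+z. ennreal (\<bar>v * z\<bar> ^ 5) \<partial>std_normal_distribution)"
    unfolding v_def by (rule nn_integral_centred_gaussian[OF D]) measurable
  also have "\<dots> \<le> (\<integral>\<^sup>+z. ennreal (v ^ 5) * ennreal ((1 + 1 * z\<^sup>2) ^ 3) \<partial>std_normal_distribution)"
  proof (intro nn_integral_mono)
    fix z :: real
    have "\<bar>z\<bar> \<le> 1 + z\<^sup>2"
      using sum_squares_bound[of 1 "\<bar>z\<bar>"] by simp
    moreover have "(z\<^sup>2)\<^sup>2 \<le> (1 + z\<^sup>2)\<^sup>2" by (intro power_mono) auto
    ultimately have "\<bar>z\<bar> * (z\<^sup>2)\<^sup>2 \<le> (1 + z\<^sup>2) * (1 + z\<^sup>2)\<^sup>2" by (intro mult_mono) auto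
    moreover have "\<bar>z\<bar> ^ 5 = \<bar>z\<bar> * (z\<^sup>2)\<^sup>2" by (simp add: eval_nat_numeral abs_mult)
    ultimately have "\<bar>z\<bar> ^ 5 \<le> (1 + z\<^sup>2) ^ 3" by (simp add: power2_eq_square power3_eq_cube)
    then have "v ^ 5 * \<bar>z\<bar> ^ 5 \<le> v ^ 5 * (1 + 1 * z\<^sup>2) ^ 3" using v0 by (intro mult_left_mono) auto
    then show "ennreal (\<bar>v * z\<bar> ^ 5) \<le> ennreal (v ^ 5) * ennreal ((1 + 1 * z\<^sup>2) ^ 3)"
      using v0 by (subst ennreal_mult[symmetric]) (auto intro!: ennreal_leI simp: abs_mult power_mult_distrib)
  qed
  also have "\<dots> = ennreal (v ^ 5) * ennreal (normal_weight_moment 3 1)"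
    unfolding normal_weight_moment_def using nn_integral_eq_integral[OF integrable_std_normal_weight[of 1 3]]
    by (subst nn_integral_cmult) auto
  finally have "(\<integral>\<^sup>+\<omega>. ?f (S \<omega>, D \<omega>) \<partial>M) \<le> ennreal (1 / \<sigma>) * (ennreal (v ^ 5) * ennreal (normal_weight_moment 3 1))"
    by (intro order_trans[OF 1] mult_left_mono) auto
  also have "\<dots> = ennreal (normal_weight_moment 3 1 / \<sigma> * v ^ 5)"
    using v0 S(2) normal_weight_moment_nonneg[of 1 3] by (simp add: ennreal_mult[symmetric] mult_ac)
  finally show ?thesis by (simp add: v_def)
qed

end

section \<open>Second order expansions\<close>

text \<open>
  The calculus is used for \<open>e r = r\<close>, the variable in which the diagonalisation has to be expanded,
  and for \<open>e r = r\<^sup>2\<close>, because all covariances are even functions of \<open>r\<close>. Keeping \<open>r\<^sup>2\<close> as the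
  parameter records that odd powers are absent.
\<close>

locale small_parameter =
  fixes e :: "real \<Rightarrow> real"
  assumes tendsto_e: "(e \<longlongrightarrow> 0) (at_right 0)"
    and e_nonzero: "\<forall>\<^sub>F r in at_right 0. e r \<noteq> 0"
begin

text \<open>
  That is, \<open>f = a + b e + c e\<^sup>2 + o(e\<^sup>2)\<close>. As a limit, this passes through the field operations
  and the square root by the rules for limits.
\<close>

definition quad :: "(real \<Rightarrow> real) \<Rightarrow> real \<Rightarrow> real \<Rightarrow> real \<Rightarrow> bool" where
  "quad f a b c \<longleftrightarrow> ((\<lambda>r. (f r - a - b * e r) / (e r)\<^sup>2) \<longlongrightarrow> c) (at_right 0)"

lemma quad_cong_ev:
  assumes "quad f a b c" "\<forall>\<^sub>F r in at_right 0. f r = g r"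
  shows "quad g a b c"
  unfolding quad_def
  by (rule Lim_transform_eventually[OF assms(1)[unfolded quad_def]])
     (use assms(2) in eventually_elim, simp)

lemma quad_cong: "quad f a b c \<Longrightarrow> (\<And>r. f r = g r) \<Longrightarrow> a = a' \<Longrightarrow> b = b' \<Longrightarrow> c = c' \<Longrightarrow> quad g a' b' c'"
  by (auto intro: quad_cong_ev)

lemma quad_ratio:
  assumes "quad f a b c"
  shows "((\<lambda>r. (f r - a) / e r) \<longlongrightarrow> b) (at_right 0)"
proof -
  have "((\<lambda>r. b + e r * ((f r - a - b * e r) / (e r)\<^sup>2)) \<longlongrightarrow> b + 0 * c) (at_right 0)"
    by (intro tendsto_intros tendsto_e assms[unfolded quad_def])
  then have "((\<lambda>r. b + e r * ((f r - a - b * e r) / (e r)\<^sup>2)) \<longlongrightarrow> b) (at_right 0)" by simp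
  then show ?thesis
    by (rule Lim_transform_eventually)
       (use e_nonzero in eventually_elim, simp add: power2_eq_square field_simps)
qed

lemma quad_tendsto:
  assumes "quad f a b c"
  shows "(f \<longlongrightarrow> a) (at_right 0)"
proof -
  have "((\<lambda>r. a + e r * ((f r - a) / e r)) \<longlongrightarrow> a + 0 * b) (at_right 0)"
    by (intro tendsto_intros tendsto_e quad_ratio[OF assms])
  then have "((\<lambda>r. a + e r * ((f r - a) / e r)) \<longlongrightarrow> a) (at_right 0)" by simp
  then show ?thesis
    by (rule Lim_transform_eventually) (use e_nonzero in eventually_elim, simp)
qed

lemma quad_const: "quad (\<lambda>_. k) k 0 0"
  by (simp add: quad_def)

lemma quad_param: "quad e 0 1 0"
  by (simp add: quad_def)

lemma quad_add: "quad f a b c \<Longrightarrow> quad g a' b' c' \<Longrightarrow> quad (\<lambda>r. f r + g r) (a + a') (b + b') (c + c')"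
  unfolding quad_def using tendsto_add by (fastforce simp: add_divide_distrib diff_divide_distrib algebra_simps)

lemma quad_minus: "quad f a b c \<Longrightarrow> quad (\<lambda>r. - f r) (- a) (- b) (- c)"
  unfolding quad_def using tendsto_minus by (fastforce simp: diff_divide_distrib algebra_simps)

lemma quad_diff: "quad f a b c \<Longrightarrow> quad g a' b' c' \<Longrightarrow> quad (\<lambda>r. f r - g r) (a - a') (b - b') (c - c')"
  using quad_add[OF _ quad_minus, of f a b c g a' b' c'] by simp

lemma quad_mult:
  assumes f: "quad f a b c" and g: "quad g a' b' c'"
  shows "quad (\<lambda>r. f r * g r) (a * a') (a * b' + b * a') (a * c' + b * b' + c * a')"
proof -
  have "((\<lambda>r. f r * ((g r - a' - b' * e r) / (e r)\<^sup>2) + (b' * ((f r - a) / e r) + a' * ((f r - a - b * e r) / (e r)\<^sup>2)))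
      \<longlongrightarrow> a * c' + (b' * b + a' * c)) (at_right 0)"
    by (intro tendsto_intros quad_tendsto[OF f] quad_ratio[OF f] f[unfolded quad_def] g[unfolded quad_def])
  then have *: "((\<lambda>r. f r * ((g r - a' - b' * e r) / (e r)\<^sup>2) + (b' * ((f r - a) / e r) + a' * ((f r - a - b * e r) / (e r)\<^sup>2)))
      \<longlongrightarrow> a * c' + b * b' + c * a') (at_right 0)" by (simp add: algebra_simps)
  show ?thesis unfolding quad_def
    by (rule Lim_transform_eventually[OF *])
       (use e_nonzero in eventually_elim, simp add: power2_eq_square field_simps)
qed

lemma quad_cmult: "quad f a b c \<Longrightarrow> quad (\<lambda>r. k * f r) (k * a) (k * b) (k * c)"
  using quad_mult[OF quad_const[of k], of f a b c] by simp

lemma quad_param_mult: "quad f a b c \<Longrightarrow> quad (\<lambda>r. e r * f r) 0 a b"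
  using quad_mult[OF quad_param, of f a b c] by simp

lemma quad_param2_mult:
  assumes "(f \<longlongrightarrow> c) (at_right 0)"
  shows "quad (\<lambda>r. (e r)\<^sup>2 * f r) 0 0 c"
  unfolding quad_def
  by (rule Lim_transform_eventually[OF assms]) (use e_nonzero in eventually_elim, simp)

lemma quad_inverse:
  assumes f: "quad f a b c" and a: "a \<noteq> 0"
  shows "quad (\<lambda>r. inverse (f r)) (1 / a) (- b / a\<^sup>2) (b\<^sup>2 / a ^ 3 - c / a\<^sup>2)"
proof -
  have ev: "\<forall>\<^sub>F r in at_right 0. f r \<noteq> 0"
    using quad_tendsto[OF f] a by (rule tendsto_imp_eventually_ne)
  have "((\<lambda>r. (b / a * ((f r - a) / e r) - (f r - a - b * e r) / (e r)\<^sup>2) / (a * f r))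
      \<longlongrightarrow> (b / a * b - c) / (a * a)) (at_right 0)"
    by (intro tendsto_intros quad_tendsto[OF f] quad_ratio[OF f] f[unfolded quad_def]) (use a in simp)
  moreover have "(b / a * b - c) / (a * a) = b\<^sup>2 / a ^ 3 - c / a\<^sup>2"
    using a by (simp add: field_simps power2_eq_square power3_eq_cube)
  ultimately have *: "((\<lambda>r. (b / a * ((f r - a) / e r) - (f r - a - b * e r) / (e r)\<^sup>2) / (a * f r))
      \<longlongrightarrow> b\<^sup>2 / a ^ 3 - c / a\<^sup>2) (at_right 0)" by simp
  show ?thesis unfolding quad_def
  proof (rule Lim_transform_eventually[OF *])
    show "\<forall>\<^sub>F r in at_right 0. (b / a * ((f r - a) / e r) - (f r - a - b * e r) / (e r)\<^sup>2) / (a * f r)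
       = (inverse (f r) - 1 / a - - b / a\<^sup>2 * e r) / (e r)\<^sup>2"
      using e_nonzero ev
    proof eventually_elim
      case (elim r)
      then show ?case using a by (simp add: divide_simps) (simp add: algebra_simps power2_eq_square)
    qed
  qed
qed

lemma quad_divide:
  assumes "quad f a b c" "quad g a' b' c'" "a' \<noteq> 0"
  shows "quad (\<lambda>r. f r / g r) (a * (1 / a')) (a * (- b' / a'\<^sup>2) + b * (1 / a'))
    (a * (b'\<^sup>2 / a' ^ 3 - c' / a'\<^sup>2) + b * (- b' / a'\<^sup>2) + c * (1 / a'))"
  using quad_mult[OF assms(1) quad_inverse[OF assms(2,3)]] by (simp add: divide_inverse)

lemma quad_power2: "quad f a b c \<Longrightarrow> quad (\<lambda>r. (f r)\<^sup>2) (a * a) (a * b + b * a) (a * c + b * b + c * a)"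
  using quad_mult[of f a b c f a b c] by (simp add: power2_eq_square)

text \<open>
  \<open>\<surd>f - s\<^sub>0 - s\<^sub>1 e\<close> is rationalised by multiplication with \<open>\<surd>f + s\<^sub>0 + s\<^sub>1 e\<close>, whose limit is
  positive.
\<close>

lemma quad_sqrt:
  assumes f: "quad f a b c" and a: "a > 0"
  shows "\<exists>b' c'. quad (\<lambda>r. sqrt (f r)) (sqrt a) b' c'"
proof -
  define s0 s1 s2 where "s0 = sqrt a" and "s1 = b / (2 * s0)" and "s2 = (c - s1\<^sup>2) / (2 * s0)"
  have s0: "s0 > 0" "s0 * s0 = a" using a by (auto simp: s0_def)
  have s1: "2 * s0 * s1 = b" using s0 by (simp add: s1_def)
  have evp: "\<forall>\<^sub>F r in at_right 0. f r > 0" using quad_tendsto[OF f] a by (rule order_tendstoD)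
  have lim0: "((\<lambda>r. sqrt (f r)) \<longlongrightarrow> s0) (at_right 0)" unfolding s0_def by (intro tendsto_intros quad_tendsto[OF f])
  have "((\<lambda>r. ((f r - a - b * e r) / (e r)\<^sup>2 - s1\<^sup>2) / (sqrt (f r) + (s0 + s1 * e r)))
      \<longlongrightarrow> (c - s1\<^sup>2) / (s0 + (s0 + s1 * 0))) (at_right 0)"
    by (intro tendsto_intros f[unfolded quad_def] lim0 tendsto_e) (use s0 in simp)
  then have *: "((\<lambda>r. ((f r - a - b * e r) / (e r)\<^sup>2 - s1\<^sup>2) / (sqrt (f r) + (s0 + s1 * e r))) \<longlongrightarrow> s2) (at_right 0)"
    by (simp add: s2_def)
  have "((\<lambda>r. sqrt (f r) + (s0 + s1 * e r)) \<longlongrightarrow> s0 + (s0 + s1 * 0)) (at_right 0)"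
    by (intro tendsto_intros lim0 tendsto_e)
  then have ev: "\<forall>\<^sub>F r in at_right 0. sqrt (f r) + (s0 + s1 * e r) > 0"
    by (rule order_tendstoD) (use s0 in simp)
  have "quad (\<lambda>r. sqrt (f r)) s0 s1 s2"
    unfolding quad_def
  proof (rule Lim_transform_eventually[OF *])
    show "\<forall>\<^sub>F r in at_right 0. ((f r - a - b * e r) / (e r)\<^sup>2 - s1\<^sup>2) / (sqrt (f r) + (s0 + s1 * e r))
      = (sqrt (f r) - s0 - s1 * e r) / (e r)\<^sup>2"
      using ev evp e_nonzero
    proof eventually_elim
      case (elim r)
      have "(sqrt (f r) - s0 - s1 * e r) * (sqrt (f r) + (s0 + s1 * e r)) = (sqrt (f r))\<^sup>2 - (s0 + s1 * e r)\<^sup>2"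
        by (simp add: algebra_simps power2_eq_square)
      also have "\<dots> = f r - a - b * e r - s1\<^sup>2 * (e r)\<^sup>2"
        using elim s0 s1 by (simp add: power2_eq_square algebra_simps flip: s1)
      finally have eq: "(sqrt (f r) - s0 - s1 * e r) * (sqrt (f r) + (s0 + s1 * e r)) = f r - a - b * e r - s1\<^sup>2 * (e r)\<^sup>2" .
      have "((f r - a - b * e r) / (e r)\<^sup>2 - s1\<^sup>2) = (f r - a - b * e r - s1\<^sup>2 * (e r)\<^sup>2) / (e r)\<^sup>2"
        using elim by (simp add: field_simps)
      also have "\<dots> = (sqrt (f r) - s0 - s1 * e r) * (sqrt (f r) + (s0 + s1 * e r)) / (e r)\<^sup>2"
        by (simp only: eq)
      finally show ?case using elim by simp
    qed
  qed
  then show ?thesis by (auto simp: s0_def)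
qed

end

interpretation lin: small_parameter "\<lambda>r. r"
  by unfold_locales (auto simp: eventually_at_filter intro!: tendsto_eq_intros always_eventually)

interpretation sq: small_parameter "\<lambda>r. r\<^sup>2"
  by unfold_locales (auto simp: eventually_at_filter intro!: tendsto_eq_intros always_eventually)

lemma sq_quad_imp_lin_quad:
  assumes "sq.quad f a b c"
  shows "lin.quad f a 0 b"
  using sq.quad_ratio[OF assms] by (simp add: lin.quad_def)

lemma has_taylor2_iff_quad: "has_taylor2 f a b c \<longleftrightarrow> lin.quad f a b c"
proof -
  have ev: "\<forall>\<^sub>F r in at_right (0::real). r\<^sup>2 \<noteq> 0" by (simp add: eventually_at_filter)
  have "has_taylor2 f a b c \<longleftrightarrow> ((\<lambda>r. (f r - (a + b * r + c * r\<^sup>2)) / r\<^sup>2) \<longlongrightarrow> 0) (at_right 0)"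
    unfolding has_taylor2_def by (blast intro: smalloI_tendsto[OF _ ev] dest: smalloD_tendsto)
  also have "\<dots> \<longleftrightarrow> ((\<lambda>r. (f r - a - b * r) / r\<^sup>2 - c) \<longlongrightarrow> 0) (at_right 0)"
    by (intro tendsto_cong) (use ev in eventually_elim, simp add: field_simps)
  also have "\<dots> \<longleftrightarrow> lin.quad f a b c"
    unfolding lin.quad_def by (rule LIM_zero_iff)
  finally show ?thesis .
qed

section \<open>Peano expansions from a chain of derivatives\<close>

text \<open>
  The top derivative exists but may be discontinuous. The base case is the definition of the
  derivative at \<open>0\<close>; the mean value theorem raises the order by one.
\<close>

lemma peano_of_derivatives:
  fixes f :: "nat \<Rightarrow> real \<Rightarrow> real"
  assumes "\<And>k t. k < Suc n \<Longrightarrow> (f k has_real_derivative f (Suc k) t) (at t)"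
  shows "((\<lambda>t. (f 0 t - (\<Sum>k\<le>Suc n. f k 0 / fact k * t ^ k)) / t ^ Suc n) \<longlongrightarrow> 0) (at_right 0)"
  using assms
proof (induction n arbitrary: f)
  case 0
  have "((\<lambda>h. (f 0 h - f 0 0) / h) \<longlongrightarrow> f 1 0) (at 0)"
    using 0[of 0 0] by (simp add: DERIV_def)
  then have "((\<lambda>h. (f 0 h - f 0 0) / h) \<longlongrightarrow> f 1 0) (at_right 0)"
    by (rule filterlim_mono) (auto simp: at_within_le_at)
  then have "((\<lambda>h. (f 0 h - f 0 0) / h - f 1 0) \<longlongrightarrow> 0) (at_right 0)" by (simp add: LIM_zero_iff)
  then show ?case
    by (rule Lim_transform_eventually) (auto simp: eventually_at_filter field_simps)
next
  case (Suc n)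
  define g where "g t = f 0 t - (\<Sum>k\<le>Suc (Suc n). f k 0 / fact k * t ^ k)" for t
  define g' where "g' t = f 1 t - (\<Sum>k\<le>Suc n. f (Suc k) 0 / fact k * t ^ k)" for t
  have IH: "((\<lambda>t. g' t / t ^ Suc n) \<longlongrightarrow> 0) (at_right 0)"
    using Suc.IH[of "\<lambda>k. f (Suc k)"] Suc.prems by (simp add: g'_def)
  have der: "(g has_real_derivative g' t) (at t)" for t
  proof -
    have "((\<lambda>t. f 0 t - (\<Sum>k\<le>Suc (Suc n). f k 0 / fact k * t ^ k)) has_real_derivative
        f (Suc 0) t - (\<Sum>k\<le>Suc (Suc n). f k 0 / fact k * (real k * t ^ (k - Suc 0)))) (at t)"
      using Suc.prems[of 0 t] by (intro DERIV_diff DERIV_sum DERIV_cmult DERIV_pow) simp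
    moreover have "(\<Sum>k\<le>Suc (Suc n). f k 0 / fact k * (real k * t ^ (k - Suc 0))) = (\<Sum>k\<le>Suc n. f (Suc k) 0 / fact k * t ^ k)"
    proof -
      have aux: "f (Suc i) 0 / fact (Suc i) * (real (Suc i) * t ^ (Suc i - Suc 0)) = f (Suc i) 0 / fact i * t ^ i" for i
        by (simp del: of_nat_Suc)
      show ?thesis
        unfolding sum.atMost_Suc_shift[of _ "Suc n"] aux by simp
    qed
    ultimately show ?thesis by (simp add: g_def[abs_def] g'_def)
  qed
  have g0: "g 0 = 0"
    unfolding g_def by (subst sum.atMost_Suc_shift) simp
  show ?case
    unfolding g_def[symmetric]
  proof (rule tendstoI)
    fix \<epsilon> :: real assume "\<epsilon> > 0"
    then have "\<forall>\<^sub>F t in at_right 0. dist (g' t / t ^ Suc n) 0 < \<epsilon>" using IH by (rule tendstoD[rotated])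
    then obtain d where d: "d > 0" "\<And>t. 0 < t \<Longrightarrow> t < d \<Longrightarrow> \<bar>g' t / t ^ Suc n\<bar> < \<epsilon>"
      by (auto simp: eventually_at_right_field)
    have "\<bar>g t / t ^ Suc (Suc n)\<bar> < \<epsilon>" if t: "0 < t" "t < d" for t
    proof -
      obtain z where z: "0 < z" "z < t" "g t - g 0 = (t - 0) * g' z"
        using MVT2[of 0 t g g'] der t by auto
      have "\<bar>g t / t ^ Suc (Suc n)\<bar> = \<bar>g' z\<bar> / t ^ Suc n"
        using z t g0 by (simp add: abs_mult)
      also have "\<dots> \<le> \<bar>g' z\<bar> / z ^ Suc n"
        using z t by (intro divide_left_mono power_mono mult_pos_pos) auto
      also have "\<dots> < \<epsilon>" using d(2)[of z] z t by simp
      finally show ?thesis .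
    qed
    then show "\<forall>\<^sub>F t in at_right 0. dist (g t / t ^ Suc (Suc n)) 0 < \<epsilon>"
      using d(1) by (auto simp: eventually_at_right_field)
  qed
qed

text \<open>
  The lowest nonvanishing coefficient would dominate.
\<close>

lemma polynomial_smallo_imp_zero:
  fixes d :: "nat \<Rightarrow> real"
  assumes lim: "((\<lambda>t. (\<Sum>k\<le>n. d k * t ^ k) / t ^ n) \<longlongrightarrow> 0) (at_right 0)" and "k \<le> n"
  shows "d k = 0"
  using \<open>k \<le> n\<close>
proof (induction k rule: less_induct)
  case (less k)
  have "((\<lambda>t. t ^ (n - k) * ((\<Sum>k\<le>n. d k * t ^ k) / t ^ n)) \<longlongrightarrow> 0 ^ (n - k) * 0) (at_right 0)"
    by (intro tendsto_intros lim)
  then have 1: "((\<lambda>t. t ^ (n - k) * ((\<Sum>k\<le>n. d k * t ^ k) / t ^ n)) \<longlongrightarrow> 0) (at_right 0)" by simp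
  have "((\<lambda>t. \<Sum>j\<in>{k..n}. d j * t ^ (j - k)) \<longlongrightarrow> (\<Sum>j\<in>{k..n}. d j * 0 ^ (j - k))) (at_right (0::real))"
    by (intro tendsto_intros)
  also have "(\<Sum>j\<in>{k..n}. d j * 0 ^ (j - k)) = (\<Sum>j\<in>{k..n}. if j = k then d k else 0)"
    by (intro sum.cong) auto
  also have "\<dots> = d k" using less by simp
  finally have 2: "((\<lambda>t. \<Sum>j\<in>{k..n}. d j * t ^ (j - k)) \<longlongrightarrow> d k) (at_right 0)" .
  have "\<forall>\<^sub>F t in at_right (0::real). (\<Sum>j\<in>{k..n}. d j * t ^ (j - k)) = t ^ (n - k) * ((\<Sum>k\<le>n. d k * t ^ k) / t ^ n)"
    unfolding eventually_at_filter
  proof (intro always_eventually allI impI)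
    fix t :: real assume t: "t \<noteq> 0"
    have "(\<Sum>j\<le>n. d j * t ^ j) = (\<Sum>j\<in>{k..n}. d j * t ^ j)"
      using less by (intro sum.mono_neutral_right) auto
    also have "\<dots> = t ^ k * (\<Sum>j\<in>{k..n}. d j * t ^ (j - k))"
      by (auto simp: sum_distrib_left power_add[symmetric] intro!: sum.cong)
    finally show "(\<Sum>j\<in>{k..n}. d j * t ^ (j - k)) = t ^ (n - k) * ((\<Sum>k\<le>n. d k * t ^ k) / t ^ n)"
      using t less by (simp add: field_simps flip: power_add)
  qed
  from Lim_transform_eventually[OF 2 this] have "((\<lambda>t. t ^ (n - k) * ((\<Sum>k\<le>n. d k * t ^ k) / t ^ n)) \<longlongrightarrow> d k) (at_right 0)" .
  from tendsto_unique[OF _ this 1] show ?case by simp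
qed

section \<open>Expansion of an isotropic covariance function\<close>

lemma tendsto_right_transform:
  fixes f g :: "real \<Rightarrow> real"
  assumes "(f \<longlongrightarrow> c) (at_right 0)" "\<And>t. t > 0 \<Longrightarrow> f t = g t" "c = c'"
  shows "(g \<longlongrightarrow> c') (at_right 0)"
  unfolding assms(3)[symmetric]
  by (rule Lim_transform_eventually[OF assms(1)]) (auto simp: eventually_at_filter assms(2))

text \<open>
  \<open>G k\<close> is the \<open>k\<close>-th derivative of \<open>t \<mapsto> C |t|\<close>. For a field with derivatives of order four, the
  covariance function has eight derivatives, four from each of the two arguments.
\<close>

locale covariance_expansion =
  fixes G :: "nat \<Rightarrow> real \<Rightarrow> real" and g4 g6 :: real
  assumes G_deriv: "k < 8 \<Longrightarrow> (G k has_real_derivative G (Suc k) t) (at t)"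
    and G_even: "G 0 (- t) = G 0 t"
    and G_taylor: "(\<lambda>r. G 0 r - (1 - r ^ 2 + g4 * r ^ 4 - g6 * r ^ 6)) \<in> o[at_right 0](\<lambda>r. r ^ 6)"
begin

lemma G_parity: "k \<le> 8 \<Longrightarrow> G k (- t) = (- 1) ^ k * G k t"
proof (induction k arbitrary: t)
  case 0
  then show ?case using G_even by simp
next
  case (Suc k)
  have k: "k < 8" "k \<le> 8" using Suc.prems by auto
  have "((\<lambda>t. G k (- t)) has_real_derivative G (Suc k) (- t) * (- 1)) (at t)"
    by (rule DERIV_chain2[OF G_deriv[OF k(1)]]) (auto intro!: derivative_eq_intros)
  moreover have "(\<lambda>t. G k (- t)) = (\<lambda>t. (- 1) ^ k * G k t)"
    using Suc.IH[OF k(2)] by (intro ext)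
  moreover have "((\<lambda>t. (- 1) ^ k * G k t) has_real_derivative (- 1) ^ k * G (Suc k) t) (at t)"
    by (rule DERIV_cmult[OF G_deriv[OF k(1)]])
  ultimately have "G (Suc k) (- t) * (- 1) = (- 1) ^ k * G (Suc k) t" by (metis DERIV_unique)
  then show ?case by simp
qed

lemma G_peano:
  assumes "j + n = 8" "n > 0"
  shows "((\<lambda>t. (G j t - (\<Sum>k\<le>n. G (j + k) 0 / fact k * t ^ k)) / t ^ n) \<longlongrightarrow> 0) (at_right 0)"
proof -
  obtain m where m: "n = Suc m" using assms by (cases n) auto
  have "((\<lambda>t. (G (j + 0) t - (\<Sum>k\<le>Suc m. G (j + k) 0 / fact k * t ^ k)) / t ^ Suc m) \<longlongrightarrow> 0) (at_right 0)"
  proof (rule peano_of_derivatives[of m "\<lambda>k. G (j + k)"])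
    fix k t assume "k < Suc m"
    then show "(G (j + k) has_real_derivative G (j + Suc k) t) (at t)"
      using G_deriv[of "j + k" t] assms m by simp
  qed
  then show ?thesis unfolding m by (simp only: add_0_right)
qed

lemma G_odd: "k \<le> 8 \<Longrightarrow> odd k \<Longrightarrow> G k 0 = 0"
  using G_parity[of k 0] by simp

text \<open>
  The given expansion and the Peano expansion of \<open>G 0\<close> agree to order six, and such expansions are
  unique.
\<close>

lemma G_at_0: "G 0 0 = 1" "G 2 0 = - 2" "G 4 0 = 24 * g4" "G 6 0 = - 720 * g6"
proof -
  define d where "d k = G k 0 / fact k - (if k = 0 then 1 else if k = 2 then - 1 else if k = 4 then g4
     else if k = 6 then - g6 else 0)" for k :: nat
  have 1: "((\<lambda>t. (G 0 t - (\<Sum>k\<le>6. G k 0 / fact k * t ^ k)) / t ^ 6) \<longlongrightarrow> 0) (at_right 0)"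
  proof -
    have "Suc 5 = 6" by simp
    then show ?thesis using peano_of_derivatives[of 5 G, OF G_deriv] by (simp only:)
  qed
  have 2: "((\<lambda>t. (G 0 t - (1 - t ^ 2 + g4 * t ^ 4 - g6 * t ^ 6)) / t ^ 6) \<longlongrightarrow> 0) (at_right 0)"
    using smalloD_tendsto[OF G_taylor] .
  have "((\<lambda>t. (\<Sum>k\<le>6. d k * t ^ k) / t ^ 6) \<longlongrightarrow> 0) (at_right 0)"
  proof (rule tendsto_right_transform[OF tendsto_diff[OF 2 1]])
    fix t :: real
    have "(\<Sum>k\<le>6. d k * t ^ k) = (\<Sum>k\<le>6. G k 0 / fact k * t ^ k) - (1 - t ^ 2 + g4 * t ^ 4 - g6 * t ^ 6)"
      unfolding d_def by (simp add: left_diff_distrib sum_subtractf) (simp add: numeral_eq_Suc algebra_simps)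
    then show "(G 0 t - (1 - t ^ 2 + g4 * t ^ 4 - g6 * t ^ 6)) / t ^ 6 - (G 0 t - (\<Sum>k\<le>6. G k 0 / fact k * t ^ k)) / t ^ 6
       = (\<Sum>k\<le>6. d k * t ^ k) / t ^ 6"
      by (simp add: diff_divide_distrib[symmetric])
  qed simp
  then have d0: "d k = 0" if "k \<le> 6" for k using polynomial_smallo_imp_zero that by blast
  show "G 0 0 = 1" "G 2 0 = - 2" "G 4 0 = 24 * g4" "G 6 0 = - 720 * g6"
    using d0[of 0] d0[of 2] d0[of 4] d0[of 6] by (simp_all add: d_def fact_numeral)
qed

definition g8 :: real where "g8 = G 8 0 / 40320"

lemma G_limits:
  "((\<lambda>t. (G 1 t + 2 * t - 4 * g4 * t ^ 3 + 6 * g6 * t ^ 5) / t ^ 7) \<longlongrightarrow> 8 * g8) (at_right 0)"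
  "((\<lambda>t. (G 2 t + 2 - 12 * g4 * t ^ 2 + 30 * g6 * t ^ 4) / t ^ 6) \<longlongrightarrow> 56 * g8) (at_right 0)"
  "((\<lambda>t. (G 3 t - 24 * g4 * t + 120 * g6 * t ^ 3) / t ^ 5) \<longlongrightarrow> 336 * g8) (at_right 0)"
  "((\<lambda>t. (G 4 t - 24 * g4 + 360 * g6 * t ^ 2) / t ^ 4) \<longlongrightarrow> 1680 * g8) (at_right 0)"
proof -
  have odd: "G 1 0 = 0" "G 3 0 = 0" "G 5 0 = 0" "G 7 0 = 0" using G_odd by simp_all
  have e8: "G 8 0 = 40320 * g8" by (simp add: g8_def)
  have v': "G (Suc 0) 0 = 0" "G (Suc (Suc 0)) 0 = - 2" "G (Suc (Suc (Suc 0))) 0 = 0" 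
    "G (Suc (Suc (Suc (Suc 0)))) 0 = 24 * g4" "G (Suc (Suc (Suc (Suc (Suc 0))))) 0 = 0"
    "G (Suc (Suc (Suc (Suc (Suc (Suc 0)))))) 0 = - 720 * g6" "G (Suc (Suc (Suc (Suc (Suc (Suc (Suc 0))))))) 0 = 0" 
    "G (Suc (Suc (Suc (Suc (Suc (Suc (Suc (Suc 0)))))))) 0 = 40320 * g8"
    using odd e8 G_at_0 by (simp_all add: eval_nat_numeral)
  show "((\<lambda>t. (G 1 t + 2 * t - 4 * g4 * t ^ 3 + 6 * g6 * t ^ 5) / t ^ 7) \<longlongrightarrow> 8 * g8) (at_right 0)"
    using tendsto_add[OF G_peano[of 1 7] tendsto_const[of "G 8 0 / fact 7"]]
    by (rule tendsto_right_transform) (simp_all add: eval_nat_numeral v' field_simps)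
  show "((\<lambda>t. (G 2 t + 2 - 12 * g4 * t ^ 2 + 30 * g6 * t ^ 4) / t ^ 6) \<longlongrightarrow> 56 * g8) (at_right 0)"
    using tendsto_add[OF G_peano[of 2 6] tendsto_const[of "G 8 0 / fact 6"]]
    by (rule tendsto_right_transform) (simp_all add: eval_nat_numeral v' field_simps)
  show "((\<lambda>t. (G 3 t - 24 * g4 * t + 120 * g6 * t ^ 3) / t ^ 5) \<longlongrightarrow> 336 * g8) (at_right 0)"
    using tendsto_add[OF G_peano[of 3 5] tendsto_const[of "G 8 0 / fact 5"]]
    by (rule tendsto_right_transform) (simp_all add: eval_nat_numeral v' field_simps)
  show "((\<lambda>t. (G 4 t - 24 * g4 + 360 * g6 * t ^ 2) / t ^ 4) \<longlongrightarrow> 1680 * g8) (at_right 0)"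
    using tendsto_add[OF G_peano[of 4 4] tendsto_const[of "G 8 0 / fact 4"]]
    by (rule tendsto_right_transform) (simp_all add: eval_nat_numeral v' field_simps)
qed

text \<open>
  Writing \<open>C(t) = h(t\<^sup>2)\<close>, the functions below are \<open>t \<mapsto> h\<^sup>(\<^sup>k\<^sup>)(t\<^sup>2)\<close> for \<open>k = 1, \<dots>, 4\<close>, solved from
  the formulas for the derivatives of \<open>h(t\<^sup>2)\<close>. In terms of these, the partial derivatives of
  \<open>x \<mapsto> C(|x|)\<close> are polynomial in the coordinates.
\<close>

definition h1 :: "real \<Rightarrow> real" where "h1 t = G 1 t / (2 * t)"
definition h2 :: "real \<Rightarrow> real" where "h2 t = (G 2 t - 2 * h1 t) / (4 * t ^ 2)"
definition h3 :: "real \<Rightarrow> real" where "h3 t = (G 3 t - 12 * t * h2 t) / (8 * t ^ 3)"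
definition h4 :: "real \<Rightarrow> real" where "h4 t = (G 4 t - 12 * h2 t - 48 * t ^ 2 * h3 t) / (16 * t ^ 4)"

lemma h_deriv:
  assumes t: "t \<noteq> 0"
  shows "(G 0 has_real_derivative 2 * t * h1 t) (at t)"
    "(h1 has_real_derivative 2 * t * h2 t) (at t)"
    "(h2 has_real_derivative 2 * t * h3 t) (at t)"
    "(h3 has_real_derivative 2 * t * h4 t) (at t)"
proof -
  have G: "(G 0 has_real_derivative G 1 t) (at t)" "(G 1 has_real_derivative G 2 t) (at t)"
    "(G 2 has_real_derivative G 3 t) (at t)" "(G 3 has_real_derivative G 4 t) (at t)"
  proof -
    have e: "Suc 0 = 1" "Suc 1 = 2" "Suc 2 = 3" "Suc 3 = 4" by simp_all
    have l: "0 < (8::nat)" "1 < (8::nat)" "2 < (8::nat)" "3 < (8::nat)" by simp_all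
    show "(G 0 has_real_derivative G 1 t) (at t)" "(G 1 has_real_derivative G 2 t) (at t)"
      "(G 2 has_real_derivative G 3 t) (at t)" "(G 3 has_real_derivative G 4 t) (at t)"
      using G_deriv[OF l(1), of t, unfolded e(1)] G_deriv[OF l(2), of t, unfolded e(2)]
        G_deriv[OF l(3), of t, unfolded e(3)] G_deriv[OF l(4), of t, unfolded e(4)]
      by (simp_all only:)
  qed
  have eqs: "G 1 t = 2 * t * h1 t" "G 2 t = 2 * h1 t + 4 * t ^ 2 * h2 t"
    "G 3 t = 12 * t * h2 t + 8 * t ^ 3 * h3 t" "G 4 t = 12 * h2 t + 48 * t ^ 2 * h3 t + 16 * t ^ 4 * h4 t"
    using t by (simp_all only: h1_def h2_def h3_def h4_def) simp_all
  show "(G 0 has_real_derivative 2 * t * h1 t) (at t)" using G(1) by (simp only: eqs(1))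
  have "((\<lambda>t. G 1 t / (2 * t)) has_real_derivative (G 2 t * (2 * t) - G 1 t * (2 * 1)) / ((2 * t) * (2 * t))) (at t)"
    using t by (intro DERIV_divide DERIV_cmult DERIV_ident G) simp
  also have "(G 2 t * (2 * t) - G 1 t * (2 * 1)) / ((2 * t) * (2 * t)) = 2 * t * h2 t"
    unfolding eqs using t by (simp add: divide_simps) (simp add: algebra_simps power2_eq_square)
  finally have h1: "(h1 has_real_derivative 2 * t * h2 t) (at t)" by (simp only: h1_def[abs_def])
  then show "(h1 has_real_derivative 2 * t * h2 t) (at t)" .
  have pow: "((\<lambda>t. t ^ 2) has_real_derivative 2 * t) (at t)" "((\<lambda>t. t ^ 3) has_real_derivative 3 * t ^ 2) (at t)"
    by (auto intro!: derivative_eq_intros)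
  have "((\<lambda>t. (G 2 t - 2 * h1 t) / (4 * t ^ 2)) has_real_derivative
     ((G 3 t - 2 * (2 * t * h2 t)) * (4 * t ^ 2) - (G 2 t - 2 * h1 t) * (4 * (2 * t))) / ((4 * t ^ 2) * (4 * t ^ 2))) (at t)"
    using t by (intro DERIV_divide DERIV_diff DERIV_cmult G h1 pow) simp
  also have "((G 3 t - 2 * (2 * t * h2 t)) * (4 * t ^ 2) - (G 2 t - 2 * h1 t) * (4 * (2 * t))) / ((4 * t ^ 2) * (4 * t ^ 2)) = 2 * t * h3 t"
    unfolding eqs using t by (simp add: divide_simps) (simp add: algebra_simps power2_eq_square power3_eq_cube power4_eq_xxxx)
  finally have h2: "(h2 has_real_derivative 2 * t * h3 t) (at t)" by (simp only: h2_def[abs_def])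
  then show "(h2 has_real_derivative 2 * t * h3 t) (at t)" .
  have "((\<lambda>t. (G 3 t - 12 * (t * h2 t)) / (8 * t ^ 3)) has_real_derivative
     ((G 4 t - 12 * (1 * h2 t + 2 * t * h3 t * t)) * (8 * t ^ 3) - (G 3 t - 12 * (t * h2 t)) * (8 * (3 * t ^ 2))) / ((8 * t ^ 3) * (8 * t ^ 3))) (at t)"
    using t by (intro DERIV_divide DERIV_diff DERIV_cmult DERIV_mult DERIV_ident G h2 pow) simp
  also have "((G 4 t - 12 * (1 * h2 t + 2 * t * h3 t * t)) * (8 * t ^ 3) - (G 3 t - 12 * (t * h2 t)) * (8 * (3 * t ^ 2))) / ((8 * t ^ 3) * (8 * t ^ 3)) = 2 * t * h4 t"
    unfolding eqs using t by (simp add: divide_simps) (simp add: algebra_simps power2_eq_square power3_eq_cube, simp add: eval_nat_numeral)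
  finally show "(h3 has_real_derivative 2 * t * h4 t) (at t)" by (simp only: h3_def[abs_def] mult.assoc)
qed

text \<open>
  As \<open>h' (0) = -1\<close>, the function \<open>1 + h1\<close> vanishes to second order.
\<close>

definition hA :: "real \<Rightarrow> real" where "hA t = (1 + h1 t) / t\<^sup>2"

lemma quad_hA: "sq.quad hA (2 * g4) (- 3 * g6) (4 * g8)"
proof -
  have "((\<lambda>t. (G 1 t + 2 * t - 4 * g4 * t ^ 3 + 6 * g6 * t ^ 5) / t ^ 7 / 2) \<longlongrightarrow> 8 * g8 / 2) (at_right 0)"
    by (intro tendsto_intros G_limits) auto
  then show ?thesis unfolding sq.quad_def
    by (rule tendsto_right_transform) (simp_all add: hA_def h1_def field_simps eval_nat_numeral)
qed

lemma quad_h2: "sq.quad h2 (2 * g4) (- 6 * g6) (12 * g8)"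
proof -
  have "((\<lambda>t. ((G 2 t + 2 - 12 * g4 * t ^ 2 + 30 * g6 * t ^ 4) / t ^ 6 
        - (G 1 t + 2 * t - 4 * g4 * t ^ 3 + 6 * g6 * t ^ 5) / t ^ 7) / 4) \<longlongrightarrow> (56 * g8 - 8 * g8) / 4) (at_right 0)"
    by (intro tendsto_intros G_limits) auto
  then show ?thesis unfolding sq.quad_def
    by (rule tendsto_right_transform) (simp_all add: h2_def h1_def field_simps eval_nat_numeral)
qed

lemma quad_h3: "sq.quad (\<lambda>t. t\<^sup>2 * h3 t) 0 (- 6 * g6) (24 * g8)"
proof -
  have "((\<lambda>t. ((G 3 t - 24 * g4 * t + 120 * g6 * t ^ 3) / t ^ 5 
       - 12 * ((h2 t - 2 * g4 - (- 6 * g6) * t\<^sup>2) / (t\<^sup>2)\<^sup>2)) / 8) \<longlongrightarrow> (336 * g8 - 12 * (12 * g8)) / 8) (at_right 0)"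
    by (intro tendsto_intros G_limits quad_h2[unfolded sq.quad_def]) auto
  then show ?thesis unfolding sq.quad_def
    by (rule tendsto_right_transform) (simp_all add: h3_def field_simps eval_nat_numeral)
qed

lemma quad_h4: "sq.quad (\<lambda>t. t ^ 4 * h4 t) 0 0 (24 * g8)"
proof -
  have "((\<lambda>t. ((G 4 t - 24 * g4 + 360 * g6 * t ^ 2) / t ^ 4
       - 12 * ((h2 t - 2 * g4 - (- 6 * g6) * t\<^sup>2) / (t\<^sup>2)\<^sup>2)
       - 48 * ((t\<^sup>2 * h3 t - 0 - (- 6 * g6) * t\<^sup>2) / (t\<^sup>2)\<^sup>2)) / 16) \<longlongrightarrow> (1680 * g8 - 12 * (12 * g8) - 48 * (24 * g8)) / 16) (at_right 0)"
    by (intro tendsto_intros G_limits quad_h2[unfolded sq.quad_def] quad_h3[unfolded sq.quad_def]) auto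
  then show ?thesis unfolding sq.quad_def
    by (rule tendsto_right_transform) (simp_all add: h4_def field_simps eval_nat_numeral)
qed

section \<open>Covariances of the gradient and of the conditioned Hessian\<close>

text \<open>
  \<open>vs1, vs2\<close> and \<open>vd1, vd2\<close> will be the variances of the half sums and half differences of the
  first and second partial derivative at \<open>0\<close> and \<open>(0,r)\<close>, and \<open>cl, ct\<close> the covariances of the half
  sums of \<open>F\<^sub>1\<^sub>1, F\<^sub>2\<^sub>2\<close> with the half difference of \<open>F\<^sub>2\<close>. The remaining functions are the variances
  and covariances of the residuals \<open>p, q, a, b, m, n\<close>: a covariance of second derivatives minus the
  part that is explained by the one gradient variable of the family.
\<close>

definition vs1 :: "real \<Rightarrow> real" where "vs1 r = 1 - h1 r"
definition vd1 :: "real \<Rightarrow> real" where "vd1 r = 1 + h1 r"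
definition vs2 :: "real \<Rightarrow> real" where "vs2 r = 1 - h1 r - 2 * r\<^sup>2 * h2 r"
definition vd2 :: "real \<Rightarrow> real" where "vd2 r = 1 + h1 r + 2 * r\<^sup>2 * h2 r"

definition cl :: "real \<Rightarrow> real" where "cl r = 2 * r * h2 r"
definition ct :: "real \<Rightarrow> real" where "ct r = 6 * r * h2 r + 4 * r ^ 3 * h3 r"

definition Vp :: "real \<Rightarrow> real" where
  "Vp r = 12 * g4 + 6 * h2 r - (cl r)\<^sup>2 / vd2 r"
definition Cpq :: "real \<Rightarrow> real" where
  "Cpq r = 4 * g4 + 2 * h2 r + 4 * r\<^sup>2 * h3 r - cl r * ct r / vd2 r"
definition Vq :: "real \<Rightarrow> real" where
  "Vq r = 12 * g4 + 6 * h2 r + 24 * r\<^sup>2 * h3 r + 8 * r ^ 4 * h4 r - (ct r)\<^sup>2 / vd2 r"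
definition Va :: "real \<Rightarrow> real" where
  "Va r = 12 * g4 - 6 * h2 r - (cl r)\<^sup>2 / vs2 r"
definition Cab :: "real \<Rightarrow> real" where
  "Cab r = 4 * g4 - 2 * h2 r - 4 * r\<^sup>2 * h3 r - cl r * ct r / vs2 r"
definition Vb :: "real \<Rightarrow> real" where
  "Vb r = 12 * g4 - 6 * h2 r - 24 * r\<^sup>2 * h3 r - 8 * r ^ 4 * h4 r - (ct r)\<^sup>2 / vs2 r"
definition Vm :: "real \<Rightarrow> real" where
  "Vm r = 4 * g4 + 2 * h2 r + 4 * r\<^sup>2 * h3 r - (cl r)\<^sup>2 / vd1 r"
definition Vn :: "real \<Rightarrow> real" where
  "Vn r = 4 * g4 - 2 * h2 r - 4 * r\<^sup>2 * h3 r - (cl r)\<^sup>2 / vs1 r"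

lemma quad_cong_ne:
  assumes "sq.quad f a b c" "\<And>r. r \<noteq> 0 \<Longrightarrow> f r = g r" "a = a'" "b = b'" "c = c'"
  shows "sq.quad g a' b' c'"
  using sq.quad_cong_ev[OF assms(1), of g] assms(2-5) by (auto simp: eventually_at_filter)

lemma vd1_eq: "r \<noteq> 0 \<Longrightarrow> vd1 r = r\<^sup>2 * hA r"
  by (simp add: vd1_def hA_def)

lemma vd2_eq: "r \<noteq> 0 \<Longrightarrow> vd2 r = r\<^sup>2 * (hA r + 2 * h2 r)"
  using vd1_eq[of r] by (simp add: vd2_def vd1_def distrib_left)

lemma quad_vs1: "sq.quad vs1 2 (- 2 * g4) (3 * g6)"
proof -
  have "sq.quad (\<lambda>r. 2 - r\<^sup>2 * hA r) (2 - 0) (0 - 2 * g4) (0 - (- 3 * g6))"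
    by (rule sq.quad_diff[OF sq.quad_const sq.quad_param_mult[OF quad_hA]])
  then show ?thesis
    by (rule quad_cong_ne) (simp_all add: vs1_def vd1_eq[symmetric] vd1_def)
qed

lemma quad_vs2: "sq.quad vs2 2 (- 6 * g4) (15 * g6)"
proof -
  have "sq.quad (\<lambda>r. 2 - r\<^sup>2 * (hA r + 2 * h2 r)) (2 - 0) (0 - (2 * g4 + 2 * (2 * g4))) (0 - (- 3 * g6 + 2 * (- 6 * g6)))"
    by (rule sq.quad_diff[OF sq.quad_const sq.quad_param_mult[OF sq.quad_add[OF quad_hA sq.quad_cmult[OF quad_h2]]]])
  then show ?thesis
    by (rule quad_cong_ne) (simp_all add: vs2_def vd2_eq[symmetric] vd2_def)
qed

text \<open>
  \<open>vd2\<close> is \<open>r\<^sup>2\<close> times this function, which stays away from \<open>0\<close>; dividing by it keeps the expansions.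
\<close>

lemma quad_W2: "sq.quad (\<lambda>r. hA r + 2 * h2 r) (6 * g4) (- 15 * g6) (28 * g8)"
  by (rule sq.quad_cong[OF sq.quad_add[OF quad_hA sq.quad_cmult[OF quad_h2]]]) auto

lemma quad_T: "sq.quad (\<lambda>r. 6 * h2 r + 4 * (r\<^sup>2 * h3 r)) (12 * g4) (- 60 * g6) (168 * g8)"
  by (rule sq.quad_cong[OF sq.quad_add[OF sq.quad_cmult[OF quad_h2] sq.quad_cmult[OF quad_h3]]]) auto

lemma quad_ex_cong:
  assumes "sq.quad f a b c" "\<And>r. r \<noteq> 0 \<Longrightarrow> f r = g r" "a = a'" "b = b'"
  shows "\<exists>c. sq.quad g a' b' c"
  using sq.quad_cong_ev[OF assms(1), of g] assms(2-4) by (auto simp: eventually_at_filter)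

lemma cl_W2: "r \<noteq> 0 \<Longrightarrow> (cl r)\<^sup>2 / vd2 r = 4 * ((h2 r)\<^sup>2 / (hA r + 2 * h2 r))"
  by (simp add: vd2_eq cl_def power2_eq_square)

lemma ct_W2: "r \<noteq> 0 \<Longrightarrow> (ct r)\<^sup>2 / vd2 r = (6 * h2 r + 4 * (r\<^sup>2 * h3 r))\<^sup>2 / (hA r + 2 * h2 r)"
proof -
  assume r: "r \<noteq> 0"
  have "ct r = r * (6 * h2 r + 4 * (r\<^sup>2 * h3 r))" by (simp add: ct_def algebra_simps power2_eq_square power3_eq_cube)
  then show ?thesis using r by (simp add: vd2_eq power_mult_distrib)
qed

lemma clct_W2: "r \<noteq> 0 \<Longrightarrow> cl r * ct r / vd2 r = 2 * (h2 r * (6 * h2 r + 4 * (r\<^sup>2 * h3 r)) / (hA r + 2 * h2 r))"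
proof -
  assume r: "r \<noteq> 0"
  have "cl r * ct r = r\<^sup>2 * (2 * (h2 r * (6 * h2 r + 4 * (r\<^sup>2 * h3 r))))"
    by (simp add: cl_def ct_def algebra_simps power2_eq_square power3_eq_cube)
  then show ?thesis using r by (simp add: vd2_eq)
qed

context
  assumes g4: "g4 > 0"
begin

lemma g4_ne: "6 * g4 \<noteq> 0" "2 * g4 \<noteq> 0" using g4 by auto

text \<open>
  The half difference of the gradient, divided by \<open>r\<close>, determines the half sums of \<open>F\<^sub>1\<^sub>2\<close> and
  \<open>F\<^sub>2\<^sub>2\<close> up to an error of order \<open>r\<^sup>2\<close>. This is why in \<open>Vm\<close> and \<open>Vq\<close> the constant terms and those
  of order \<open>r\<^sup>2\<close> cancel, whereas \<open>Vp\<close> has a positive limit.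
\<close>

lemma quad_Vp: "\<exists>b c. sq.quad Vp (64 / 3 * g4) b c"
proof -
  have "\<exists>c. sq.quad Vp (64 / 3 * g4) (0 + 6 * (- 6 * g6) - 4 * (2 * g4 * (2 * g4) * (- (- 15 * g6) / (6 * g4)\<^sup>2) + (2 * g4 * (- 6 * g6) + - 6 * g6 * (2 * g4)) * (1 / (6 * g4)))) c"
    by (rule quad_ex_cong[OF sq.quad_diff[OF sq.quad_add[OF sq.quad_const[of "12 * g4"] sq.quad_cmult[OF quad_h2, of 6]]
          sq.quad_cmult[OF sq.quad_divide[OF sq.quad_power2[OF quad_h2] quad_W2 g4_ne(1)], of 4]]])
       (use g4 in \<open>simp_all add: Vp_def cl_W2 field_simps\<close>)
  then show ?thesis by blast
qed

lemma quad_Cpq: "\<exists>b c. sq.quad Cpq 0 b c"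
proof -
  note * = sq.quad_diff[OF sq.quad_add[OF sq.quad_add[OF sq.quad_const[of "4 * g4"] sq.quad_cmult[OF quad_h2, of 2]] sq.quad_cmult[OF quad_h3, of 4]]
          sq.quad_cmult[OF sq.quad_divide[OF sq.quad_mult[OF quad_h2 quad_T] quad_W2 g4_ne(1)], of 2]]
  show ?thesis
    by (rule exI, rule quad_ex_cong[OF *, OF _ _ refl])
       (use g4 in \<open>simp_all add: Cpq_def clct_W2 field_simps\<close>)
qed

lemma quad_Vq: "\<exists>c. sq.quad Vq 0 0 c"
proof -
  note * = sq.quad_diff[OF sq.quad_add[OF sq.quad_add[OF sq.quad_add[OF sq.quad_const[of "12 * g4"] sq.quad_cmult[OF quad_h2, of 6]] sq.quad_cmult[OF quad_h3, of 24]]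
       sq.quad_cmult[OF quad_h4, of 8]]
       sq.quad_divide[OF sq.quad_power2[OF quad_T] quad_W2 g4_ne(1)]]
  show ?thesis
    by (rule quad_ex_cong[OF *])
       (use g4 in \<open>simp_all add: Vq_def ct_W2\<close>, simp_all add: field_simps power2_eq_square)
qed

lemma quad_Vm: "\<exists>c. sq.quad Vm 0 0 c"
proof -
  note * = sq.quad_diff[OF sq.quad_add[OF sq.quad_add[OF sq.quad_const[of "4 * g4"] sq.quad_cmult[OF quad_h2, of 2]] sq.quad_cmult[OF quad_h3, of 4]]
       sq.quad_cmult[OF sq.quad_divide[OF sq.quad_power2[OF quad_h2] quad_hA g4_ne(2)], of 4]]
  show ?thesis
    by (rule quad_ex_cong[OF *])
       (use g4 in \<open>simp_all add: Vm_def cl_def vd1_eq field_simps power2_eq_square\<close>)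
qed

end

lemma two_ne: "(2::real) \<noteq> 0" by simp

lemma quad_Va: "\<exists>c. sq.quad Va 0 (36 * g6 - 8 * g4\<^sup>2) c"
proof -
  note * = sq.quad_diff[OF sq.quad_diff[OF sq.quad_const[of "12 * g4"] sq.quad_cmult[OF quad_h2, of 6]]
       sq.quad_cmult[OF sq.quad_param_mult[OF sq.quad_divide[OF sq.quad_power2[OF quad_h2] quad_vs2 two_ne]], of 4]]
  show ?thesis
    by (rule quad_ex_cong[OF *]) (simp_all add: Va_def cl_def power2_eq_square)
qed

lemma quad_Vn: "\<exists>b c. sq.quad Vn 0 b c"
proof -
  note * = sq.quad_diff[OF sq.quad_diff[OF sq.quad_diff[OF sq.quad_const[of "4 * g4"] sq.quad_cmult[OF quad_h2, of 2]] sq.quad_cmult[OF quad_h3, of 4]]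
       sq.quad_cmult[OF sq.quad_param_mult[OF sq.quad_divide[OF sq.quad_power2[OF quad_h2] quad_vs1 two_ne]], of 4]]
  show ?thesis
    by (rule exI, rule quad_ex_cong[OF *, OF _ _ refl]) (simp_all add: Vn_def cl_def power2_eq_square)
qed

lemma quad_Cab: "\<exists>c. sq.quad Cab 0 (36 * g6 - 24 * g4\<^sup>2) c"
proof -
  note * = sq.quad_diff[OF sq.quad_diff[OF sq.quad_diff[OF sq.quad_const[of "4 * g4"] sq.quad_cmult[OF quad_h2, of 2]] sq.quad_cmult[OF quad_h3, of 4]]
       sq.quad_cmult[OF sq.quad_param_mult[OF sq.quad_divide[OF sq.quad_mult[OF quad_h2 quad_T] quad_vs2 two_ne]], of 2]]
  show ?thesis
    by (rule quad_ex_cong[OF *]) (simp_all add: Cab_def cl_def ct_def algebra_simps add_divide_distrib power2_eq_square power3_eq_cube)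
qed

lemma quad_Vb: "\<exists>c. sq.quad Vb 0 (180 * g6 - 72 * g4\<^sup>2) c"
proof -
  note * = sq.quad_diff[OF sq.quad_diff[OF sq.quad_diff[OF sq.quad_diff[OF sq.quad_const[of "12 * g4"] sq.quad_cmult[OF quad_h2, of 6]] sq.quad_cmult[OF quad_h3, of 24]]
       sq.quad_cmult[OF quad_h4, of 8]]
       sq.quad_param_mult[OF sq.quad_divide[OF sq.quad_power2[OF quad_T] quad_vs2 two_ne]]]
  show ?thesis
    by (rule quad_ex_cong[OF *]) (simp_all add: Vb_def ct_def algebra_simps add_divide_distrib power2_eq_square power3_eq_cube)
qed

end

section \<open>The Gaussian space of the derivatives of a field\<close>

lemma (in prob_space) prob_space_completion: "prob_space (completion M)"
  by (rule prob_spaceI) (simp add: emeasure_space_1)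

lemma centred_gaussian_completion:
  assumes "centred_gaussian M X"
  shows "centred_gaussian (completion M) X"
proof -
  have X: "X \<in> borel_measurable M" using assms by (simp add: centred_gaussian_def)
  then have Xc: "X \<in> borel_measurable (completion M)" by (rule measurable_completion)
  have d: "distributed (completion M) lborel X f" if "distributed M lborel X f" for f
  proof -
    have "X \<in> measurable M lborel" using X by simp
    then have "distr (completion M) lborel X = distr M lborel X" by (rule distr_completion)
    with that Xc show ?thesis by (simp add: distributed_def)
  qed
  show ?thesis using assms Xc d by (auto simp: centred_gaussian_def AE_completion_iff)
qed

text \<open>
  The pathwise derivatives agree almost surely with limits of measurable difference quotients,
  and are therefore measurable for the completion.
\<close>

lemma borel_measurable_completion_AE:
  fixes f g :: "'a \<Rightarrow> real"
  assumes g: "g \<in> borel_measurable (completion M)" and ae: "AE x in completion M. f x = g x"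
  shows "f \<in> borel_measurable (completion M)"
proof (rule measurableI)
  fix A :: "real set" assume A: "A \<in> sets borel"
  have gA: "g -` A \<inter> space (completion M) \<in> sets (completion M)" using measurable_sets[OF g A] .
  show "f -` A \<inter> space (completion M) \<in> sets (completion M)"
    by (rule complete_measure.in_sets_AE[OF _ _ gA, unfolded complete_measure_def])
       (use ae in \<open>auto intro: completion.complete\<close>)
qed auto

lemma gaussian_space_span:
  assumes "prob_space M" "centred_gaussian_field M F"
  shows "gaussian_space (completion M) {\<lambda>\<omega>. \<Sum>x\<in>S. a x * F x \<omega> | S a. finite S}"
proof -
  interpret M: prob_space M by fact
  interpret prob_space "completion M" by (rule M.prob_space_completion)
  show ?thesis
  proof
    fix X assume "X \<in> {\<lambda>\<omega>. \<Sum>x\<in>S. a x * F x \<omega> | S a. finite S}"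
    then show "centred_gaussian (completion M) X"
      using assms(2) by (auto simp: centred_gaussian_field_def intro!: centred_gaussian_completion)
  next
    fix X Y :: "'a \<Rightarrow> real" and p q :: real
    assume "X \<in> {\<lambda>\<omega>. \<Sum>x\<in>S. a x * F x \<omega> | S a. finite S}" "Y \<in> {\<lambda>\<omega>. \<Sum>x\<in>S. a x * F x \<omega> | S a. finite S}"
    then obtain S a T b where ST: "finite S" "finite T" "X = (\<lambda>\<omega>. \<Sum>x\<in>S. a x * F x \<omega>)" "Y = (\<lambda>\<omega>. \<Sum>x\<in>T. b x * F x \<omega>)"
      by auto
    have "p * X \<omega> + q * Y \<omega> = (\<Sum>x\<in>S \<union> T. (p * (if x \<in> S then a x else 0) + q * (if x \<in> T then b x else 0)) * F x \<omega>)" for \<omega>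
    proof -
      have "X \<omega> = (\<Sum>x\<in>S \<union> T. (if x \<in> S then a x else 0) * F x \<omega>)"
        unfolding ST using ST(1,2) by (intro sum.mono_neutral_cong_left) auto
      moreover have "Y \<omega> = (\<Sum>x\<in>S \<union> T. (if x \<in> T then b x else 0) * F x \<omega>)"
        unfolding ST using ST(1,2) by (intro sum.mono_neutral_cong_left) auto
      ultimately show ?thesis
        by (simp only: sum_distrib_left sum.distrib[symmetric] distrib_right mult.assoc)
    qed
    then show "(\<lambda>\<omega>. p * X \<omega> + q * Y \<omega>) \<in> {\<lambda>\<omega>. \<Sum>x\<in>S. a x * F x \<omega> | S a. finite S}"
      using ST(1,2) by (auto intro!: exI[of _ "S \<union> T"])
  qed
qed

text \<open>
  The field is considered on the completed probability space throughout, as its derivatives are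
  measurable only there.
\<close>

locale smooth_gaussian_field = field_space: prob_space M for M :: "'w measure" +
  fixes F :: "real ^ 2 \<Rightarrow> 'w \<Rightarrow> real"
  assumes gaussian_field: "centred_gaussian_field M F"
    and smooth: "AE \<omega> in M. C_diff 4 (\<lambda>x. F x \<omega>)"
begin

definition span_F :: "('w \<Rightarrow> real) set" where
  "span_F = {\<lambda>\<omega>. \<Sum>x\<in>S. a x * F x \<omega> | S a. finite S}"

text \<open>
  Derivatives of order \<open>k\<close> are almost sure limits of difference quotients of derivatives of order
  \<open>k - 1\<close>, and hence belong to the \<open>k\<close>-th iterated closure of the linear span of the field.
\<close>

primrec closure_F :: "nat \<Rightarrow> ('w \<Rightarrow> real) set" where
  "closure_F 0 = span_F"
| "closure_F (Suc k) = gaussian_space.AE_closure (completion M) (closure_F k)"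

lemma gaussian_space_closure_F: "gaussian_space (completion M) (closure_F k)"
proof (induction k)
  case 0
  show ?case
    using gaussian_space_span[OF field_space.prob_space_axioms gaussian_field] by (simp add: span_F_def)
next
  case (Suc k)
  then show ?case by (simp add: gaussian_space.gaussian_space_AE_closure)
qed

lemma closure_F_mono: "k \<le> l \<Longrightarrow> closure_F k \<subseteq> closure_F l"
proof (induction l rule: dec_induct)
  case (step l)
  then show ?case
    using gaussian_space.subset_AE_closure[OF gaussian_space_closure_F[of l]] by auto
qed simp

sublocale gaussian_space "completion M" "closure_F 4"
  by (rule gaussian_space_closure_F)

abbreviation fd :: "2 list \<Rightarrow> real ^ 2 \<Rightarrow> 'w \<Rightarrow> real" where
  "fd js x \<equiv> field_deriv js F x"

lemma field_deriv_difference_quotient: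
  assumes "length js < 4" "\<And>n. h n \<noteq> 0" "h \<longlonglongrightarrow> 0"
  shows "AE \<omega> in completion M. (\<lambda>n. 1 / h n * fd js (x + h n *\<^sub>R axis i 1) \<omega> + (- 1 / h n) * fd js x \<omega>) \<longlonglongrightarrow> fd (i # js) x \<omega>"
proof (rule AE_completion)
  show "AE \<omega> in M. (\<lambda>n. 1 / h n * fd js (x + h n *\<^sub>R axis i 1) \<omega> + (- 1 / h n) * fd js x \<omega>) \<longlonglongrightarrow> fd (i # js) x \<omega>"
    using smooth
  proof eventually_elim
    case (elim \<omega>)
    let ?g = "\<lambda>t. partial_derivs js (\<lambda>x. F x \<omega>) (x + t *\<^sub>R axis i 1)"
    have "?g differentiable (at 0)" using elim assms(1) by (simp add: C_diff_def)
    then have "(?g has_real_derivative deriv ?g 0) (at 0)"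
      using DERIV_deriv_iff_real_differentiable by blast
    then have "((\<lambda>h. (?g h - ?g 0) / h) \<longlongrightarrow> deriv ?g 0) (at 0)" by (simp add: DERIV_def)
    then have "(\<lambda>n. (?g (h n) - ?g 0) / h n) \<longlonglongrightarrow> deriv ?g 0"
      using assms(2,3) LIMSEQ_SEQ_conv[of 0 "\<lambda>h. (?g h - ?g 0) / h"] by blast
    moreover have "deriv ?g 0 = fd (i # js) x \<omega>"
      by (simp add: field_deriv_def partial_derivs_def partial_deriv_def)
    moreover have "(?g (h n) - ?g 0) / h n = 1 / h n * fd js (x + h n *\<^sub>R axis i 1) \<omega> + (- 1 / h n) * fd js x \<omega>" for n
      by (simp add: field_deriv_def diff_divide_distrib)
    ultimately show ?case by simp
  qed
qed

lemma fd_closure: "length js \<le> 4 \<Longrightarrow> fd js x \<in> closure_F (length js)"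
proof (induction js arbitrary: x)
  case Nil
  have "fd [] x = (\<lambda>\<omega>. \<Sum>y\<in>{x}. 1 * F y \<omega>)"
    by (simp add: field_deriv_def partial_derivs_def fun_eq_iff)
  then show ?case unfolding list.size closure_F.simps span_F_def
    by (auto intro!: exI[of _ "{x}"] exI[of _ "\<lambda>_. 1"])
next
  case (Cons i js)
  then have js: "length js < 4" "\<And>x. fd js x \<in> closure_F (length js)" by auto
  interpret K: gaussian_space "completion M" "closure_F (length js)" by (rule gaussian_space_closure_F)
  let ?X = "\<lambda>n \<omega>. 1 / (1 / real (Suc n)) * fd js (x + (1 / real (Suc n)) *\<^sub>R axis i 1) \<omega> + (- 1 / (1 / real (Suc n))) * fd js x \<omega>"
  have X: "?X n \<in> closure_F (length js)" for n using js by (intro K.lincomb) auto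
  have lim: "AE \<omega> in completion M. (\<lambda>n. ?X n \<omega>) \<longlonglongrightarrow> fd (i # js) x \<omega>"
    by (rule field_deriv_difference_quotient[OF js(1)])
       (auto simp del: of_nat_Suc intro!: LIMSEQ_Suc[OF lim_1_over_n])
  have "fd (i # js) x \<in> borel_measurable (completion M)"
  proof (rule borel_measurable_completion_AE)
    show "(\<lambda>\<omega>. lim (\<lambda>n. ?X n \<omega>)) \<in> borel_measurable (completion M)"
      using K.measurable_H[OF X] by (rule borel_measurable_lim_metric)
    show "AE \<omega> in completion M. fd (i # js) x \<omega> = lim (\<lambda>n. ?X n \<omega>)"
      using lim by eventually_elim (simp add: limI)
  qed
  then show ?case
    using X lim by (auto simp: K.AE_closure_def intro!: exI[of _ ?X])
qed

lemma fd_H: "length js \<le> 4 \<Longrightarrow> fd js x \<in> closure_F 4"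
  using fd_closure[of js x] closure_F_mono[of "length js" 4] by auto

definition R :: "2 list \<Rightarrow> 2 list \<Rightarrow> real ^ 2 \<Rightarrow> real ^ 2 \<Rightarrow> real" where
  "R js ks x y = ip (fd js x) (fd ks y)"

lemma R_commute: "R js ks x y = R ks js y x"
  by (simp add: R_def ip_commute)

text \<open>
  Difference quotients converge almost surely within a Gaussian space, and there almost sure
  convergence implies the convergence of covariances.
\<close>

lemma R_deriv:
  assumes js: "length js < 4" and ks: "length ks \<le> 4"
  shows "((\<lambda>t. R js ks (x + t *\<^sub>R axis i 1) y) has_real_derivative R (i # js) ks x y) (at 0)"
  unfolding DERIV_def
proof (subst LIMSEQ_SEQ_conv[symmetric], intro allI impI)
  fix h :: "nat \<Rightarrow> real" assume h: "(\<forall>n. h n \<noteq> 0) \<and> h \<longlonglongrightarrow> 0"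
  let ?X = "\<lambda>n \<omega>. 1 / h n * fd js (x + h n *\<^sub>R axis i 1) \<omega> + (- 1 / h n) * fd js x \<omega>"
  have H: "fd js z \<in> closure_F 4" "fd ks z \<in> closure_F 4" "fd (i # js) z \<in> closure_F 4" for z
    using js ks by (auto intro!: fd_H)
  have "(\<lambda>n. ip (?X n) (fd ks y)) \<longlonglongrightarrow> ip (fd (i # js) x) (fd ks y)"
  proof (rule ip_tendsto)
    show "?X n \<in> closure_F 4" for n by (intro lincomb H)
    show "AE \<omega> in completion M. (\<lambda>n. ?X n \<omega>) \<longlonglongrightarrow> fd (i # js) x \<omega>"
      by (rule field_deriv_difference_quotient[OF js]) (use h in auto)
  qed (rule H)+
  moreover have "ip (?X n) (fd ks y) = (R js ks (x + (0 + h n) *\<^sub>R axis i 1) y - R js ks (x + 0 *\<^sub>R axis i 1) y) / h n" for n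
    by (subst ip_lincomb_left) (auto simp: H R_def diff_divide_distrib)
  ultimately show "(\<lambda>n. (R js ks (x + (0 + h n) *\<^sub>R axis i 1) y - R js ks (x + 0 *\<^sub>R axis i 1) y) / h n) \<longlonglongrightarrow> R (i # js) ks x y"
    by (simp add: R_def)
qed

lemma R_deriv_at:
  assumes "length js < 4" "length ks \<le> 4"
  shows "((\<lambda>t. R js ks (x + t *\<^sub>R axis i 1) y) has_real_derivative R (i # js) ks (x + t *\<^sub>R axis i 1) y) (at t)"
proof -
  have "((\<lambda>s. R js ks ((x + t *\<^sub>R axis i 1) + s *\<^sub>R axis i 1) y) has_real_derivative R (i # js) ks (x + t *\<^sub>R axis i 1) y) (at 0)"
    by (rule R_deriv[OF assms])
  moreover have "(x + t *\<^sub>R axis i 1) + s *\<^sub>R axis i 1 = x + (s + t) *\<^sub>R axis i (1::real)" for s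
    by (simp add: algebra_simps)
  ultimately have "((\<lambda>s. R js ks (x + (s + t) *\<^sub>R axis i 1) y) has_real_derivative R (i # js) ks (x + t *\<^sub>R axis i 1) y) (at 0)"
    by simp
  then show ?thesis
    using DERIV_shift[of "\<lambda>s. R js ks (x + s *\<^sub>R axis i 1) y" _ 0 t] by (simp add: add.commute)
qed

end

locale isotropic_gaussian_field = smooth_gaussian_field +
  fixes C :: "real \<Rightarrow> real" and g4 g6 :: real
  assumes isotropic: "isotropic_covariance M F C"
    and C_taylor: "(\<lambda>r. C r - (1 - r ^ 2 + g4 * r ^ 4 - g6 * r ^ 6)) \<in> o[at_right 0](\<lambda>r. r ^ 6)"
begin

lemma R_Nil: "R [] [] x y = C (norm (x - y))"
proof -
  have m: "F z \<in> borel_measurable M" for z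
    using gaussian_field[unfolded centred_gaussian_field_def, rule_format, of "{z}" "\<lambda>_. 1"]
    by (simp add: centred_gaussian_def)
  have "R [] [] x y = integral\<^sup>L (completion M) (\<lambda>\<omega>. F x \<omega> * F y \<omega>)"
    by (simp add: R_def ip_def field_deriv_def partial_derivs_def)
  also have "\<dots> = integral\<^sup>L M (\<lambda>\<omega>. F x \<omega> * F y \<omega>)"
    by (rule integral_completion) (use m in measurable)
  finally show ?thesis using isotropic by (simp add: isotropic_covariance_def)
qed

text \<open>
  The covariance of the field depends only on the difference of the points, and this is preserved by
  differentiation in either argument.
\<close>

lemma R_translation:
  assumes "length js \<le> 4" "length ks \<le> 4"
  shows "R js ks (x + h) (y + h) = R js ks x y"
proof -
  have step: "R (i # js) ks (x + h) (y + h) = R (i # js) ks x y"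
    if "\<And>x y. R js ks (x + h) (y + h) = R js ks x y" "length js < 4" "length ks \<le> 4" for i js ks x y
  proof -
    have "((\<lambda>t. R js ks ((x + h) + t *\<^sub>R axis i 1) (y + h)) has_real_derivative R (i # js) ks (x + h) (y + h)) (at 0)"
      by (rule R_deriv[OF that(2,3)])
    moreover have "R js ks ((x + h) + t *\<^sub>R axis i 1) (y + h) = R js ks (x + t *\<^sub>R axis i 1) y" for t
      using that(1)[of "x + t *\<^sub>R axis i 1" y] by (simp add: algebra_simps)
    ultimately show ?thesis using R_deriv[OF that(2,3), of x i y] by (auto dest: DERIV_unique)
  qed
  have 1: "R js [] (x + h) (y + h) = R js [] x y" if "length js \<le> 4" for js x y
    using that
  proof (induction js arbitrary: x y)
    case Nil then show ?case by (simp add: R_Nil)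
  next
    case (Cons i js) then show ?case by (intro step) auto
  qed
  show ?thesis using assms(2)
  proof (induction ks arbitrary: x y)
    case Nil then show ?case using 1 assms(1) by simp
  next
    case (Cons i ks)
    then have "R (i # ks) js (y + h) (x + h) = R (i # ks) js y x"
      using assms(1) by (intro step) (auto simp: R_commute[of ks js])
    then show ?case by (simp add: R_commute[of js "i # ks"])
  qed
qed

text \<open>
  The first four derivatives act on the first argument of the covariance, the others on the second,
  where each contributes a factor \<open>-1\<close>.
\<close>

definition G :: "nat \<Rightarrow> real \<Rightarrow> real" where
  "G k t = (if k \<le> 4 then R (replicate k 2) [] (t *\<^sub>R axis 2 1) 0
     else (- 1) ^ (k - 4) * R (replicate 4 2) (replicate (k - 4) 2) (t *\<^sub>R axis 2 1) 0)"

lemma G_deriv: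
  assumes "k < 8"
  shows "(G k has_real_derivative G (Suc k) t) (at t)"
proof (cases "k < 4")
  case True
  have "((\<lambda>t. R (replicate k 2) [] (0 + t *\<^sub>R axis 2 1) 0) has_real_derivative R (2 # replicate k 2) [] (0 + t *\<^sub>R axis 2 1) 0) (at t)"
    by (rule R_deriv_at) (use True in auto)
  then show ?thesis using True by (simp add: G_def[abs_def])
next
  case False
  define j where "j = k - 4"
  have j: "j < 4" "k = 4 + j" using assms False by (auto simp: j_def)
  have sym: "R (replicate 4 2) (replicate l 2) (t *\<^sub>R axis 2 1) 0 = R (replicate l 2) (replicate 4 2) (0 + (- t) *\<^sub>R axis 2 1) 0" if "l \<le> 4" for l t
    using R_translation[of "replicate 4 2" "replicate l 2" 0 "t *\<^sub>R axis 2 1" "(- t) *\<^sub>R axis 2 1"] that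
    by (simp add: R_commute[of "replicate 4 2"])
  have "((\<lambda>t. R (replicate j 2) (replicate 4 2) (0 + t *\<^sub>R axis 2 1) 0) has_real_derivative R (2 # replicate j 2) (replicate 4 2) (0 + (- t) *\<^sub>R axis 2 1) 0) (at (- t))"
    by (rule R_deriv_at) (use j in auto)
  moreover have "(uminus has_real_derivative - 1) (at t)"
    by (auto intro!: derivative_eq_intros)
  ultimately  have "((\<lambda>t. R (replicate j 2) (replicate 4 2) (0 + (- t) *\<^sub>R axis 2 1) 0) has_real_derivative R (2 # replicate j 2) (replicate 4 2) (0 + (- t) *\<^sub>R axis 2 1) 0 * (- 1)) (at t)"
    by (rule DERIV_chain2[where g="uminus :: real \<Rightarrow> real"])
  from DERIV_cmult[OF this, of "(- 1) ^ j"]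
  have "((\<lambda>t. (- 1) ^ j * R (replicate 4 2) (replicate j 2) (t *\<^sub>R axis 2 1) 0) has_real_derivative
      (- 1) ^ Suc j * R (replicate 4 2) (replicate (Suc j) 2) (t *\<^sub>R axis 2 1) 0) (at t)"
    using sym[of j] sym[of "Suc j" t] j by simp
  moreover have "G k = (\<lambda>t. (- 1) ^ j * R (replicate 4 2) (replicate j 2) (t *\<^sub>R axis 2 1) 0)"
    using j by (cases "j = 0") (auto simp: G_def fun_eq_iff)
  moreover have "G (Suc k) t = (- 1) ^ Suc j * R (replicate 4 2) (replicate (Suc j) 2) (t *\<^sub>R axis 2 1) 0"
    using j by (simp add: G_def)
  ultimately show ?thesis by (simp only:)
qed

lemma norm_axis_one: "norm (axis i 1 :: real ^ 2) = 1"
  by (simp add: norm_eq_sqrt_inner inner_axis_axis)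

lemma G_0: "G 0 t = C \<bar>t\<bar>"
  by (simp add: G_def R_Nil norm_axis_one)

sublocale covariance_expansion G g4 g6
proof
  show "k < 8 \<Longrightarrow> (G k has_real_derivative G (Suc k) t) (at t)" for k t by (rule G_deriv)
  show "G 0 (- t) = G 0 t" for t by (simp add: G_0)
  show "(\<lambda>r. G 0 r - (1 - r ^ 2 + g4 * r ^ 4 - g6 * r ^ 6)) \<in> o[at_right 0](\<lambda>r. r ^ 6)"
    by (rule landau_o.small.in_cong[THEN iffD1, OF _ C_taylor])
       (auto simp: eventually_at_filter G_0)
qed

end

section \<open>Covariances of the derivatives of an isotropic field\<close>

text \<open>
  The Kronecker symbol.
\<close>

definition kd :: "2 \<Rightarrow> 2 \<Rightarrow> real" where "kd i j = (if i = j then 1 else 0)"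

lemma kd_sym: "kd i j = kd j i" by (simp add: kd_def)

lemma kd_numeral: "kd i i = 1" "kd 1 2 = 0" "kd 2 1 = 0"
  by (auto simp: kd_def)

lemma line_component: "(z + c *\<^sub>R axis i 1) $ j = z $ j + c * kd i j"
  by (simp add: axis_def kd_def)

lemma norm_line_deriv:
  fixes z :: "real ^ 2"
  assumes "z \<noteq> 0"
  shows "((\<lambda>t. norm (z + (s * t) *\<^sub>R axis i 1)) has_real_derivative s * (z $ i / norm z)) (at 0)"
proof -
  have n: "norm (z + (s * t) *\<^sub>R axis i 1) = sqrt ((norm z)\<^sup>2 + 2 * (s * t) * z $ i + (s * t)\<^sup>2)" for t
    by (simp add: norm_eq_sqrt_inner inner_add_left inner_add_right inner_axis inner_commute[of "axis i 1"] inner_axis_axis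
        power2_eq_square algebra_simps)
  have p: "0 < (norm z)\<^sup>2" using assms by simp
  have "((\<lambda>t. sqrt ((norm z)\<^sup>2 + 2 * (s * t) * z $ i + (s * t)\<^sup>2)) has_real_derivative s * (z $ i / norm z)) (at 0)"
    using p by (auto intro!: derivative_eq_intros simp: field_simps)
  then show ?thesis by (simp add: n)
qed

context isotropic_gaussian_field
begin

lemma radial_deriv:
  fixes z :: "real ^ 2"
  assumes "z \<noteq> 0"
  shows "((\<lambda>t. G 0 (norm (z + (s * t) *\<^sub>R axis i 1))) has_real_derivative s * (2 * z $ i * h1 (norm z))) (at 0)"
    "((\<lambda>t. h1 (norm (z + (s * t) *\<^sub>R axis i 1))) has_real_derivative s * (2 * z $ i * h2 (norm z))) (at 0)"
    "((\<lambda>t. h2 (norm (z + (s * t) *\<^sub>R axis i 1))) has_real_derivative s * (2 * z $ i * h3 (norm z))) (at 0)"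
    "((\<lambda>t. h3 (norm (z + (s * t) *\<^sub>R axis i 1))) has_real_derivative s * (2 * z $ i * h4 (norm z))) (at 0)"
proof -
  have n: "norm z \<noteq> 0" using assms by simp
  have ch: "((\<lambda>t. f (norm (z + (s * t) *\<^sub>R axis i 1))) has_real_derivative s * (2 * z $ i * D)) (at 0)"
    if "(f has_real_derivative 2 * norm z * D) (at (norm z))" for f D
  proof -
    have "((\<lambda>t. f (norm (z + (s * t) *\<^sub>R axis i 1))) has_real_derivative (2 * norm z * D) * (s * (z $ i / norm z))) (at 0)"
      by (rule DERIV_chain2[where g="\<lambda>t. norm (z + (s * t) *\<^sub>R axis i 1)", OF _ norm_line_deriv[OF assms]])
         (use that in simp)
    then show ?thesis using n by (simp add: mult_ac)
  qed
  show "((\<lambda>t. G 0 (norm (z + (s * t) *\<^sub>R axis i 1))) has_real_derivative s * (2 * z $ i * h1 (norm z))) (at 0)"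
    by (rule ch[OF h_deriv(1)[OF n]])
  show "((\<lambda>t. h1 (norm (z + (s * t) *\<^sub>R axis i 1))) has_real_derivative s * (2 * z $ i * h2 (norm z))) (at 0)"
    by (rule ch[OF h_deriv(2)[OF n]])
  show "((\<lambda>t. h2 (norm (z + (s * t) *\<^sub>R axis i 1))) has_real_derivative s * (2 * z $ i * h3 (norm z))) (at 0)"
    by (rule ch[OF h_deriv(3)[OF n]])
  show "((\<lambda>t. h3 (norm (z + (s * t) *\<^sub>R axis i 1))) has_real_derivative s * (2 * z $ i * h4 (norm z))) (at 0)"
    by (rule ch[OF h_deriv(4)[OF n]])
qed

lemma line_avoids_0:
  fixes z :: "real ^ 2"
  assumes "z \<noteq> 0"
  shows "\<forall>\<^sub>F t in nhds 0. z + (s * t) *\<^sub>R axis i 1 \<noteq> 0"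
proof -
  have "((\<lambda>t. z + (s * t) *\<^sub>R axis i 1) \<longlongrightarrow> z + (s * 0) *\<^sub>R axis i 1) (nhds 0)"
    by (intro tendsto_intros filterlim_ident)
  then show ?thesis by (rule tendsto_imp_eventually_ne) (use assms in simp)
qed

text \<open>
  A formula for a covariance that is valid off the diagonal may be differentiated there, because
  points near \<open>x\<close> remain different from \<open>y\<close>.
\<close>

lemma R_Cons_left:
  assumes \<Phi>: "\<And>x y. x \<noteq> y \<Longrightarrow> R js ks x y = \<Phi> (x - y)" and len: "length js < 4" "length ks \<le> 4"
    and xy: "x \<noteq> y" and D: "((\<lambda>t. \<Phi> ((x - y) + (1 * t) *\<^sub>R axis i 1)) has_real_derivative D) (at 0)"
  shows "R (i # js) ks x y = D"
proof -
  have z: "x - y \<noteq> 0" using xy by simp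
  have "\<forall>\<^sub>F t in nhds 0. \<Phi> ((x - y) + (1 * t) *\<^sub>R axis i 1) = R js ks (x + t *\<^sub>R axis i 1) y"
    using line_avoids_0[OF z, of 1 i]
  proof (eventually_elim)
    case (elim t)
    then have "x + t *\<^sub>R axis i 1 \<noteq> y" by (auto simp: algebra_simps)
    then show ?case using \<Phi>[of "x + t *\<^sub>R axis i 1" y] by (simp add: algebra_simps)
  qed
  then have "((\<lambda>t. R js ks (x + t *\<^sub>R axis i 1) y) has_real_derivative D) (at 0)"
    using D by (subst DERIV_cong_ev[symmetric]) auto
  with R_deriv[OF len, of x i y] show ?thesis by (rule DERIV_unique[symmetric, rotated])
qed

lemma R_Cons_right:
  assumes \<Phi>: "\<And>x y. x \<noteq> y \<Longrightarrow> R js ks x y = \<Phi> (x - y)" and len: "length js \<le> 4" "length ks < 4"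
    and xy: "x \<noteq> y" and D: "((\<lambda>t. \<Phi> ((x - y) + (- 1 * t) *\<^sub>R axis i 1)) has_real_derivative D) (at 0)"
  shows "R js (i # ks) x y = D"
proof -
  have "R (i # ks) js y x = D"
  proof (rule R_Cons_left[where \<Phi>="\<lambda>z. \<Phi> (- z)"])
    show "R ks js x y = \<Phi> (- (x - y))" if "x \<noteq> y" for x y
      using \<Phi>[of y x] that by (simp add: R_commute[of ks js])
    have "- (y - x + (1 * t) *\<^sub>R axis i 1) = (x - y) + (- 1 * t) *\<^sub>R axis i 1" for t :: real by simp
    then show "((\<lambda>t. \<Phi> (- (y - x + (1 * t) *\<^sub>R axis i 1))) has_real_derivative D) (at 0)" using D by (simp only:)
  qed (use len xy in auto)
  then show ?thesis by (simp add: R_commute[of js])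
qed

lemma R_1_0: "x \<noteq> y \<Longrightarrow> R [i] [] x y = 2 * (x - y) $ i * h1 (norm (x - y))"
proof (rule R_Cons_left[where \<Phi>="\<lambda>z. G 0 (norm z)"])
  show "R [] [] x y = G 0 (norm (x - y))" for x y by (simp add: R_Nil G_0)
  assume "x \<noteq> y"
  then show "((\<lambda>t. G 0 (norm (x - y + (1 * t) *\<^sub>R axis i 1))) has_real_derivative 2 * (x - y) $ i * h1 (norm (x - y))) (at 0)"
    using radial_deriv(1)[of "x - y" 1 i] by simp
qed auto

lemma R_1_1:
  assumes "x \<noteq> y"
  shows "R [i] [j] x y = - (2 * kd i j * h1 (norm (x - y)) + 4 * (x - y) $ i * (x - y) $ j * h2 (norm (x - y)))"
proof (rule R_Cons_right[OF R_1_0])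
  have z: "x - y \<noteq> 0" using assms by simp
  show "((\<lambda>t. 2 * (x - y + (- 1 * t) *\<^sub>R axis j 1) $ i * h1 (norm (x - y + (- 1 * t) *\<^sub>R axis j 1))) has_real_derivative
      - (2 * kd i j * h1 (norm (x - y)) + 4 * (x - y) $ i * (x - y) $ j * h2 (norm (x - y)))) (at 0)"
    unfolding line_component
    by (rule derivative_eq_intros radial_deriv[OF z] refl)+ (simp add: algebra_simps kd_sym[of j])
qed (use assms in auto)

lemma R_2_0:
  assumes "x \<noteq> y"
  shows "R [i, j] [] x y = 2 * kd i j * h1 (norm (x - y)) + 4 * (x - y) $ i * (x - y) $ j * h2 (norm (x - y))"
proof (rule R_Cons_left[OF R_1_0])
  have z: "x - y \<noteq> 0" using assms by simp
  show "((\<lambda>t. 2 * (x - y + (1 * t) *\<^sub>R axis i 1) $ j * h1 (norm (x - y + (1 * t) *\<^sub>R axis i 1))) has_real_derivative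
      2 * kd i j * h1 (norm (x - y)) + 4 * (x - y) $ i * (x - y) $ j * h2 (norm (x - y))) (at 0)"
    unfolding line_component
    by (rule derivative_eq_intros radial_deriv[OF z] refl)+ (simp add: algebra_simps)
qed (use assms in auto)

lemma R_2_1:
  assumes "x \<noteq> y"
  defines "z \<equiv> x - y"
  shows "R [i, j] [k] x y = - (4 * (kd i j * z $ k + kd i k * z $ j + kd j k * z $ i) * h2 (norm z)
     + 8 * z $ i * z $ j * z $ k * h3 (norm z))"
  unfolding z_def
proof (rule R_Cons_right[OF R_2_0])
  have z: "x - y \<noteq> 0" using assms by simp
  show "((\<lambda>t. 2 * kd i j * h1 (norm (x - y + (- 1 * t) *\<^sub>R axis k 1))
      + 4 * (x - y + (- 1 * t) *\<^sub>R axis k 1) $ i * (x - y + (- 1 * t) *\<^sub>R axis k 1) $ j * h2 (norm (x - y + (- 1 * t) *\<^sub>R axis k 1)))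
      has_real_derivative
      - (4 * (kd i j * (x - y) $ k + kd i k * (x - y) $ j + kd j k * (x - y) $ i) * h2 (norm (x - y))
     + 8 * (x - y) $ i * (x - y) $ j * (x - y) $ k * h3 (norm (x - y)))) (at 0)"
    unfolding line_component
    by (rule derivative_eq_intros radial_deriv[OF z] refl)+ (simp add: algebra_simps kd_sym[of k])
qed (use assms in auto)

lemma R_2_2:
  assumes "x \<noteq> y"
  defines "z \<equiv> x - y"
  shows "R [i, j] [k, l] x y = 4 * (kd i j * kd k l + kd i k * kd j l + kd i l * kd j k) * h2 (norm z)
     + 8 * (kd i j * z $ k * z $ l + kd i k * z $ j * z $ l + kd i l * z $ j * z $ k
          + kd j k * z $ i * z $ l + kd j l * z $ i * z $ k + kd k l * z $ i * z $ j) * h3 (norm z)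
     + 16 * z $ i * z $ j * z $ k * z $ l * h4 (norm z)"
  unfolding z_def
proof (rule R_Cons_right[OF R_2_1])
  have z: "x - y \<noteq> 0" using assms by simp
  show "((\<lambda>t. - (4 * (kd i j * (x - y + (- 1 * t) *\<^sub>R axis k 1) $ l + kd i l * (x - y + (- 1 * t) *\<^sub>R axis k 1) $ j
        + kd j l * (x - y + (- 1 * t) *\<^sub>R axis k 1) $ i) * h2 (norm (x - y + (- 1 * t) *\<^sub>R axis k 1))
     + 8 * (x - y + (- 1 * t) *\<^sub>R axis k 1) $ i * (x - y + (- 1 * t) *\<^sub>R axis k 1) $ j * (x - y + (- 1 * t) *\<^sub>R axis k 1) $ l
        * h3 (norm (x - y + (- 1 * t) *\<^sub>R axis k 1))))
      has_real_derivative
      4 * (kd i j * kd k l + kd i k * kd j l + kd i l * kd j k) * h2 (norm (x - y))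
     + 8 * (kd i j * (x - y) $ k * (x - y) $ l + kd i k * (x - y) $ j * (x - y) $ l + kd i l * (x - y) $ j * (x - y) $ k
          + kd j k * (x - y) $ i * (x - y) $ l + kd j l * (x - y) $ i * (x - y) $ k + kd k l * (x - y) $ i * (x - y) $ j) * h3 (norm (x - y))
     + 16 * (x - y) $ i * (x - y) $ j * (x - y) $ k * (x - y) $ l * h4 (norm (x - y))) (at 0)"
    unfolding line_component
    by (rule derivative_eq_intros radial_deriv[OF z] refl)+ (simp add: algebra_simps kd_sym[of k])
qed (use assms in auto)

lemma h_limits:
  "(h1 \<longlongrightarrow> - 1) (at_right 0)" "(h2 \<longlongrightarrow> 2 * g4) (at_right 0)"
  "((\<lambda>t. t\<^sup>2 * h3 t) \<longlongrightarrow> 0) (at_right 0)" "((\<lambda>t. t ^ 4 * h4 t) \<longlongrightarrow> 0) (at_right 0)"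
proof -
  have "((\<lambda>t. t\<^sup>2 * hA t - 1) \<longlongrightarrow> 0 - 1) (at_right 0)"
    by (intro tendsto_diff tendsto_const sq.quad_tendsto[OF sq.quad_param_mult[OF quad_hA]])
  then show "(h1 \<longlongrightarrow> - 1) (at_right 0)"
    by (rule tendsto_right_transform) (auto simp: hA_def)
qed (rule sq.quad_tendsto[OF quad_h2] sq.quad_tendsto[OF quad_h3] sq.quad_tendsto[OF quad_h4])+

text \<open>
  The functions \<open>h1, \<dots>, h4\<close> are quotients with denominator \<open>0\<close> at \<open>0\<close>; the covariances at coinciding
  points are obtained as limits along the second axis.
\<close>

lemma R_at_0:
  assumes len: "length js < 4" "length ks \<le> 4" and lim: "(\<Phi> \<longlongrightarrow> c) (at_right 0)"
    and \<Phi>: "\<And>t. t > 0 \<Longrightarrow> R js ks (t *\<^sub>R axis 2 1) 0 = \<Phi> t"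
  shows "R js ks x x = c"
proof -
  have "isCont (\<lambda>t. R js ks (0 + t *\<^sub>R axis 2 1) 0) 0"
    by (rule DERIV_isCont[OF R_deriv_at[OF len]])
  then have "((\<lambda>t. R js ks (0 + t *\<^sub>R axis 2 1) 0) \<longlongrightarrow> R js ks 0 0) (at_right 0)"
    by (auto simp: isCont_def intro: filterlim_mono at_le)
  moreover have "((\<lambda>t. R js ks (0 + t *\<^sub>R axis 2 1) 0) \<longlongrightarrow> c) (at_right 0)"
    by (rule tendsto_right_transform[OF lim]) (use \<Phi> in auto)
  ultimately have "R js ks 0 0 = c" by (intro tendsto_unique[of "at_right (0::real)"]) auto
  then show ?thesis using R_translation[of js ks 0 x 0] len by simp
qed

lemma axis2_nonzero: "t > 0 \<Longrightarrow> t *\<^sub>R axis 2 1 \<noteq> (0 :: real ^ 2)"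
  by (auto simp: axis_eq_0_iff)

lemma norm_axis2: "t > 0 \<Longrightarrow> norm (t *\<^sub>R axis 2 1 :: real ^ 2) = t"
  by (simp add: norm_axis_one)

lemma axis2_nth: "(axis 2 1 :: real ^ 2) $ i = kd i 2"
  by (simp add: axis_def kd_def)

lemma R_1_1_at_0: "R [i] [j] x x = 2 * kd i j"
proof (rule R_at_0)
  have "((\<lambda>t. - (2 * kd i j * h1 t + 4 * (kd i 2 * kd j 2) * (t * t * h2 t))) \<longlongrightarrow> - (2 * kd i j * (- 1) + 4 * (kd i 2 * kd j 2) * (0 * 0 * (2 * g4)))) (at_right 0)"
    by (intro tendsto_intros h_limits)
  then show "((\<lambda>t. - (2 * kd i j * h1 t + 4 * (kd i 2 * kd j 2) * (t * t * h2 t))) \<longlongrightarrow> 2 * kd i j) (at_right 0)" by simp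
  show "R [i] [j] (t *\<^sub>R axis 2 1) 0 = - (2 * kd i j * h1 t + 4 * (kd i 2 * kd j 2) * (t * t * h2 t))" if "t > 0" for t
    by (subst R_1_1) (use that in \<open>auto simp: norm_axis2 axis2_nth axis2_nonzero simp del: scaleR_eq_0_iff\<close>)
qed auto

lemma R_2_1_at_0: "R [i, j] [k] x x = 0"
proof (rule R_at_0)
  let ?\<Phi> = "\<lambda>t. - (4 * (kd i j * kd k 2 + kd i k * kd j 2 + kd j k * kd i 2) * (t * h2 t) + 8 * (kd i 2 * kd j 2 * kd k 2) * (t * (t\<^sup>2 * h3 t)))"
  have "(?\<Phi> \<longlongrightarrow> - (4 * (kd i j * kd k 2 + kd i k * kd j 2 + kd j k * kd i 2) * (0 * (2 * g4)) + 8 * (kd i 2 * kd j 2 * kd k 2) * (0 * 0))) (at_right 0)"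
    by (intro tendsto_intros h_limits)
  then show "(?\<Phi> \<longlongrightarrow> 0) (at_right 0)" by simp
  show "R [i, j] [k] (t *\<^sub>R axis 2 1) 0 = ?\<Phi> t" if "t > 0" for t
    by (subst R_2_1) (use that in \<open>auto simp: norm_axis2 axis2_nth axis2_nonzero power2_eq_square algebra_simps simp del: scaleR_eq_0_iff\<close>)
qed auto

lemma R_2_2_at_0: "R [i, j] [k, l] x x = 8 * g4 * (kd i j * kd k l + kd i k * kd j l + kd i l * kd j k)"
proof (rule R_at_0)
  let ?\<Phi> = "\<lambda>t. 4 * (kd i j * kd k l + kd i k * kd j l + kd i l * kd j k) * h2 t
     + 8 * (kd i j * kd k 2 * kd l 2 + kd i k * kd j 2 * kd l 2 + kd i l * kd j 2 * kd k 2
          + kd j k * kd i 2 * kd l 2 + kd j l * kd i 2 * kd k 2 + kd k l * kd i 2 * kd j 2) * (t\<^sup>2 * h3 t)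
     + 16 * (kd i 2 * kd j 2 * kd k 2 * kd l 2) * (t ^ 4 * h4 t)"
  have "(?\<Phi> \<longlongrightarrow> 4 * (kd i j * kd k l + kd i k * kd j l + kd i l * kd j k) * (2 * g4)
     + 8 * (kd i j * kd k 2 * kd l 2 + kd i k * kd j 2 * kd l 2 + kd i l * kd j 2 * kd k 2
          + kd j k * kd i 2 * kd l 2 + kd j l * kd i 2 * kd k 2 + kd k l * kd i 2 * kd j 2) * 0
     + 16 * (kd i 2 * kd j 2 * kd k 2 * kd l 2) * 0) (at_right 0)"
    by (intro tendsto_intros h_limits)
  then show "(?\<Phi> \<longlongrightarrow> 8 * g4 * (kd i j * kd k l + kd i k * kd j l + kd i l * kd j k)) (at_right 0)"
    by (rule tendsto_eq_rhs) (simp add: algebra_simps)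
  show "R [i, j] [k, l] (t *\<^sub>R axis 2 1) 0 = ?\<Phi> t" if "t > 0" for t
    by (subst R_2_2) (use that in \<open>auto simp: norm_axis2 axis2_nth axis2_nonzero eval_nat_numeral algebra_simps simp del: scaleR_eq_0_iff\<close>)
qed auto

end

section \<open>The conditioned Hessians\<close>

lemma exhaust_6:
  fixes x :: 6
  shows "x = 1 \<or> x = 2 \<or> x = 3 \<or> x = 4 \<or> x = 5 \<or> x = 6"
proof (induct x)
  case (of_int z)
  then have "z = 0 \<or> z = 1 \<or> z = 2 \<or> z = 3 \<or> z = 4 \<or> z = 5" by fastforce
  then show ?case by auto
qed

lemma forall_6: "(\<forall>i::6. P i) \<longleftrightarrow> P 1 \<and> P 2 \<and> P 3 \<and> P 4 \<and> P 5 \<and> P 6"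
  by (metis exhaust_6)

lemma UNIV_6: "UNIV = {1, 2, 3, 4, 5, 6::6}"
  using exhaust_6 by auto

lemma sum_6: "sum f (UNIV::6 set) = f 1 + f 2 + f 3 + f 4 + f 5 + f 6"
  unfolding UNIV_6 by (simp add: ac_simps)

lemma vector_4:
  "(vector [a, b, c, d] :: 'a::zero ^ 4) $ 1 = a"
  "(vector [a, b, c, d] :: 'a ^ 4) $ 2 = b"
  "(vector [a, b, c, d] :: 'a ^ 4) $ 3 = c"
  "(vector [a, b, c, d] :: 'a ^ 4) $ 4 = d"
  unfolding vector_def by simp_all

lemma vector_6:
  "(vector [a, b, c, d, e, f] :: 'a::zero ^ 6) $ 1 = a"
  "(vector [a, b, c, d, e, f] :: 'a ^ 6) $ 2 = b"
  "(vector [a, b, c, d, e, f] :: 'a ^ 6) $ 3 = c"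
  "(vector [a, b, c, d, e, f] :: 'a ^ 6) $ 4 = d"
  "(vector [a, b, c, d, e, f] :: 'a ^ 6) $ 5 = e"
  "(vector [a, b, c, d, e, f] :: 'a ^ 6) $ 6 = f"
  unfolding vector_def by simp_all

lemma prod_4: "prod f (UNIV::4 set) = f 1 * f 2 * f 3 * f 4"
  unfolding UNIV_4 by (simp add: ac_simps)

lemma matrix_inv_right_inverse:
  fixes A :: "real ^ 'n ^ 'n"
  assumes "invertible A"
  shows "A ** matrix_inv A = mat 1"
  using someI_ex[OF assms[unfolded invertible_def]] unfolding matrix_inv_def by blast

context isotropic_gaussian_field
begin

abbreviation pt :: "real \<Rightarrow> real ^ 2" where "pt r \<equiv> axis 2 r"

lemma pt_eq: "axis 2 r = r *\<^sub>R (axis 2 1 :: real ^ 2)"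
  by (simp add: axis_def vec_eq_iff)

lemma pt_nth: "(axis 2 r :: real ^ 2) $ i = r * kd i 2"
  by (simp add: axis_def kd_def)

lemma norm_pt: "r > 0 \<Longrightarrow> norm (axis 2 r :: real ^ 2) = r"
  by (subst pt_eq) (simp add: norm_axis_one)

lemma pt_nonzero: "r > 0 \<Longrightarrow> axis 2 r \<noteq> (0 :: real ^ 2)"
  by (auto simp: axis_eq_0_iff)

definition hsum :: "2 list \<Rightarrow> real \<Rightarrow> 'a \<Rightarrow> real" where
  "hsum js r = (\<lambda>\<omega>. 1 / 2 * fd js 0 \<omega> + 1 / 2 * fd js (pt r) \<omega>)"

definition hdiff :: "2 list \<Rightarrow> real \<Rightarrow> 'a \<Rightarrow> real" where
  "hdiff js r = (\<lambda>\<omega>. (- 1 / 2) * fd js 0 \<omega> + 1 / 2 * fd js (pt r) \<omega>)"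

lemma half_H: "length js \<le> 4 \<Longrightarrow> hsum js r \<in> closure_F 4" "length js \<le> 4 \<Longrightarrow> hdiff js r \<in> closure_F 4"
  unfolding hsum_def hdiff_def by (intro lincomb fd_H; simp)+

lemma ip_two_points:
  assumes "length js \<le> 4" "length ks \<le> 4"
  shows "ip (\<lambda>\<omega>. a * fd js x \<omega> + b * fd js y \<omega>) (\<lambda>\<omega>. a' * fd ks x \<omega> + b' * fd ks y \<omega>)
    = a * a' * R js ks x x + a * b' * R js ks x y + b * a' * R js ks y x + b * b' * R js ks y y"
  using fd_H[OF assms(1)] fd_H[OF assms(2)]
  by (simp add: ip_lincomb_left ip_lincomb_right lincomb R_def algebra_simps)

lemma half_1_1:
  assumes r: "r > 0"
  shows "ip (hsum [i] r) (hsum [j] r) = kd i j * (1 - h1 r) - 2 * r\<^sup>2 * (kd i 2 * kd j 2) * h2 r"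
    "ip (hdiff [i] r) (hdiff [j] r) = kd i j * (1 + h1 r) + 2 * r\<^sup>2 * (kd i 2 * kd j 2) * h2 r"
    "ip (hsum [i] r) (hdiff [j] r) = 0" "ip (hdiff [i] r) (hsum [j] r) = 0"
proof -
  have v: "R [i] [j] 0 0 = 2 * kd i j" "R [i] [j] (pt r) (pt r) = 2 * kd i j"
    "R [i] [j] 0 (pt r) = - (2 * kd i j * h1 r + 4 * r\<^sup>2 * (kd i 2 * kd j 2) * h2 r)"
    "R [i] [j] (pt r) 0 = - (2 * kd i j * h1 r + 4 * r\<^sup>2 * (kd i 2 * kd j 2) * h2 r)"
    using pt_nonzero[OF r] pt_nonzero[OF r, symmetric]
    by (simp_all add: R_1_1_at_0 R_1_1 norm_pt[OF r] pt_nth power2_eq_square)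
  show "ip (hsum [i] r) (hsum [j] r) = kd i j * (1 - h1 r) - 2 * r\<^sup>2 * (kd i 2 * kd j 2) * h2 r"
    "ip (hdiff [i] r) (hdiff [j] r) = kd i j * (1 + h1 r) + 2 * r\<^sup>2 * (kd i 2 * kd j 2) * h2 r"
    "ip (hsum [i] r) (hdiff [j] r) = 0" "ip (hdiff [i] r) (hsum [j] r) = 0"
    unfolding hsum_def hdiff_def by (simp_all only: ip_two_points list.size v) (simp_all add: algebra_simps)
qed

text \<open>
  The covariance of the half sum of \<open>F\<^sub>i\<^sub>j\<close> and the half difference of \<open>F\<^sub>k\<close>.
\<close>

definition mixed :: "2 \<Rightarrow> 2 \<Rightarrow> 2 \<Rightarrow> real \<Rightarrow> real" where
  "mixed i j k r = 2 * r * (kd i j * kd k 2 + kd i k * kd j 2 + kd j k * kd i 2) * h2 r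
     + 4 * r ^ 3 * (kd i 2 * kd j 2 * kd k 2) * h3 r"

lemma half_2_1:
  assumes r: "r > 0"
  shows "ip (hsum [i, j] r) (hsum [k] r) = 0" "ip (hdiff [i, j] r) (hdiff [k] r) = 0"
    "ip (hsum [i, j] r) (hdiff [k] r) = mixed i j k r" "ip (hdiff [i, j] r) (hsum [k] r) = - mixed i j k r"
proof -
  have v: "R [i, j] [k] 0 0 = 0" "R [i, j] [k] (pt r) (pt r) = 0"
    "R [i, j] [k] 0 (pt r) = 2 * mixed i j k r"
    "R [i, j] [k] (pt r) 0 = - 2 * mixed i j k r"
    using pt_nonzero[OF r] pt_nonzero[OF r, symmetric]
    by (simp_all add: R_2_1_at_0 R_2_1 norm_pt[OF r] pt_nth mixed_def power3_eq_cube algebra_simps)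
  show "ip (hsum [i, j] r) (hsum [k] r) = 0" "ip (hdiff [i, j] r) (hdiff [k] r) = 0"
    "ip (hsum [i, j] r) (hdiff [k] r) = mixed i j k r" "ip (hdiff [i, j] r) (hsum [k] r) = - mixed i j k r"
    unfolding hsum_def hdiff_def by (simp_all only: ip_two_points list.size v)
qed

lemma half_1_2:
  assumes r: "r > 0"
  shows "ip (hsum [k] r) (hsum [i, j] r) = 0" "ip (hdiff [k] r) (hdiff [i, j] r) = 0"
    "ip (hdiff [k] r) (hsum [i, j] r) = mixed i j k r" "ip (hsum [k] r) (hdiff [i, j] r) = - mixed i j k r"
  using half_2_1[OF r, of i j k] by (simp_all add: ip_commute[of "hsum [k] r"] ip_commute[of "hdiff [k] r"])

text \<open>
  The covariances of half sums and of half differences of second derivatives are the sum and the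
  difference of a one-point part and a two-point part.
\<close>

definition fourth0 :: "2 \<Rightarrow> 2 \<Rightarrow> 2 \<Rightarrow> 2 \<Rightarrow> real" where
  "fourth0 i j k l = 4 * g4 * (kd i j * kd k l + kd i k * kd j l + kd i l * kd j k)"

definition fourth :: "2 \<Rightarrow> 2 \<Rightarrow> 2 \<Rightarrow> 2 \<Rightarrow> real \<Rightarrow> real" where
  "fourth i j k l r = 2 * (kd i j * kd k l + kd i k * kd j l + kd i l * kd j k) * h2 r
     + 4 * r\<^sup>2 * (kd i j * kd k 2 * kd l 2 + kd i k * kd j 2 * kd l 2 + kd i l * kd j 2 * kd k 2
          + kd j k * kd i 2 * kd l 2 + kd j l * kd i 2 * kd k 2 + kd k l * kd i 2 * kd j 2) * h3 r
     + 8 * r ^ 4 * (kd i 2 * kd j 2 * kd k 2 * kd l 2) * h4 r"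

lemma half_2_2:
  assumes r: "r > 0"
  shows "ip (hsum [i, j] r) (hsum [k, l] r) = fourth0 i j k l + fourth i j k l r"
    "ip (hdiff [i, j] r) (hdiff [k, l] r) = fourth0 i j k l - fourth i j k l r"
    "ip (hsum [i, j] r) (hdiff [k, l] r) = 0" "ip (hdiff [i, j] r) (hsum [k, l] r) = 0"
proof -
  have v: "R [i, j] [k, l] 0 0 = 2 * fourth0 i j k l" "R [i, j] [k, l] (pt r) (pt r) = 2 * fourth0 i j k l"
    "R [i, j] [k, l] 0 (pt r) = 2 * fourth i j k l r"
    "R [i, j] [k, l] (pt r) 0 = 2 * fourth i j k l r"
    using pt_nonzero[OF r] pt_nonzero[OF r, symmetric]
    by (simp_all add: R_2_2_at_0 R_2_2 norm_pt[OF r] pt_nth fourth_def fourth0_def eval_nat_numeral algebra_simps)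
  show "ip (hsum [i, j] r) (hsum [k, l] r) = fourth0 i j k l + fourth i j k l r"
    "ip (hdiff [i, j] r) (hdiff [k, l] r) = fourth0 i j k l - fourth i j k l r"
    "ip (hsum [i, j] r) (hdiff [k, l] r) = 0" "ip (hdiff [i, j] r) (hsum [k, l] r) = 0"
    unfolding hsum_def hdiff_def by (simp_all only: ip_two_points list.size v)
qed

definition resid :: "('a \<Rightarrow> real) \<Rightarrow> real \<Rightarrow> ('a \<Rightarrow> real) \<Rightarrow> 'a \<Rightarrow> real" where
  "resid X k Y = (\<lambda>\<omega>. 1 * X \<omega> + (- k) * Y \<omega>)"

lemma resid_H: "X \<in> closure_F 4 \<Longrightarrow> Y \<in> closure_F 4 \<Longrightarrow> resid X k Y \<in> closure_F 4"
  unfolding resid_def by (rule lincomb)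

lemma ip_resid:
  assumes "X \<in> closure_F 4" "Y \<in> closure_F 4" "X' \<in> closure_F 4" "Y' \<in> closure_F 4"
  shows "ip (resid X k Y) (resid X' k' Y') = ip X X' - k' * ip X Y' - k * ip Y X' + k * k' * ip Y Y'"
  unfolding resid_def
  by (simp only: ip_lincomb_left ip_lincomb_right lincomb assms) (simp add: algebra_simps)

text \<open>
  The residuals \<open>p, q, a, b, m, n\<close>. The coefficient is the covariance of the Hessian variable with
  the gradient variable of its family, divided by the variance of the latter.
\<close>

definition zp :: "real \<Rightarrow> 'a \<Rightarrow> real" where "zp r = resid (hsum [1, 1] r) (cl r / vd2 r) (hdiff [2] r)"
definition zq :: "real \<Rightarrow> 'a \<Rightarrow> real" where "zq r = resid (hsum [2, 2] r) (ct r / vd2 r) (hdiff [2] r)"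
definition za :: "real \<Rightarrow> 'a \<Rightarrow> real" where "za r = resid (hdiff [1, 1] r) (- cl r / vs2 r) (hsum [2] r)"
definition zb :: "real \<Rightarrow> 'a \<Rightarrow> real" where "zb r = resid (hdiff [2, 2] r) (- ct r / vs2 r) (hsum [2] r)"
definition zm :: "real \<Rightarrow> 'a \<Rightarrow> real" where "zm r = resid (hsum [1, 2] r) (cl r / vd1 r) (hdiff [1] r)"
definition zn :: "real \<Rightarrow> 'a \<Rightarrow> real" where "zn r = resid (hdiff [1, 2] r) (- cl r / vs1 r) (hsum [1] r)"

lemma z_H: "zp r \<in> closure_F 4" "zq r \<in> closure_F 4" "za r \<in> closure_F 4" "zb r \<in> closure_F 4"
  "zm r \<in> closure_F 4" "zn r \<in> closure_F 4"
  unfolding zp_def zq_def za_def zb_def zm_def zn_def by (intro resid_H half_H; simp)+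

text \<open>
  For such \<open>r\<close> the covariance matrix of the gradients is invertible; it holds for all small \<open>r > 0\<close>.
\<close>

definition nondegenerate :: "real \<Rightarrow> bool" where
  "nondegenerate r \<longleftrightarrow> r > 0 \<and> vs1 r > 0 \<and> vd1 r > 0 \<and> vs2 r > 0 \<and> vd2 r > 0"

lemma z_cov:
  assumes "nondegenerate r"
  shows "ip (zp r) (zp r) = Vp r" "ip (zp r) (zq r) = Cpq r" "ip (zq r) (zp r) = Cpq r" "ip (zq r) (zq r) = Vq r"
    "ip (za r) (za r) = Va r" "ip (za r) (zb r) = Cab r" "ip (zb r) (za r) = Cab r" "ip (zb r) (zb r) = Vb r"
    "ip (zm r) (zm r) = Vm r" "ip (zn r) (zn r) = Vn r"
    "ip (zp r) (za r) = 0" "ip (za r) (zp r) = 0" "ip (zp r) (zb r) = 0" "ip (zb r) (zp r) = 0"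
    "ip (zq r) (za r) = 0" "ip (za r) (zq r) = 0" "ip (zq r) (zb r) = 0" "ip (zb r) (zq r) = 0"
    "ip (zp r) (zm r) = 0" "ip (zm r) (zp r) = 0" "ip (zp r) (zn r) = 0" "ip (zn r) (zp r) = 0"
    "ip (zq r) (zm r) = 0" "ip (zm r) (zq r) = 0" "ip (zq r) (zn r) = 0" "ip (zn r) (zq r) = 0"
    "ip (za r) (zm r) = 0" "ip (zm r) (za r) = 0" "ip (za r) (zn r) = 0" "ip (zn r) (za r) = 0"
    "ip (zb r) (zm r) = 0" "ip (zm r) (zb r) = 0" "ip (zb r) (zn r) = 0" "ip (zn r) (zb r) = 0"
    "ip (zm r) (zn r) = 0" "ip (zn r) (zm r) = 0"
proof -
  have r: "r > 0" and ne: "vs1 r \<noteq> 0" "vd1 r \<noteq> 0" "vs2 r \<noteq> 0" "vd2 r \<noteq> 0"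
    using assms by (auto simp: nondegenerate_def)
  have H: "hsum [i] r \<in> closure_F 4" "hdiff [i] r \<in> closure_F 4" "hsum [i, j] r \<in> closure_F 4" "hdiff [i, j] r \<in> closure_F 4" for i j
    by (intro half_H; simp)+
  have g: "ip (hsum [1] r) (hsum [1] r) = vs1 r" "ip (hdiff [1] r) (hdiff [1] r) = vd1 r"
    "ip (hsum [2] r) (hsum [2] r) = vs2 r" "ip (hdiff [2] r) (hdiff [2] r) = vd2 r"
    "ip (hsum [1] r) (hsum [2] r) = 0" "ip (hsum [2] r) (hsum [1] r) = 0"
    "ip (hdiff [1] r) (hdiff [2] r) = 0" "ip (hdiff [2] r) (hdiff [1] r) = 0"
    by (simp_all add: half_1_1[OF r] kd_numeral vs1_def vd1_def vs2_def vd2_def)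
  have m: "mixed 1 1 2 r = cl r" "mixed 2 2 2 r = ct r" "mixed 1 2 1 r = cl r"
    "mixed 1 1 1 r = 0" "mixed 2 2 1 r = 0" "mixed 1 2 2 r = 0"
    by (simp_all add: mixed_def kd_numeral cl_def ct_def)
  have f: "fourth0 1 1 1 1 = 12 * g4" "fourth0 1 1 2 2 = 4 * g4" "fourth0 2 2 1 1 = 4 * g4" "fourth0 2 2 2 2 = 12 * g4" "fourth0 1 2 1 2 = 4 * g4"
    "fourth0 1 1 1 2 = 0" "fourth0 1 2 1 1 = 0" "fourth0 2 2 1 2 = 0" "fourth0 1 2 2 2 = 0"
    "fourth 1 1 1 1 r = 6 * h2 r" "fourth 1 1 2 2 r = 2 * h2 r + 4 * r\<^sup>2 * h3 r" "fourth 2 2 1 1 r = 2 * h2 r + 4 * r\<^sup>2 * h3 r"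
    "fourth 2 2 2 2 r = 6 * h2 r + 24 * r\<^sup>2 * h3 r + 8 * r ^ 4 * h4 r" "fourth 1 2 1 2 r = 2 * h2 r + 4 * r\<^sup>2 * h3 r"
    "fourth 1 1 1 2 r = 0" "fourth 1 2 1 1 r = 0" "fourth 2 2 1 2 r = 0" "fourth 1 2 2 2 r = 0"
    by (simp_all add: fourth0_def fourth_def kd_numeral)
  note all = zp_def zq_def za_def zb_def zm_def zn_def ip_resid[OF H(3) H(2) H(3) H(2)] ip_resid[OF H(4) H(1) H(4) H(1)]
    ip_resid[OF H(3) H(2) H(4) H(1)] ip_resid[OF H(4) H(1) H(3) H(2)] half_2_2[OF r] half_2_1[OF r] half_1_2[OF r] half_1_1(3,4)[OF r] g m f
  show "ip (zp r) (zp r) = Vp r" "ip (zp r) (zq r) = Cpq r" "ip (zq r) (zp r) = Cpq r" "ip (zq r) (zq r) = Vq r"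
    "ip (za r) (za r) = Va r" "ip (za r) (zb r) = Cab r" "ip (zb r) (za r) = Cab r" "ip (zb r) (zb r) = Vb r"
    "ip (zm r) (zm r) = Vm r" "ip (zn r) (zn r) = Vn r"
    unfolding all Vp_def Cpq_def Vq_def Va_def Cab_def Vb_def Vm_def Vn_def
    using ne by (simp_all add: power2_eq_square)
  show "ip (zp r) (za r) = 0" "ip (za r) (zp r) = 0" "ip (zp r) (zb r) = 0" "ip (zb r) (zp r) = 0"
    "ip (zq r) (za r) = 0" "ip (za r) (zq r) = 0" "ip (zq r) (zb r) = 0" "ip (zb r) (zq r) = 0"
    "ip (zp r) (zm r) = 0" "ip (zm r) (zp r) = 0" "ip (zp r) (zn r) = 0" "ip (zn r) (zp r) = 0"
    "ip (zq r) (zm r) = 0" "ip (zm r) (zq r) = 0" "ip (zq r) (zn r) = 0" "ip (zn r) (zq r) = 0"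
    "ip (za r) (zm r) = 0" "ip (zm r) (za r) = 0" "ip (za r) (zn r) = 0" "ip (zn r) (za r) = 0"
    "ip (zb r) (zm r) = 0" "ip (zm r) (zb r) = 0" "ip (zb r) (zn r) = 0" "ip (zn r) (zb r) = 0"
    "ip (zm r) (zn r) = 0" "ip (zn r) (zm r) = 0"
    unfolding all by simp_all
qed

text \<open>
  Half sum minus half difference is the value at \<open>0\<close>, half sum plus half difference the one at \<open>(0,r)\<close>.
\<close>

definition zeta :: "real \<Rightarrow> 'a \<Rightarrow> real ^ 6" where
  "zeta r \<omega> = vector [zp r \<omega> - za r \<omega>, zm r \<omega> - zn r \<omega>, zq r \<omega> - zb r \<omega>,
     zp r \<omega> + za r \<omega>, zm r \<omega> + zn r \<omega>, zq r \<omega> + zb r \<omega>]"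

lemma cov_matrix_nth: "cov_matrix M X Y $ i $ j = ip (\<lambda>\<omega>. X \<omega> $ i) (\<lambda>\<omega>. Y \<omega> $ j)"
  by (simp add: cov_matrix_def expect_def ip_def)

lemma gradient_cov:
  assumes r: "r > 0"
  shows "cov_matrix M (gradient_pair F 0 (pt r)) (gradient_pair F 0 (pt r)) =
    vector [vector [vs1 r + vd1 r, 0, vs1 r - vd1 r, 0], vector [0, vs2 r + vd2 r, 0, vs2 r - vd2 r],
      vector [vs1 r - vd1 r, 0, vs1 r + vd1 r, 0], vector [0, vs2 r - vd2 r, 0, vs2 r + vd2 r]]"
  using pt_nonzero[OF r] pt_nonzero[OF r, symmetric]
  by (simp add: vec_eq_iff forall_4 cov_matrix_nth gradient_pair_def vector_4 R_def[symmetric]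
      R_1_1 R_1_1_at_0 kd_numeral norm_pt[OF r] pt_nth vs1_def vd1_def vs2_def vd2_def power2_eq_square)

lemma hessian_gradient_cov:
  assumes r: "r > 0"
  shows "cov_matrix M (hessian_pair F 0 (pt r)) (gradient_pair F 0 (pt r)) =
    vector [vector [0, 0, 0, 2 * cl r], vector [0, 0, 2 * cl r, 0], vector [0, 0, 0, 2 * ct r],
      vector [0, - 2 * cl r, 0, 0], vector [- 2 * cl r, 0, 0, 0], vector [0, - 2 * ct r, 0, 0]]"
  using pt_nonzero[OF r] pt_nonzero[OF r, symmetric]
  by (simp add: vec_eq_iff forall_4 forall_6 cov_matrix_nth gradient_pair_def hessian_pair_def vector_4 vector_6 R_def[symmetric]
      R_2_1 R_2_1_at_0 kd_numeral norm_pt[OF r] pt_nth cl_def ct_def power3_eq_cube)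

text \<open>
  Passing to half sums and half differences diagonalises the covariance matrix of the gradients.
\<close>

lemma det_gradient_cov:
  assumes r: "r > 0"
  shows "det (cov_matrix M (gradient_pair F 0 (pt r)) (gradient_pair F 0 (pt r))) = 16 * (vs1 r * vd1 r * vs2 r * vd2 r)"
    (is "det ?S = _")
proof -
  define U :: "real ^ 4 ^ 4" where "U = vector [vector [1/2, 0, 1/2, 0], vector [-1/2, 0, 1/2, 0],
     vector [0, 1/2, 0, 1/2], vector [0, -1/2, 0, 1/2]]"
  have diag: "det (vector [vector [a, 0, 0, 0], vector [0, b, 0, 0], vector [0, 0, c, 0], vector [0, 0, 0, d]] :: real ^ 4 ^ 4) = a * b * c * d"
    (is "det ?D = _") for a b c d :: real
  proof -
    have "\<forall>i j. i \<noteq> j \<longrightarrow> ?D $ i $ j = 0" by (simp add: forall_4 vector_4)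
    then have "det ?D = (\<Prod>i\<in>UNIV. ?D $ i $ i)" by (intro det_diagonal) blast
    then show ?thesis by (simp only: prod_4 vector_4)
  qed
  have "U ** transpose U = vector [vector [1/2, 0, 0, 0], vector [0, 1/2, 0, 0], vector [0, 0, 1/2, 0], vector [0, 0, 0, 1/2]]"
    by (simp add: vec_eq_iff forall_4 U_def matrix_matrix_mult_def transpose_def sum_4 vector_4)
  then have UU: "det (U ** transpose U) = 1 / 16"
    by (simp only: diag)
  have "U ** ?S ** transpose U = vector [vector [vs1 r, 0, 0, 0], vector [0, vd1 r, 0, 0], vector [0, 0, vs2 r, 0], vector [0, 0, 0, vd2 r]]"
    unfolding gradient_cov[OF r]
    by (simp add: vec_eq_iff forall_4 U_def matrix_matrix_mult_def transpose_def sum_4 vector_4 field_simps)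
  then have USU: "det (U ** ?S ** transpose U) = vs1 r * vd1 r * vs2 r * vd2 r"
    by (simp only: diag)
  have "det (U ** ?S ** transpose U) = det (U ** transpose U) * det ?S"
    by (simp only: det_mul mult_ac)
  then show ?thesis using UU USU by simp
qed

text \<open>
  The regression matrix is characterised by \<open>A Cov(Y) = Cov(X,Y)\<close>, so that a candidate can be
  verified without inverting \<open>Cov(Y)\<close>.
\<close>

lemma gaussian_cond_eq:
  fixes A :: "real ^ 'm ^ 'n"
  assumes inv: "invertible (cov_matrix M Y Y)" and A: "A ** cov_matrix M Y Y = cov_matrix M X Y"
  shows "gaussian_cond M X Y 0 \<omega> = X \<omega> - A *v Y \<omega>"
proof -
  have "cov_matrix M X Y ** matrix_inv (cov_matrix M Y Y) = A ** (cov_matrix M Y Y ** matrix_inv (cov_matrix M Y Y))"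
    by (simp add: A[symmetric] matrix_mul_assoc)
  also have "\<dots> = A" using matrix_inv_right_inverse[OF inv] by simp
  finally have *: "cov_matrix M X Y ** matrix_inv (cov_matrix M Y Y) = A" .
  show ?thesis unfolding gaussian_cond_def *
    by (simp only: matrix_vector_mult_diff_distrib matrix_vector_mult_0_right) simp
qed

lemma cond_hessian_pair_eq:
  assumes nd: "nondegenerate r"
  shows "cond_hessian_pair M F 0 (pt r) \<omega> = zeta r \<omega>"
proof -
  have r: "r > 0" and p: "vs1 r > 0" "vd1 r > 0" "vs2 r > 0" "vd2 r > 0"
    using nd by (auto simp: nondegenerate_def)
  define kp kq ka kb km kn where "kp = cl r / vd2 r" and "kq = ct r / vd2 r" and "ka = - cl r / vs2 r"
    and "kb = - ct r / vs2 r" and "km = cl r / vd1 r" and "kn = - cl r / vs1 r"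
  have k: "kp * vd2 r = cl r" "kq * vd2 r = ct r" "ka * vs2 r = - cl r" "kb * vs2 r = - ct r" "km * vd1 r = cl r" "kn * vs1 r = - cl r"
    using p by (auto simp: kp_def kq_def ka_def kb_def km_def kn_def)
  \<comment> \<open>The regression on the half sums and half differences, rewritten in terms of the gradients at
      the two points.\<close>
  define A :: "real ^ 4 ^ 6" where "A = vector [
     vector [0, - kp / 2 - ka / 2, 0, kp / 2 - ka / 2],
     vector [- km / 2 - kn / 2, 0, km / 2 - kn / 2, 0],
     vector [0, - kq / 2 - kb / 2, 0, kq / 2 - kb / 2],
     vector [0, - kp / 2 + ka / 2, 0, kp / 2 + ka / 2],
     vector [- km / 2 + kn / 2, 0, km / 2 + kn / 2, 0],
     vector [0, - kq / 2 + kb / 2, 0, kq / 2 + kb / 2]]"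
  have inv: "invertible (cov_matrix M (gradient_pair F 0 (pt r)) (gradient_pair F 0 (pt r)))"
    using det_gradient_cov[OF r] p by (simp add: invertible_det_nz)
  have AS: "A ** cov_matrix M (gradient_pair F 0 (pt r)) (gradient_pair F 0 (pt r)) = cov_matrix M (hessian_pair F 0 (pt r)) (gradient_pair F 0 (pt r))"
    unfolding gradient_cov[OF r] hessian_gradient_cov[OF r]
    using k by (simp add: vec_eq_iff forall_4 forall_6 A_def matrix_matrix_mult_def sum_4 vector_4 vector_6 algebra_simps)
  have "cond_hessian_pair M F 0 (pt r) \<omega> = hessian_pair F 0 (pt r) \<omega> - A *v gradient_pair F 0 (pt r) \<omega>"
    unfolding cond_hessian_pair_def by (rule gaussian_cond_eq[OF inv AS])
  also have "\<dots> = zeta r \<omega>"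
    unfolding zeta_def zp_def zq_def za_def zb_def zm_def zn_def resid_def hsum_def hdiff_def
        kp_def[symmetric] kq_def[symmetric] ka_def[symmetric] kb_def[symmetric] km_def[symmetric] kn_def[symmetric]
    by (simp add: vec_eq_iff forall_6 A_def matrix_vector_mult_def sum_4 vector_4 vector_6 hessian_pair_def gradient_pair_def)
       (simp add: algebra_simps)
  finally show ?thesis .
qed

lemma gaussian_density_gradient:
  assumes r: "r > 0"
  shows "gaussian_density (cov_matrix M (gradient_pair F 0 (pt r)) (gradient_pair F 0 (pt r))) 0
    = 1 / sqrt ((2 * pi) ^ 4 * (16 * (vs1 r * vd1 r * vs2 r * vd2 r)))"
  by (simp add: gaussian_density_def det_gradient_cov[OF r])

end

section \<open>Uncorrelated elements of a Gaussian space\<close>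

lemma prod_mono_ennreal:
  fixes f g :: "'i \<Rightarrow> ennreal"
  assumes "finite I" "\<And>i. i \<in> I \<Longrightarrow> f i \<le> g i"
  shows "prod f I \<le> prod g I"
  using assms by (induction I rule: finite_induct) (auto intro!: mult_mono)

context gaussian_space
begin

lemma uncorrelated_indep_pair:
  assumes "X \<in> H" "Y \<in> H" "ip X Y = 0"
  shows "indep_pair borel X borel Y"
proof -
  define Z where "Z i = (if i = (0::nat) then X else Y)" for i
  have ind: "indep_vars (\<lambda>_. borel) Z {0, 1}"
  proof (rule uncorrelated_indep_vars)
    show "Z i \<in> H" for i using assms(1,2) by (simp add: Z_def)
    show "ip (Z i) (Z j) = 0" if "i \<in> {0, 1}" "j \<in> {0, 1}" "i \<noteq> j" for i j
      using that assms(3) ip_commute[of X Y] by (auto simp: Z_def)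
  qed auto
  have "indep_pair borel (\<lambda>\<omega>. (\<lambda>f. f 0) (\<lambda>i\<in>{0}. Z i \<omega>)) borel (\<lambda>\<omega>. (\<lambda>f. f 1) (\<lambda>i\<in>{1}. Z i \<omega>))"
    by (rule indep_pair_of_indep_var[OF indep_var_restrict[OF ind]])
       (auto intro!: measurable_component_singleton)
  then show ?thesis by (simp add: Z_def)
qed

text \<open>
  The small product estimate with \<open>X 0\<close> and \<open>X 1\<close> as its two factors; the other variables enter
  through the weight.
\<close>

lemma uncorrelated_small_product:
  fixes X :: "nat \<Rightarrow> 'w \<Rightarrow> real"
  assumes H: "\<And>i. i < 6 \<Longrightarrow> X i \<in> H" and unc: "\<And>i j. i < 6 \<Longrightarrow> j < 6 \<Longrightarrow> i \<noteq> j \<Longrightarrow> ip (X i) (X j) = 0"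
    and V: "\<And>i. i < 6 \<Longrightarrow> ip (X i) (X i) \<le> V" and \<sigma>: "\<sigma> > 0" "\<sigma>\<^sup>2 \<le> ip (X 0) (X 0)" "\<sigma>\<^sup>2 \<le> ip (X 1) (X 1)"
    and \<epsilon>: "0 < \<epsilon>" "\<epsilon> \<le> 1 / 2"
  defines "W \<equiv> \<lambda>\<omega>. (1 + (X 1 \<omega>)\<^sup>2) * (1 + (X 0 \<omega>)\<^sup>2) * (\<Prod>i\<in>{2..5}. 1 + (X i \<omega>)\<^sup>2)"
  shows "(\<integral>\<^sup>+\<omega>. ennreal ((W \<omega>)\<^sup>2 * of_bool (\<bar>X 1 \<omega> * X 0 \<omega>\<bar> \<le> \<epsilon> * W \<omega>)) \<partial>M)
    \<le> ennreal (small_product_const \<sigma> V (normal_weight_moment 3 V ^ 4) * (\<epsilon> * ln (1 / \<epsilon>)))"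
proof -
  have V0: "0 \<le> V" using V[of 0] ip_nonneg[of "X 0"] by simp
  have ind: "indep_vars (\<lambda>_. borel) X {0..5}"
    by (rule uncorrelated_indep_vars) (use H unc in auto)
  define T where "T \<omega> = (\<Prod>i\<in>{2..5}. 1 + (X i \<omega>)\<^sup>2)" for \<omega>
  have T1: "1 \<le> T \<omega>" for \<omega> unfolding T_def by (intro prod_ge_1) auto
  have "indep_pair borel (\<lambda>\<omega>. (\<lambda>f. f 0) (\<lambda>i\<in>{0}. X i \<omega>)) (borel \<Otimes>\<^sub>M borel)
     (\<lambda>\<omega>. (\<lambda>f. (f 1, \<Prod>i\<in>{2..5}. 1 + (f i)\<^sup>2)) (\<lambda>i\<in>{1..5}. X i \<omega>))"
  proof (rule indep_pair_of_indep_var[OF indep_var_restrict[OF ind]])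
    have "(\<lambda>f. f i) \<in> borel_measurable (PiM {1..5} (\<lambda>_. borel))" if "i \<in> {2..5}" for i :: nat
      using that by (intro measurable_component_singleton) auto
    then show "(\<lambda>f. (f 1, \<Prod>i\<in>{2..5}. 1 + (f i)\<^sup>2)) \<in> measurable (PiM {1..5::nat} (\<lambda>_. borel)) (borel \<Otimes>\<^sub>M (borel :: real measure))"
      by (intro measurable_Pair borel_measurable_prod borel_measurable_add borel_measurable_power) auto
  qed auto
  then have iB: "indep_pair borel (X 0) (borel \<Otimes>\<^sub>M borel) (\<lambda>\<omega>. (X 1 \<omega>, T \<omega>))"
    by (simp add: T_def[abs_def])
  have "indep_pair borel (\<lambda>\<omega>. (\<lambda>f. f 1) (\<lambda>i\<in>{1}. X i \<omega>)) borel
     (\<lambda>\<omega>. (\<lambda>f. \<Prod>i\<in>{2..5}. 1 + (f i)\<^sup>2) (\<lambda>i\<in>{2..5}. X i \<omega>))"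
  proof (rule indep_pair_of_indep_var[OF indep_var_restrict[OF ind]])
    have "(\<lambda>f. f i) \<in> borel_measurable (PiM {2..5} (\<lambda>_. borel))" if "i \<in> {2..5}" for i :: nat
      using that by (intro measurable_component_singleton) auto
    then show "(\<lambda>f. \<Prod>i\<in>{2..5}. 1 + (f i)\<^sup>2) \<in> measurable (PiM {2..5::nat} (\<lambda>_. borel)) (borel :: real measure)"
      by (intro borel_measurable_prod borel_measurable_add borel_measurable_power) auto
  qed auto
  then have iP: "indep_pair borel (X 1) borel T"
    by (simp add: T_def[abs_def])
  have g: "centred_gaussian M (X i)" "expectation (\<lambda>\<omega>. (X i \<omega>)\<^sup>2) = ip (X i) (X i)" if "i < 6" for i
    using gaussian[OF H[OF that]] by (auto simp: ip_def power2_eq_square)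
  have "(\<integral>\<^sup>+\<omega>. ennreal (T \<omega> ^ 3) \<partial>M) = (\<integral>\<^sup>+\<omega>. (\<Prod>i\<in>{2..5}. ennreal ((1 + (X i \<omega>)\<^sup>2) ^ 3)) \<partial>M)"
  proof (intro nn_integral_cong)
    fix \<omega>
    have "T \<omega> ^ 3 = (\<Prod>i\<in>{2..5}. (1 + (X i \<omega>)\<^sup>2) ^ 3)" unfolding T_def by (rule prod_power_distrib)
    then show "ennreal (T \<omega> ^ 3) = (\<Prod>i\<in>{2..5}. ennreal ((1 + (X i \<omega>)\<^sup>2) ^ 3))"
      by (simp only:) (rule prod_ennreal[symmetric], simp)
  qed
  also have "\<dots> = (\<Prod>i\<in>{2..5}. \<integral>\<^sup>+\<omega>. ennreal ((1 + (X i \<omega>)\<^sup>2) ^ 3) \<partial>M)"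
  proof (rule indep_vars_nn_integral)
    have "indep_vars (\<lambda>_. borel) X {2..5}" by (rule indep_vars_subset[OF ind]) auto
    then show "indep_vars (\<lambda>_. borel) (\<lambda>i \<omega>. ennreal ((1 + (X i \<omega>)\<^sup>2) ^ 3)) {2..5}"
      by (rule indep_vars_compose2[where Y="\<lambda>i x. ennreal ((1 + x\<^sup>2) ^ 3)"]) measurable
  qed auto
  also have "\<dots> \<le> (\<Prod>i\<in>{2..5::nat}. ennreal (normal_weight_moment 3 V))"
  proof (rule prod_mono_ennreal[OF _ gaussian_weight_moment])
    fix i :: nat assume "i \<in> {2..5}"
    then have "i < 6" by simp
    from g[OF this] V[OF this] show "centred_gaussian M (X i)" "expectation (\<lambda>\<omega>. (X i \<omega>)\<^sup>2) \<le> V" by simp_all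
  qed simp
  also have "\<dots> = ennreal (normal_weight_moment 3 V ^ 4)"
    using normal_weight_moment_nonneg[OF V0] by (simp add: ennreal_power)
  finally have T3: "(\<integral>\<^sup>+\<omega>. ennreal (T \<omega> ^ 3) \<partial>M) \<le> ennreal (normal_weight_moment 3 V ^ 4)" .
  show ?thesis
    unfolding W_def T_def[symmetric]
  proof (rule gaussian_small_product[OF _ _ _ _ _ _ \<sigma>(1) _ iB iP T1 T3 \<epsilon>])
    show "centred_gaussian M (X 0)" "centred_gaussian M (X 1)" by (rule g(1), simp)+
    show "\<sigma>\<^sup>2 \<le> expectation (\<lambda>\<omega>. (X 0 \<omega>)\<^sup>2)" "expectation (\<lambda>\<omega>. (X 0 \<omega>)\<^sup>2) \<le> V"
      "\<sigma>\<^sup>2 \<le> expectation (\<lambda>\<omega>. (X 1 \<omega>)\<^sup>2)" "expectation (\<lambda>\<omega>. (X 1 \<omega>)\<^sup>2) \<le> V"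
      using g(2)[of 0] g(2)[of 1] V[of 0] V[of 1] \<sigma> by simp_all
    show "0 \<le> normal_weight_moment 3 V ^ 4" by simp
  qed
qed

end

text \<open>
  For a nonintegrable \<open>f\<close> the expectation is \<open>0\<close> by convention, and the bound is trivial.
\<close>

lemma (in prob_space) expectation_le_nn_integral:
  fixes f g :: "'a \<Rightarrow> real"
  assumes fg: "\<And>\<omega>. 0 \<le> f \<omega>" "\<And>\<omega>. f \<omega> \<le> g \<omega>" and B: "(\<integral>\<^sup>+\<omega>. ennreal (g \<omega>) \<partial>M) \<le> ennreal B" "0 \<le> B"
  shows "expectation f \<le> B"
proof (cases "integrable M f")
  case True
  have "ennreal (expectation f) = (\<integral>\<^sup>+\<omega>. ennreal (f \<omega>) \<partial>M)"
    by (rule nn_integral_eq_integral[symmetric, OF True]) (simp add: fg(1))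
  also have "\<dots> \<le> ennreal B"
    by (rule order_trans[OF nn_integral_mono B(1)]) (rule ennreal_leI[OF fg(2)])
  finally show ?thesis using B(2) by (simp add: ennreal_le_iff)
next
  case False
  then show ?thesis using B(2) by (simp add: not_integrable_integral_eq)
qed

section \<open>Deterministic bounds for pairs of symmetric matrices\<close>

lemma det_sym_matrix2: "det (sym_matrix2 a b c) = a * c - b\<^sup>2"
  by (simp add: sym_matrix2_def det_2 power2_eq_square)

lemma quadratic_form_sym_matrix2:
  "(vector [x, y] :: real ^ 2) \<bullet> (sym_matrix2 a b c *v vector [x, y]) = a * x\<^sup>2 + 2 * b * x * y + c * y\<^sup>2"
  by (simp add: sym_matrix2_def inner_vec_def matrix_vector_mult_def sum_2 power2_eq_square algebra_simps)

lemma vector_2_eq_0: "(vector [x, y] :: real ^ 2) = 0 \<longleftrightarrow> x = 0 \<and> y = 0"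
  by (simp add: vec_eq_iff forall_2)

lemma of_type_Minimum:
  assumes "of_type (sym_matrix2 a b c) Minimum"
  shows "a > 0" "c > 0" "a * c - b\<^sup>2 > 0"
proof -
  have q: "a * x\<^sup>2 + 2 * b * x * y + c * y\<^sup>2 > 0" if "x \<noteq> 0 \<or> y \<noteq> 0" for x y
    using assms[simplified, rule_format, of "vector [x, y]"] that
    by (auto simp: vector_2_eq_0 quadratic_form_sym_matrix2)
  show a: "a > 0" "c > 0" using q[of 1 0] q[of 0 1] by auto
  have "0 < a * (- b)\<^sup>2 + 2 * b * (- b) * a + c * a\<^sup>2" using q[of "- b" a] a by simp
  also have "\<dots> = a * (a * c - b\<^sup>2)" by (simp add: power2_eq_square algebra_simps)
  finally show "a * c - b\<^sup>2 > 0" using a by (simp add: zero_less_mult_iff)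
qed

lemma of_type_Maximum:
  assumes "of_type (sym_matrix2 a b c) Maximum"
  shows "a < 0" "c < 0" "a * c - b\<^sup>2 > 0"
proof -
  have q: "a * x\<^sup>2 + 2 * b * x * y + c * y\<^sup>2 < 0" if "x \<noteq> 0 \<or> y \<noteq> 0" for x y
    using assms[simplified, rule_format, of "vector [x, y]"] that
    by (auto simp: vector_2_eq_0 quadratic_form_sym_matrix2)
  show a: "a < 0" "c < 0" using q[of 1 0] q[of 0 1] by auto
  have "0 > a * (- b)\<^sup>2 + 2 * b * (- b) * a + c * a\<^sup>2" using q[of "- b" a] a by simp
  moreover have "a * (- b)\<^sup>2 + 2 * b * (- b) * a + c * a\<^sup>2 = a * (a * c - b\<^sup>2)" by (simp add: power2_eq_square algebra_simps)
  ultimately show "a * c - b\<^sup>2 > 0" using a by (simp add: mult_less_0_iff)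
qed

lemma kac_rice_weight_nonneg: "0 \<le> kac_rice_weight \<alpha> \<beta> z"
  by (simp add: kac_rice_weight_def)

lemma same_sign_weight:
  fixes u v :: real
  assumes "u * v > 0"
  shows "\<bar>v - u\<bar> \<le> \<bar>u + v\<bar>" "\<bar>u\<bar> * \<bar>v\<bar> \<le> ((u + v) / 2)\<^sup>2"
proof -
  show "\<bar>v - u\<bar> \<le> \<bar>u + v\<bar>" using assms by (auto simp: zero_less_mult_iff)
  have "\<bar>u\<bar> * \<bar>v\<bar> = u * v" using assms by (simp add: abs_mult[symmetric])
  also have "\<dots> = ((u + v) / 2)\<^sup>2 - ((u - v) / 2)\<^sup>2" by (simp add: power2_eq_square field_simps)
  finally show "\<bar>u\<bar> * \<bar>v\<bar> \<le> ((u + v) / 2)\<^sup>2" by simp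
qed

lemma kac_rice_weight_same_type:
  assumes "\<alpha> = \<beta>" "\<alpha> \<in> {Minimum, Maximum, Saddle, Extremum}"
  shows "kac_rice_weight \<alpha> \<beta> z \<le> \<bar>det (first_hessian z)\<bar> * \<bar>det (second_hessian z)\<bar>
     * of_bool (det (first_hessian z) * det (second_hessian z) > 0)"
proof -
  have "det (first_hessian z) * det (second_hessian z) > 0"
    if "of_type (first_hessian z) \<alpha>" "of_type (second_hessian z) \<beta>"
  proof (cases \<alpha>)
    case Minimum
    then show ?thesis using that assms(1) of_type_Minimum(3)
      unfolding first_hessian_def second_hessian_def det_sym_matrix2 by (metis mult_pos_pos)
  next
    case Maximum
    then show ?thesis using that assms(1) of_type_Maximum(3)
      unfolding first_hessian_def second_hessian_def det_sym_matrix2 by (metis mult_pos_pos)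
  qed (use that assms(1) in \<open>auto intro: mult_pos_pos mult_neg_neg\<close>)
  then show ?thesis by (auto simp: kac_rice_weight_def)
qed

text \<open>
  The diagonal entries of the first matrix are negative and those of the second positive. Hence the
  four diagonal entries, in absolute value, have sum \<open>2 (a + b)\<close>, and by the inequality of the
  arithmetic and geometric mean each determinant is at most \<open>(a + b)\<^sup>2\<close>. Comparison of the traces
  gives \<open>|p + q| \<le> a + b\<close>.
\<close>

lemma kac_rice_weight_max_min:
  fixes p q a b m n :: real
  assumes z: "z = vector [p - a, m - n, q - b, p + a, m + n, q + b]"
  shows "kac_rice_weight Maximum Minimum z \<le> (a + b) ^ 4 * of_bool (\<bar>p + q\<bar> \<le> \<bar>a + b\<bar>)"
proof (cases "of_type (first_hessian z) Maximum \<and> of_type (second_hessian z) Minimum")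
  case True
  have z1: "first_hessian z = sym_matrix2 (p - a) (m - n) (q - b)" "second_hessian z = sym_matrix2 (p + a) (m + n) (q + b)"
    by (simp_all add: first_hessian_def second_hessian_def z vector_6)
  note mx = of_type_Maximum[OF True[THEN conjunct1, unfolded z1]] and mn = of_type_Minimum[OF True[THEN conjunct2, unfolded z1]]
  have D: "0 < a + b" "\<bar>p + q\<bar> \<le> \<bar>a + b\<bar>" using mx mn by auto
  have am: "x * y \<le> ((x + y) / 2)\<^sup>2" for x y :: real
  proof -
    have "((x + y) / 2)\<^sup>2 - x * y = ((x - y) / 2)\<^sup>2" by (simp add: power2_eq_square field_simps)
    then show ?thesis using zero_le_power2[of "(x - y) / 2"] by linarith
  qed
  have half: "((x + y) / 2)\<^sup>2 \<le> (a + b)\<^sup>2" if "\<bar>x + y\<bar> \<le> 2 * (a + b)" for x y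
    using that D by (subst abs_le_square_iff[symmetric]) auto
  have 1: "\<bar>(p - a) * (q - b) - (m - n)\<^sup>2\<bar> \<le> (a + b)\<^sup>2"
  proof -
    have "(p - a) * (q - b) \<le> (a + b)\<^sup>2"
      by (rule order_trans[OF am half]) (use mx mn in auto)
    then show ?thesis using mx(3) zero_le_power2[of "m - n"] by linarith
  qed
  have 2: "\<bar>(p + a) * (q + b) - (m + n)\<^sup>2\<bar> \<le> (a + b)\<^sup>2"
  proof -
    have "(p + a) * (q + b) \<le> (a + b)\<^sup>2"
      by (rule order_trans[OF am half]) (use mx mn in auto)
    then show ?thesis using mn(3) zero_le_power2[of "m + n"] by linarith
  qed
  have "kac_rice_weight Maximum Minimum z \<le> (a + b)\<^sup>2 * (a + b)\<^sup>2"
    using mult_mono[OF 1 2] True by (simp add: kac_rice_weight_def z1 det_sym_matrix2)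
  then show ?thesis using D by (simp add: power2_eq_square eval_nat_numeral mult.assoc)
next
  case False
  then show ?thesis by (auto simp: kac_rice_weight_def)
qed

text \<open>
  The variables \<open>x 0, \<dots>, x 5\<close> stand for the rescaled residuals, which are of order one, and \<open>W\<close> is a
  weight that bounds all the quadratic expressions in them. With \<open>E1\<close> and \<open>E2\<close> bounded by
  multiples of \<open>W\<close>, one has \<open>(u + v) / 2 = r\<^sup>2 E1\<close> and \<open>(v - u) / 2 = r x\<^sub>1 x\<^sub>0 + r\<^sup>3 E2\<close>. For
  determinants of the same sign the second is at most the first in absolute value.
\<close>

lemma det_pair_bounds:
  fixes x :: "nat \<Rightarrow> real" and k l r L :: real
  assumes kl: "\<bar>k\<bar> \<le> L" "\<bar>l\<bar> \<le> L" and r: "0 < r" "r \<le> 1"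
  defines "W \<equiv> \<Prod>i<6. 1 + (x i)\<^sup>2"
    and "p \<equiv> x 1" and "b \<equiv> r * x 0" and "q \<equiv> r\<^sup>2 * (k * x 1 + x 2)" and "a \<equiv> r * (l * x 0 + x 3)"
    and "m \<equiv> r\<^sup>2 * x 4" and "n \<equiv> r * x 5" and "c \<equiv> L\<^sup>2 + 4 * L + 7"
  defines "u \<equiv> (p - a) * (q - b) - (m - n)\<^sup>2" and "v \<equiv> (p + a) * (q + b) - (m + n)\<^sup>2"
  shows "\<bar>u\<bar> * \<bar>v\<bar> * of_bool (u * v > 0) \<le> c\<^sup>2 * r ^ 4 * (W\<^sup>2 * of_bool (\<bar>x 1 * x 0\<bar> \<le> c * r * W))"
proof (cases "u * v > 0")
  case True
  have L: "0 \<le> L" using kl by linarith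
  have W1: "1 \<le> W" unfolding W_def by (intro prod_ge_1) auto
  have sq: "(x i)\<^sup>2 \<le> W" if "i < 6" for i
  proof -
    have "(\<Prod>i\<in>{i}. 1 + (x i)\<^sup>2) \<le> W"
      unfolding W_def using that by (intro prod_mono2) auto
    then show ?thesis by simp
  qed
  have xy: "\<bar>x i * x j\<bar> \<le> W" if "i < 6" "j < 6" "i \<noteq> j" for i j
  proof -
    have one: "\<bar>y\<bar> \<le> 1 + y\<^sup>2" for y :: real
      using sum_squares_bound[of 1 "\<bar>y\<bar>"] by simp
    have "\<bar>x i * x j\<bar> \<le> (1 + (x i)\<^sup>2) * (1 + (x j)\<^sup>2)"
      unfolding abs_mult by (intro mult_mono one) auto
    also have "\<dots> = (\<Prod>i\<in>{i, j}. 1 + (x i)\<^sup>2)" using that by simp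
    also have "\<dots> \<le> W" unfolding W_def using that by (intro prod_mono2) auto
    finally show ?thesis .
  qed
  have kx: "\<bar>k * y\<bar> \<le> L * W" "\<bar>l * y\<bar> \<le> L * W" if "\<bar>y\<bar> \<le> W" for y
    unfolding abs_mult using kl that L by (auto intro!: mult_mono)
  have lk: "\<bar>l * (k * y)\<bar> \<le> L * (L * W)" if "\<bar>y\<bar> \<le> W" for y
    unfolding abs_mult using kl that L W1 by (intro mult_mono) auto
  define E1 where "E1 = k * (x 1)\<^sup>2 + x 1 * x 2 + l * (x 0)\<^sup>2 + x 0 * x 3 - r\<^sup>2 * (x 4)\<^sup>2 - (x 5)\<^sup>2"
  define E2 where "E2 = l * (k * (x 0 * x 1)) + l * (x 0 * x 2) + k * (x 3 * x 1) + x 3 * x 2 - 2 * (x 4 * x 5)"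
  have r2: "r\<^sup>2 \<le> 1" using r by (simp add: power_le_one)
  have "\<bar>r\<^sup>2 * (x 4)\<^sup>2\<bar> \<le> 1 * W" unfolding abs_mult using r2 sq[of 4] by (intro mult_mono) auto
  then have w4: "\<bar>r\<^sup>2 * (x 4)\<^sup>2\<bar> \<le> W" by simp
  have tri: "\<bar>t1 + t2 + t3 + t4 - t5 - t6\<bar> \<le> \<bar>t1\<bar> + \<bar>t2\<bar> + \<bar>t3\<bar> + \<bar>t4\<bar> + \<bar>t5\<bar> + \<bar>t6\<bar>" for t1 t2 t3 t4 t5 t6 :: real
    by linarith
  have sqa: "\<bar>(x i)\<^sup>2\<bar> \<le> W" if "i < 6" for i using sq[OF that] by simp
  have "\<bar>E1\<bar> \<le> L * W + W + L * W + W + W + W"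
    unfolding E1_def
    by (rule order_trans[OF tri]) (intro add_mono kx xy sqa w4; simp)
  also have "\<dots> = (2 * L + 4) * W" by (simp add: algebra_simps)
  finally have E1: "\<bar>E1\<bar> \<le> (2 * L + 4) * W" .
  have w45: "\<bar>x 4 * x 5\<bar> \<le> W" by (rule xy) auto
  have "\<bar>E2\<bar> = \<bar>l * (k * (x 0 * x 1)) + l * (x 0 * x 2) + k * (x 3 * x 1) + x 3 * x 2 - x 4 * x 5 - x 4 * x 5\<bar>"
    unfolding E2_def by (rule arg_cong[where f=abs]) linarith
  also have "\<dots> \<le> L * (L * W) + L * W + L * W + W + W + W"
    by (rule order_trans[OF tri]) (intro add_mono lk kx xy w45; simp)
  also have "\<dots> = (L\<^sup>2 + 2 * L + 3) * W" by (simp add: algebra_simps power2_eq_square)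
  finally have E2: "\<bar>E2\<bar> \<le> (L\<^sup>2 + 2 * L + 3) * W" .
  have "u + v = 2 * (r\<^sup>2 * E1)"
    by (simp add: u_def v_def p_def q_def a_def b_def m_def n_def E1_def power2_eq_square algebra_simps)
  then have s: "(u + v) / 2 = r\<^sup>2 * E1" by simp
  have "v - u = 2 * (r * (x 1 * x 0) + r ^ 3 * E2)"
    by (simp add: u_def v_def p_def q_def a_def b_def m_def n_def E2_def power2_eq_square power3_eq_cube algebra_simps)
  then have d: "(v - u) / 2 = r * (x 1 * x 0) + r ^ 3 * E2" by simp
  have "\<bar>(v - u) / 2\<bar> \<le> \<bar>(u + v) / 2\<bar>" using same_sign_weight(1)[OF True] by simp
  then have "r * \<bar>x 1 * x 0\<bar> \<le> r\<^sup>2 * \<bar>E1\<bar> + r ^ 3 * \<bar>E2\<bar>"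
    using abs_triangle_ineq2[of "r * (x 1 * x 0)" "- (r ^ 3 * E2)"] r unfolding s d
    by (simp add: abs_mult)
  also have "\<dots> \<le> r\<^sup>2 * ((2 * L + 4) * W) + r\<^sup>2 * ((L\<^sup>2 + 2 * L + 3) * W)"
  proof (intro add_mono mult_left_mono E1)
    have "r ^ 3 \<le> r\<^sup>2" using r by (intro power_decreasing) auto
    then show "r ^ 3 * \<bar>E2\<bar> \<le> r\<^sup>2 * ((L\<^sup>2 + 2 * L + 3) * W)" using E2 by (intro mult_mono) auto
  qed auto
  also have "\<dots> = r * (c * r * W)" by (simp add: c_def algebra_simps power2_eq_square)
  finally have ev: "\<bar>x 1 * x 0\<bar> \<le> c * r * W" using r by simp
  have "\<bar>u\<bar> * \<bar>v\<bar> \<le> (r\<^sup>2 * E1)\<^sup>2" using same_sign_weight(2)[OF True] by (simp only: s)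
  also have "\<dots> \<le> (r\<^sup>2 * (c * W))\<^sup>2"
  proof (subst abs_le_square_iff[symmetric])
    have "(2 * L + 4) * W \<le> c * W" using L W1 by (intro mult_right_mono) (auto simp: c_def)
    then have "\<bar>E1\<bar> \<le> c * W" using E1 by simp
    also have "\<dots> \<le> \<bar>c * W\<bar>" by simp
    finally show "\<bar>r\<^sup>2 * E1\<bar> \<le> \<bar>r\<^sup>2 * (c * W)\<bar>" unfolding abs_mult[of "r\<^sup>2"] by (intro mult_left_mono) auto
  qed
  also have "\<dots> = c\<^sup>2 * r ^ 4 * W\<^sup>2" by (simp add: power_mult_distrib eval_nat_numeral mult_ac)
  finally show ?thesis using ev True by simp
next
  case False
  then show ?thesis by (simp add: zero_le_mult_iff)
qed

section \<open>Bounds for the two-point correlation functions\<close>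

lemma tendsto_ev_le: "(f \<longlongrightarrow> c) F \<Longrightarrow> c < d \<Longrightarrow> \<forall>\<^sub>F x in F. f x \<le> (d::real)"
  by (drule (1) order_tendstoD(2)) (auto elim: eventually_mono)

lemma tendsto_ev_ge: "(f \<longlongrightarrow> c) F \<Longrightarrow> d < c \<Longrightarrow> \<forall>\<^sub>F x in F. (d::real) \<le> f x"
  by (drule (1) order_tendstoD(1)) (auto elim: eventually_mono)

context isotropic_gaussian_field
begin

text \<open>
  The Cauchy-Schwarz inequality for \<open>F\<close> and \<open>F\<^sub>2\<^sub>2\<close> at one point, with variances \<open>1\<close> and \<open>24 g\<^sub>4\<close> and
  covariance \<open>-2\<close>.
\<close>

lemma g4_pos: "g4 > 0"
proof -
  have "R [2, 2] [] 0 0 = - 2" using G_at_0(2) by (simp add: G_def numeral_2_eq_2)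
  moreover have "R [] [] 0 0 = 1" using G_at_0(1) by (simp add: G_def)
  moreover have "R [2, 2] [2, 2] 0 0 = 24 * g4" by (simp add: R_2_2_at_0 kd_numeral)
  ultimately have "4 \<le> 24 * g4"
    using ip_Cauchy_Schwarz[OF fd_H[of "[2, 2]" 0] fd_H[of "[]" 0]] by (simp add: R_def)
  then show ?thesis by simp
qed

lemma gradient_limits:
  "(vs1 \<longlongrightarrow> 2) (at_right 0)" "(vs2 \<longlongrightarrow> 2) (at_right 0)"
  "((\<lambda>r. vd1 r / r\<^sup>2) \<longlongrightarrow> 2 * g4) (at_right 0)" "((\<lambda>r. vd2 r / r\<^sup>2) \<longlongrightarrow> 6 * g4) (at_right 0)"
proof -
  show "(vs1 \<longlongrightarrow> 2) (at_right 0)" by (rule sq.quad_tendsto[OF quad_vs1])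
  show "(vs2 \<longlongrightarrow> 2) (at_right 0)" by (rule sq.quad_tendsto[OF quad_vs2])
  show "((\<lambda>r. vd1 r / r\<^sup>2) \<longlongrightarrow> 2 * g4) (at_right 0)"
    by (rule tendsto_right_transform[OF sq.quad_tendsto[OF quad_hA]]) (auto simp: vd1_eq)
  show "((\<lambda>r. vd2 r / r\<^sup>2) \<longlongrightarrow> 6 * g4) (at_right 0)"
    by (rule tendsto_right_transform[OF sq.quad_tendsto[OF quad_W2]]) (auto simp: vd2_eq)
qed

lemma ev_pos: "\<forall>\<^sub>F r in at_right 0. (0::real) < r"
  by (simp add: eventually_at_filter)

lemma ev_nondegenerate: "\<forall>\<^sub>F r in at_right 0. nondegenerate r"
proof -
  have "\<forall>\<^sub>F r in at_right 0. vs1 r > 0" "\<forall>\<^sub>F r in at_right 0. vs2 r > 0"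
    "\<forall>\<^sub>F r in at_right 0. vd1 r / r\<^sup>2 > 0" "\<forall>\<^sub>F r in at_right 0. vd2 r / r\<^sup>2 > 0"
    using gradient_limits g4_pos by (auto intro: order_tendstoD(1))
  then show ?thesis using ev_pos
    by eventually_elim (auto simp: nondegenerate_def zero_less_divide_iff)
qed

text \<open>
  The variance of \<open>D = a + b\<close>.
\<close>

definition VD :: "real \<Rightarrow> real" where "VD r = Va r + 2 * Cab r + Vb r"

lemma VD_ip: "nondegenerate r \<Longrightarrow> ip (\<lambda>\<omega>. za r \<omega> + zb r \<omega>) (\<lambda>\<omega>. za r \<omega> + zb r \<omega>) = VD r"
  using z_H[of r] add_H[OF z_H(3,4), of r r]
  by (simp add: ip_add_left ip_add_right z_cov VD_def)

lemma quad_VD: "\<exists>c. sq.quad VD 0 (32 * (9 * g6 - 4 * g4\<^sup>2)) c"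
proof -
  from quad_Va quad_Cab quad_Vb obtain c1 c2 c3 where
    "sq.quad Va 0 (36 * g6 - 8 * g4\<^sup>2) c1" "sq.quad Cab 0 (36 * g6 - 24 * g4\<^sup>2) c2" "sq.quad Vb 0 (180 * g6 - 72 * g4\<^sup>2) c3"
    by auto
  from quad_ex_cong[OF sq.quad_add[OF sq.quad_add[OF this(1) sq.quad_cmult[OF this(2), of 2]] this(3)], of VD]
  show ?thesis by (simp add: VD_def algebra_simps)
qed

text \<open>
  The leading coefficient of a variance is nonnegative.
\<close>

lemma g6_bound: "4 * g4\<^sup>2 \<le> 9 * g6"
proof -
  obtain c where "sq.quad VD 0 (32 * (9 * g6 - 4 * g4\<^sup>2)) c" using quad_VD by auto
  from sq.quad_ratio[OF this] have lim: "((\<lambda>r. VD r / r\<^sup>2) \<longlongrightarrow> 32 * (9 * g6 - 4 * g4\<^sup>2)) (at_right 0)" by simp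
  have "\<forall>\<^sub>F r in at_right 0. 0 \<le> VD r / r\<^sup>2"
    using ev_nondegenerate by eventually_elim (simp add: VD_ip[symmetric] ip_nonneg)
  from tendsto_lowerbound[OF lim this] show ?thesis by simp
qed

lemma Vb_coeff_pos: "180 * g6 - 72 * g4\<^sup>2 > 0"
proof -
  have "g4\<^sup>2 > 0" using g4_pos by simp
  then show ?thesis using g6_bound by linarith
qed

text \<open>
  The density of the gradient pair at the origin.
\<close>

definition dens :: "real \<Rightarrow> real" where
  "dens r = 1 / sqrt ((2 * pi) ^ 4 * (16 * (vs1 r * vd1 r * vs2 r * vd2 r)))"

lemma K2_eq:
  assumes "nondegenerate r"
  shows "K2 M F \<alpha> \<beta> r = dens r * expectation (\<lambda>\<omega>. kac_rice_weight \<alpha> \<beta> (zeta r \<omega>))"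
proof -
  have "r > 0" using assms by (simp add: nondegenerate_def)
  then show ?thesis
    by (simp add: K2_def two_point_corr_def gaussian_density_gradient cond_hessian_pair_eq[OF assms] dens_def expect_def)
qed

text \<open>
  The variances \<open>vd1, vd2\<close> of the half differences of the gradient are of order \<open>r\<^sup>2\<close>, the others
  converge to positive limits.
\<close>

lemma dens_bound: "\<exists>K\<ge>0. \<forall>\<^sub>F r in at_right 0. 0 \<le> dens r \<and> dens r \<le> K / r\<^sup>2"
proof -
  let ?c = "1 / sqrt ((2 * pi) ^ 4 * (16 * (2 * (2 * g4) * 2 * (6 * g4))))"
  have "((\<lambda>r. 1 / sqrt ((2 * pi) ^ 4 * (16 * (vs1 r * (vd1 r / r\<^sup>2) * vs2 r * (vd2 r / r\<^sup>2))))) \<longlongrightarrow> ?c) (at_right 0)"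
    by (intro tendsto_intros gradient_limits) (use g4_pos in auto)
  then have "\<forall>\<^sub>F r in at_right 0. 1 / sqrt ((2 * pi) ^ 4 * (16 * (vs1 r * (vd1 r / r\<^sup>2) * vs2 r * (vd2 r / r\<^sup>2)))) \<le> ?c + 1"
    by (rule tendsto_ev_le) simp
  then have "\<forall>\<^sub>F r in at_right 0. 0 \<le> dens r \<and> dens r \<le> (?c + 1) / r\<^sup>2"
    using ev_nondegenerate
  proof eventually_elim
    case (elim r)
    then have r: "r > 0" and nn: "0 \<le> vs1 r * vd1 r * vs2 r * vd2 r" by (auto simp: nondegenerate_def)
    have "(2 * pi) ^ 4 * (16 * (vs1 r * (vd1 r / r\<^sup>2) * vs2 r * (vd2 r / r\<^sup>2)))
      = ((2 * pi) ^ 4 * (16 * (vs1 r * vd1 r * vs2 r * vd2 r))) / (r\<^sup>2)\<^sup>2"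
      using r by (simp add: field_simps power2_eq_square)
    then have "1 / sqrt ((2 * pi) ^ 4 * (16 * (vs1 r * (vd1 r / r\<^sup>2) * vs2 r * (vd2 r / r\<^sup>2)))) = dens r * r\<^sup>2"
      by (simp only: real_sqrt_divide real_sqrt_abs) (simp add: dens_def)
    then have "dens r * r\<^sup>2 \<le> ?c + 1" using elim by simp
    then show ?case using r nn by (simp add: dens_def pos_le_divide_eq)
  qed
  moreover have "0 \<le> ?c + 1" by simp
  ultimately show ?thesis by blast
qed

lemma K2_nonneg_bound:
  assumes "nondegenerate r" and d: "0 \<le> dens r" "dens r \<le> K / r\<^sup>2"
    and g: "\<And>\<omega>. kac_rice_weight \<alpha> \<beta> (zeta r \<omega>) \<le> g \<omega>" "(\<integral>\<^sup>+\<omega>. ennreal (g \<omega>) \<partial>completion M) \<le> ennreal B" "0 \<le> B"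
  shows "\<bar>K2 M F \<alpha> \<beta> r\<bar> \<le> K / r\<^sup>2 * B"
proof -
  have E: "expectation (\<lambda>\<omega>. kac_rice_weight \<alpha> \<beta> (zeta r \<omega>)) \<le> B"
    by (rule expectation_le_nn_integral[OF kac_rice_weight_nonneg g])
  have E0: "0 \<le> expectation (\<lambda>\<omega>. kac_rice_weight \<alpha> \<beta> (zeta r \<omega>))"
    by (intro integral_nonneg_AE) (simp add: kac_rice_weight_nonneg)
  have "0 \<le> K2 M F \<alpha> \<beta> r" unfolding K2_eq[OF assms(1)] using d E0 by simp
  moreover have "K2 M F \<alpha> \<beta> r \<le> K / r\<^sup>2 * B"
    unfolding K2_eq[OF assms(1)] using d E E0 by (intro mult_mono) auto
  ultimately show ?thesis by simp
qed

text \<open>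
  \<open>S = p + q\<close> has a nondegenerate limit law and is independent of \<open>D = a + b\<close>, because \<open>(p,q)\<close> and
  \<open>(a,b)\<close> belong to different families.
\<close>

lemma K2_max_min_bound:
  assumes VDb: "\<forall>\<^sub>F r in at_right 0. sqrt (VD r) \<le> A * r ^ j" and A: "0 \<le> A"
  shows "\<exists>K. \<forall>\<^sub>F r in at_right 0. \<bar>K2 M F Maximum Minimum r\<bar> \<le> K * (r ^ (5 * j) / r\<^sup>2)"
proof -
  obtain K where K: "K \<ge> 0" "\<forall>\<^sub>F r in at_right 0. 0 \<le> dens r \<and> dens r \<le> K / r\<^sup>2" using dens_bound by auto
  obtain b c b' c' c'' where q: "sq.quad Vp (64 / 3 * g4) b c" "sq.quad Cpq 0 b' c'" "sq.quad Vq 0 0 c''"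
    using quad_Vp[OF g4_pos] quad_Cpq[OF g4_pos] quad_Vq[OF g4_pos] by auto
  have "((\<lambda>r. Vp r + 2 * Cpq r + Vq r) \<longlongrightarrow> 64 / 3 * g4 + 2 * 0 + 0) (at_right 0)"
    by (intro tendsto_intros sq.quad_tendsto[OF q(1)] sq.quad_tendsto[OF q(2)] sq.quad_tendsto[OF q(3)])
  then have S: "\<forall>\<^sub>F r in at_right 0. g4 \<le> Vp r + 2 * Cpq r + Vq r"
    by (rule tendsto_ev_ge) (use g4_pos in simp)
  let ?c = "normal_weight_moment 3 1 / sqrt g4"
  have c0: "0 \<le> ?c" using normal_weight_moment_nonneg[of 1 3] g4_pos by simp
  have "\<forall>\<^sub>F r in at_right 0. \<bar>K2 M F Maximum Minimum r\<bar> \<le> (K * ?c * A ^ 5) * (r ^ (5 * j) / r\<^sup>2)"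
    using K(2) S VDb ev_nondegenerate
  proof eventually_elim
    case (elim r)
    have r: "r > 0" using elim by (simp add: nondegenerate_def)
    let ?S = "\<lambda>\<omega>. zp r \<omega> + zq r \<omega>" and ?D = "\<lambda>\<omega>. za r \<omega> + zb r \<omega>"
    have H: "?S \<in> closure_F 4" "?D \<in> closure_F 4" by (intro add_H z_H)+
    have SS: "ip ?S ?S = Vp r + 2 * Cpq r + Vq r" and SD: "ip ?S ?D = 0"
      using z_H[of r] H elim by (simp_all add: ip_add_left ip_add_right z_cov)
    have "(\<integral>\<^sup>+\<omega>. ennreal ((?D \<omega>) ^ 4 * of_bool (\<bar>?S \<omega>\<bar> \<le> \<bar>?D \<omega>\<bar>)) \<partial>completion M)
        \<le> ennreal (?c * sqrt (expectation (\<lambda>\<omega>. (?D \<omega>)\<^sup>2)) ^ 5)"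
    proof (rule gaussian_dominated_fourth_moment)
      show "centred_gaussian (completion M) ?S" "centred_gaussian (completion M) ?D" using H gaussian by auto
      show "indep_pair borel ?S borel ?D" by (rule uncorrelated_indep_pair[OF H SD])
      show "(sqrt g4)\<^sup>2 \<le> expectation (\<lambda>\<omega>. (?S \<omega>)\<^sup>2)"
        using SS elim g4_pos by (simp add: ip_def power2_eq_square)
    qed (use g4_pos in simp)
    also have "expectation (\<lambda>\<omega>. (?D \<omega>)\<^sup>2) = VD r"
      using VD_ip[of r] elim by (simp add: ip_def power2_eq_square)
    also have "ennreal (?c * sqrt (VD r) ^ 5) \<le> ennreal (?c * (A * r ^ j) ^ 5)"
    proof (intro ennreal_leI mult_left_mono power_mono c0)
      show "0 \<le> sqrt (VD r)" using VD_ip[of r] elim ip_nonneg[of ?D] by simp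
    qed (use elim in auto)
    finally have I: "(\<integral>\<^sup>+\<omega>. ennreal ((?D \<omega>) ^ 4 * of_bool (\<bar>?S \<omega>\<bar> \<le> \<bar>?D \<omega>\<bar>)) \<partial>completion M) \<le> ennreal (?c * (A * r ^ j) ^ 5)" .
    have nn: "0 \<le> ?c * (A * r ^ j) ^ 5"
      using A r by (intro mult_nonneg_nonneg[OF c0]) simp
    have "\<bar>K2 M F Maximum Minimum r\<bar> \<le> K / r\<^sup>2 * (?c * (A * r ^ j) ^ 5)"
      by (rule K2_nonneg_bound[OF _ _ _ kac_rice_weight_max_min[OF zeta_def] I nn])
         (use elim in auto)
    also have "\<dots> = (K * ?c * A ^ 5) * (r ^ (5 * j) / r\<^sup>2)"
      by (simp add: power_mult_distrib power_mult[symmetric] mult_ac)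
    finally show ?case .
  qed
  then show ?thesis by blast
qed

lemma sqrt_VD_bound:
  assumes "((\<lambda>r. VD r / (r ^ j)\<^sup>2) \<longlongrightarrow> c) (at_right 0)"
  shows "\<exists>A\<ge>0. \<forall>\<^sub>F r in at_right 0. sqrt (VD r) \<le> A * r ^ j"
proof -
  have "\<forall>\<^sub>F r in at_right 0. VD r / (r ^ j)\<^sup>2 \<le> \<bar>c\<bar> + 1"
    by (rule tendsto_ev_le[OF assms]) simp
  then have "\<forall>\<^sub>F r in at_right 0. sqrt (VD r) \<le> sqrt (\<bar>c\<bar> + 1) * r ^ j"
    using ev_pos
  proof eventually_elim
    case (elim r)
    then have "VD r \<le> (\<bar>c\<bar> + 1) * (r ^ j)\<^sup>2" by (simp add: field_simps)
    then have "sqrt (VD r) \<le> sqrt ((\<bar>c\<bar> + 1) * (r ^ j)\<^sup>2)" by (rule real_sqrt_le_mono)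
    then show ?case using elim by (simp add: real_sqrt_mult)
  qed
  then show ?thesis by (intro exI[of _ "sqrt (\<bar>c\<bar> + 1)"]) auto
qed

lemma K2_max_min_cubic: "K2 M F Maximum Minimum \<in> O[at_right 0](\<lambda>r. r ^ 3)"
proof -
  obtain c where "sq.quad VD 0 (32 * (9 * g6 - 4 * g4\<^sup>2)) c" using quad_VD by auto
  from sq.quad_ratio[OF this] have "((\<lambda>r. VD r / (r ^ 1)\<^sup>2) \<longlongrightarrow> 32 * (9 * g6 - 4 * g4\<^sup>2)) (at_right 0)" by simp
  from sqrt_VD_bound[OF this] obtain A where "A \<ge> 0" "\<forall>\<^sub>F r in at_right 0. sqrt (VD r) \<le> A * r ^ 1" by auto
  from K2_max_min_bound[OF this(2,1)] obtain K where K: "\<forall>\<^sub>F r in at_right 0. \<bar>K2 M F Maximum Minimum r\<bar> \<le> K * (r ^ 5 / r\<^sup>2)" by auto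
  show ?thesis
  proof (rule bigoI[of _ K])
    show "\<forall>\<^sub>F r in at_right 0. norm (K2 M F Maximum Minimum r) \<le> K * norm (r ^ 3)"
      using K ev_pos by eventually_elim (simp add: power_diff[symmetric] power_divide eval_nat_numeral)
  qed
qed

text \<open>
  The standard deviation of \<open>D\<close> is now \<open>O(r\<^sup>2)\<close>, and the bound obtained is in fact \<open>O(r\<^sup>8)\<close>.
\<close>

lemma K2_max_min_degenerate:
  assumes "9 * g6 = 4 * g4\<^sup>2"
  shows "K2 M F Maximum Minimum \<in> O[at_right 0](\<lambda>r. r ^ 7)"
proof -
  obtain c where "sq.quad VD 0 (32 * (9 * g6 - 4 * g4\<^sup>2)) c" using quad_VD by auto
  then have "((\<lambda>r. VD r / (r ^ 2)\<^sup>2) \<longlongrightarrow> c) (at_right 0)" using assms by (simp add: sq.quad_def)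
  from sqrt_VD_bound[OF this] obtain A where "A \<ge> 0" "\<forall>\<^sub>F r in at_right 0. sqrt (VD r) \<le> A * r ^ 2" by auto
  from K2_max_min_bound[OF this(2,1)] obtain K where K: "\<forall>\<^sub>F r in at_right 0. \<bar>K2 M F Maximum Minimum r\<bar> \<le> K * (r ^ 10 / r\<^sup>2)" by auto
  have small: "\<forall>\<^sub>F r in at_right 0. r < (1::real)"
    by (rule order_tendstoD(2)[OF tendsto_ident_at]) simp
  show ?thesis
  proof (rule bigoI[of _ "\<bar>K\<bar>"])
    show "\<forall>\<^sub>F r in at_right 0. norm (K2 M F Maximum Minimum r) \<le> \<bar>K\<bar> * norm (r ^ 7)"
      using K ev_pos small
    proof eventually_elim
      case (elim r)
      have "r ^ 10 / r\<^sup>2 = r ^ 8" using elim by (simp add: eval_nat_numeral)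
      then have "\<bar>K2 M F Maximum Minimum r\<bar> \<le> K * r ^ 8" using elim by simp
      also have "\<dots> \<le> \<bar>K\<bar> * r ^ 8" using elim by (intro mult_right_mono) auto
      finally have "\<bar>K2 M F Maximum Minimum r\<bar> \<le> \<bar>K\<bar> * r ^ 8" .
      also have "\<dots> \<le> \<bar>K\<bar> * r ^ 7" using elim by (intro mult_left_mono power_decreasing) auto
      finally show ?case using elim by simp
    qed
  qed
qed

text \<open>
  The residuals rescaled to order one, in the order \<open>b, p, q, a, m, n\<close>. From \<open>q\<close> and \<open>a\<close> the
  regression on \<open>p\<close> and \<open>b\<close>, respectively, is subtracted, which makes all six uncorrelated; the
  factors \<open>p\<close> and \<open>b\<close> of the critical product are left intact. Each entry is written as a
  combination of two residuals, so that one rule evaluates all covariances.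
\<close>

definition scaled :: "real \<Rightarrow> nat \<Rightarrow> 'a \<Rightarrow> real" where
  "scaled r i = [\<lambda>\<omega>. (1 / r) * zb r \<omega> + 0 * zb r \<omega>, \<lambda>\<omega>. 1 * zp r \<omega> + 0 * zp r \<omega>,
      \<lambda>\<omega>. (1 / r\<^sup>2) * zq r \<omega> + (- (Cpq r / r\<^sup>2 / Vp r)) * zp r \<omega>,
      \<lambda>\<omega>. (1 / r) * za r \<omega> + (- (Cab r / Vb r) / r) * zb r \<omega>,
      \<lambda>\<omega>. (1 / r\<^sup>2) * zm r \<omega> + 0 * zm r \<omega>, \<lambda>\<omega>. (1 / r) * zn r \<omega> + 0 * zn r \<omega>] ! i"

lemma scaled_simps:
  "scaled r 0 = (\<lambda>\<omega>. (1 / r) * zb r \<omega> + 0 * zb r \<omega>)" "scaled r 1 = (\<lambda>\<omega>. 1 * zp r \<omega> + 0 * zp r \<omega>)"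
  "scaled r 2 = (\<lambda>\<omega>. (1 / r\<^sup>2) * zq r \<omega> + (- (Cpq r / r\<^sup>2 / Vp r)) * zp r \<omega>)"
  "scaled r 3 = (\<lambda>\<omega>. (1 / r) * za r \<omega> + (- (Cab r / Vb r) / r) * zb r \<omega>)"
  "scaled r 4 = (\<lambda>\<omega>. (1 / r\<^sup>2) * zm r \<omega> + 0 * zm r \<omega>)"
  "scaled r 5 = (\<lambda>\<omega>. (1 / r) * zn r \<omega> + 0 * zn r \<omega>)"
  by (simp_all add: scaled_def)

lemma less_6_cases: "i < (6::nat) \<Longrightarrow> i = 0 \<or> i = 1 \<or> i = 2 \<or> i = 3 \<or> i = 4 \<or> i = 5"
  by linarith

lemma scaled_H: "i < 6 \<Longrightarrow> scaled r i \<in> closure_F 4"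
  by (drule less_6_cases, elim disjE; simp only: scaled_simps; intro lincomb z_H)

lemma ip_lincomb:
  assumes "U \<in> closure_F 4" "U' \<in> closure_F 4" "W \<in> closure_F 4" "W' \<in> closure_F 4"
  shows "ip (\<lambda>\<omega>. e1 * U \<omega> + e2 * U' \<omega>) (\<lambda>\<omega>. f1 * W \<omega> + f2 * W' \<omega>)
       = e1 * f1 * ip U W + e1 * f2 * ip U W' + e2 * f1 * ip U' W + e2 * f2 * ip U' W'"
  using assms by (simp only: ip_lincomb_left ip_lincomb_right lincomb) (simp add: algebra_simps)

lemma scaled_uncorrelated:
  assumes nd: "nondegenerate r" and Vpp: "Vp r > 0" "Vb r > 0" and ij: "i < 6" "j < 6" "i \<noteq> j"
  shows "ip (scaled r i) (scaled r j) = 0"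
proof -
  have r: "r > 0" using nd by (simp add: nondegenerate_def)
  have 2: "ip (scaled r 1) (scaled r 2) = 0" "ip (scaled r 0) (scaled r 3) = 0"
    unfolding scaled_simps ip_lincomb[OF z_H(1) z_H(1) z_H(2) z_H(1)] ip_lincomb[OF z_H(4) z_H(4) z_H(3) z_H(4)]
    using Vpp r by (simp_all add: z_cov[OF nd])
  have 1: "ip (scaled r 0) (scaled r 1) = 0" "ip (scaled r 0) (scaled r 2) = 0" "ip (scaled r 0) (scaled r 4) = 0" "ip (scaled r 0) (scaled r 5) = 0"
    "ip (scaled r 1) (scaled r 3) = 0" "ip (scaled r 1) (scaled r 4) = 0" "ip (scaled r 1) (scaled r 5) = 0"
    "ip (scaled r 2) (scaled r 3) = 0" "ip (scaled r 2) (scaled r 4) = 0" "ip (scaled r 2) (scaled r 5) = 0"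
    "ip (scaled r 3) (scaled r 4) = 0" "ip (scaled r 3) (scaled r 5) = 0" "ip (scaled r 4) (scaled r 5) = 0"
    unfolding scaled_simps by (simp_all only: ip_lincomb z_H z_cov[OF nd] mult_zero_right add_0_right)
  have lt: "ip (scaled r a) (scaled r b) = 0" if ab: "a < b" "b < 6" for a b
  proof -
    have "b \<in> {1, 2, 3, 4, 5}" "a \<in> {0, 1, 2, 3, 4}" using ab by auto
    then show ?thesis using ab(1) 1 2 by (elim insertE emptyE; simp only:; simp)
  qed
  show ?thesis using lt[of i j] lt[of j i] ij ip_commute[of "scaled r i" "scaled r j"]
    by (cases "i < j") auto
qed

lemma scaled_var:
  assumes nd: "nondegenerate r" and Vpp: "Vp r > 0" "Vb r > 0"
  shows "ip (scaled r 0) (scaled r 0) = Vb r / r\<^sup>2" "ip (scaled r 1) (scaled r 1) = Vp r"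
    "ip (scaled r 2) (scaled r 2) \<le> Vq r / (r\<^sup>2)\<^sup>2" "ip (scaled r 3) (scaled r 3) \<le> Va r / r\<^sup>2"
    "ip (scaled r 4) (scaled r 4) = Vm r / (r\<^sup>2)\<^sup>2" "ip (scaled r 5) (scaled r 5) = Vn r / r\<^sup>2"
proof -
  have r: "r > 0" using nd by (simp add: nondegenerate_def)
  show "ip (scaled r 0) (scaled r 0) = Vb r / r\<^sup>2" "ip (scaled r 1) (scaled r 1) = Vp r"
    "ip (scaled r 4) (scaled r 4) = Vm r / (r\<^sup>2)\<^sup>2" "ip (scaled r 5) (scaled r 5) = Vn r / r\<^sup>2"
    unfolding scaled_simps by (simp_all only: ip_lincomb z_H z_cov[OF nd]) (simp_all add: power2_eq_square)
  have "ip (scaled r 2) (scaled r 2) = Vq r / (r\<^sup>2)\<^sup>2 - (Cpq r / r\<^sup>2)\<^sup>2 / Vp r"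
    unfolding scaled_simps ip_lincomb[OF z_H(2) z_H(1) z_H(2) z_H(1)] z_cov[OF nd]
    using Vpp r by (simp add: divide_simps) (simp add: algebra_simps power2_eq_square)
  then show "ip (scaled r 2) (scaled r 2) \<le> Vq r / (r\<^sup>2)\<^sup>2" using Vpp by simp
  have "ip (scaled r 3) (scaled r 3) = Va r / r\<^sup>2 - (Cab r / r)\<^sup>2 / Vb r"
    unfolding scaled_simps ip_lincomb[OF z_H(3) z_H(4) z_H(3) z_H(4)] z_cov[OF nd]
    using Vpp r by (simp add: divide_simps) (simp add: algebra_simps power2_eq_square)
  then show "ip (scaled r 3) (scaled r 3) \<le> Va r / r\<^sup>2" using Vpp by simp
qed

lemma zeta_scaled:
  assumes r: "r > 0"
  shows "zp r \<omega> = scaled r 1 \<omega>" "zb r \<omega> = r * scaled r 0 \<omega>"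
    "zq r \<omega> = r\<^sup>2 * ((Cpq r / r\<^sup>2 / Vp r) * scaled r 1 \<omega> + scaled r 2 \<omega>)"
    "za r \<omega> = r * ((Cab r / Vb r) * scaled r 0 \<omega> + scaled r 3 \<omega>)" "zm r \<omega> = r\<^sup>2 * scaled r 4 \<omega>" "zn r \<omega> = r * scaled r 5 \<omega>"
  unfolding scaled_simps using r by (simp_all add: distrib_left)

text \<open>
  After rescaling, the limits of the variances give bounds \<open>V\<close> from above for all six variables and
  \<open>\<sigma>\<^sup>2\<close> from below for those of \<open>p\<close> and \<open>b / r\<close>, uniformly for small \<open>r\<close>. The factor \<open>r\<^sup>4\<close> comes from
  the size of the determinants, the factor \<open>r log (1/r)\<close> from the small product, and \<open>r\<^sup>-\<^sup>2\<close> from the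
  density.
\<close>

lemma K2_same_type:
  assumes \<alpha>: "\<alpha> \<in> {Minimum, Maximum, Saddle, Extremum}"
  shows "K2 M F \<alpha> \<alpha> \<in> O[at_right 0](\<lambda>r. r ^ 3 * ln (1 / r))"
proof -
  obtain K where K: "K \<ge> 0" "\<forall>\<^sub>F r in at_right 0. 0 \<le> dens r \<and> dens r \<le> K / r\<^sup>2" using dens_bound by auto
  define cp cb where "cp = 64 / 3 * g4" and "cb = 180 * g6 - 72 * g4\<^sup>2"
  have cpos: "cp > 0" "cb > 0" using g4_pos Vb_coeff_pos by (auto simp: cp_def cb_def)
  obtain b1 c1 b2 c2 c3 c4 c5 c6 c7 b8 c8 where q: "sq.quad Vp cp b1 c1" "sq.quad Cpq 0 b2 c2" "sq.quad Vq 0 0 c3"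
    "sq.quad Va 0 (36 * g6 - 8 * g4\<^sup>2) c4" "sq.quad Cab 0 (36 * g6 - 24 * g4\<^sup>2) c5" "sq.quad Vb 0 cb c6"
    "sq.quad Vm 0 0 c7" "sq.quad Vn 0 b8 c8"
    using quad_Vp[OF g4_pos] quad_Cpq[OF g4_pos] quad_Vq[OF g4_pos] quad_Va quad_Cab quad_Vb quad_Vm[OF g4_pos] quad_Vn
    unfolding cp_def cb_def by auto
  have lp: "(Vp \<longlongrightarrow> cp) (at_right 0)" by (rule sq.quad_tendsto[OF q(1)])
  have lpq: "((\<lambda>r. Cpq r / r\<^sup>2) \<longlongrightarrow> b2) (at_right 0)" using sq.quad_ratio[OF q(2)] by simp
  have lq: "((\<lambda>r. Vq r / (r\<^sup>2)\<^sup>2) \<longlongrightarrow> c3) (at_right 0)" using q(3) by (simp add: sq.quad_def)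
  have la: "((\<lambda>r. Va r / r\<^sup>2) \<longlongrightarrow> 36 * g6 - 8 * g4\<^sup>2) (at_right 0)" using sq.quad_ratio[OF q(4)] by simp
  have lab: "((\<lambda>r. Cab r / r\<^sup>2) \<longlongrightarrow> 36 * g6 - 24 * g4\<^sup>2) (at_right 0)" using sq.quad_ratio[OF q(5)] by simp
  have lb: "((\<lambda>r. Vb r / r\<^sup>2) \<longlongrightarrow> cb) (at_right 0)" using sq.quad_ratio[OF q(6)] by simp
  have lm: "((\<lambda>r. Vm r / (r\<^sup>2)\<^sup>2) \<longlongrightarrow> c7) (at_right 0)" using q(7) by (simp add: sq.quad_def)
  have ln: "((\<lambda>r. Vn r / r\<^sup>2) \<longlongrightarrow> b8) (at_right 0)" using sq.quad_ratio[OF q(8)] by simp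
  define V where "V = 1 + \<bar>cp\<bar> + \<bar>c3\<bar> + \<bar>36 * g6 - 8 * g4\<^sup>2\<bar> + \<bar>cb\<bar> + \<bar>c7\<bar> + \<bar>b8\<bar>"
  define \<sigma> where "\<sigma> = sqrt (min cp cb / 2)"
  have \<sigma>: "\<sigma> > 0" "\<sigma>\<^sup>2 < cp" "\<sigma>\<^sup>2 < cb" using cpos by (auto simp: \<sigma>_def min_def)
  define L where "L = \<bar>b2 / cp\<bar> + \<bar>(36 * g6 - 24 * g4\<^sup>2) / cb\<bar> + 1"
  define c where "c = L\<^sup>2 + 4 * L + 7"
  have L0: "0 \<le> L" by (simp add: L_def)
  have c1: "1 \<le> c" using L0 by (simp add: c_def)
  define B where "B = small_product_const \<sigma> V (normal_weight_moment 3 V ^ 4)"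
  \<comment> \<open>The summand \<open>1\<close> in \<open>V\<close> and in \<open>L\<close> makes room between the limits and the bounds.\<close>
  have evV: "\<forall>\<^sub>F r in at_right 0. Vp r \<le> V \<and> Vq r / (r\<^sup>2)\<^sup>2 \<le> V \<and> Va r / r\<^sup>2 \<le> V \<and> Vb r / r\<^sup>2 \<le> V
      \<and> Vm r / (r\<^sup>2)\<^sup>2 \<le> V \<and> Vn r / r\<^sup>2 \<le> V"
    by (intro eventually_conj tendsto_ev_le[OF lp] tendsto_ev_le[OF lq] tendsto_ev_le[OF la] tendsto_ev_le[OF lb]
        tendsto_ev_le[OF lm] tendsto_ev_le[OF ln]) (auto simp: V_def)
  have ev\<sigma>: "\<forall>\<^sub>F r in at_right 0. \<sigma>\<^sup>2 \<le> Vp r \<and> \<sigma>\<^sup>2 \<le> Vb r / r\<^sup>2"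
    by (intro eventually_conj tendsto_ev_ge[OF lp] tendsto_ev_ge[OF lb]) (use \<sigma> in auto)
  have "((\<lambda>r. \<bar>Cpq r / r\<^sup>2 / Vp r\<bar>) \<longlongrightarrow> \<bar>b2 / cp\<bar>) (at_right 0)"
    by (intro tendsto_intros lp lpq) (use cpos in simp)
  then have evk: "\<forall>\<^sub>F r in at_right 0. \<bar>Cpq r / r\<^sup>2 / Vp r\<bar> \<le> L"
    by (rule tendsto_ev_le) (use abs_ge_zero[of "b2 / cp"] abs_ge_zero[of "(36 * g6 - 24 * g4\<^sup>2) / cb"] in \<open>unfold L_def; linarith\<close>)
  have "((\<lambda>r. \<bar>(Cab r / r\<^sup>2) / (Vb r / r\<^sup>2)\<bar>) \<longlongrightarrow> \<bar>(36 * g6 - 24 * g4\<^sup>2) / cb\<bar>) (at_right 0)"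
    by (intro tendsto_intros lab lb) (use cpos in simp)
  then have evl: "\<forall>\<^sub>F r in at_right 0. \<bar>(Cab r / r\<^sup>2) / (Vb r / r\<^sup>2)\<bar> \<le> L"
    by (rule tendsto_ev_le) (use abs_ge_zero[of "b2 / cp"] abs_ge_zero[of "(36 * g6 - 24 * g4\<^sup>2) / cb"] in \<open>unfold L_def; linarith\<close>)
  have evr: "\<forall>\<^sub>F r in at_right 0. r < 1 / (2 * c)"
    by (rule order_tendstoD(2)[OF tendsto_ident_at]) (use c1 in simp)
  have main: "\<forall>\<^sub>F r in at_right 0. \<bar>K2 M F \<alpha> \<alpha> r\<bar> \<le> (K * c ^ 3 * \<bar>B\<bar>) * (r ^ 3 * ln (1 / r))"
    using K(2) evV ev\<sigma> evk evl evr ev_nondegenerate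
  proof eventually_elim
    case (elim r)
    have nd: "nondegenerate r" and r: "r > 0" using elim by (auto simp: nondegenerate_def)
    have cr: "0 < c * r" "c * r \<le> 1 / 2" using elim(6) r c1 by (auto simp: field_simps)
    have r1: "r \<le> 1" 
    proof -
      have "1 * r \<le> c * r" using c1 r by (intro mult_right_mono) auto
      then show ?thesis using cr(2) by linarith
    qed
    have Vpp: "Vp r > 0" "Vb r > 0"
    proof -
      have s2: "0 < \<sigma>\<^sup>2" using \<sigma> by simp
      show "Vp r > 0" using elim(3) s2 by linarith
      have "0 < Vb r / r\<^sup>2" using elim(3) s2 by linarith
      then show "Vb r > 0" using r by (simp add: zero_less_divide_iff)
    qed
    define k l where "k = Cpq r / r\<^sup>2 / Vp r" and "l = Cab r / Vb r"
    have l_eq: "(Cab r / r\<^sup>2) / (Vb r / r\<^sup>2) = l" using r by (simp add: l_def)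
    define X where "X = scaled r"
    have XH: "X i \<in> closure_F 4" if "i < 6" for i unfolding X_def using that by (rule scaled_H)
    note unc = scaled_uncorrelated[OF nd Vpp, folded X_def] and var = scaled_var[OF nd Vpp, folded X_def]
    note z = zeta_scaled[OF r, folded X_def k_def l_def]
    have XV: "ip (X i) (X i) \<le> V" if "i < 6" for i
    proof -
      have "i = 0 \<or> i = 1 \<or> i = 2 \<or> i = 3 \<or> i = 4 \<or> i = 5" using that by linarith
      then show ?thesis using var elim(2) by (elim disjE; simp only:; linarith)
    qed
    define W where "W \<omega> = (\<Prod>i<6. 1 + (X i \<omega>)\<^sup>2)" for \<omega>
    have W_eq: "W \<omega> = (1 + (X 1 \<omega>)\<^sup>2) * (1 + (X 0 \<omega>)\<^sup>2) * (\<Prod>i\<in>{2..5}. 1 + (X i \<omega>)\<^sup>2)" for \<omega>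
    proof -
      have "{..<6} = insert 1 (insert 0 {2..5::nat})" by auto
      then show ?thesis unfolding W_def by (simp add: mult.assoc)
    qed
    have "(\<integral>\<^sup>+\<omega>. ennreal ((W \<omega>)\<^sup>2 * of_bool (\<bar>X 1 \<omega> * X 0 \<omega>\<bar> \<le> (c * r) * W \<omega>)) \<partial>completion M)
        \<le> ennreal (B * ((c * r) * ln (1 / (c * r))))"
      unfolding W_eq B_def
      by (rule uncorrelated_small_product) (use XH unc XV \<sigma> var elim(3) cr in auto)
    also have "\<dots> \<le> ennreal (\<bar>B\<bar> * ((c * r) * ln (1 / r)))"
    proof (intro ennreal_leI mult_mono)
      have "r \<le> c * r" using c1 r by simp
      then have "1 / (c * r) \<le> 1 / r" using r c1 by (intro divide_left_mono) auto
      then show "ln (1 / (c * r)) \<le> ln (1 / r)" using cr r by simp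
      show "0 \<le> ln (1 / (c * r))" using cr by simp
    qed (use cr c1 r in auto)
    finally have I0: "(\<integral>\<^sup>+\<omega>. ennreal ((W \<omega>)\<^sup>2 * of_bool (\<bar>X 1 \<omega> * X 0 \<omega>\<bar> \<le> (c * r) * W \<omega>)) \<partial>completion M)
        \<le> ennreal (\<bar>B\<bar> * ((c * r) * ln (1 / r)))" .
    have Xm: "X i \<in> borel_measurable (completion M)" if "i < 6" for i by (rule measurable_H[OF XH[OF that]])
    have [measurable]: "X 0 \<in> borel_measurable (completion M)" "X 1 \<in> borel_measurable (completion M)" by (rule Xm, simp)+
    have Wm[measurable]: "W \<in> borel_measurable (completion M)" unfolding W_def
      by (intro borel_measurable_prod borel_measurable_add borel_measurable_power borel_measurable_const Xm) auto
    have l1: "0 \<le> ln (1 / r)" using r r1 by simp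
    have "(\<integral>\<^sup>+\<omega>. ennreal (c\<^sup>2 * r ^ 4 * ((W \<omega>)\<^sup>2 * of_bool (\<bar>X 1 \<omega> * X 0 \<omega>\<bar> \<le> c * r * W \<omega>))) \<partial>completion M)
      = (\<integral>\<^sup>+\<omega>. ennreal (c\<^sup>2 * r ^ 4) * ennreal ((W \<omega>)\<^sup>2 * of_bool (\<bar>X 1 \<omega> * X 0 \<omega>\<bar> \<le> c * r * W \<omega>)) \<partial>completion M)"
      by (intro nn_integral_cong ennreal_mult) auto
    also have "\<dots> = ennreal (c\<^sup>2 * r ^ 4) * (\<integral>\<^sup>+\<omega>. ennreal ((W \<omega>)\<^sup>2 * of_bool (\<bar>X 1 \<omega> * X 0 \<omega>\<bar> \<le> c * r * W \<omega>)) \<partial>completion M)"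
      by (rule nn_integral_cmult) measurable
    also have "\<dots> \<le> ennreal (c\<^sup>2 * r ^ 4) * ennreal (\<bar>B\<bar> * ((c * r) * ln (1 / r)))"
      by (intro mult_left_mono I0) auto
    also have "\<dots> = ennreal (c\<^sup>2 * r ^ 4 * (\<bar>B\<bar> * ((c * r) * ln (1 / r))))"
      using cr l1 by (intro ennreal_mult[symmetric]) auto
    finally have I: "(\<integral>\<^sup>+\<omega>. ennreal (c\<^sup>2 * r ^ 4 * ((W \<omega>)\<^sup>2 * of_bool (\<bar>X 1 \<omega> * X 0 \<omega>\<bar> \<le> c * r * W \<omega>))) \<partial>completion M)
      \<le> ennreal (c\<^sup>2 * r ^ 4 * (\<bar>B\<bar> * ((c * r) * ln (1 / r))))" .
    have pw: "kac_rice_weight \<alpha> \<alpha> (zeta r \<omega>) \<le> c\<^sup>2 * r ^ 4 * ((W \<omega>)\<^sup>2 * of_bool (\<bar>X 1 \<omega> * X 0 \<omega>\<bar> \<le> c * r * W \<omega>))" for \<omega>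
    proof -
      have "kac_rice_weight \<alpha> \<alpha> (zeta r \<omega>) \<le> \<bar>det (first_hessian (zeta r \<omega>))\<bar> * \<bar>det (second_hessian (zeta r \<omega>))\<bar>
         * of_bool (det (first_hessian (zeta r \<omega>)) * det (second_hessian (zeta r \<omega>)) > 0)"
        by (rule kac_rice_weight_same_type[OF refl \<alpha>])
      also have "\<dots> \<le> c\<^sup>2 * r ^ 4 * ((W \<omega>)\<^sup>2 * of_bool (\<bar>X 1 \<omega> * X 0 \<omega>\<bar> \<le> c * r * W \<omega>))"
        unfolding first_hessian_def second_hessian_def det_sym_matrix2 zeta_def vector_6 W_def c_def z
        by (rule det_pair_bounds[of k L l r "\<lambda>i. X i \<omega>"]) (use elim(4,5) l_eq k_def r r1 in auto)
      finally show ?thesis .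
    qed
    have "\<bar>K2 M F \<alpha> \<alpha> r\<bar> \<le> K / r\<^sup>2 * (c\<^sup>2 * r ^ 4 * (\<bar>B\<bar> * ((c * r) * ln (1 / r))))"
      by (rule K2_nonneg_bound[OF nd _ _ pw I]) (use elim(1) cr l1 in auto)
    also have "\<dots> = (K * c ^ 3 * \<bar>B\<bar>) * (r ^ 3 * ln (1 / r))"
      using r by (simp add: eval_nat_numeral)
    finally show ?case .
  qed
  show ?thesis
  proof (rule bigoI[of _ "K * c ^ 3 * \<bar>B\<bar>"])
    show "\<forall>\<^sub>F r in at_right 0. norm (K2 M F \<alpha> \<alpha> r) \<le> K * c ^ 3 * \<bar>B\<bar> * norm (r ^ 3 * ln (1 / r))"
      using main
    proof eventually_elim
      case (elim r)
      also have "(K * c ^ 3 * \<bar>B\<bar>) * (r ^ 3 * ln (1 / r)) \<le> (K * c ^ 3 * \<bar>B\<bar>) * \<bar>r ^ 3 * ln (1 / r)\<bar>"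
        using K(1) c1 by (intro mult_left_mono) auto
      finally show ?case by simp
    qed
  qed
qed

end

section \<open>Diagonalisation with Taylor expansions\<close>

context small_parameter
begin

text \<open>
  With the larger eigenvalue \<open>lp\<close>, the vector \<open>(x,B)\<close>, where \<open>x = lp - D = (A - D + \<delta>) / 2\<close> and \<open>\<delta>\<close> is
  the square root of the discriminant, is an eigenvector of the matrix with rows \<open>(A,B)\<close> and
  \<open>(B,D)\<close>. The hypothesis \<open>pos\<close> says that \<open>x\<close> does not vanish at \<open>0\<close>, so that the eigenvector can be
  normalised there. The smaller eigenvalue \<open>lm\<close> is recovered from the determinant; this
  preserves the order to which it vanishes.
\<close>

lemma symmetric2_diagonalisation:
  assumes A: "quad A a a1 a2" and B: "quad B b e1 e2" and D: "quad D d d1 d2"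
    and pos: "(a - d) + sqrt ((a - d)\<^sup>2 + 4 * b\<^sup>2) > 0"
  shows "\<exists>c s lp lm c0 c1 c2 s0 s1 s2 p1 p2. quad c c0 c1 c2 \<and> quad s s0 s1 s2
    \<and> quad lp ((a + d + sqrt ((a - d)\<^sup>2 + 4 * b\<^sup>2)) / 2) p1 p2
    \<and> (\<forall>\<^sub>F r in at_right 0. (c r)\<^sup>2 + (s r)\<^sup>2 = 1 \<and> A r = lp r * (c r)\<^sup>2 + lm r * (s r)\<^sup>2
        \<and> B r = (lp r - lm r) * (c r * s r) \<and> D r = lp r * (s r)\<^sup>2 + lm r * (c r)\<^sup>2
        \<and> lp r * lm r = A r * D r - (B r)\<^sup>2)"
proof -
  define \<delta>0 where "\<delta>0 = sqrt ((a - d)\<^sup>2 + 4 * b\<^sup>2)"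
  have "(a - d)\<^sup>2 + 4 * b\<^sup>2 \<noteq> 0"
  proof
    assume z: "(a - d)\<^sup>2 + 4 * b\<^sup>2 = 0"
    moreover have "0 \<le> (a - d)\<^sup>2" "0 \<le> b\<^sup>2" by simp_all
    ultimately have "(a - d)\<^sup>2 = 0" by linarith
    then show False using pos z by simp
  qed
  moreover have "0 \<le> (a - d)\<^sup>2 + 4 * b\<^sup>2" by simp
  ultimately have disc: "(a - d)\<^sup>2 + 4 * b\<^sup>2 > 0" by linarith
  define \<delta> where "\<delta> r = sqrt ((A r - D r)\<^sup>2 + 4 * (B r)\<^sup>2)" for r
  note sqd = quad_add[OF quad_power2[OF quad_diff[OF A D]] quad_cmult[OF quad_power2[OF B], of 4]]
  obtain e1 e2 where \<delta>: "quad \<delta> \<delta>0 e1 e2"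
    using quad_sqrt[OF sqd] disc unfolding \<delta>_def[abs_def] \<delta>0_def by (auto simp: power2_eq_square)
  define x where "x r = (A r - D r + \<delta> r) * (1 / 2)" for r
  define x0 where "x0 = (a - d + \<delta>0) * (1 / 2)"
  have x0: "x0 > 0" using pos by (simp add: x0_def \<delta>0_def)
  note qx = quad_mult[OF quad_add[OF quad_diff[OF A D] \<delta>] quad_const[of "1 / 2"]]
  obtain x1 x2 where x: "quad x x0 x1 x2" using qx unfolding x_def[abs_def] x0_def by blast
  define lp lm where "lp r = (A r + D r + \<delta> r) * (1 / 2)" and "lm r = (A r + D r - \<delta> r) * (1 / 2)" for r
  obtain p1 p2 where lp: "quad lp ((a + d + \<delta>0) / 2) p1 p2"
    using quad_mult[OF quad_add[OF quad_add[OF A D] \<delta>] quad_const[of "1 / 2"]] unfolding lp_def[abs_def] by auto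
  define \<nu> where "\<nu> r = sqrt ((x r)\<^sup>2 + (B r)\<^sup>2)" for r
  have "x0 * x0 + b * b > 0" using x0 by (intro add_pos_nonneg) auto
  with quad_sqrt[OF quad_add[OF quad_power2[OF x] quad_power2[OF B]]]
  obtain n1 n2 where \<nu>: "quad \<nu> (sqrt (x0 * x0 + b * b)) n1 n2" unfolding \<nu>_def[abs_def] by blast
  have n0: "sqrt (x0 * x0 + b * b) \<noteq> 0" using real_sqrt_gt_zero[OF \<open>x0 * x0 + b * b > 0\<close>] by linarith
  note c = quad_divide[OF x \<nu> n0] and s = quad_divide[OF B \<nu> n0]
  have "\<forall>\<^sub>F r in at_right 0. x r > 0" using quad_tendsto[OF x] x0 by (rule order_tendstoD)
  then have "\<forall>\<^sub>F r in at_right 0. (x r / \<nu> r)\<^sup>2 + (B r / \<nu> r)\<^sup>2 = 1 \<and> A r = lp r * (x r / \<nu> r)\<^sup>2 + lm r * (B r / \<nu> r)\<^sup>2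
        \<and> B r = (lp r - lm r) * (x r / \<nu> r * (B r / \<nu> r)) \<and> D r = lp r * (B r / \<nu> r)\<^sup>2 + lm r * (x r / \<nu> r)\<^sup>2
        \<and> lp r * lm r = A r * D r - (B r)\<^sup>2"
  proof eventually_elim
    case (elim r)
    have n2: "(\<nu> r)\<^sup>2 = (x r)\<^sup>2 + (B r)\<^sup>2" by (simp add: \<nu>_def)
    have n2p: "(\<nu> r)\<^sup>2 > 0" unfolding n2 using elim by (intro add_pos_nonneg) auto
    have d2: "\<delta> r * \<delta> r = (A r - D r)\<^sup>2 + 4 * (B r)\<^sup>2" by (simp add: \<delta>_def)
    have eq: "lp r = D r + x r" "lm r = A r - x r" "\<delta> r = 2 * x r - A r + D r"
      by (simp_all add: lp_def lm_def x_def field_simps)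
    have key: "x r * (x r + D r - A r) = (B r)\<^sup>2"
      using d2 unfolding eq(3) by (simp add: power2_eq_square algebra_simps)
    have 1: "(x r / \<nu> r)\<^sup>2 + (B r / \<nu> r)\<^sup>2 = 1"
      unfolding power_divide add_divide_distrib[symmetric] n2[symmetric] using n2p by simp
    have e2: "lp r * (x r)\<^sup>2 + lm r * (B r)\<^sup>2 = A r * ((x r)\<^sup>2 + (B r)\<^sup>2)"
      unfolding eq key[symmetric] by (simp add: power2_eq_square algebra_simps)
    have "lp r * (x r / \<nu> r)\<^sup>2 + lm r * (B r / \<nu> r)\<^sup>2 = (lp r * (x r)\<^sup>2 + lm r * (B r)\<^sup>2) / (\<nu> r)\<^sup>2"
      by (simp add: power_divide add_divide_distrib)
    then have 2: "A r = lp r * (x r / \<nu> r)\<^sup>2 + lm r * (B r / \<nu> r)\<^sup>2"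
      using n2p unfolding e2 n2[symmetric] by simp
    have e3: "(lp r - lm r) * (x r * B r) = B r * ((x r)\<^sup>2 + (B r)\<^sup>2)"
      unfolding eq key[symmetric] by (simp add: power2_eq_square algebra_simps)
    have "(lp r - lm r) * (x r / \<nu> r * (B r / \<nu> r)) = ((lp r - lm r) * (x r * B r)) / (\<nu> r)\<^sup>2"
      by (simp add: power2_eq_square)
    then have 3: "B r = (lp r - lm r) * (x r / \<nu> r * (B r / \<nu> r))"
      using n2p unfolding e3 n2[symmetric] by simp
    have e4: "lp r * (B r)\<^sup>2 + lm r * (x r)\<^sup>2 = D r * ((x r)\<^sup>2 + (B r)\<^sup>2)"
      unfolding eq key[symmetric] by (simp add: power2_eq_square algebra_simps)
    have "lp r * (B r / \<nu> r)\<^sup>2 + lm r * (x r / \<nu> r)\<^sup>2 = (lp r * (B r)\<^sup>2 + lm r * (x r)\<^sup>2) / (\<nu> r)\<^sup>2"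
      by (simp add: power_divide add_divide_distrib)
    then have 4: "D r = lp r * (B r / \<nu> r)\<^sup>2 + lm r * (x r / \<nu> r)\<^sup>2"
      using n2p unfolding e4 n2[symmetric] by simp
    have 5: "lp r * lm r = A r * D r - (B r)\<^sup>2"
      unfolding eq key[symmetric] by (simp add: algebra_simps)
    show ?case using 1 2 3 4 5 by blast
  qed
  with c s lp show ?thesis unfolding \<delta>0_def by blast
qed

end

text \<open>
  The square root of a nonnegative function with a zero at \<open>0\<close> has an expansion only if the zero has
  even order; here a first-order zero is excluded.
\<close>

lemma sqrt_order2:
  assumes w: "lin.quad w m0 m1 m2" and m1: "m0 = 0 \<Longrightarrow> m1 = 0" and nn: "\<forall>\<^sub>F r in at_right 0. 0 \<le> w r"
  shows "\<exists>b c. lin.quad (\<lambda>r. r * sqrt (w r)) 0 b c"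
proof -
  have "0 \<le> m0" by (rule tendsto_lowerbound[OF lin.quad_tendsto[OF w] nn]) simp
  then consider "m0 > 0" | "m0 = 0" by linarith
  then show ?thesis
  proof cases
    case 1
    from lin.quad_sqrt[OF w 1] obtain b c where "lin.quad (\<lambda>r. sqrt (w r)) (sqrt m0) b c" by blast
    from lin.quad_param_mult[OF this] show ?thesis by blast
  next
    case 2
    have "((\<lambda>r. w r / r\<^sup>2) \<longlongrightarrow> m2) (at_right 0)" using w 2 m1 by (simp add: lin.quad_def)
    then have "((\<lambda>r. sqrt (w r / r\<^sup>2)) \<longlongrightarrow> sqrt m2) (at_right 0)" by (rule tendsto_real_sqrt)
    from lin.quad_param2_mult[OF this] have "lin.quad (\<lambda>r. r\<^sup>2 * sqrt (w r / r\<^sup>2)) 0 0 (sqrt m2)" .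
    moreover have "\<forall>\<^sub>F r in at_right 0. r\<^sup>2 * sqrt (w r / r\<^sup>2) = r * sqrt (w r)"
      unfolding eventually_at_filter by (auto intro!: always_eventually simp: real_sqrt_divide power2_eq_square)
    ultimately show ?thesis by (blast intro: lin.quad_cong_ev)
  qed
qed

lemma sqrt_order4:
  assumes V: "sq.quad V 0 0 c"
  shows "\<exists>c'. lin.quad (\<lambda>r. sqrt (V r)) 0 0 c'"
proof -
  have "((\<lambda>r. V r / (r\<^sup>2)\<^sup>2) \<longlongrightarrow> c) (at_right 0)" using V by (simp add: sq.quad_def)
  then have "((\<lambda>r. sqrt (V r / (r\<^sup>2)\<^sup>2)) \<longlongrightarrow> sqrt c) (at_right 0)" by (rule tendsto_real_sqrt)
  from lin.quad_param2_mult[OF this] have "lin.quad (\<lambda>r. r\<^sup>2 * sqrt (V r / (r\<^sup>2)\<^sup>2)) 0 0 (sqrt c)" .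
  moreover have "\<forall>\<^sub>F r in at_right 0. r\<^sup>2 * sqrt (V r / (r\<^sup>2)\<^sup>2) = sqrt (V r)"
    unfolding eventually_at_filter
    by (intro always_eventually allI impI, simp only: real_sqrt_divide real_sqrt_abs) simp
  ultimately show ?thesis by (blast intro: lin.quad_cong_ev)
qed

lemma quad_sum:
  assumes "finite I" "\<And>i. i \<in> I \<Longrightarrow> lin.quad (f i) (a i) (b i) (c i)"
  shows "lin.quad (\<lambda>r. \<Sum>i\<in>I. f i r) (\<Sum>i\<in>I. a i) (\<Sum>i\<in>I. b i) (\<Sum>i\<in>I. c i)"
  using assms
proof (induction I rule: finite_induct)
  case empty
  show ?case using lin.quad_const[of 0] by simp
next
  case (insert i I)
  then show ?case using lin.quad_add by simp
qed

text \<open>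
  The coefficients of \<open>b\<^sub>1\<close> are read off from the columns of \<open>Q\<close>; this reduces statements about
  \<open>b\<^sub>1\<^sub>,\<^sub>1\<close> to statements about single eigenvectors.
\<close>

lemma b1_eq: "b1 Q l \<xi> = - (\<Sum>k\<in>UNIV. (Q $ 1 $ k + Q $ 3 $ k) * sqrt (l $ k) * \<xi> $ k)"
proof -
  have "((Q ** sqrt_diag_matrix l) *v \<xi>) $ i = (\<Sum>k\<in>UNIV. Q $ i $ k * sqrt (l $ k) * \<xi> $ k)" for i
  proof -
    have "(Q ** sqrt_diag_matrix l) $ i $ k = Q $ i $ k * sqrt (l $ k)" for k
      by (simp add: matrix_matrix_mult_def sqrt_diag_matrix_def diag_matrix_def if_distrib cong: if_cong)
    then show ?thesis by (simp add: matrix_vector_mult_def)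
  qed
  then show ?thesis by (simp only: b1_def Let_def sum.distrib distrib_right)
qed

lemma expandable_imp_b11_expansion:
  assumes "expandable_diagonalisation D Q l"
  shows "\<exists>b10 b b12. linear b10 \<and> linear b \<and> linear b12 \<and>
    (\<forall>\<xi>. has_taylor2 (\<lambda>r. b1 (Q r) (l r) \<xi>) (b10 \<xi>) (b \<xi>) (b12 \<xi>))"
proof -
  have ex: "\<exists>a b c. lin.quad (\<lambda>r. (Q r $ 1 $ k + Q r $ 3 $ k) * sqrt (l r $ k)) a b c" for k
  proof -
    note e = assms[unfolded expandable_diagonalisation_def has_taylor2_iff_quad]
    have Q: "\<exists>a b c. lin.quad (\<lambda>r. Q r $ i $ j) a b c" for i j
      by (rule e[THEN conjunct2, THEN conjunct1, THEN spec, THEN spec])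
    have "\<exists>a b c. lin.quad (\<lambda>r. sqrt_diag_matrix (l r) $ k $ k) a b c"
      by (rule e[THEN conjunct2, THEN conjunct2, THEN spec, THEN spec])
    then have "\<exists>a b c. lin.quad (\<lambda>r. sqrt (l r $ k)) a b c"
      by (simp add: sqrt_diag_matrix_def diag_matrix_def)
    then obtain a b c where t: "lin.quad (\<lambda>r. sqrt (l r $ k)) a b c" by blast
    obtain a1 b1 c1 a3 b3 c3 where "lin.quad (\<lambda>r. Q r $ 1 $ k) a1 b1 c1" "lin.quad (\<lambda>r. Q r $ 3 $ k) a3 b3 c3"
      using Q[of 1 k] Q[of 3 k] by blast
    from lin.quad_mult[OF lin.quad_add[OF this] t] show ?thesis by blast
  qed
  have "\<forall>k. \<exists>p. lin.quad (\<lambda>r. (Q r $ 1 $ k + Q r $ 3 $ k) * sqrt (l r $ k)) (fst p) (fst (snd p)) (snd (snd p))"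
  proof (rule allI)
    fix k
    obtain a b c where "lin.quad (\<lambda>r. (Q r $ 1 $ k + Q r $ 3 $ k) * sqrt (l r $ k)) a b c"
      using ex[of k] by blast
    then show "\<exists>p. lin.quad (\<lambda>r. (Q r $ 1 $ k + Q r $ 3 $ k) * sqrt (l r $ k)) (fst p) (fst (snd p)) (snd (snd p))"
      by (intro exI[of _ "(a, b, c)"]) simp
  qed
  from choice[OF this] obtain p where
    "\<forall>k. lin.quad (\<lambda>r. (Q r $ 1 $ k + Q r $ 3 $ k) * sqrt (l r $ k)) (fst (p k)) (fst (snd (p k))) (snd (snd (p k)))" ..
  then obtain a b c where q: "\<And>k. lin.quad (\<lambda>r. (Q r $ 1 $ k + Q r $ 3 $ k) * sqrt (l r $ k)) (a k) (b k) (c k)"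
    using that[of "\<lambda>k. fst (p k)" "\<lambda>k. fst (snd (p k))" "\<lambda>k. snd (snd (p k))"] by blast
  have lin: "linear (\<lambda>\<xi>::real ^ 6. - (\<Sum>k\<in>UNIV. f k * \<xi> $ k))" for f :: "6 \<Rightarrow> real"
  proof (rule linearI)
    show "- (\<Sum>k\<in>UNIV. f k * (x + y) $ k) = - (\<Sum>k\<in>UNIV. f k * x $ k) + - (\<Sum>k\<in>UNIV. f k * y $ k)" for x y :: "real ^ 6"
      by (simp add: distrib_left sum.distrib)
    show "- (\<Sum>k\<in>UNIV. f k * (c *\<^sub>R x) $ k) = c *\<^sub>R - (\<Sum>k\<in>UNIV. f k * x $ k)" for c and x :: "real ^ 6"
      by (simp add: sum_distrib_left mult.left_commute)
  qed
  have "has_taylor2 (\<lambda>r. b1 (Q r) (l r) \<xi>) (- (\<Sum>k\<in>UNIV. a k * \<xi> $ k)) (- (\<Sum>k\<in>UNIV. b k * \<xi> $ k)) (- (\<Sum>k\<in>UNIV. c k * \<xi> $ k))" for \<xi>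
    unfolding has_taylor2_iff_quad b1_eq
  proof (rule lin.quad_minus, rule quad_sum)
    fix k
    show "lin.quad (\<lambda>r. (Q r $ 1 $ k + Q r $ 3 $ k) * sqrt (l r $ k) * \<xi> $ k) (a k * \<xi> $ k) (b k * \<xi> $ k) (c k * \<xi> $ k)"
      using lin.quad_mult[OF q lin.quad_const[of "\<xi> $ k"]] by simp
  qed simp
  note T = this
  show ?thesis by (intro exI conjI allI, rule lin, rule lin, rule lin, rule T)
qed

section \<open>The linear coefficient of the trace\<close>

abbreviation bigO :: "(real \<Rightarrow> real) \<Rightarrow> nat \<Rightarrow> bool" where
  "bigO f j \<equiv> f \<in> O[at_right 0](\<lambda>r. r ^ j)"

lemma bigO_mult: "bigO f i \<Longrightarrow> bigO g j \<Longrightarrow> bigO (\<lambda>r. f r * g r) (i + j)"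
  using landau_o.big.mult[of f "at_right 0" "\<lambda>r. r ^ i" g "\<lambda>r. r ^ j"] by (simp add: power_add)

lemma bigO_add: "bigO f i \<Longrightarrow> bigO g i \<Longrightarrow> bigO (\<lambda>r. f r + g r) i"
  by (rule sum_in_bigo(1))

lemma bigO_diff: "bigO f i \<Longrightarrow> bigO g i \<Longrightarrow> bigO (\<lambda>r. f r - g r) i"
  by (rule sum_in_bigo(2))

lemma bigO_cmult: "bigO f i \<Longrightarrow> bigO (\<lambda>r. k * f r) i"
  using bigO_mult[of "\<lambda>_. k" 0 f i] by simp

lemma bigO_tendsto: "(f \<longlongrightarrow> c) (at_right 0) \<Longrightarrow> bigO f 0"
  by (rule bigoI_tendsto[of _ _ c]) auto

lemma bigO_cong: "bigO f j \<Longrightarrow> \<forall>\<^sub>F r in at_right 0. f r = g r \<Longrightarrow> bigO g j"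
  by (rule landau_o.big.in_cong[THEN iffD1])

lemma pos_eventually: "(\<And>r. r > 0 \<Longrightarrow> P r) \<Longrightarrow> \<forall>\<^sub>F r in at_right (0::real). P r"
  by (auto simp: eventually_at_filter)

lemma bigO_ratio: "((\<lambda>r. f r / r ^ j) \<longlongrightarrow> c) (at_right 0) \<Longrightarrow> bigO f j"
  by (erule bigoI_tendsto, rule pos_eventually) simp

lemma bigO_Suc_tendsto: "bigO f (Suc j) \<Longrightarrow> ((\<lambda>r. f r / r ^ j) \<longlongrightarrow> 0) (at_right 0)"
proof -
  assume "bigO f (Suc j)"
  then obtain K where K: "\<forall>\<^sub>F r in at_right 0. norm (f r) \<le> K * norm (r ^ Suc j)" by (auto elim: landau_o.bigE)
  have "((\<lambda>r. K * r) \<longlongrightarrow> K * 0) (at_right 0)" by (intro tendsto_intros)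
  then have lim: "((\<lambda>r. K * r) \<longlongrightarrow> 0) (at_right 0)" by simp
  show ?thesis
  proof (rule Lim_null_comparison[OF _ lim])
    have "\<forall>\<^sub>F r in at_right (0::real). r > 0" by (rule pos_eventually)
    with K show "\<forall>\<^sub>F r in at_right 0. norm (f r / r ^ j) \<le> K * r"
      by eventually_elim (simp add: field_simps abs_mult)
  qed
qed

lemma bigO_weaken: "bigO f i \<Longrightarrow> j \<le> i \<Longrightarrow> bigO f j"
proof -
  assume f: "bigO f i" and "j \<le> i"
  then obtain m where i: "i = j + m" by (auto simp: le_iff_add)
  have "((\<lambda>r::real. r ^ m) \<longlongrightarrow> 0 ^ m) (at_right 0)" by (intro tendsto_intros)
  then have "bigO (\<lambda>r. r ^ m) 0" by (rule bigO_tendsto)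
  from bigO_mult[OF _ this, of "\<lambda>r. r ^ j" j] have "(\<lambda>r::real. r ^ i) \<in> O[at_right 0](\<lambda>r. r ^ j)"
    by (simp add: i power_add)
  with f show ?thesis by (rule landau_o.big_trans)
qed

lemma bigO_sqrt: "bigO (\<lambda>r. (f r)\<^sup>2) (2 * j) \<Longrightarrow> bigO f j"
proof -
  assume "bigO (\<lambda>r. (f r)\<^sup>2) (2 * j)"
  then obtain K where K: "K > 0" "\<forall>\<^sub>F r in at_right 0. norm ((f r)\<^sup>2) \<le> K * norm (r ^ (2 * j))" by (auto elim: landau_o.bigE)
  show ?thesis
  proof (rule bigoI[of _ "sqrt K"])
    show "\<forall>\<^sub>F r in at_right 0. norm (f r) \<le> sqrt K * norm (r ^ j)"
      using K(2)
    proof eventually_elim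
      case (elim r)
      have "r ^ (2 * j) = (r ^ j)\<^sup>2" by (rule power_even_eq)
      then have "(f r)\<^sup>2 \<le> K * (r ^ j)\<^sup>2" using elim by (simp only: real_norm_def abs_power2)
      then have "sqrt ((f r)\<^sup>2) \<le> sqrt (K * (r ^ j)\<^sup>2)" by (rule real_sqrt_le_mono)
      then show ?case by (simp add: real_sqrt_mult)
    qed
  qed
qed

lemma bigO_divide:
  assumes "bigO (\<lambda>r. g r * f r) j" "(g \<longlongrightarrow> c) (at_right 0)" "c \<noteq> 0"
  shows "bigO f j"
proof -
  have "((\<lambda>r. 1 / g r) \<longlongrightarrow> 1 / c) (at_right 0)" by (intro tendsto_intros assms)
  from bigO_mult[OF assms(1) bigO_tendsto[OF this]] have "bigO (\<lambda>r. g r * f r * (1 / g r)) j" by simp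
  then show ?thesis
    by (rule bigO_cong) (use tendsto_imp_eventually_ne[OF assms(2,3)] in eventually_elim, simp)
qed

lemma quad_bigO2: "lin.quad f 0 0 c \<Longrightarrow> bigO f 2"
  by (rule bigO_ratio[of _ _ c]) (simp add: lin.quad_def)

lemma bigO2_quad_coeff:
  assumes "bigO f 2" "lin.quad f a b c"
  shows "a = 0" "b = 0"
proof -
  have f1: "bigO f (Suc 1)" using assms(1) by (simp add: numeral_2_eq_2)
  have "bigO f (Suc 0)" by (rule bigO_weaken[OF assms(1)]) simp
  from bigO_Suc_tendsto[OF this] have "(f \<longlongrightarrow> 0) (at_right 0)" by simp
  then show a: "a = 0" using lin.quad_tendsto[OF assms(2)] by (auto intro: tendsto_unique[of "at_right (0::real)"])
  from bigO_Suc_tendsto[OF f1] have "((\<lambda>r. f r / r) \<longlongrightarrow> 0) (at_right 0)" by simp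
  then show "b = 0" using lin.quad_ratio[OF assms(2)] a by (auto intro: tendsto_unique[of "at_right (0::real)"])
qed

text \<open>
  \<open>(x1, \<dots>, x6)\<close> is a unit eigenvector of the covariance matrix of the conditioned Hessians, with
  eigenvalue \<open>l = \<tau>\<^sup>2\<close>, and \<open>w\<close> is its contribution to the trace at the first point. The first six
  equations are the eigenvector equation in the coordinates \<open>p, q, a, b, m, n\<close>; all entries of the
  matrix are \<open>O(r\<^sup>2)\<close> except the variance of \<open>p\<close>, which tends to \<open>cp\<close>.
  
  If \<open>l\<close> has a nonzero limit, the eigenvector equation forces all components but the one along \<open>p\<close> to
  be \<open>O(r\<^sup>2)\<close>. Then \<open>w\<^sup>2 = cp + O(r\<^sup>2)\<close>, so that \<open>w\<close> has no linear term, and the component along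
  \<open>a + b\<close> is \<open>O(r\<^sup>2)\<close> as well. If \<open>l\<close> tends to \<open>0\<close>, then the component along \<open>p\<close> is \<open>O(r\<^sup>2)\<close>, and the
  one along \<open>q\<close>, multiplied by \<open>\<tau>\<close>, is also \<open>O(r\<^sup>2)\<close>, since the variance of \<open>q\<close> is \<open>O(r\<^sup>4)\<close>. So the
  linear term of \<open>w\<close> is that of the component along \<open>a + b\<close>.
\<close>

lemma eigenvector_trace_order:
  fixes Vp Cpq Vq Va Cab Vb Vm Vn x1 x2 x3 x4 x5 x6 l \<tau> :: "real \<Rightarrow> real"
  assumes cp: "cp > 0" and Vp: "bigO (\<lambda>r. Vp r - cp) 2" and V2: "bigO Cpq 2" "bigO Va 2" "bigO Cab 2" "bigO Vb 2" "bigO Vm 2" "bigO Vn 2"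
    and V4: "bigO Vq 4"
    and eqs: "\<forall>\<^sub>F r in at_right 0.
       l r * (x1 r + x4 r) = 2 * (Vp r * (x1 r + x4 r)) + 2 * (Cpq r * (x3 r + x6 r)) \<and>
       l r * (x3 r + x6 r) = 2 * (Cpq r * (x1 r + x4 r)) + 2 * (Vq r * (x3 r + x6 r)) \<and>
       l r * (x4 r - x1 r) = 2 * (Va r * (x4 r - x1 r)) + 2 * (Cab r * (x6 r - x3 r)) \<and>
       l r * (x6 r - x3 r) = 2 * (Cab r * (x4 r - x1 r)) + 2 * (Vb r * (x6 r - x3 r)) \<and>
       l r * (x2 r + x5 r) = 2 * (Vm r * (x2 r + x5 r)) \<and>
       l r * (x5 r - x2 r) = 2 * (Vn r * (x5 r - x2 r)) \<and>
       (x1 r)\<^sup>2 + (x2 r)\<^sup>2 + (x3 r)\<^sup>2 + (x4 r)\<^sup>2 + (x5 r)\<^sup>2 + (x6 r)\<^sup>2 = 1 \<and> (\<tau> r)\<^sup>2 = l r"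
    and \<tau>: "lin.quad \<tau> t0 t1 t2" and w: "lin.quad (\<lambda>r. (x1 r + x3 r) * \<tau> r) w0 w1 w2"
  shows "w1 = 0 \<longleftrightarrow> bigO (\<lambda>r. (x4 r - x1 r + (x6 r - x3 r)) * \<tau> r) 2"
proof -
  define P S A B m n where "P r = x1 r + x4 r" and "S r = x3 r + x6 r" and "A r = x4 r - x1 r" and "B r = x6 r - x3 r"
    and "m r = x2 r + x5 r" and "n r = x5 r - x2 r" for r
  have ev: "\<forall>\<^sub>F r in at_right 0. l r * P r = 2 * (Vp r * P r) + 2 * (Cpq r * S r)"
    "\<forall>\<^sub>F r in at_right 0. l r * S r = 2 * (Cpq r * P r) + 2 * (Vq r * S r)"
    "\<forall>\<^sub>F r in at_right 0. l r * A r = 2 * (Va r * A r) + 2 * (Cab r * B r)"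
    "\<forall>\<^sub>F r in at_right 0. l r * B r = 2 * (Cab r * A r) + 2 * (Vb r * B r)"
    "\<forall>\<^sub>F r in at_right 0. l r * m r = 2 * (Vm r * m r)"
    "\<forall>\<^sub>F r in at_right 0. l r * n r = 2 * (Vn r * n r)"
    "\<forall>\<^sub>F r in at_right 0. (P r)\<^sup>2 + (S r)\<^sup>2 + (A r)\<^sup>2 + (B r)\<^sup>2 + (m r)\<^sup>2 + (n r)\<^sup>2 = 2"
    "\<forall>\<^sub>F r in at_right 0. (\<tau> r)\<^sup>2 = l r"
    by (rule eventually_mono[OF eqs], simp add: P_def S_def A_def B_def m_def n_def,
        (simp add: power2_eq_square algebra_simps; fail)?)+
  have bd: "bigO P 0" "bigO S 0" "bigO A 0" "bigO B 0" "bigO m 0" "bigO n 0"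
  proof -
    have b: "bigO f 0" if "\<forall>\<^sub>F r in at_right 0. (f r)\<^sup>2 \<le> 2" for f
    proof (rule bigoI[of _ 2])
      show "\<forall>\<^sub>F r in at_right 0. norm (f r) \<le> 2 * norm (r ^ 0)"
        using that
      proof eventually_elim
        case (elim r)
        have "(f r)\<^sup>2 \<le> 2\<^sup>2" using elim by simp
        then have "\<bar>f r\<bar> \<le> \<bar>2\<bar>" by (subst abs_le_square_iff)
        then show ?case by simp
      qed
    qed
    have le: "a \<le> 2" "b \<le> 2" "c \<le> 2" "d \<le> 2" "e \<le> 2" "f \<le> 2" if "a + b + c + d + e + f = 2" "0 \<le> a" "0 \<le> b" "0 \<le> c" "0 \<le> d" "0 \<le> e" "0 \<le> f"
      for a b c d e f :: real using that by linarith+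
    show "bigO P 0" by (rule b, use ev(7) in eventually_elim, rule le(1), assumption, simp_all)
    show "bigO S 0" by (rule b, use ev(7) in eventually_elim, rule le(2), assumption, simp_all)
    show "bigO A 0" by (rule b, use ev(7) in eventually_elim, rule le(3), assumption, simp_all)
    show "bigO B 0" by (rule b, use ev(7) in eventually_elim, rule le(4), assumption, simp_all)
    show "bigO m 0" by (rule b, use ev(7) in eventually_elim, rule le(5), assumption, simp_all)
    show "bigO n 0" by (rule b, use ev(7) in eventually_elim, rule le(6), assumption, simp_all)
  qed
  have lt: "(l \<longlongrightarrow> t0\<^sup>2) (at_right 0)"
    by (rule Lim_transform_eventually[OF tendsto_power[OF lin.quad_tendsto[OF \<tau>]] ev(8)])
  have \<tau>b: "bigO \<tau> 0" by (rule bigO_tendsto[OF lin.quad_tendsto[OF \<tau>]])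
  have O2: "bigO (\<lambda>r. 2 * (f r * g r)) 2" if "bigO f 2" "bigO g 0" for f g
    using bigO_cmult[OF bigO_mult[OF that], of 2] by simp
  have evs: "\<forall>\<^sub>F r in at_right 0. b r = a r" if "\<forall>\<^sub>F r in at_right 0. a r = b r" for a b :: "real \<Rightarrow> real"
    using that by eventually_elim simp
  note V42 = bigO_weaken[OF V4, of 2]
  have lS: "bigO (\<lambda>r. l r * S r) 2"
    by (rule bigO_cong[OF bigO_add[OF O2[OF V2(1) bd(1)] O2[OF V42 bd(2)]] evs[OF ev(2)]]) simp
  have lA: "bigO (\<lambda>r. l r * A r) 2"
    by (rule bigO_cong[OF bigO_add[OF O2[OF V2(2) bd(3)] O2[OF V2(3) bd(4)]] evs[OF ev(3)]])
  have lB: "bigO (\<lambda>r. l r * B r) 2"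
    by (rule bigO_cong[OF bigO_add[OF O2[OF V2(3) bd(3)] O2[OF V2(4) bd(4)]] evs[OF ev(4)]])
  have lm: "bigO (\<lambda>r. l r * m r) 2"
    by (rule bigO_cong[OF O2[OF V2(5) bd(5)] evs[OF ev(5)]])
  have ln: "bigO (\<lambda>r. l r * n r) 2"
    by (rule bigO_cong[OF O2[OF V2(6) bd(6)] evs[OF ev(6)]])
  have Vpl: "(Vp \<longlongrightarrow> cp) (at_right 0)"
  proof -
    have "bigO (\<lambda>r. Vp r - cp) (Suc 0)" by (rule bigO_weaken[OF Vp]) simp
    from bigO_Suc_tendsto[OF this] show ?thesis by (simp add: LIM_zero_iff)
  qed
  have w_eq: "(x1 r + x3 r) * \<tau> r = (P r + S r) / 2 * \<tau> r - (A r + B r) / 2 * \<tau> r" for r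
    by (simp add: P_def S_def A_def B_def field_simps)
  have z_eq: "(x4 r - x1 r + (x6 r - x3 r)) * \<tau> r = (A r + B r) * \<tau> r" for r by (simp add: A_def B_def)
  show ?thesis
  proof (cases "t0 = 0")
    case False
    then have t0: "t0\<^sup>2 \<noteq> 0" by simp
    have S: "bigO S 2" and A: "bigO A 2" and B: "bigO B 2" and mm: "bigO m 2" and nn: "bigO n 2"
      by (rule bigO_divide[OF lS lt t0] bigO_divide[OF lA lt t0] bigO_divide[OF lB lt t0] bigO_divide[OF lm lt t0] bigO_divide[OF ln lt t0])+
    have z: "bigO (\<lambda>r. (A r + B r) * \<tau> r) 2" using bigO_mult[OF bigO_add[OF A B] \<tau>b] by simp
    have sq: "bigO (\<lambda>r. (f r)\<^sup>2) 2" if "bigO f 2" for f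
      using bigO_weaken[OF bigO_mult[OF that that], of 2] by (simp add: power2_eq_square)
    have "bigO (\<lambda>r. (S r)\<^sup>2 + (A r)\<^sup>2 + (B r)\<^sup>2 + (m r)\<^sup>2 + (n r)\<^sup>2) 2"
      by (intro bigO_add sq S A B mm nn)
    from bigO_cmult[OF this, of "- 1"] have P2: "bigO (\<lambda>r. (P r)\<^sup>2 - 2) 2"
      by (rule bigO_cong) (use ev(7) in eventually_elim, simp)
    have P2l: "((\<lambda>r. (P r)\<^sup>2) \<longlongrightarrow> 2) (at_right 0)"
      using bigO_Suc_tendsto[OF bigO_weaken[OF P2, of "Suc 0"]] by (simp add: LIM_zero_iff)
    have "bigO (\<lambda>r. 2 * (Cpq r * S r) * P r) 2"
      using bigO_mult[OF O2[OF V2(1) bd(2)] bd(1)] by simp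
    then have "bigO (\<lambda>r. (P r)\<^sup>2 * (l r - 2 * Vp r)) 2"
      by (rule bigO_cong) (use ev(1) in eventually_elim, simp add: power2_eq_square algebra_simps)
    from bigO_divide[OF this P2l] have l1: "bigO (\<lambda>r. l r - 2 * Vp r) 2" by simp
    from bigO_add[OF l1 bigO_cmult[OF Vp, of 2]] have l2: "bigO (\<lambda>r. l r - 2 * cp) 2"
      by (simp add: algebra_simps)
    define e where "e r = S r / 2 * \<tau> r - (A r + B r) / 2 * \<tau> r" for r
    have "bigO (\<lambda>r. (1 / 2) * (S r * \<tau> r) - (1 / 2) * ((A r + B r) * \<tau> r)) 2"
      by (intro bigO_diff bigO_cmult z) (use bigO_mult[OF S \<tau>b] in simp)
    then have e: "bigO e 2" unfolding e_def[abs_def] by simp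
    have "bigO (\<lambda>r. (1 / 4) * (((P r)\<^sup>2 - 2) * l r + 2 * (l r - 2 * cp)) + (P r * \<tau> r) * e r + (e r)\<^sup>2) 2"
    proof (intro bigO_add bigO_cmult sq e l2)
      show "bigO (\<lambda>r. ((P r)\<^sup>2 - 2) * l r) 2" using bigO_mult[OF P2 bigO_tendsto[OF lt]] by simp
      show "bigO (\<lambda>r. P r * \<tau> r * e r) 2" using bigO_mult[OF bigO_mult[OF bd(1) \<tau>b] e] by (simp only: add_0)
    qed
    then have "bigO (\<lambda>r. ((x1 r + x3 r) * \<tau> r)\<^sup>2 - cp) 2"
    proof (rule bigO_cong)
      show "\<forall>\<^sub>F r in at_right 0. (1 / 4) * (((P r)\<^sup>2 - 2) * l r + 2 * (l r - 2 * cp)) + (P r * \<tau> r) * e r + (e r)\<^sup>2 = ((x1 r + x3 r) * \<tau> r)\<^sup>2 - cp"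
        using ev(8)
      proof eventually_elim
        case (elim r)
        have we: "(x1 r + x3 r) * \<tau> r = P r / 2 * \<tau> r + e r" unfolding w_eq e_def by (simp add: field_simps)
        show ?case unfolding we elim[symmetric] by (simp add: power2_eq_square field_simps)
      qed
    qed
    from bigO2_quad_coeff[OF this lin.quad_diff[OF lin.quad_power2[OF w] lin.quad_const[of cp]]]
    have "w0 * w0 = cp" "w0 * w1 + w1 * w0 = 0" by simp_all
    then have "w1 = 0" using cp by auto
    then show ?thesis using z by (simp add: z_eq)
  next
    case True
    from \<tau> True have "((\<lambda>r. \<tau> r / r ^ 1) \<longlongrightarrow> t1) (at_right 0)" using lin.quad_ratio[OF \<tau>] by simp
    then have \<tau>1: "bigO \<tau> 1" by (rule bigO_ratio)
    have l0: "(l \<longlongrightarrow> 0) (at_right 0)" using lt True by simp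
    have "((\<lambda>r. 2 * Vp r - l r) \<longlongrightarrow> 2 * cp - 0) (at_right 0)" by (intro tendsto_intros Vpl l0)
    then have lim: "((\<lambda>r. 2 * Vp r - l r) \<longlongrightarrow> 2 * cp) (at_right 0)" by simp
    have "bigO (\<lambda>r. - 1 * (2 * (Cpq r * S r))) 2" by (rule bigO_cmult[OF O2[OF V2(1) bd(2)]])
    then have "bigO (\<lambda>r. (2 * Vp r - l r) * P r) 2"
      by (rule bigO_cong) (use ev(1) in eventually_elim, simp add: algebra_simps)
    from bigO_divide[OF this lim] cp have P: "bigO P 2" by simp
    have "bigO (\<lambda>r. 2 * (Cpq r * P r) + 2 * (Vq r * S r)) 4"
    proof (intro bigO_add bigO_cmult)
      show "bigO (\<lambda>r. Cpq r * P r) 4" using bigO_mult[OF V2(1) P] by simp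
      show "bigO (\<lambda>r. Vq r * S r) 4" using bigO_mult[OF V4 bd(2)] by simp
    qed
    from bigO_mult[OF this bd(2)] have "bigO (\<lambda>r. (2 * (Cpq r * P r) + 2 * (Vq r * S r)) * S r) (2 * 2)" by simp
    then have "bigO (\<lambda>r. (S r * \<tau> r)\<^sup>2) (2 * 2)"
      by (rule bigO_cong) (use ev(2) ev(8) in eventually_elim, simp add: power2_eq_square[of "S _"] power_mult_distrib mult_ac)
    then have S\<tau>: "bigO (\<lambda>r. S r * \<tau> r) 2" by (rule bigO_sqrt)
    have P\<tau>: "bigO (\<lambda>r. P r * \<tau> r) 2" using bigO_mult[OF P \<tau>b] by simp
    from bigO_cmult[OF bigO_add[OF P\<tau> S\<tau>], of "1/2"]
    have y: "bigO (\<lambda>r. (P r + S r) / 2 * \<tau> r) 2" by (simp add: algebra_simps add_divide_distrib)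
    have zw: "bigO (\<lambda>r. (A r + B r) * \<tau> r) 2 \<longleftrightarrow> bigO (\<lambda>r. (x1 r + x3 r) * \<tau> r) 2"
    proof
      assume "bigO (\<lambda>r. (A r + B r) * \<tau> r) 2"
      from bigO_diff[OF y bigO_cmult[OF this, of "1/2"]]
      show "bigO (\<lambda>r. (x1 r + x3 r) * \<tau> r) 2" unfolding w_eq by simp
    next
      assume "bigO (\<lambda>r. (x1 r + x3 r) * \<tau> r) 2"
      from bigO_cmult[OF bigO_diff[OF y this], of 2]
      show "bigO (\<lambda>r. (A r + B r) * \<tau> r) 2"
        by (rule bigO_cong) (auto intro!: always_eventually simp: P_def S_def A_def B_def field_simps)
    qed
    have w0: "w0 = 0"
    proof -
      have "bigO (\<lambda>r. (P r + S r) / 2 * \<tau> r - (A r + B r) / 2 * \<tau> r) 1"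
      proof (rule bigO_diff)
        show "bigO (\<lambda>r. (P r + S r) / 2 * \<tau> r) 1" by (rule bigO_weaken[OF y]) simp
        show "bigO (\<lambda>r. (A r + B r) / 2 * \<tau> r) 1"
          using bigO_cmult[OF bigO_mult[OF bigO_add[OF bd(3,4)] \<tau>1], of "1/2"] by simp
      qed
      then have "bigO (\<lambda>r. (x1 r + x3 r) * \<tau> r) (Suc 0)" unfolding w_eq by simp
      from bigO_Suc_tendsto[OF this] have "((\<lambda>r. (x1 r + x3 r) * \<tau> r) \<longlongrightarrow> 0) (at_right 0)" by simp
      from tendsto_unique[OF _ lin.quad_tendsto[OF w] this] show ?thesis by simp
    qed
    have "w1 = 0 \<longleftrightarrow> bigO (\<lambda>r. (x1 r + x3 r) * \<tau> r) 2"
      using quad_bigO2[of "\<lambda>r. (x1 r + x3 r) * \<tau> r" w2] w w0 bigO2_quad_coeff(2)[OF _ w] by auto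
    then show ?thesis using zw by (simp add: z_eq)
  qed
qed

section \<open>Existence of a diagonalisation with Taylor expansions\<close>

lemma sq_quad_divide:
  assumes "sq.quad V 0 b c"
  shows "lin.quad (\<lambda>r. V r / r\<^sup>2) b 0 c"
  unfolding lin.quad_def
  by (rule tendsto_right_transform[OF assms[unfolded sq.quad_def]]) (simp_all add: power2_eq_square field_simps)

context isotropic_gaussian_field
begin

lemma Delta_eq:
  assumes nd: "nondegenerate r"
  shows "Delta M F r = vector [
    vector [Vp r + Va r, 0, Cpq r + Cab r, Vp r - Va r, 0, Cpq r - Cab r],
    vector [0, Vm r + Vn r, 0, 0, Vm r - Vn r, 0],
    vector [Cpq r + Cab r, 0, Vq r + Vb r, Cpq r - Cab r, 0, Vq r - Vb r],
    vector [Vp r - Va r, 0, Cpq r - Cab r, Vp r + Va r, 0, Cpq r + Cab r],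
    vector [0, Vm r - Vn r, 0, 0, Vm r + Vn r, 0],
    vector [Cpq r - Cab r, 0, Vq r - Vb r, Cpq r + Cab r, 0, Vq r + Vb r]]"
proof -
  have "cond_hessian_pair M F 0 (pt r) = zeta r" using cond_hessian_pair_eq[OF nd] by (rule ext)
  then have D: "Delta M F r = cov_matrix M (zeta r) (zeta r)" by (simp add: Delta_def)
  show ?thesis
    unfolding D
    by (simp add: vec_eq_iff forall_6 cov_matrix_nth zeta_def vector_6 ip_add_left ip_add_right ip_diff_left ip_diff_right
        add_H diff_H z_H z_cov[OF nd])
qed

text \<open>
  These are variances and Cauchy-Schwarz inequalities, for all \<open>r\<close> at which the residuals are
  defined.
\<close>

lemma block_nonneg:
  assumes nd: "nondegenerate r"
  shows "0 \<le> Vp r * x\<^sup>2 + 2 * (Cpq r * (x * y)) + Vq r * y\<^sup>2"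
    "0 \<le> Va r * x\<^sup>2 + 2 * (Cab r * (x * y)) + Vb r * y\<^sup>2" "0 \<le> Vm r" "0 \<le> Vn r"
    "(Cpq r)\<^sup>2 \<le> Vp r * Vq r" "(Cab r)\<^sup>2 \<le> Vb r * Va r"
proof -
  show "0 \<le> Vp r * x\<^sup>2 + 2 * (Cpq r * (x * y)) + Vq r * y\<^sup>2"
    using ip_nonneg[of "\<lambda>\<omega>. x * zp r \<omega> + y * zq r \<omega>"]
    by (simp add: ip_lincomb[OF z_H(1,2) z_H(1,2)] z_cov[OF nd] power2_eq_square algebra_simps)
  show "0 \<le> Va r * x\<^sup>2 + 2 * (Cab r * (x * y)) + Vb r * y\<^sup>2"
    using ip_nonneg[of "\<lambda>\<omega>. x * za r \<omega> + y * zb r \<omega>"]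
    by (simp add: ip_lincomb[OF z_H(3,4) z_H(3,4)] z_cov[OF nd] power2_eq_square algebra_simps)
  show "0 \<le> Vm r" "0 \<le> Vn r" using ip_nonneg[of "zm r"] ip_nonneg[of "zn r"] by (simp_all add: z_cov[OF nd])
  show "(Cpq r)\<^sup>2 \<le> Vp r * Vq r" using ip_Cauchy_Schwarz[OF z_H(1,2), of r r] by (simp add: z_cov[OF nd])
  show "(Cab r)\<^sup>2 \<le> Vb r * Va r" using ip_Cauchy_Schwarz[OF z_H(4,3), of r r] by (simp add: z_cov[OF nd])
qed

text \<open>
  In the coordinates \<open>p, q, a, b, m, n\<close> the covariance matrix consists of two blocks of size two and
  two of size one. Each block is diagonalised explicitly; the block of \<open>(a,b)\<close> tends to \<open>0\<close> and is
  divided by \<open>r\<^sup>2\<close> first. The square roots of the eigenvalues have expansions because every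
  eigenvalue vanishes to even order.
\<close>

lemma ex_expandable_diagonalisation: "\<exists>Q l. expandable_diagonalisation (Delta M F) Q l"
proof -
  define cp cb ca cab where "cp = 64 / 3 * g4" and "cb = 180 * g6 - 72 * g4\<^sup>2"
    and "ca = 36 * g6 - 8 * g4\<^sup>2" and "cab = 36 * g6 - 24 * g4\<^sup>2"
  have cp: "cp > 0" using g4_pos by (simp add: cp_def)
  obtain e1 e2 e3 e4 e5 e6 e7 e8 e9 e10 e11 where q: "sq.quad Vp cp e1 e2" "sq.quad Cpq 0 e3 e4" "sq.quad Vq 0 0 e5"
    "sq.quad Va 0 ca e6" "sq.quad Cab 0 cab e7" "sq.quad Vb 0 cb e8"
    "sq.quad Vm 0 0 e9" "sq.quad Vn 0 e10 e11"
    using quad_Vp[OF g4_pos] quad_Cpq[OF g4_pos] quad_Vq[OF g4_pos] quad_Va quad_Cab quad_Vb quad_Vm[OF g4_pos] quad_Vn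
    unfolding cp_def cb_def ca_def cab_def by auto
  \<comment> \<open>The block of \<open>(p,q)\<close>, whose limit has the distinct eigenvalues \<open>cp\<close> and \<open>0\<close>.\<close>
  have pos1: "(cp - 0) + sqrt ((cp - 0)\<^sup>2 + 4 * 0\<^sup>2) > 0" using cp by simp
  from sq.symmetric2_diagonalisation[OF q(1) q(2) q(3) pos1]
  obtain c s lp lm c0 c1 c2 s0 s1 s2 p1 p2 where even: "sq.quad c c0 c1 c2" "sq.quad s s0 s1 s2"
    "sq.quad lp ((cp + 0 + sqrt ((cp - 0)\<^sup>2 + 4 * 0\<^sup>2)) / 2) p1 p2"
    and even_ev: "\<forall>\<^sub>F r in at_right 0. (c r)\<^sup>2 + (s r)\<^sup>2 = 1 \<and> Vp r = lp r * (c r)\<^sup>2 + lm r * (s r)\<^sup>2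
        \<and> Cpq r = (lp r - lm r) * (c r * s r) \<and> Vq r = lp r * (s r)\<^sup>2 + lm r * (c r)\<^sup>2
        \<and> lp r * lm r = Vp r * Vq r - (Cpq r)\<^sup>2" by blast
  have lp: "sq.quad lp cp p1 p2" using even(3) cp by simp
  have lp_ne: "\<forall>\<^sub>F r in at_right 0. lp r \<noteq> 0"
    by (rule tendsto_imp_eventually_ne[OF sq.quad_tendsto[OF lp]]) (use cp in simp)
  have "\<exists>k. sq.quad lm 0 0 k"
  proof -
    note d = sq.quad_divide[OF sq.quad_diff[OF sq.quad_mult[OF q(1,3)] sq.quad_power2[OF q(2)]] lp]
    have "\<exists>k. sq.quad (\<lambda>r. (Vp r * Vq r - (Cpq r)\<^sup>2) / lp r) 0 0 k"
      using d cp by auto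
    then obtain k where k: "sq.quad (\<lambda>r. (Vp r * Vq r - (Cpq r)\<^sup>2) / lp r) 0 0 k" ..
    have "sq.quad lm 0 0 k"
    proof (rule sq.quad_cong_ev[OF k])
      show "\<forall>\<^sub>F r in at_right 0. (Vp r * Vq r - (Cpq r)\<^sup>2) / lp r = lm r"
        using even_ev lp_ne
      proof eventually_elim
        case (elim r)
        then have "Vp r * Vq r - (Cpq r)\<^sup>2 = lp r * lm r" by simp
        then show ?case using elim(2) by simp
      qed
    qed
    then show ?thesis by blast
  qed
  then obtain k where lm: "sq.quad lm 0 0 k" by blast
  \<comment> \<open>The block of \<open>(b,a)\<close> divided by \<open>r\<^sup>2\<close>. If its diagonal entries have the same limit, then
    \<open>9 g\<^sub>6 = 4 g\<^sub>4\<^sup>2\<close>, and the off-diagonal entry has a nonzero limit: either way the eigenvalues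
    of the limit are distinct.\<close>
  have pos2: "(cb - ca) + sqrt ((cb - ca)\<^sup>2 + 4 * cab\<^sup>2) > 0"
  proof -
    have d: "cb - ca = 16 * (9 * g6 - 4 * g4\<^sup>2)" by (simp add: cb_def ca_def)
    then have d0: "0 \<le> cb - ca" using g6_bound by simp
    show ?thesis
    proof (cases "cb - ca = 0")
      case True
      then have "cab = - 8 * g4\<^sup>2" unfolding d cab_def by simp
      then have "cab \<noteq> 0" using g4_pos by simp
      then have "0 < 4 * cab\<^sup>2" by simp
      then show ?thesis using True by simp
    next
      case False
      then have "0 < cb - ca" using d0 by simp
      then show ?thesis by (intro add_pos_nonneg) auto
    qed
  qed
  note odd_q = sq_quad_divide[OF q(6)] sq_quad_divide[OF q(5)] sq_quad_divide[OF q(4)]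
  from lin.symmetric2_diagonalisation[OF odd_q pos2]
  obtain c' s' lp' lm' c0' c1' c2' s0' s1' s2' p1' p2' where odd: "lin.quad c' c0' c1' c2'" "lin.quad s' s0' s1' s2'"
    "lin.quad lp' ((cb + ca + sqrt ((cb - ca)\<^sup>2 + 4 * cab\<^sup>2)) / 2) p1' p2'"
    and odd_ev: "\<forall>\<^sub>F r in at_right 0. (c' r)\<^sup>2 + (s' r)\<^sup>2 = 1 \<and> Vb r / r\<^sup>2 = lp' r * (c' r)\<^sup>2 + lm' r * (s' r)\<^sup>2
        \<and> Cab r / r\<^sup>2 = (lp' r - lm' r) * (c' r * s' r) \<and> Va r / r\<^sup>2 = lp' r * (s' r)\<^sup>2 + lm' r * (c' r)\<^sup>2
        \<and> lp' r * lm' r = Vb r / r\<^sup>2 * (Va r / r\<^sup>2) - (Cab r / r\<^sup>2)\<^sup>2" by blast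
  define L0 where "L0 = (cb + ca + sqrt ((cb - ca)\<^sup>2 + 4 * cab\<^sup>2)) / 2"
  have ca0: "ca \<ge> 0"
  proof -
    have "((\<lambda>r. Va r / r\<^sup>2) \<longlongrightarrow> ca) (at_right 0)" by (rule lin.quad_tendsto[OF odd_q(3)])
    then show ?thesis
      by (rule tendsto_lowerbound) (use ev_nondegenerate in \<open>eventually_elim, use block_nonneg(2)[of _ 1 0] in simp\<close>, simp)
  qed
  have L0: "L0 > 0" using pos2 ca0 by (simp add: L0_def)
  have lp': "lin.quad lp' L0 p1' p2'" using odd(3) by (simp add: L0_def)
  have lp'_pos: "\<forall>\<^sub>F r in at_right 0. lp' r > 0"
    by (rule order_tendstoD(1)[OF lin.quad_tendsto[OF lp'] L0])
  have lm'_nn: "\<forall>\<^sub>F r in at_right 0. 0 \<le> lm' r"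
    using odd_ev lp'_pos ev_nondegenerate
  proof eventually_elim
    case (elim r)
    have r: "r > 0" using elim(3) by (simp add: nondegenerate_def)
    have "lp' r * lm' r = (Vb r * Va r - (Cab r)\<^sup>2) / (r\<^sup>2)\<^sup>2"
      using elim(1) r by (simp add: power_divide diff_divide_distrib power2_eq_square)
    also have "\<dots> \<ge> 0" using block_nonneg(6)[OF elim(3)] by simp
    finally show ?case using elim(2) by (simp add: zero_le_mult_iff)
  qed
  have "\<exists>m0 m1 m2. lin.quad lm' m0 m1 m2 \<and> (m0 = 0 \<longrightarrow> m1 = 0)"
  proof -
    have L0': "L0 \<noteq> 0" using L0 by simp
    note d = lin.quad_divide[OF lin.quad_diff[OF lin.quad_mult[OF odd_q(1,3)] lin.quad_power2[OF odd_q(2)]] lp' L0']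
    have "\<exists>m0 m1 m2. lin.quad (\<lambda>r. (Vb r / r\<^sup>2 * (Va r / r\<^sup>2) - (Cab r / r\<^sup>2)\<^sup>2) / lp' r) m0 m1 m2 \<and> (m0 = 0 \<longrightarrow> m1 = 0)"
      by (intro exI conjI, rule d) (use L0 in auto)
    then obtain m0 m1 m2 where m: "lin.quad (\<lambda>r. (Vb r / r\<^sup>2 * (Va r / r\<^sup>2) - (Cab r / r\<^sup>2)\<^sup>2) / lp' r) m0 m1 m2" "m0 = 0 \<longrightarrow> m1 = 0"
      by blast
    have "lin.quad lm' m0 m1 m2"
    proof (rule lin.quad_cong_ev[OF m(1)])
      show "\<forall>\<^sub>F r in at_right 0. (Vb r / r\<^sup>2 * (Va r / r\<^sup>2) - (Cab r / r\<^sup>2)\<^sup>2) / lp' r = lm' r"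
        using odd_ev lp'_pos
      proof eventually_elim
        case (elim r)
        from elim(1) have "lp' r * lm' r = Vb r / r\<^sup>2 * (Va r / r\<^sup>2) - (Cab r / r\<^sup>2)\<^sup>2" by (elim conjE)
        then show ?case using elim(2) by (metis less_irrefl nonzero_mult_div_cancel_left)
      qed
    qed
    then show ?thesis using m(2) by blast
  qed
  then obtain m0 m1 m2 where lm': "lin.quad lm' m0 m1 m2" "m0 = 0 \<Longrightarrow> m1 = 0" by blast
  \<comment> \<open>The limits of \<open>lp\<close> and \<open>lp'\<close> are positive, \<open>Vm\<close> and \<open>lm\<close> are \<open>O(r\<^sup>4)\<close>, and \<open>lm'\<close> and \<open>Vn / r\<^sup>2\<close>
    have no linear term if their limit is \<open>0\<close>.\<close>
  have r1: "\<exists>a b c. lin.quad (\<lambda>r. sqrt (2 * lp r)) a b c"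
    using lin.quad_sqrt[OF lin.quad_cmult[OF sq_quad_imp_lin_quad[OF lp], of 2]] cp by auto
  have r2: "\<exists>a b c. lin.quad (\<lambda>r. sqrt (2 * Vm r)) a b c"
    using sqrt_order4[of "\<lambda>r. 2 * Vm r" "2 * e9"] sq.quad_cmult[OF q(7), of 2] by auto
  have r3: "\<exists>a b c. lin.quad (\<lambda>r. sqrt (2 * lm r)) a b c"
    using sqrt_order4[of "\<lambda>r. 2 * lm r" "2 * k"] sq.quad_cmult[OF lm, of 2] by auto
  have rr: "\<exists>a b c. lin.quad (\<lambda>r. sqrt (2 * r\<^sup>2 * w r)) a b c"
    if w: "lin.quad w m0 m1 m2" "m0 = 0 \<Longrightarrow> m1 = 0" "\<forall>\<^sub>F r in at_right 0. 0 \<le> w r" for w m0 m1 m2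
  proof -
    have "\<exists>b c. lin.quad (\<lambda>r. r * sqrt (2 * w r)) 0 b c"
      by (rule sqrt_order2[OF lin.quad_cmult[OF w(1), of 2]]) (use w in auto)
    then obtain b c where bc: "lin.quad (\<lambda>r. r * sqrt (2 * w r)) 0 b c" by blast
    have "\<forall>\<^sub>F r in at_right 0. r * sqrt (2 * w r) = sqrt (2 * r\<^sup>2 * w r)"
      by (rule pos_eventually) (simp add: real_sqrt_mult)
    from lin.quad_cong_ev[OF bc this] show ?thesis by blast
  qed
  have r4: "\<exists>a b c. lin.quad (\<lambda>r. sqrt (2 * r\<^sup>2 * lp' r)) a b c"
    by (rule rr[OF lp']) (use L0 lp'_pos in \<open>auto elim: eventually_mono\<close>)
  have r6: "\<exists>a b c. lin.quad (\<lambda>r. sqrt (2 * r\<^sup>2 * lm' r)) a b c"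
    by (rule rr[OF lm' lm'_nn])
  have "\<exists>a b c. lin.quad (\<lambda>r. sqrt (2 * r\<^sup>2 * (Vn r / r\<^sup>2))) a b c"
    by (rule rr[OF sq_quad_divide[OF q(8)]]) (use ev_nondegenerate in \<open>simp_all add: eventually_mono[OF ev_nondegenerate] block_nonneg\<close>)
  then obtain a5 b5 c5 where t5: "lin.quad (\<lambda>r. sqrt (2 * r\<^sup>2 * (Vn r / r\<^sup>2))) a5 b5 c5" by blast
  have "\<forall>\<^sub>F r in at_right 0. sqrt (2 * r\<^sup>2 * (Vn r / r\<^sup>2)) = sqrt (2 * Vn r)"
    by (rule pos_eventually) simp
  from lin.quad_cong_ev[OF t5 this] have r5: "\<exists>a b c. lin.quad (\<lambda>r. sqrt (2 * Vn r)) a b c" by blast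
  \<comment> \<open>An eigenvector \<open>y\<close> of a block of half sums gives the eigenvector \<open>(y,y) / \<surd>2\<close> of the whole matrix,
      and one of a block of half differences gives \<open>(-y,y) / \<surd>2\<close>; the eigenvalues are doubled.\<close>
  define h where "h = sqrt (1 / 2 :: real)"
  have hh: "h * h = 1 / 2" by (simp add: h_def)
  have hx: "h * (h * x) = x / 2" for x by (simp add: mult.assoc[symmetric] hh)
  define l :: "real \<Rightarrow> real ^ 6" where "l r = vector [2 * lp r, 2 * Vm r, 2 * lm r, 2 * r\<^sup>2 * lp' r, 2 * Vn r, 2 * r\<^sup>2 * lm' r]" for r
  define Cc Ss Cc' Ss' where "Cc r = h * c r" and "Ss r = h * s r" and "Cc' r = h * c' r" and "Ss' r = h * s' r" for r
  define Q :: "real \<Rightarrow> real ^ 6 ^ 6" where "Q r = vector [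
    vector [Cc r, 0, - Ss r, - Ss' r, 0, - Cc' r],
    vector [0, h, 0, 0, - h, 0],
    vector [Ss r, 0, Cc r, - Cc' r, 0, Ss' r],
    vector [Cc r, 0, - Ss r, Ss' r, 0, Cc' r],
    vector [0, h, 0, 0, h, 0],
    vector [Ss r, 0, Cc r, Cc' r, 0, - Ss' r]]" for r
  have "expandable_diagonalisation (Delta M F) Q l"
    unfolding expandable_diagonalisation_def
  proof (intro conjI)
    show "\<forall>\<^sub>F r in at_right 0. orthogonal_matrix (Q r) \<and> Delta M F r = Q r ** diag_matrix (l r) ** transpose (Q r)"
      using even_ev odd_ev ev_nondegenerate
    proof eventually_elim
      case (elim r)
      have r: "r > 0" using elim(3) by (simp add: nondegenerate_def)
      have sc: "h * x * (h * y) = x * y / 2" for x y :: real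
        using hh by (metis (no_types) mult.assoc mult.commute mult.left_commute mult_1 times_divide_eq_left)
      have o: "Cc r * Cc r + Ss r * Ss r = 1 / 2" "Cc' r * Cc' r + Ss' r * Ss' r = 1 / 2"
        using elim(1,2) unfolding Cc_def Ss_def Cc'_def Ss'_def sc by (simp_all add: power2_eq_square flip: add_divide_distrib)
      have v: "Vp r = 2 * (lp r * (Cc r * Cc r)) + 2 * (lm r * (Ss r * Ss r))"
        "Cpq r = 2 * (lp r * (Cc r * Ss r)) - 2 * (lm r * (Cc r * Ss r))"
        "Vq r = 2 * (lp r * (Ss r * Ss r)) + 2 * (lm r * (Cc r * Cc r))"
        using elim(1) unfolding Cc_def Ss_def sc by (simp_all add: power2_eq_square algebra_simps)
      have Vr: "Vb r = r\<^sup>2 * (lp' r * (c' r)\<^sup>2 + lm' r * (s' r)\<^sup>2)" "Cab r = r\<^sup>2 * ((lp' r - lm' r) * (c' r * s' r))"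
        "Va r = r\<^sup>2 * (lp' r * (s' r)\<^sup>2 + lm' r * (c' r)\<^sup>2)"
        using elim(2) r by (simp_all add: field_simps)
      have v': "Vb r = 2 * (r\<^sup>2 * (lp' r * (Cc' r * Cc' r))) + 2 * (r\<^sup>2 * (lm' r * (Ss' r * Ss' r)))"
        "Cab r = 2 * (r\<^sup>2 * (lp' r * (Cc' r * Ss' r))) - 2 * (r\<^sup>2 * (lm' r * (Cc' r * Ss' r)))"
        "Va r = 2 * (r\<^sup>2 * (lp' r * (Ss' r * Ss' r))) + 2 * (r\<^sup>2 * (lm' r * (Cc' r * Cc' r)))"
        unfolding Vr Cc'_def Ss'_def sc by (simp_all add: power2_eq_square algebra_simps)
      have "orthogonal_matrix (Q r)"
        unfolding orthogonal_matrix
        by (simp add: vec_eq_iff forall_6 matrix_matrix_mult_def transpose_def sum_6 Q_def vector_6 mat_def hh)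
           (use o in \<open>simp add: mult.commute; linarith\<close>)
      moreover have "Delta M F r = Q r ** diag_matrix (l r) ** transpose (Q r)"
        unfolding Delta_eq[OF elim(3)] v v'
        by (simp add: vec_eq_iff forall_6 matrix_matrix_mult_def transpose_def sum_6 Q_def vector_6 diag_matrix_def l_def)
           (simp add: algebra_simps hx)
      ultimately show ?case by blast
    qed
    have cs: "\<exists>a b c. lin.quad Cc a b c" "\<exists>a b c. lin.quad Ss a b c" "\<exists>a b c. lin.quad Cc' a b c" "\<exists>a b c. lin.quad Ss' a b c"
      unfolding Cc_def[abs_def] Ss_def[abs_def] Cc'_def[abs_def] Ss'_def[abs_def]
      using lin.quad_cmult[OF sq_quad_imp_lin_quad[OF even(1)], of h] lin.quad_cmult[OF sq_quad_imp_lin_quad[OF even(2)], of h]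
        lin.quad_cmult[OF odd(1), of h] lin.quad_cmult[OF odd(2), of h] by blast+
    have mn: "\<exists>a b c. lin.quad (\<lambda>r. - f r) a b c" if "\<exists>a b c. lin.quad f a b c" for f
      using that lin.quad_minus by blast
    have cn: "\<exists>a b c. lin.quad (\<lambda>_. k) a b c" for k using lin.quad_const by blast
    show "\<forall>i j. \<exists>a0 a1 a2. has_taylor2 (\<lambda>r. Q r $ i $ j) a0 a1 a2"
      unfolding has_taylor2_iff_quad forall_6 Q_def vector_6
      by (intro conjI cs mn[OF cs(1)] mn[OF cs(2)] mn[OF cs(3)] mn[OF cs(4)] cn)
    show "\<forall>i j. \<exists>a0 a1 a2. has_taylor2 (\<lambda>r. sqrt_diag_matrix (l r) $ i $ j) a0 a1 a2"
    proof (intro allI)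
      fix i j :: 6
      have "\<forall>i. \<exists>a b c. lin.quad (\<lambda>r. sqrt (l r $ i)) a b c"
        unfolding forall_6 l_def vector_6 by (intro conjI r1 r2 r3 r4 r5 r6)
      then show "\<exists>a0 a1 a2. has_taylor2 (\<lambda>r. sqrt_diag_matrix (l r) $ i $ j) a0 a1 a2"
        unfolding has_taylor2_iff_quad using cn[of 0] by (cases "i = j") (simp_all add: sqrt_diag_matrix_def diag_matrix_def)
    qed
  qed
  then show ?thesis by blast
qed

end

section \<open>Vanishing of the linear coefficient\<close>

context isotropic_gaussian_field
begin

text \<open>
  The columns of \<open>Q\<close> are eigenvectors; taking sums and differences of their two halves separates the
  blocks. The last equation is Parseval's identity for the variance of \<open>2 D\<close>.
\<close>

lemma diagonalisation_columns:
  assumes nd: "nondegenerate r" and orth: "orthogonal_matrix Q"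
    and D: "Delta M F r = Q ** diag_matrix l ** transpose Q"
  defines "x \<equiv> \<lambda>i k. Q $ i $ k"
  shows "l $ k * (x 1 k + x 4 k) = 2 * (Vp r * (x 1 k + x 4 k)) + 2 * (Cpq r * (x 3 k + x 6 k))"
    "l $ k * (x 3 k + x 6 k) = 2 * (Cpq r * (x 1 k + x 4 k)) + 2 * (Vq r * (x 3 k + x 6 k))"
    "l $ k * (x 4 k - x 1 k) = 2 * (Va r * (x 4 k - x 1 k)) + 2 * (Cab r * (x 6 k - x 3 k))"
    "l $ k * (x 6 k - x 3 k) = 2 * (Cab r * (x 4 k - x 1 k)) + 2 * (Vb r * (x 6 k - x 3 k))"
    "l $ k * (x 2 k + x 5 k) = 2 * (Vm r * (x 2 k + x 5 k))"
    "l $ k * (x 5 k - x 2 k) = 2 * (Vn r * (x 5 k - x 2 k))"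
    "(x 1 k)\<^sup>2 + (x 2 k)\<^sup>2 + (x 3 k)\<^sup>2 + (x 4 k)\<^sup>2 + (x 5 k)\<^sup>2 + (x 6 k)\<^sup>2 = 1"
    "0 \<le> l $ k"
    "(\<Sum>k\<in>UNIV. (x 4 k - x 1 k + (x 6 k - x 3 k))\<^sup>2 * l $ k) = 4 * VD r"
proof -
  have QQ: "transpose Q ** Q = mat 1" using orth by (simp add: orthogonal_matrix)
  have "Delta M F r ** Q = Q ** diag_matrix l ** (transpose Q ** Q)"
    unfolding D by (simp add: matrix_mul_assoc)
  then have DQ: "Delta M F r ** Q = Q ** diag_matrix l" by (simp add: QQ)
  have e: "(\<Sum>j\<in>UNIV. Delta M F r $ i $ j * x j k) = x i k * l $ k" for i k
  proof -
    have "(Delta M F r ** Q) $ i $ k = (Q ** diag_matrix l) $ i $ k" by (simp only: DQ)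
    then show ?thesis by (simp add: matrix_matrix_mult_def diag_matrix_def x_def if_distrib cong: if_cong)
  qed
  note E = e[unfolded sum_6 Delta_eq[OF nd] vector_6]
  show 1: "l $ k * (x 1 k + x 4 k) = 2 * (Vp r * (x 1 k + x 4 k)) + 2 * (Cpq r * (x 3 k + x 6 k))"
    using E[of 1 k] E[of 4 k] unfolding vector_6 by (simp add: algebra_simps)
  show 2: "l $ k * (x 3 k + x 6 k) = 2 * (Cpq r * (x 1 k + x 4 k)) + 2 * (Vq r * (x 3 k + x 6 k))"
    using E[of 3 k] E[of 6 k] unfolding vector_6 by (simp add: algebra_simps)
  show 3: "l $ k * (x 4 k - x 1 k) = 2 * (Va r * (x 4 k - x 1 k)) + 2 * (Cab r * (x 6 k - x 3 k))"
    using E[of 1 k] E[of 4 k] unfolding vector_6 by (simp add: algebra_simps)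
  show 4: "l $ k * (x 6 k - x 3 k) = 2 * (Cab r * (x 4 k - x 1 k)) + 2 * (Vb r * (x 6 k - x 3 k))"
    using E[of 3 k] E[of 6 k] unfolding vector_6 by (simp add: algebra_simps)
  show 5: "l $ k * (x 2 k + x 5 k) = 2 * (Vm r * (x 2 k + x 5 k))"
    using E[of 2 k] E[of 5 k] unfolding vector_6 by (simp add: algebra_simps)
  show 6: "l $ k * (x 5 k - x 2 k) = 2 * (Vn r * (x 5 k - x 2 k))"
    using E[of 2 k] E[of 5 k] unfolding vector_6 by (simp add: algebra_simps)
  have "(transpose Q ** Q) $ k $ k = 1" by (simp add: QQ mat_def)
  then show n: "(x 1 k)\<^sup>2 + (x 2 k)\<^sup>2 + (x 3 k)\<^sup>2 + (x 4 k)\<^sup>2 + (x 5 k)\<^sup>2 + (x 6 k)\<^sup>2 = 1"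
    by (simp add: matrix_matrix_mult_def transpose_def sum_6 x_def power2_eq_square)
  define P S A B m n where "P = x 1 k + x 4 k" and "S = x 3 k + x 6 k" and "A = x 4 k - x 1 k" and "B = x 6 k - x 3 k"
    and "m = x 2 k + x 5 k" and "n = x 5 k - x 2 k"
  note d = P_def[symmetric] S_def[symmetric] A_def[symmetric] B_def[symmetric] m_def[symmetric] n_def[symmetric]
  have n2: "P\<^sup>2 + S\<^sup>2 + A\<^sup>2 + B\<^sup>2 + m\<^sup>2 + n\<^sup>2 = 2"
    using n by (simp add: P_def S_def A_def B_def m_def n_def power2_eq_square algebra_simps)
  have "2 * l $ k = l $ k * (P\<^sup>2 + S\<^sup>2 + A\<^sup>2 + B\<^sup>2 + m\<^sup>2 + n\<^sup>2)" unfolding n2 by simp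
  also have "\<dots> = (l $ k * P) * P + (l $ k * S) * S + (l $ k * A) * A + (l $ k * B) * B + (l $ k * m) * m + (l $ k * n) * n"
    by (simp add: power2_eq_square algebra_simps)
  also have "\<dots> = 2 * (Vp r * P\<^sup>2 + 2 * (Cpq r * (P * S)) + Vq r * S\<^sup>2) + 2 * (Va r * A\<^sup>2 + 2 * (Cab r * (A * B)) + Vb r * B\<^sup>2)
       + 2 * (Vm r * m\<^sup>2) + 2 * (Vn r * n\<^sup>2)"
    unfolding 1[unfolded d] 2[unfolded d] 3[unfolded d] 4[unfolded d] 5[unfolded d] 6[unfolded d]
    by (simp add: power2_eq_square algebra_simps)
  also have "\<dots> \<ge> 0"
    using block_nonneg(1)[OF nd, of P S] block_nonneg(2)[OF nd, of A B] block_nonneg(3,4)[OF nd] by simp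
  finally show "0 \<le> l $ k" by simp
  have "(\<Sum>k\<in>UNIV. (x 4 k - x 1 k + (x 6 k - x 3 k))\<^sup>2 * l $ k)
     = (\<Sum>k\<in>UNIV. (x 4 k - x 1 k + (x 6 k - x 3 k)) * (x 4 k * l $ k - x 1 k * l $ k + (x 6 k * l $ k - x 3 k * l $ k)))"
    by (intro sum.cong) (simp_all add: power2_eq_square algebra_simps)
  also have "\<dots> = (\<Sum>k\<in>UNIV. (x 4 k - x 1 k + (x 6 k - x 3 k)) * (2 * (Va r + Cab r) * (x 4 k - x 1 k) + 2 * (Cab r + Vb r) * (x 6 k - x 3 k)))"
  proof (intro sum.cong refl)
    fix k
    have "x 4 k * l $ k - x 1 k * l $ k = 2 * (Va r * (x 4 k - x 1 k)) + 2 * (Cab r * (x 6 k - x 3 k))"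
      unfolding E[symmetric] vector_6 by (simp add: algebra_simps)
    moreover have "x 6 k * l $ k - x 3 k * l $ k = 2 * (Cab r * (x 4 k - x 1 k)) + 2 * (Vb r * (x 6 k - x 3 k))"
      unfolding E[symmetric] vector_6 by (simp add: algebra_simps)
    ultimately show "(x 4 k - x 1 k + (x 6 k - x 3 k)) * (x 4 k * l $ k - x 1 k * l $ k + (x 6 k * l $ k - x 3 k * l $ k))
       = (x 4 k - x 1 k + (x 6 k - x 3 k)) * (2 * (Va r + Cab r) * (x 4 k - x 1 k) + 2 * (Cab r + Vb r) * (x 6 k - x 3 k))"
      by (simp only:) (simp add: algebra_simps)
  qed
  also have "\<dots> = 4 * VD r"
  proof -
    have QQt: "Q ** transpose Q = mat 1" using orth by (simp add: orthogonal_matrix_def)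
    have xx: "(\<Sum>k\<in>UNIV. x i k * x j k) = (if i = j then 1 else 0)" for i j
    proof -
      have "(Q ** transpose Q) $ i $ j = (if i = j then 1 else 0)" by (simp add: QQt mat_def)
      then show ?thesis by (simp add: matrix_matrix_mult_def transpose_def x_def)
    qed
    define \<alpha> \<beta> where "\<alpha> = 2 * (Va r + Cab r)" and "\<beta> = 2 * (Cab r + Vb r)"
    have "(\<Sum>k\<in>UNIV. (x 4 k - x 1 k + (x 6 k - x 3 k)) * (\<alpha> * (x 4 k - x 1 k) + \<beta> * (x 6 k - x 3 k)))
      = (\<Sum>k\<in>UNIV. \<alpha> * (x 4 k * x 4 k) + \<alpha> * (x 1 k * x 1 k) - 2 * \<alpha> * (x 4 k * x 1 k) + \<beta> * (x 6 k * x 6 k) + \<beta> * (x 3 k * x 3 k)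
          - 2 * \<beta> * (x 6 k * x 3 k) + (\<alpha> + \<beta>) * (x 4 k * x 6 k) - (\<alpha> + \<beta>) * (x 4 k * x 3 k) - (\<alpha> + \<beta>) * (x 1 k * x 6 k) + (\<alpha> + \<beta>) * (x 1 k * x 3 k))"
      by (intro sum.cong refl) (simp add: algebra_simps)
    also have "\<dots> = 2 * \<alpha> + 2 * \<beta>"
      unfolding sum.distrib sum_subtractf sum_distrib_left[symmetric] xx by simp
    also have "\<dots> = 4 * VD r" by (simp add: \<alpha>_def \<beta>_def VD_def)
    finally show ?thesis by (simp only: \<alpha>_def \<beta>_def)
  qed
  finally show "(\<Sum>k\<in>UNIV. (x 4 k - x 1 k + (x 6 k - x 3 k))\<^sup>2 * l $ k) = 4 * VD r" .
qed

text \<open>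
  By \<open>b1_eq\<close>, the form \<open>b\<close> vanishes if and only if no column contributes a linear term, which means
  that all the components \<open>z k\<close> of \<open>2 D\<close> are \<open>O(r\<^sup>2)\<close>. Their squares sum to \<open>4 Var D\<close>, so that this
  holds if and only if \<open>Var D\<close> is \<open>O(r\<^sup>4)\<close>.
\<close>

lemma is_b11_eq_0_iff:
  assumes b: "is_b11 M F b"
  shows "b = (\<lambda>_. 0) \<longleftrightarrow> 9 * g6 = 4 * g4\<^sup>2"
proof -
  from b obtain Q l b10 b12 where ex: "expandable_diagonalisation (Delta M F) Q l" and lin: "linear b"
    and tay: "\<And>\<xi>. has_taylor2 (\<lambda>r. b1 (Q r) (l r) \<xi>) (b10 \<xi>) (b \<xi>) (b12 \<xi>)"
    unfolding is_b11_def by blast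
  obtain e1 e2 e3 e4 e5 ca e6 cab e7 cb e8 e9 e10 e11 where q: "sq.quad Vp (64 / 3 * g4) e1 e2" "sq.quad Cpq 0 e3 e4" "sq.quad Vq 0 0 e5"
    "sq.quad Va 0 ca e6" "sq.quad Cab 0 cab e7" "sq.quad Vb 0 cb e8" "sq.quad Vm 0 0 e9" "sq.quad Vn 0 e10 e11"
    using quad_Vp[OF g4_pos] quad_Cpq[OF g4_pos] quad_Vq[OF g4_pos] quad_Va quad_Cab quad_Vb quad_Vm[OF g4_pos] quad_Vn by auto
  note O2 = quad_bigO2[OF sq_quad_imp_lin_quad]
  have Vp: "bigO (\<lambda>r. Vp r - 64 / 3 * g4) 2"
    using quad_bigO2[OF lin.quad_diff[OF sq_quad_imp_lin_quad[OF q(1)] lin.quad_const[of "64 / 3 * g4"], simplified]] by simp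
  have Vq4: "bigO Vq 4"
    by (rule bigO_ratio[of _ _ e5]) (use q(3) in \<open>simp add: sq.quad_def\<close>)
  define z where "z k r = (Q r $ 4 $ k - Q r $ 1 $ k + (Q r $ 6 $ k - Q r $ 3 $ k)) * sqrt (l r $ k)" for k r
  have ev: "\<forall>\<^sub>F r in at_right 0. nondegenerate r \<and> orthogonal_matrix (Q r) \<and> Delta M F r = Q r ** diag_matrix (l r) ** transpose (Q r)"
    using ex ev_nondegenerate unfolding expandable_diagonalisation_def by (auto intro: eventually_conj)
  have key: "b (axis k 1) = 0 \<longleftrightarrow> bigO (z k) 2" for k
  proof -
    have "\<exists>a b c. lin.quad (\<lambda>r. sqrt_diag_matrix (l r) $ k $ k) a b c"
      using ex[unfolded expandable_diagonalisation_def has_taylor2_iff_quad, THEN conjunct2, THEN conjunct2] by blast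
    then obtain t0 t1 t2 where \<tau>: "lin.quad (\<lambda>r. sqrt (l r $ k)) t0 t1 t2"
      by (auto simp: sqrt_diag_matrix_def diag_matrix_def)
    have "b1 (Q r) (l r) (axis k 1) = - ((Q r $ 1 $ k + Q r $ 3 $ k) * sqrt (l r $ k))" for r
      unfolding b1_eq by (simp add: axis_def if_distrib cong: if_cong)
    then have "lin.quad (\<lambda>r. - ((Q r $ 1 $ k + Q r $ 3 $ k) * sqrt (l r $ k))) (b10 (axis k 1)) (b (axis k 1)) (b12 (axis k 1))"
      using tay[of "axis k 1"] by (simp add: has_taylor2_iff_quad)
    from lin.quad_minus[OF this]
    have w: "lin.quad (\<lambda>r. (Q r $ 1 $ k + Q r $ 3 $ k) * sqrt (l r $ k)) (- b10 (axis k 1)) (- b (axis k 1)) (- b12 (axis k 1))"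
      by simp
    have "- b (axis k 1) = 0 \<longleftrightarrow> bigO (\<lambda>r. (Q r $ 4 $ k - Q r $ 1 $ k + (Q r $ 6 $ k - Q r $ 3 $ k)) * sqrt (l r $ k)) 2"
    proof (rule eigenvector_trace_order[OF _ Vp O2[OF q(2)] O2[OF q(4)] O2[OF q(5)] O2[OF q(6)] O2[OF q(7)] O2[OF q(8)] Vq4 _ \<tau> w])
      show "64 / 3 * g4 > 0" using g4_pos by simp
      show "\<forall>\<^sub>F r in at_right 0.
       l r $ k * (Q r $ 1 $ k + Q r $ 4 $ k) = 2 * (Vp r * (Q r $ 1 $ k + Q r $ 4 $ k)) + 2 * (Cpq r * (Q r $ 3 $ k + Q r $ 6 $ k)) \<and>
       l r $ k * (Q r $ 3 $ k + Q r $ 6 $ k) = 2 * (Cpq r * (Q r $ 1 $ k + Q r $ 4 $ k)) + 2 * (Vq r * (Q r $ 3 $ k + Q r $ 6 $ k)) \<and>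
       l r $ k * (Q r $ 4 $ k - Q r $ 1 $ k) = 2 * (Va r * (Q r $ 4 $ k - Q r $ 1 $ k)) + 2 * (Cab r * (Q r $ 6 $ k - Q r $ 3 $ k)) \<and>
       l r $ k * (Q r $ 6 $ k - Q r $ 3 $ k) = 2 * (Cab r * (Q r $ 4 $ k - Q r $ 1 $ k)) + 2 * (Vb r * (Q r $ 6 $ k - Q r $ 3 $ k)) \<and>
       l r $ k * (Q r $ 2 $ k + Q r $ 5 $ k) = 2 * (Vm r * (Q r $ 2 $ k + Q r $ 5 $ k)) \<and>
       l r $ k * (Q r $ 5 $ k - Q r $ 2 $ k) = 2 * (Vn r * (Q r $ 5 $ k - Q r $ 2 $ k)) \<and>
       (Q r $ 1 $ k)\<^sup>2 + (Q r $ 2 $ k)\<^sup>2 + (Q r $ 3 $ k)\<^sup>2 + (Q r $ 4 $ k)\<^sup>2 + (Q r $ 5 $ k)\<^sup>2 + (Q r $ 6 $ k)\<^sup>2 = 1 \<and> (sqrt (l r $ k))\<^sup>2 = l r $ k"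
        using ev
      proof eventually_elim
        case (elim r)
        then have nd: "nondegenerate r" and o: "orthogonal_matrix (Q r)" and D: "Delta M F r = Q r ** diag_matrix (l r) ** transpose (Q r)" by auto
        note d = diagonalisation_columns[OF nd o D]
        show ?case by (intro conjI d(1-7) real_sqrt_pow2 d(8))
      qed
    qed
    then show ?thesis by (simp add: z_def[abs_def])
  qed
  have sum_z: "\<forall>\<^sub>F r in at_right 0. (\<Sum>k\<in>UNIV. (z k r)\<^sup>2) = 4 * VD r"
    using ev
  proof eventually_elim
    case (elim r)
    then have nd: "nondegenerate r" and o: "orthogonal_matrix (Q r)" and D: "Delta M F r = Q r ** diag_matrix (l r) ** transpose (Q r)" by auto
    note d = diagonalisation_columns[OF nd o D]
    have "(z k r)\<^sup>2 = (Q r $ 4 $ k - Q r $ 1 $ k + (Q r $ 6 $ k - Q r $ 3 $ k))\<^sup>2 * l r $ k" for k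
      using d(8)[of k] by (simp add: z_def power_mult_distrib)
    then show ?case using d(9) by simp
  qed
  obtain c where VDq: "sq.quad VD 0 (32 * (9 * g6 - 4 * g4\<^sup>2)) c" using quad_VD by auto
  show ?thesis
  proof
    assume "b = (\<lambda>_. 0)"
    then have "bigO (z k) 2" for k using key[of k] by simp
    then have "bigO (\<lambda>r. (z k r)\<^sup>2) 4" for k using bigO_mult[of "z k" 2 "z k" 2] by (simp add: power2_eq_square)
    then have "bigO (\<lambda>r. \<Sum>k\<in>UNIV. (z k r)\<^sup>2) 4"
      unfolding sum_6 by (intro bigO_add)
    from bigO_cmult[OF bigO_cong[OF this sum_z], of "1 / 4"] have "bigO VD 4" by simp
    then have "bigO VD (Suc 2)" by (rule bigO_weaken) simp
    from bigO_Suc_tendsto[OF this] have "((\<lambda>r. VD r / r\<^sup>2) \<longlongrightarrow> 0) (at_right 0)" .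
    moreover have "((\<lambda>r. VD r / r\<^sup>2) \<longlongrightarrow> 32 * (9 * g6 - 4 * g4\<^sup>2)) (at_right 0)" using sq.quad_ratio[OF VDq] by simp
    ultimately have "32 * (9 * g6 - 4 * g4\<^sup>2) = 0" by (intro tendsto_unique[of "at_right (0::real)" "\<lambda>r. VD r / r\<^sup>2"]) auto
    then show "9 * g6 = 4 * g4\<^sup>2" by simp
  next
    assume eq: "9 * g6 = 4 * g4\<^sup>2"
    have "bigO VD 4"
      by (rule bigO_ratio[of _ _ c]) (use VDq eq in \<open>simp add: sq.quad_def\<close>)
    then have V4: "bigO (\<lambda>r. 4 * VD r) 4" by (rule bigO_cmult)
    have "bigO (z k) 2" for k
    proof (rule bigO_sqrt)
      have "\<forall>\<^sub>F r in at_right 0. norm ((z k r)\<^sup>2) \<le> norm (4 * VD r)"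
        using sum_z
      proof eventually_elim
        case (elim r)
        have "(z k r)\<^sup>2 \<le> (\<Sum>k\<in>UNIV. (z k r)\<^sup>2)" by (rule member_le_sum) auto
        then show ?case using elim by simp
      qed
      then have "(\<lambda>r. (z k r)\<^sup>2) \<in> O[at_right 0](\<lambda>r. 4 * VD r)" by (rule landau_o.big_mono)
      from landau_o.big_trans[OF this V4] show "bigO (\<lambda>r. (z k r)\<^sup>2) (2 * 2)" by simp
    qed
    then have ax: "b (axis k 1) = 0" for k using key by blast
    show "b = (\<lambda>_. 0)"
    proof
      fix \<xi> :: "real ^ 6"
      have "b \<xi> = b (\<Sum>k\<in>UNIV. (\<xi> $ k) *\<^sub>R axis k 1)"
        using basis_expansion[of \<xi>] by (simp add: scalar_mult_eq_scaleR)
      also have "\<dots> = (\<Sum>k\<in>UNIV. (\<xi> $ k) *\<^sub>R b (axis k 1))"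
        by (simp add: linear_sum[OF lin] linear_scale[OF lin])
      finally show "b \<xi> = 0" by (simp add: ax)
    qed
  qed
qed

lemma ex_is_b11: "\<exists>b. is_b11 M F b"
proof -
  obtain Q l where e: "expandable_diagonalisation (Delta M F) Q l" using ex_expandable_diagonalisation by blast
  from expandable_imp_b11_expansion[OF e] e show ?thesis unfolding is_b11_def by blast
qed

end

section \<open>The random plane wave\<close>

text \<open>
  The coefficients of the power series in \<open>u = r\<^sup>2\<close> are at most \<open>1 / k!\<close> in absolute value, so that the
  tail from \<open>k = 4\<close> on is at most \<open>e r\<^sup>8\<close>.
\<close>

lemma bessel_J0_expansion:
  "(\<lambda>r. bessel_J0 (2 * r) - (1 - r ^ 2 + r ^ 4 / 4 - r ^ 6 / 36)) \<in> O[at_right 0](\<lambda>r. r ^ 8)"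
proof -
  define a :: "nat \<Rightarrow> real" where "a k = (-1) ^ k / (fact k)\<^sup>2" for k
  have a: "\<bar>a k * u ^ k\<bar> \<le> inverse (fact k)" if "\<bar>u\<bar> \<le> 1" for k u
  proof -
    have "fact k * 1 \<le> fact k * (fact k :: real)" by (intro mult_left_mono) auto
    then have "inverse ((fact k)\<^sup>2) \<le> inverse (fact k :: real)" by (intro le_imp_inverse_le) (auto simp: power2_eq_square)
    moreover have "\<bar>u\<bar> ^ k \<le> 1" using that by (intro power_le_one) auto
    ultimately have "inverse ((fact k)\<^sup>2) * \<bar>u\<bar> ^ k \<le> inverse (fact k :: real) * 1" by (intro mult_mono) auto
    then show ?thesis by (simp add: a_def abs_mult power_abs inverse_eq_divide)
  qed
  have sm: "summable (\<lambda>k. inverse (fact k :: real))" using summable_exp[of "1::real"] by simp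
  have summ: "summable (\<lambda>k. a k * u ^ k)" if "\<bar>u\<bar> \<le> 1" for u
    by (rule summable_comparison_test'[OF sm, of 0]) (use a[OF that] in auto)
  have bound: "\<bar>bessel_J0 (2 * r) - (1 - r ^ 2 + r ^ 4 / 4 - r ^ 6 / 36)\<bar> \<le> (\<Sum>k. inverse (fact k)) * r ^ 8" if r: "0 < r" "r < 1" for r
  proof -
    define u where "u = r\<^sup>2"
    have u: "\<bar>u\<bar> \<le> 1" using r by (simp add: u_def power_le_one)
    have "bessel_J0 (2 * r) = (\<Sum>k. a k * u ^ k)"
      unfolding bessel_J0_def a_def u_def by (simp add: power_mult)
    also have "\<dots> = (\<Sum>k. a (k + 4) * u ^ (k + 4)) + (\<Sum>k<4. a k * u ^ k)"
      by (rule suminf_split_initial_segment[OF summ[OF u]])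
    also have "(\<Sum>k<4. a k * u ^ k) = 1 - r ^ 2 + r ^ 4 / 4 - r ^ 6 / 36"
      by (simp add: a_def u_def numeral_eq_Suc fact_numeral power2_eq_square)
    finally have d: "bessel_J0 (2 * r) - (1 - r ^ 2 + r ^ 4 / 4 - r ^ 6 / 36) = (\<Sum>k. a (k + 4) * u ^ (k + 4))" by simp
    have le: "\<bar>a (k + 4) * u ^ (k + 4)\<bar> \<le> inverse (fact k) * r ^ 8" for k
    proof -
      have "\<bar>a (k + 4)\<bar> \<le> inverse (fact (k + 4))" using a[of 1 "k + 4"] by simp
      also have "\<dots> \<le> inverse (fact k :: real)"
        by (intro le_imp_inverse_le fact_mono) auto
      finally have "\<bar>a (k + 4)\<bar> * \<bar>u\<bar> ^ k * r ^ 8 \<le> inverse (fact k) * \<bar>u\<bar> ^ k * r ^ 8"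
        using r by (intro mult_right_mono) auto
      moreover have "\<bar>a (k + 4) * u ^ (k + 4)\<bar> = \<bar>a (k + 4)\<bar> * \<bar>u\<bar> ^ k * r ^ 8"
        by (simp add: abs_mult power_add u_def power_abs)
      ultimately have 1: "\<bar>a (k + 4) * u ^ (k + 4)\<bar> \<le> inverse (fact k) * \<bar>u\<bar> ^ k * r ^ 8" by simp
      have "\<bar>u\<bar> ^ k \<le> 1" using u by (intro power_le_one) auto
      then have "inverse (fact k) * \<bar>u\<bar> ^ k * r ^ 8 \<le> inverse (fact k) * 1 * r ^ 8"
        using r by (intro mult_right_mono mult_left_mono) auto
      from order_trans[OF 1 this] show ?thesis by simp
    qed
    have sm8: "summable (\<lambda>k. inverse (fact k :: real) * r ^ 8)" by (rule summable_mult2[OF sm])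
    have "\<bar>\<Sum>k. a (k + 4) * u ^ (k + 4)\<bar> \<le> (\<Sum>k. inverse (fact k) * r ^ 8)"
      using norm_suminf_le[OF _ sm8, of "\<lambda>k. a (k + 4) * u ^ (k + 4)"] le by simp
    also have "\<dots> = (\<Sum>k. inverse (fact k)) * r ^ 8" by (rule suminf_mult2[OF sm, symmetric])
    finally show ?thesis by (simp add: d)
  qed
  show ?thesis
  proof (rule bigoI[of _ "\<Sum>k. inverse (fact k)"])
    have small: "\<forall>\<^sub>F r in at_right 0. r < (1::real)" by (rule order_tendstoD(2)[OF tendsto_ident_at]) simp
    have pos: "\<forall>\<^sub>F r in at_right 0. (0::real) < r" by (rule pos_eventually)
    show "\<forall>\<^sub>F r in at_right 0. norm (bessel_J0 (2 * r) - (1 - r ^ 2 + r ^ 4 / 4 - r ^ 6 / 36)) \<le> (\<Sum>k. inverse (fact k)) * norm (r ^ 8)"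
      using small pos by eventually_elim (use bound in simp)
  qed
qed

lemma bessel_coefficients:
  assumes C: "\<And>r. r \<ge> 0 \<Longrightarrow> C r = bessel_J0 (2 * r)"
    and T: "(\<lambda>r. C r - (1 - r ^ 2 + g4 * r ^ 4 - g6 * r ^ 6)) \<in> o[at_right 0](\<lambda>r. r ^ 6)"
  shows "g4 = 1 / 4" "g6 = 1 / 36"
proof -
  define d :: "nat \<Rightarrow> real" where "d k = (if k = 4 then 1 / 4 - g4 else if k = 6 then g6 - 1 / 36 else 0)" for k
  have 1: "((\<lambda>t. (C t - (1 - t ^ 2 + g4 * t ^ 4 - g6 * t ^ 6)) / t ^ 6) \<longlongrightarrow> 0) (at_right 0)"
    using smalloD_tendsto[OF T] .
  have "bigO (\<lambda>r. bessel_J0 (2 * r) - (1 - r ^ 2 + r ^ 4 / 4 - r ^ 6 / 36)) (Suc 6)"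
    by (rule bigO_weaken[OF bessel_J0_expansion]) simp
  from bigO_Suc_tendsto[OF this]
  have 2: "((\<lambda>t. (bessel_J0 (2 * t) - (1 - t ^ 2 + t ^ 4 / 4 - t ^ 6 / 36)) / t ^ 6) \<longlongrightarrow> 0) (at_right 0)" .
  have "((\<lambda>t. (\<Sum>k\<le>6. d k * t ^ k) / t ^ 6) \<longlongrightarrow> 0) (at_right 0)"
  proof (rule tendsto_right_transform[OF tendsto_diff[OF 1 2]])
    fix t :: real assume t: "t > 0"
    have "(\<Sum>k\<le>6. d k * t ^ k) = (1 / 4 - g4) * t ^ 4 + (g6 - 1 / 36) * t ^ 6"
      by (simp add: d_def numeral_eq_Suc)
    then show "(C t - (1 - t ^ 2 + g4 * t ^ 4 - g6 * t ^ 6)) / t ^ 6 - (bessel_J0 (2 * t) - (1 - t ^ 2 + t ^ 4 / 4 - t ^ 6 / 36)) / t ^ 6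
        = (\<Sum>k\<le>6. d k * t ^ k) / t ^ 6"
      using C[of t] t by (simp add: diff_divide_distrib[symmetric]) (simp add: algebra_simps)
  qed simp
  from polynomial_smallo_imp_zero[OF this, of 4] polynomial_smallo_imp_zero[OF this, of 6]
  show "g4 = 1 / 4" "g6 = 1 / 36" by (simp_all add: d_def)
qed

theorem theorem1p5:
  fixes M :: "'w measure"
    and F :: "real ^ 2 \<Rightarrow> 'w \<Rightarrow> real"
    and C :: "real \<Rightarrow> real"
    and g4 g6 \<epsilon> :: real
  assumes "prob_space M"
    and "centred_gaussian_field M F"
    and "stationary_field M F"
    and "isotropic_covariance M F C"
    and "\<not> (AE \<omega> in M. \<exists>c. \<forall>x. F x \<omega> = c)"
    and "C 0 = 1"
    and "(\<lambda>r. C r - (1 - r ^ 2 + g4 * r ^ 4 - g6 * r ^ 6)) \<in> o[at_right 0](\<lambda>r. r ^ 6)"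
    and "0 < \<epsilon>" "\<epsilon> \<le> 1"
    and "AE \<omega> in M. C_Holder 4 \<epsilon> (\<lambda>x. F x \<omega>)"
  shows "K2 M F Minimum Minimum \<in> O[at_right 0](\<lambda>r. r ^ 3 * ln (1 / r))
    \<and> K2 M F Maximum Maximum \<in> O[at_right 0](\<lambda>r. r ^ 3 * ln (1 / r))
    \<and> K2 M F Saddle Saddle \<in> O[at_right 0](\<lambda>r. r ^ 3 * ln (1 / r))
    \<and> K2 M F Extremum Extremum \<in> O[at_right 0](\<lambda>r. r ^ 3 * ln (1 / r))
    \<and> (\<exists>b. is_b11 M F b)
    \<and> (\<forall>b. is_b11 M F b \<longrightarrow>
          (b \<noteq> (\<lambda>_. 0) \<longrightarrow> K2 M F Maximum Minimum \<in> O[at_right 0](\<lambda>r. r ^ 3)) \<and>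
          (b = (\<lambda>_. 0) \<longrightarrow> K2 M F Maximum Minimum \<in> O[at_right 0](\<lambda>r. r ^ 7)))
    \<and> ((\<forall>r\<ge>0. C r = bessel_J0 (2 * r)) \<longrightarrow> (\<forall>b. is_b11 M F b \<longrightarrow> b = (\<lambda>_. 0)))"
proof -
  have smooth: "AE \<omega> in M. C_diff 4 (\<lambda>x. F x \<omega>)"
    using assms(10) by eventually_elim (simp add: C_Holder_def)
  have field: "isotropic_gaussian_field M F C g4 g6"
    by (intro isotropic_gaussian_field.intro smooth_gaussian_field.intro smooth_gaussian_field_axioms.intro
        isotropic_gaussian_field_axioms.intro assms smooth)
  have rpw: "9 * g6 = 4 * g4\<^sup>2" if "\<forall>r\<ge>0. C r = bessel_J0 (2 * r)"
  proof -
    have "g4 = 1 / 4" "g6 = 1 / 36" using bessel_coefficients[OF _ assms(7)] that by auto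
    then show ?thesis by (simp only:) (simp add: power2_eq_square)
  qed
  note b11 = isotropic_gaussian_field.is_b11_eq_0_iff[OF field]
  show ?thesis
    by (intro conjI isotropic_gaussian_field.K2_same_type[OF field] isotropic_gaussian_field.ex_is_b11[OF field])
      (auto simp: b11 rpw intro: isotropic_gaussian_field.K2_max_min_cubic[OF field]
        isotropic_gaussian_field.K2_max_min_degenerate[OF field])
qed

end
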